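(* Let $\varphi:\mathbf{RP}^1\to\mathbf{RP}^1$ be an orientation-preserving homeomorphism. The following are equivalent. (1) $\varphi$ is Weil–Petersson. (2) $\varphi$ is quasisymmetric and there exists a dyadic decomposition $\mathcal{D}$ of $\mathbf{RP}^1$ such that $\sum_{I\in\mathcal{D}}\varepsilon_\varphi(I)^2<\infty$. (3) $\varphi$ is quasisymmetric and, for every dyadic decomposition $\mathcal{D}$ of $\mathbf{RP}^1$, $\sum_{I\in\mathcal{D}}\varepsilon_\varphi(I)^2<\infty$.
   Context: $\mathbf{RP}^1$ is identified with $\mathbf{R}/\pi\mathbf{Z}$ via $x\mapsto[\cos x:\sin x]$. Let $\hat\varphi:\mathbf{R}\to\mathbf{R}$ be a lift of $\varphi$ (an increasing homeomorphism with $\hat\varphi(x+\pi)=\hat\varphi(x)+\pi$). $\varphi$ is quasisymmetric if there is $K\geq1$ with $K^{-1}\leq\frac{\hat\varphi(x+t)-\hat\varphi(x)}{\hat\varphi(x)-\hat\varphi(x-t)}\leq K$ for all $x\in\mathbf{R}$, $t>0$. Weil–Petersson: an orientation-preserving homeomorphism $\varphi:\mathbf{RP}^1\to\mathbf{RP}^1$ is Weil–Petersson if it has $L^1$ distributional derivative $\varphi'$ (i.e. it is absolutely continuous) and $\log(\varphi')\in H^{1/2}(\mathbf{RP}^1)$ (fractional Sobolev space). Dyadic decompositions: for a base point $x_0\in\mathbf{RP}^1$ and integers $m\geq0$, $0\leq k\leq 2^m-1$, let $I_{m,k}=x_0+[k\pi/2^m,(k+1)\pi/2^m]$ mod $\pi$.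 The $x_0$-based dyadic decomposition is $\mathcal{D}_{x_0}=\{I_{m,k}\mid m\geq0,\ 0\leq k\leq2^m-1\}$; a dyadic decomposition is any $\mathcal{D}_{x_0}$. $\ell(I)$ is the length of $I$, and $3I$ is the interval with the same centre as $I$ and length $3\ell(I)$; for an interval $J$ lifted to $[a,b]\subset\mathbf{R}$, $\ell(\varphi(J))=\hat\varphi(b)-\hat\varphi(a)$ (intervals of length exceeding $\pi$ are understood in the universal cover $\mathbf{R}$). Epsilon numbers: $\mathbf{PSL}(2,\mathbf{R})$ acts on $\mathbf{RP}^1$, and each $f\in\mathbf{PSL}(2,\mathbf{R})$ has lifts $\hat f:\mathbf{R}\to\mathbf{R}$ (in the coordinate of $\mathbf{R}/\pi\mathbf{Z}$). For a dyadic interval $I$, $\varepsilon_\varphi(I)$ is the infimum of all $\varepsilon>0$ for which there exist a point $x\in I$ with lift $\hat x$, and $f_\pm\in\mathbf{PSL}(2,\mathbf{R})$ with lifts $\hat f_\pm$, such that $\hat f_-\leq\hat\varphi\leq\hat f_+$ on $\mathbf{R}$ and $$|\hat f_\pm(\hat x)-\hat\varphi(\hat x)|\leq\varepsilon\,\ell(\varphi(3I)),\quad \left|\hat f_\pm'(\hat x)-\frac{\ell(\varphi(3I))}{\ell(3I)}\right|\leq\varepsilon\,\frac{\ell(\varphi(3I))}{\ell(3I)},\quad |\hat f_\pm''(\hat x)|\leq\varepsilon\,\frac{\ell(\varphi(3I))}{\ell(3I)^2}.$$ By convention $\varepsilon_\varphi(I)=1$ if no such triplet $(x,f_\pm)$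 exists. *)

theory Defs
  imports "HOL-Analysis.Analysis"
begin

section \<open>The real projective line\<close>

text \<open>Points are the lines through the origin of the plane; the topology is the quotient
  topology of the punctured plane.\<close>

definition RP1 :: "(real^2) set set" where
  "RP1 = {span {v} | v. v \<noteq> 0}"

definition RP1_topology :: "(real^2) set topology" where
  "RP1_topology = topology (\<lambda>U. U \<subseteq> RP1 \<and> open {v. v \<noteq> 0 \<and> span {v} \<in> U})"

lemma openin_RP1_topology:
  "openin RP1_topology U \<longleftrightarrow> U \<subseteq> RP1 \<and> open {v. v \<noteq> 0 \<and> span {v} \<in> U}"
proof -
  have "istopology (\<lambda>U. U \<subseteq> RP1 \<and> open {v. v \<noteq> 0 \<and> span {v} \<in> U})"
    unfolding istopology_def
  proof (intro conjI allI impI)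
    fix S T :: "(real^2) set set"
    assume S: "S \<subseteq> RP1 \<and> open {v. v \<noteq> 0 \<and> span {v} \<in> S}"
      and T: "T \<subseteq> RP1 \<and> open {v. v \<noteq> 0 \<and> span {v} \<in> T}"
    show "S \<inter> T \<subseteq> RP1" using S by blast
    have "{v. v \<noteq> 0 \<and> span {v} \<in> S \<inter> T} = {v. v \<noteq> 0 \<and> span {v} \<in> S} \<inter> {v. v \<noteq> 0 \<and> span {v} \<in> T}"
      by blast
    then show "open {v. v \<noteq> 0 \<and> span {v} \<in> S \<inter> T}" using S T by (simp only: open_Int)
  next
    fix \<K> :: "(real^2) set set set"
    assume K: "\<forall>S\<in>\<K>. S \<subseteq> RP1 \<and> open {v. v \<noteq> 0 \<and> span {v} \<in> S}"
    then show "\<Union>\<K> \<subseteq> RP1" by blast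
    have "{v. v \<noteq> 0 \<and> span {v} \<in> \<Union>\<K>} = (\<Union>S\<in>\<K>. {v. v \<noteq> 0 \<and> span {v} \<in> S})" by blast
    then show "open {v. v \<noteq> 0 \<and> span {v} \<in> \<Union>\<K>}" using K by (auto intro!: open_UN)
  qed
  then show ?thesis by (simp add: RP1_topology_def topology_inverse')
qed

lemma topspace_RP1_topology: "topspace RP1_topology = RP1"
proof -
  have "{v::real^2. v \<noteq> 0 \<and> span {v} \<in> RP1} = - {0}"
    unfolding RP1_def by blast
  then have "open {v::real^2. v \<noteq> 0 \<and> span {v} \<in> RP1}"
    by (simp only: open_Compl closed_singleton)
  then have "openin RP1_topology RP1"
    unfolding openin_RP1_topology by blast
  then have "RP1 \<subseteq> topspace RP1_topology" by (rule openin_subset)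
  moreover have "topspace RP1_topology \<subseteq> RP1"
    using openin_topspace[of RP1_topology] unfolding openin_RP1_topology by blast
  ultimately show ?thesis by blast
qed

text \<open>The coordinate identifying the projective line with the reals modulo pi.\<close>

definition rp1_point :: "real \<Rightarrow> (real^2) set" where
  "rp1_point x = span {vector [cos x, sin x]}"

lemma rp1_point_eq_iff: "rp1_point x = rp1_point y \<longleftrightarrow> (\<exists>k::int. x = y + of_int k * pi)"
proof
  assume "rp1_point x = rp1_point y"
  then have "(vector [cos x, sin x] :: real^2) \<in> span {vector [cos y, sin y]}"
    unfolding rp1_point_def by (metis insertI1 span_superset subsetD)
  then obtain c where "(vector [cos x, sin x] :: real^2) = c *\<^sub>R vector [cos y, sin y]"
    by (auto simp: span_singleton)
  then have c: "cos x = c * cos y" "sin x = c * sin y"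
    by (auto simp: vec_eq_iff forall_2 vector_2)
  have "sin (x - y) = 0" by (simp add: sin_diff c)
  then obtain k :: int where "x - y = of_int k * pi" by (auto simp: sin_zero_iff_int2)
  then show "\<exists>k::int. x = y + of_int k * pi" by (intro exI[of _ k]) simp
next
  assume "\<exists>k::int. x = y + of_int k * pi"
  then obtain k :: int where k: "x - y = of_int k * pi" by (auto simp: algebra_simps)
  then have s: "sin (x - y) = 0" by (auto simp: sin_zero_iff_int2)
  define d where "d = cos (x - y)"
  have d2: "d * d = 1" using sin_cos_squared_add[of "x - y"] s by (simp add: d_def power2_eq_square)
  have "cos x = d * cos y" "sin x = d * sin y"
    using cos_add[of "x - y" y] sin_add[of "x - y" y] s by (simp_all add: d_def)
  then have e: "(vector [cos x, sin x] :: real^2) = d *\<^sub>R vector [cos y, sin y]"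
    by (auto simp: vec_eq_iff forall_2 vector_2)
  have e': "(vector [cos y, sin y] :: real^2) = d *\<^sub>R vector [cos x, sin x]"
    using d2 by (simp add: e)
  show "rp1_point x = rp1_point y"
    unfolding rp1_point_def
    unfolding span_eq by (simp add: span_singleton) (use e e' in blast)
qed

section \<open>Lifts and orientation-preserving homeomorphisms\<close>

definition is_lift :: "((real^2) set \<Rightarrow> (real^2) set) \<Rightarrow> (real \<Rightarrow> real) \<Rightarrow> bool" where
  "is_lift \<phi> h \<longleftrightarrow>
     strict_mono h \<and> homeomorphic_map euclideanreal euclideanreal h \<and>
     (\<forall>x. h (x + pi) = h x + pi) \<and>
     (\<forall>x. \<phi> (rp1_point x) = rp1_point (h x))"

definition orientation_preserving_homeo :: "((real^2) set \<Rightarrow> (real^2) set) \<Rightarrow> bool" where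
  "orientation_preserving_homeo \<phi> \<longleftrightarrow>
     homeomorphic_map RP1_topology RP1_topology \<phi> \<and> (\<exists>h. is_lift \<phi> h)"

text \<open>The notions below use one fixed lift. Two lifts differ by an integer multiple of pi,
  and none of these notions depends on that constant.\<close>

definition lift :: "((real^2) set \<Rightarrow> (real^2) set) \<Rightarrow> real \<Rightarrow> real" where
  "lift \<phi> = (SOME h. is_lift \<phi> h)"

lemma is_lift_lift: "orientation_preserving_homeo \<phi> \<Longrightarrow> is_lift \<phi> (lift \<phi>)"
  unfolding orientation_preserving_homeo_def lift_def by (metis someI_ex)

lemma is_lift_unique:
  assumes "is_lift \<phi> g" "is_lift \<phi> h"
  shows "\<exists>k::int. \<forall>x. g x = h x + of_int k * pi"
proof -
  have c: "continuous_on UNIV g" "continuous_on UNIV h"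
    using assms unfolding is_lift_def
    by (auto dest!: homeomorphic_imp_continuous_map)
  define f where "f = (\<lambda>x. (g x - h x) / pi)"
  have "\<exists>k::int. f x = of_int k" for x
  proof -
    have "rp1_point (g x) = rp1_point (h x)"
      using assms unfolding is_lift_def by metis
    then obtain k :: int where "g x = h x + of_int k * pi" by (auto simp: rp1_point_eq_iff)
    then show ?thesis by (intro exI[of _ k]) (simp add: f_def)
  qed
  then have Z: "f x \<in> \<int>" for x by (metis Ints_of_int)
  have "continuous_on UNIV f" unfolding f_def by (intro continuous_intros c) auto
  then have "f constant_on UNIV"
  proof (rule continuous_discrete_range_constant[OF connected_UNIV])
    fix x :: real
    show "\<exists>e>0. \<forall>y. y \<in> UNIV \<and> f y \<noteq> f x \<longrightarrow> e \<le> norm (f y - f x)"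
    proof (intro exI[of _ 1] conjI allI impI)
      fix y assume "y \<in> UNIV \<and> f y \<noteq> f x"
      then have "f y - f x \<in> \<int>" "f y - f x \<noteq> 0" using Z by auto
      then show "1 \<le> norm (f y - f x)" by (metis Ints_nonzero_abs_ge1 real_norm_def)
    qed simp
  qed
  then obtain a where a: "\<And>x. f x = a" by (auto simp: constant_on_def)
  then obtain k :: int where "a = of_int k" using Z[of 0] by (auto elim: Ints_cases)
  then have "g x = h x + of_int k * pi" for x using a[of x] by (simp add: f_def field_simps)
  then show ?thesis by blast
qed

definition quasisymmetric :: "((real^2) set \<Rightarrow> (real^2) set) \<Rightarrow> bool" where
  "quasisymmetric \<phi> \<longleftrightarrow>
     (\<exists>K\<ge>1. \<forall>x. \<forall>t>0.
        1 / K \<le> (lift \<phi> (x + t) - lift \<phi> x) / (lift \<phi> x - lift \<phi> (x - t)) \<and>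
        (lift \<phi> (x + t) - lift \<phi> x) / (lift \<phi> x - lift \<phi> (x - t)) \<le> K)"

section \<open>Weil--Petersson homeomorphisms\<close>

text \<open>Functions on the projective line are treated as pi-periodic functions on the reals;
  the interval from 0 to pi is a fundamental domain.\<close>

definition test_function :: "(real \<Rightarrow> real) \<Rightarrow> bool" where
  "test_function \<psi> \<longleftrightarrow>
     (\<forall>n. (deriv ^^ n) \<psi> differentiable_on UNIV) \<and> compact (closure {x. \<psi> x \<noteq> 0})"

definition L1_distributional_derivative :: "(real \<Rightarrow> real) \<Rightarrow> (real \<Rightarrow> real) \<Rightarrow> bool" where
  "L1_distributional_derivative h g \<longleftrightarrow>
     g \<in> borel_measurable lborel \<and> (\<forall>x. g (x + pi) = g x) \<and>
     set_integrable lborel {0..pi} g \<and>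
     (\<forall>\<psi>. test_function \<psi> \<longrightarrow>
        (LINT x|lborel. h x * deriv \<psi> x) = - (LINT x|lborel. g x * \<psi> x))"

text \<open>Distance in the reals modulo pi.\<close>

definition circle_dist :: "real \<Rightarrow> real \<Rightarrow> real" where
  "circle_dist x y = infdist (x - y) (range (\<lambda>k::int. of_int k * pi))"

text \<open>The space of square-integrable functions with finite Gagliardo seminorm
  (exponent 1 + 2s = 2 in dimension one, for s = 1/2).\<close>

definition sobolev_half :: "(real \<Rightarrow> real) \<Rightarrow> bool" where
  "sobolev_half u \<longleftrightarrow>
     u \<in> borel_measurable lborel \<and> (\<forall>x. u (x + pi) = u x) \<and>
     set_integrable lborel {0..pi} (\<lambda>x. (u x)\<^sup>2) \<and>
     (\<integral>\<^sup>+x\<in>{0..pi}. (\<integral>\<^sup>+y\<in>{0..pi}.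
        ennreal ((u x - u y)\<^sup>2 / (circle_dist x y)\<^sup>2) \<partial>lborel) \<partial>lborel) < \<infinity>"

text \<open>Positivity almost everywhere says that the logarithm is finite almost everywhere,
  which membership in the Sobolev space presupposes; it must be explicit because the
  library's logarithm is total.\<close>

definition weil_petersson :: "((real^2) set \<Rightarrow> (real^2) set) \<Rightarrow> bool" where
  "weil_petersson \<phi> \<longleftrightarrow>
     (\<exists>g. L1_distributional_derivative (lift \<phi>) g \<and>
        (AE x in lborel. g x > 0) \<and> sobolev_half (\<lambda>x. ln (g x)))"

section \<open>Dyadic decompositions\<close>

text \<open>Intervals are represented by compact intervals of the universal cover, so that centre
  and length make sense also for the interval of length pi. The base point is given by
  a real representative.\<close>

definition dyadic_interval :: "real \<Rightarrow> nat \<Rightarrow> nat \<Rightarrow> real set" where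
  "dyadic_interval x0 m k = {x0 + real k * pi / 2 ^ m .. x0 + real (k + 1) * pi / 2 ^ m}"

definition dyadic_decomposition_at :: "real \<Rightarrow> real set set" where
  "dyadic_decomposition_at x0 = {dyadic_interval x0 m k | m k. k < 2 ^ m}"

definition dyadic_decomposition :: "real set set \<Rightarrow> bool" where
  "dyadic_decomposition D \<longleftrightarrow> (\<exists>x0. D = dyadic_decomposition_at x0)"

definition interval_length :: "real set \<Rightarrow> real" where
  "interval_length I = Sup I - Inf I"

definition triple_interval :: "real set \<Rightarrow> real set" where
  "triple_interval I =
     {(Inf I + Sup I) / 2 - 3 * interval_length I / 2 .. (Inf I + Sup I) / 2 + 3 * interval_length I / 2}"

definition image_length :: "((real^2) set \<Rightarrow> (real^2) set) \<Rightarrow> real set \<Rightarrow> real" where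
  "image_length \<phi> J = lift \<phi> (Sup J) - lift \<phi> (Inf J)"

section \<open>Epsilon numbers\<close>

text \<open>PSL(2,R), as the group of projective transformations it acts by (the action is faithful).\<close>

definition PSL2R :: "((real^2) set \<Rightarrow> (real^2) set) set" where
  "PSL2R = {\<lambda>L. (\<lambda>v. A *v v) ` L | A :: real^2^2. det A = 1}"

definition lift_close :: "((real^2) set \<Rightarrow> (real^2) set) \<Rightarrow> real set \<Rightarrow> real \<Rightarrow> real \<Rightarrow> (real \<Rightarrow> real) \<Rightarrow> bool" where
  "lift_close \<phi> I \<epsilon> x F \<longleftrightarrow>
     (let L = image_length \<phi> (triple_interval I); l = interval_length (triple_interval I) in
        \<bar>F x - lift \<phi> x\<bar> \<le> \<epsilon> * L \<and>
        \<bar>deriv F x - L / l\<bar> \<le> \<epsilon> * (L / l) \<and>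
        \<bar>deriv (deriv F) x\<bar> \<le> \<epsilon> * (L / l\<^sup>2))"

text \<open>It is enough to let the lift of the point range over the given lift of the interval,
  since all lifts commute with translation by pi.\<close>

definition admissible :: "((real^2) set \<Rightarrow> (real^2) set) \<Rightarrow> real set \<Rightarrow> real set" where
  "admissible \<phi> I = {\<epsilon>. \<epsilon> > 0 \<and>
     (\<exists>x\<in>I. \<exists>f\<^sub>m\<in>PSL2R. \<exists>f\<^sub>p\<in>PSL2R. \<exists>F\<^sub>m F\<^sub>p. is_lift f\<^sub>m F\<^sub>m \<and> is_lift f\<^sub>p F\<^sub>p \<and>
        (\<forall>y. F\<^sub>m y \<le> lift \<phi> y \<and> lift \<phi> y \<le> F\<^sub>p y) \<and>
        lift_close \<phi> I \<epsilon> x F\<^sub>m \<and> lift_close \<phi> I \<epsilon> x F\<^sub>p)}"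

definition epsilon_number :: "((real^2) set \<Rightarrow> (real^2) set) \<Rightarrow> real set \<Rightarrow> real" where
  "epsilon_number \<phi> I = (if admissible \<phi> I = {} then 1 else Inf (admissible \<phi> I))"

end

theory Submission
  imports Defs "HOL-Computational_Algebra.Polynomial"
begin

text \<open>Let \<open>h\<close> be the lift of \<open>\<phi>\<close>, seen from the base point of a dyadic decomposition, and let the slope of a
dyadic interval be the mean slope of \<open>h\<close> over it. Every condition of the theorem is compared with one
and the same condition on these slopes: the changes of their logarithms from an interval to its two
children and to its right neighbour, collected in \<open>slope_variation\<close>, are square summable over all
dyadic intervals. Being Weil--Petersson does not mention the base point, so comparing it with this
condition for each base point separately also shows that one decomposition is as good as all.

Small epsilon numbers make slopes vary little. A lift of a projective map is determined by its value
and its first two derivatives at one point, so if these agree approximately with those of an affine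
map, the lift stays close to that affine map on the whole of \<open>3I\<close> (\<open>lift_close_spreads\<close>). Since
\<open>h\<close> is squeezed between two such lifts, the slopes of \<open>I\<close>, its children and its neighbour agree up to
a relative error of order \<open>\<epsilon>(I) + \<ell>(I) + \<ell>(\<phi>(3I))\<close> (\<open>slope_variation_if_epsilon_tree\<close>).

Conversely, a projective map with \<open>F x = y\<close> and \<open>F' x = \<mu>\<close> acts on the cotangents of the angles from
\<open>x\<close> and from \<open>y\<close> by \<open>cot (F (x + s) - y) = cot s / \<mu> - \<kappa>\<close>. Hence \<open>F\<close> lies on the right side
of \<open>h\<close> as soon as \<open>h\<close> is almost linear near \<open>I\<close> and the cotangents of its increments differ from
\<open>cot s / \<mu>\<close> by at most \<open>\<kappa>\<close> farther away (\<open>mobius_barriers\<close>). At distance \<open>2^j \<ell>(I)\<close> the relevant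
slope is that of the ancestor of \<open>I\<close> by \<open>j\<close> generations, and the error is a sum of the variations of
all ancestors with weights decaying like \<open>(3/5)^j\<close> (\<open>cotangent_estimate\<close>). Such weighted sums
of ancestors remain square summable, because \<open>2 (3/5)^2 < 1\<close> (\<open>l2_tree_parent_recursion\<close>); the
deviation from linearity inside \<open>I\<close> is handled by the same count going down the tree
(\<open>l2_tree_child_recursion\<close>), and the lengths of the intervals and of their images shrink
geometrically. This gives \<open>epsilon_tree_if_slope_variation\<close>.

If the slope variation is square summable, the logarithms of the slopes converge almost everywhere
to a function \<open>u\<close>. At distance about \<open>2^(-n)\<close> the square \<open>(u x - u y)\<^sup>2\<close> is controlled by the variations
on the scales below \<open>2^(-n)\<close> at \<open>x\<close> and at \<open>y\<close>, and integrating this against the inverse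
square of the distance gives back the sum over the tree (\<open>sobolev_log_derivative\<close>). The slopes are
dominated, so \<open>h\<close> is the integral of \<open>exp u\<close> (\<open>exp_log_derivative_integrates\<close>), and this is the
same as having \<open>exp u\<close> as distributional derivative (\<open>L1_derivative_if_integrates_to\<close>).

If conversely \<open>h\<close> is the integral of \<open>exp u\<close> with \<open>u\<close> in \<open>H^(1/2)\<close>, the double integral of the Sobolev
norm contains, near the diagonal, the squares of the changes of the dyadic averages of \<open>u\<close>
(\<open>l2_tree_average_variation\<close>). By Jensen's inequality the logarithm of the slope lies above the
average of \<open>u\<close>; the gap at an interval is at most the square of the variation there plus 3/5 of the
gaps at the two children, so that the gaps have a finite sum (\<open>slope_variation_l2\<close>).

Finally, square summability bounds the variations, so the slopes of adjacent dyadic intervals have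
bounded ratios; this is quasisymmetry (\<open>increments_comparable\<close>).\<close>

section \<open>Square-summable functions on the dyadic tree\<close>

text \<open>The nodes of level \<open>m\<close> are indexed by all integers and read modulo \<open>2 ^ m\<close>, so that neighbours need
no case distinction at the ends of a level. The children of \<open>k\<close> are \<open>2 * k\<close> and \<open>2 * k + 1\<close>, its parent is
\<open>k div 2\<close>.\<close>

definition tree_periodic :: "(nat \<Rightarrow> int \<Rightarrow> real) \<Rightarrow> bool" where
  "tree_periodic f \<longleftrightarrow> (\<forall>m k. f m (k + 2 ^ m) = f m k)"

definition level_sum :: "(nat \<Rightarrow> int \<Rightarrow> real) \<Rightarrow> nat \<Rightarrow> real" where
  "level_sum f m = (\<Sum>k\<in>{0..<2 ^ m}. f m k)"

definition l2_tree :: "(nat \<Rightarrow> int \<Rightarrow> real) \<Rightarrow> bool" where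
  "l2_tree f \<longleftrightarrow> tree_periodic f \<and> summable (level_sum (\<lambda>m k. (f m k)\<^sup>2))"

lemma periodic_int_mult:
  fixes f :: "int \<Rightarrow> 'a"
  assumes "\<And>k. f (k + n) = f k"
  shows "f (k + i * n) = f k"
proof (induction i rule: int_induct[of _ 0])
  case base then show ?case by simp
next
  case (step1 i) then show ?case using assms[of "k + i * n"] by (simp add: algebra_simps)
next
  case (step2 i) then show ?case using assms[of "k + (i - 1) * n"] by (simp add: algebra_simps)
qed

lemma tree_periodic_mod:
  assumes "tree_periodic f"
  shows "f m (k mod 2 ^ m) = f m k"
proof -
  have "f m ((k mod 2 ^ m) + (k div 2 ^ m) * 2 ^ m) = f m (k mod 2 ^ m)"
    by (rule periodic_int_mult) (use assms in \<open>auto simp: tree_periodic_def\<close>)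
  then show ?thesis by (simp only: mod_mult_div_eq mult.commute mod_div_mult_eq)
qed

lemma sum_periodic_shift:
  assumes "tree_periodic f"
  shows "(\<Sum>k\<in>{0..<2 ^ m}. f m (k + i)) = level_sum f m"
  unfolding level_sum_def
  by (rule sum.reindex_bij_witness[of _ "\<lambda>k. (k - i) mod 2 ^ m" "\<lambda>k. (k + i) mod 2 ^ m"])
     (auto simp: mod_simps tree_periodic_mod[OF assms])

lemma sum_children:
  fixes f :: "int \<Rightarrow> real"
  shows "(\<Sum>k\<in>{0..<2 ^ Suc m}. f k) = (\<Sum>k\<in>{0..<2 ^ m}. f (2 * k) + f (2 * k + 1))"
proof -
  have e: "{0..<2 ^ Suc m} = ((*) 2) ` {0..<2 ^ m::int} \<union> (\<lambda>k. 2 * k + 1) ` {0..<2 ^ m}"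
  proof (intro equalityI subsetI)
    fix k :: int assume k: "k \<in> {0..<2 ^ Suc m}"
    then have "k div 2 \<in> {0..<2 ^ m}" by auto
    moreover have "k = 2 * (k div 2) \<or> k = 2 * (k div 2) + 1" by presburger
    ultimately show "k \<in> ((*) 2) ` {0..<2 ^ m::int} \<union> (\<lambda>k. 2 * k + 1) ` {0..<2 ^ m}" by blast
  qed auto
  have "((*) 2) ` {0..<2 ^ m::int} \<inter> (\<lambda>k. 2 * k + 1) ` {0..<2 ^ m} = {}"
    by (auto simp: image_iff) presburger
  then show ?thesis unfolding e
    by (subst sum.union_disjoint) (auto simp: sum.reindex inj_on_def sum.distrib)
qed

lemma sum_parents:
  fixes f :: "int \<Rightarrow> real"
  shows "(\<Sum>k\<in>{0..<2 ^ Suc m}. f (k div 2)) = 2 * (\<Sum>k\<in>{0..<2 ^ m}. f k)"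
  unfolding sum_children by (simp add: sum_distrib_left)

lemma level_sum_nonneg: "(\<And>m k. f m k \<ge> 0) \<Longrightarrow> level_sum f m \<ge> 0"
  unfolding level_sum_def by (intro sum_nonneg)

lemma l2_tree_dominated:
  assumes f: "l2_tree f" and g: "tree_periodic g" and le: "\<And>m k. m \<ge> M \<Longrightarrow> \<bar>g m k\<bar> \<le> f m k"
  shows "l2_tree g"
proof -
  have "summable (level_sum (\<lambda>m k. (g m k)\<^sup>2))"
  proof (rule summable_comparison_test_ev)
    show "summable (level_sum (\<lambda>m k. (f m k)\<^sup>2))" using f by (simp add: l2_tree_def)
    show "eventually (\<lambda>m. norm (level_sum (\<lambda>m k. (g m k)\<^sup>2) m) \<le> level_sum (\<lambda>m k. (f m k)\<^sup>2) m) sequentially"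
      using eventually_ge_at_top[of M]
    proof eventually_elim
      case (elim m)
      have "(g m k)\<^sup>2 \<le> (f m k)\<^sup>2" for k
        using le[OF elim, of k] by (metis abs_ge_zero power2_abs power_mono)
      then have "level_sum (\<lambda>m k. (g m k)\<^sup>2) m \<le> level_sum (\<lambda>m k. (f m k)\<^sup>2) m"
        unfolding level_sum_def by (intro sum_mono)
      then show ?case using level_sum_nonneg[of "\<lambda>m k. (g m k)\<^sup>2" m] by simp
    qed
  qed
  then show ?thesis using g by (simp add: l2_tree_def)
qed

lemma l2_tree_add:
  assumes "l2_tree f" "l2_tree g"
  shows "l2_tree (\<lambda>m k. f m k + g m k)"
proof -
  have "summable (level_sum (\<lambda>m k. (f m k + g m k)\<^sup>2))"
  proof (rule summable_comparison_test_ev)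
    show "summable (\<lambda>m. 2 * level_sum (\<lambda>m k. (f m k)\<^sup>2) m + 2 * level_sum (\<lambda>m k. (g m k)\<^sup>2) m)"
      using assms by (intro summable_add summable_mult) (auto simp: l2_tree_def)
    have "(f m k + g m k)\<^sup>2 \<le> 2 * (f m k)\<^sup>2 + 2 * (g m k)\<^sup>2" for m k
      using zero_le_power2[of "f m k - g m k"] by (simp add: power2_eq_square algebra_simps)
    then have "level_sum (\<lambda>m k. (f m k + g m k)\<^sup>2) m
        \<le> 2 * level_sum (\<lambda>m k. (f m k)\<^sup>2) m + 2 * level_sum (\<lambda>m k. (g m k)\<^sup>2) m" for m
      unfolding level_sum_def sum_distrib_left sum.distrib[symmetric] by (intro sum_mono)
    then show "eventually (\<lambda>m. norm (level_sum (\<lambda>m k. (f m k + g m k)\<^sup>2) m)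
        \<le> 2 * level_sum (\<lambda>m k. (f m k)\<^sup>2) m + 2 * level_sum (\<lambda>m k. (g m k)\<^sup>2) m) sequentially"
      using level_sum_nonneg[of "\<lambda>m k. (f m k + g m k)\<^sup>2"] by simp
  qed
  then show ?thesis using assms by (simp add: l2_tree_def tree_periodic_def)
qed

lemma l2_tree_cmult: "l2_tree f \<Longrightarrow> l2_tree (\<lambda>m k. c * f m k)"
  unfolding l2_tree_def level_sum_def tree_periodic_def
  by (auto simp: power_mult_distrib sum_distrib_left[symmetric] intro: summable_mult)

lemma l2_tree_shift:
  assumes "l2_tree f" shows "l2_tree (\<lambda>m k. f m (k + i))"
proof -
  have p: "tree_periodic f" using assms by (simp add: l2_tree_def)
  then have "tree_periodic (\<lambda>m k. (f m k)\<^sup>2)" by (simp add: tree_periodic_def)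
  then have "level_sum (\<lambda>m k. (f m (k + i))\<^sup>2) = level_sum (\<lambda>m k. (f m k)\<^sup>2)"
    unfolding level_sum_def[of "\<lambda>m k. (f m (k + i))\<^sup>2"] using sum_periodic_shift[of "\<lambda>m k. (f m k)\<^sup>2"] by auto
  moreover have "tree_periodic (\<lambda>m k. f m (k + i))"
    using p by (auto simp: tree_periodic_def) (metis add.assoc add.commute)
  ultimately show ?thesis using assms by (simp add: l2_tree_def)
qed

lemma l2_tree_children:
  assumes "l2_tree f"
  shows "l2_tree (\<lambda>m k. \<bar>f (Suc m) (2 * k)\<bar> + \<bar>f (Suc m) (2 * k + 1)\<bar>)"
proof -
  have p: "f (Suc m) (j + 2 * 2 ^ m) = f (Suc m) j" for m j
    using assms unfolding l2_tree_def tree_periodic_def by (metis power_Suc)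
  have per: "tree_periodic (\<lambda>m k. \<bar>f (Suc m) (2 * k)\<bar> + \<bar>f (Suc m) (2 * k + 1)\<bar>)"
    unfolding tree_periodic_def
  proof (intro allI)
    fix m and k :: int
    have "2 * (k + 2 ^ m) = 2 * k + 2 * 2 ^ m" "2 * (k + 2 ^ m) + 1 = (2 * k + 1) + 2 * 2 ^ m"
      by (simp_all add: algebra_simps)
    then show "\<bar>f (Suc m) (2 * (k + 2 ^ m))\<bar> + \<bar>f (Suc m) (2 * (k + 2 ^ m) + 1)\<bar>
      = \<bar>f (Suc m) (2 * k)\<bar> + \<bar>f (Suc m) (2 * k + 1)\<bar>" by (simp only: p)
  qed
  have "summable (level_sum (\<lambda>m k. (\<bar>f (Suc m) (2 * k)\<bar> + \<bar>f (Suc m) (2 * k + 1)\<bar>)\<^sup>2))"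
  proof (rule summable_comparison_test_ev)
    show "summable (\<lambda>m. 2 * level_sum (\<lambda>m k. (f m k)\<^sup>2) (Suc m))"
      using assms by (intro summable_mult) (auto simp: l2_tree_def summable_Suc_iff)
    have "(\<bar>f (Suc m) (2*k)\<bar> + \<bar>f (Suc m) (2*k+1)\<bar>)\<^sup>2 \<le> 2 * ((f (Suc m) (2*k))\<^sup>2 + (f (Suc m) (2*k+1))\<^sup>2)" for m k
      using zero_le_power2[of "\<bar>f (Suc m) (2*k)\<bar> - \<bar>f (Suc m) (2*k+1)\<bar>"]
      by (simp add: power2_sum power2_diff)
    then have "level_sum (\<lambda>m k. (\<bar>f (Suc m) (2 * k)\<bar> + \<bar>f (Suc m) (2 * k + 1)\<bar>)\<^sup>2) m
        \<le> 2 * level_sum (\<lambda>m k. (f m k)\<^sup>2) (Suc m)" for m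
      unfolding level_sum_def sum_children sum_distrib_left by (intro sum_mono)
    then show "eventually (\<lambda>m. norm (level_sum (\<lambda>m k. (\<bar>f (Suc m) (2 * k)\<bar> + \<bar>f (Suc m) (2 * k + 1)\<bar>)\<^sup>2) m)
        \<le> 2 * level_sum (\<lambda>m k. (f m k)\<^sup>2) (Suc m)) sequentially"
      using level_sum_nonneg[of "\<lambda>m k. (\<bar>f (Suc m) (2 * k)\<bar> + \<bar>f (Suc m) (2 * k + 1)\<bar>)\<^sup>2"] by simp
  qed
  then show ?thesis using per by (simp add: l2_tree_def)
qed

lemma l2_tree_small:
  assumes "l2_tree f" "\<epsilon> > 0"
  shows "\<exists>M. \<forall>m\<ge>M. \<forall>k. \<bar>f m k\<bar> \<le> \<epsilon>"
proof -
  have p: "tree_periodic f" using assms by (simp add: l2_tree_def)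
  have "level_sum (\<lambda>m k. (f m k)\<^sup>2) \<longlonglongrightarrow> 0"
    using assms by (intro summable_LIMSEQ_zero) (simp add: l2_tree_def)
  then have "eventually (\<lambda>m. level_sum (\<lambda>m k. (f m k)\<^sup>2) m < \<epsilon>\<^sup>2) sequentially"
    using assms(2) by (intro order_tendstoD) auto
  then obtain M where M: "\<And>m. m \<ge> M \<Longrightarrow> level_sum (\<lambda>m k. (f m k)\<^sup>2) m < \<epsilon>\<^sup>2"
    by (auto simp: eventually_sequentially)
  have "\<bar>f m k\<bar> \<le> \<epsilon>" if "m \<ge> M" for m k
  proof -
    have "(f m (k mod 2 ^ m))\<^sup>2 \<le> level_sum (\<lambda>m k. (f m k)\<^sup>2) m"
      unfolding level_sum_def
      by (rule member_le_sum[where f="\<lambda>k. (f m k)\<^sup>2"]) (auto)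
    then have "(f m k)\<^sup>2 \<le> \<epsilon>\<^sup>2" using M[OF that] by (simp add: tree_periodic_mod[OF p])
    then show ?thesis using assms(2) by (metis abs_le_square_iff abs_of_pos)
  qed
  then show ?thesis by blast
qed

text \<open>Summing the recursion bounds the partial sums by \<open>q\<close> times themselves plus a constant.\<close>

lemma summable_forward_recursion:
  fixes T R :: "nat \<Rightarrow> real"
  assumes q: "0 \<le> q" "q < 1" and R: "summable R" and T: "\<And>m. 0 \<le> T m"
    and Rn: "\<And>m. 0 \<le> R m"
    and rec: "\<And>m. m \<ge> M \<Longrightarrow> T (Suc m) \<le> q * T m + R m"
  shows "summable T"
proof -
  define T' where "T' n = T (n + M)" for n
  have rec': "T' (Suc n) \<le> q * T' n + R (n + M)" for n using rec[of "n + M"] by (simp add: T'_def)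
  have R': "summable (\<lambda>n. R (n + M))" using R by simp
  define B where "B = (T' 0 + (\<Sum>n. R (n + M))) / (1 - q)"
  have partial: "(\<Sum>i<n. R (i + M)) \<le> (\<Sum>n. R (n + M))" for n
    using R' Rn by (intro sum_le_suminf) auto
  have "(\<Sum>i<n. T' i) \<le> B" for n
  proof (induction n)
    case 0
    have "0 \<le> (\<Sum>n. R (n + M))" using R' Rn by (intro suminf_nonneg) auto
    then show ?case using q T[of M] by (simp add: B_def T'_def)
  next
    case (Suc n)
    have "(\<Sum>i<Suc n. T' i) = T' 0 + (\<Sum>i<n. T' (Suc i))" by (rule sum.lessThan_Suc_shift)
    also have "\<dots> \<le> T' 0 + (\<Sum>i<n. q * T' i + R (i + M))" using rec' by (intro add_left_mono sum_mono)
    also have "\<dots> = T' 0 + q * (\<Sum>i<n. T' i) + (\<Sum>i<n. R (i + M))" by (simp add: sum.distrib sum_distrib_left)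
    also have "\<dots> \<le> T' 0 + q * B + (\<Sum>n. R (n + M))" using partial[of n] Suc q by (simp add: add_mono mult_left_mono)
    also have "\<dots> = B" using q by (simp add: B_def field_simps)
    finally show ?case .
  qed
  then have "summable T'" using T by (intro summableI_nonneg_bounded[of _ B]) (auto simp: T'_def)
  then show ?thesis unfolding T'_def by (simp only: summable_iff_shift)
qed

text \<open>Here a term is bounded by its successor, which by itself allows growth like \<open>(1 / q) ^ m\<close>. Growth of
order at most \<open>2 ^ m\<close> together with \<open>q < 1/2\<close> makes the iterated terms \<open>q ^ j * T (m + j)\<close> vanish, so \<open>T\<close>
is bounded; then the recursion can be summed, the last term of each partial sum being under control.\<close>

lemma summable_backward_recursion:
  fixes T R :: "nat \<Rightarrow> real"
  assumes q: "0 \<le> q" "q < 1" and R: "summable R" and T: "\<And>m. 0 \<le> T m"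
    and Rn: "\<And>m. 0 \<le> R m" and growth: "\<And>m. T m \<le> C * 2 ^ m" and q2: "q < 1 / 2"
    and rec: "\<And>m. m \<ge> M \<Longrightarrow> T m \<le> q * T (Suc m) + R m"
  shows "summable T"
proof -
  define T' where "T' n = T (n + M)" for n
  define S where "S = (\<Sum>n. R (n + M))"
  have rec': "T' n \<le> q * T' (Suc n) + R (n + M)" for n using rec[of "n + M"] by (simp add: T'_def)
  have R': "summable (\<lambda>n. R (n + M))" using R by simp
  have S0: "0 \<le> S" unfolding S_def using R' Rn by (intro suminf_nonneg) auto
  have RS: "(\<Sum>i<n. R (i + M)) \<le> S" for n
    unfolding S_def using R' Rn by (intro sum_le_suminf) auto
  have RleS: "R (n + M) \<le> S" for n
    using RS[of "Suc n"] Rn sum_nonneg[of "{..<n}" "\<lambda>i. R (i + M)"] by simp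
  have bound: "T' n \<le> S / (1 - q)" for n
  proof -
    have it: "T' n \<le> S / (1 - q) + q ^ j * T' (n + j)" for j
    proof (induction j arbitrary: n)
      case 0 then show ?case using S0 q by simp
    next
      case (Suc j)
      have "T' n \<le> q * T' (Suc n) + S" using rec'[of n] RleS[of n] by linarith
      also have "\<dots> \<le> q * (S / (1 - q) + q ^ j * T' (Suc n + j)) + S"
        using q Suc[of "Suc n"] by (intro add_right_mono mult_left_mono) auto
      also have "\<dots> = S / (1 - q) + q ^ Suc j * T' (n + Suc j)"
        using q by (simp add: field_simps)
      finally show ?case .
    qed
    have "(\<lambda>j. S / (1 - q) + (C * 2 ^ (n + M)) * (2 * q) ^ j) \<longlonglongrightarrow> S / (1 - q) + (C * 2 ^ (n + M)) * 0"
      using q q2 by (intro tendsto_intros LIMSEQ_realpow_zero) auto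
    moreover have "T' n \<le> S / (1 - q) + (C * 2 ^ (n + M)) * (2 * q) ^ j" for j
    proof -
      have "q ^ j * T' (n + j) \<le> q ^ j * (C * 2 ^ (n + j + M))"
        using q growth[of "n + j + M"] by (intro mult_left_mono) (auto simp: T'_def)
      also have "\<dots> = (C * 2 ^ (n + M)) * (2 * q) ^ j"
        by (simp add: power_add power_mult_distrib algebra_simps)
      finally show ?thesis using it[of j] by linarith
    qed
    ultimately have "T' n \<le> S / (1 - q) + (C * 2 ^ (n + M)) * 0" by (meson LIMSEQ_le_const)
    then show ?thesis by simp
  qed
  define B where "B = (S + S / (1 - q)) / (1 - q)"
  have "(\<Sum>i<n. T' i) \<le> B" for n
  proof -
    have "(\<Sum>i<n. T' i) \<le> (\<Sum>i<n. q * T' (Suc i) + R (i + M))" using rec' by (intro sum_mono)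
    also have "\<dots> = q * (\<Sum>i<n. T' (Suc i)) + (\<Sum>i<n. R (i + M))" by (simp add: sum.distrib sum_distrib_left)
    also have "(\<Sum>i<n. T' (Suc i)) = (\<Sum>i<n. T' i) + T' n - T' 0"
      by (induction n) auto
    finally have "(\<Sum>i<n. T' i) \<le> q * (\<Sum>i<n. T' i) + q * (T' n - T' 0) + S"
      using RS[of n] by (simp add: algebra_simps)
    moreover have "q * (T' n - T' 0) \<le> 1 * (S / (1 - q))"
    proof -
      have "q * (T' n - T' 0) \<le> q * (S / (1 - q))"
        using bound[of n] T[of M] q by (intro mult_left_mono) (auto simp: T'_def)
      also have "\<dots> \<le> 1 * (S / (1 - q))" using q S0 by (intro mult_right_mono) auto
      finally show ?thesis .
    qed
    ultimately have "(1 - q) * (\<Sum>i<n. T' i) \<le> S + S / (1 - q)" by (simp add: algebra_simps)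
    then show ?thesis using q by (simp only: B_def pos_le_divide_eq diff_gt_0_iff_gt mult.commute)
  qed
  then have "summable T'" using T by (intro summableI_nonneg_bounded[of _ B]) (auto simp: T'_def)
  then show ?thesis unfolding T'_def by (simp only: summable_iff_shift)
qed

text \<open>The factor 11/10 is chosen so that \<open>11/10 * (3/5)\<^sup>2 < 2/5\<close>: the squared recursions below
contract even after a factor 2 for the two children.\<close>

lemma square_split: "(a + b)\<^sup>2 \<le> 11 / 10 * a\<^sup>2 + 11 * (b::real)\<^sup>2"
  using zero_le_power2[of "a / 10 - b"] by (simp add: power2_eq_square field_simps)

text \<open>Each parent is counted by its two children, so the level sums of squares contract by \<open>2 * 2/5\<close>.\<close>

lemma l2_tree_parent_recursion:
  assumes e: "l2_tree e" and E: "tree_periodic E" "\<And>m k. 0 \<le> E m k"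
    and rec: "\<And>m k. m \<ge> M \<Longrightarrow> E (Suc m) k \<le> 3 / 5 * E m (k div 2) + \<bar>e (Suc m) k\<bar>"
  shows "l2_tree E"
proof -
  have "summable (level_sum (\<lambda>m k. (E m k)\<^sup>2))"
  proof (rule summable_forward_recursion[where q="4/5" and M=M])
    show "summable (\<lambda>m. 11 * level_sum (\<lambda>m k. (e m k)\<^sup>2) (Suc m))"
      using e by (intro summable_mult) (auto simp: l2_tree_def summable_Suc_iff)
    fix m assume "m \<ge> M"
    have "(E (Suc m) k)\<^sup>2 \<le> 2 / 5 * (E m (k div 2))\<^sup>2 + 11 * (e (Suc m) k)\<^sup>2" for k
    proof -
      have "(E (Suc m) k)\<^sup>2 \<le> (3 / 5 * E m (k div 2) + \<bar>e (Suc m) k\<bar>)\<^sup>2"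
        using rec[OF \<open>m \<ge> M\<close>] E(2) by (intro power_mono) auto
      also have "\<dots> \<le> 11 / 10 * (3 / 5 * E m (k div 2))\<^sup>2 + 11 * \<bar>e (Suc m) k\<bar>\<^sup>2" by (rule square_split)
      also have "\<dots> \<le> 2 / 5 * (E m (k div 2))\<^sup>2 + 11 * (e (Suc m) k)\<^sup>2"
        by (simp add: power_mult_distrib power2_eq_square[of "3::real"] power_divide)
      finally show ?thesis .
    qed
    then have "level_sum (\<lambda>m k. (E m k)\<^sup>2) (Suc m)
        \<le> (\<Sum>k\<in>{0..<2 ^ Suc m}. 2 / 5 * (E m (k div 2))\<^sup>2 + 11 * (e (Suc m) k)\<^sup>2)"
      unfolding level_sum_def by (intro sum_mono)
    also have "\<dots> = 2 / 5 * (\<Sum>k\<in>{0..<2 ^ Suc m}. (E m (k div 2))\<^sup>2) + 11 * level_sum (\<lambda>m k. (e m k)\<^sup>2) (Suc m)"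
      by (simp only: sum.distrib sum_distrib_left level_sum_def)
    also have "(\<Sum>k\<in>{0..<2 ^ Suc m}. (E m (k div 2))\<^sup>2) = 2 * level_sum (\<lambda>m k. (E m k)\<^sup>2) m"
      unfolding level_sum_def by (rule sum_parents)
    finally show "level_sum (\<lambda>m k. (E m k)\<^sup>2) (Suc m)
        \<le> 4 / 5 * level_sum (\<lambda>m k. (E m k)\<^sup>2) m + 11 * level_sum (\<lambda>m k. (e m k)\<^sup>2) (Suc m)" by simp
  qed (auto intro: level_sum_nonneg)
  then show ?thesis using E by (simp add: l2_tree_def)
qed

text \<open>The square of the maximum over two children is at most the sum of both squares, so the level sums of
squares contract by 2/5 without any doubling. Boundedness supplies the growth condition: a level has
\<open>2 ^ m\<close> nodes.\<close>

lemma l2_tree_child_recursion: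
  assumes e: "l2_tree e" and E: "tree_periodic E" "\<And>m k. 0 \<le> E m k" "\<And>m k. E m k \<le> C"
    and rec: "\<And>m k. m \<ge> M \<Longrightarrow> E m k \<le> 3 / 5 * max (E (Suc m) (2 * k)) (E (Suc m) (2 * k + 1)) + \<bar>e m k\<bar>"
  shows "l2_tree E"
proof -
  have "summable (level_sum (\<lambda>m k. (E m k)\<^sup>2))"
  proof (rule summable_backward_recursion[where q="2/5" and M=M and C="C\<^sup>2"])
    show "summable (\<lambda>m. 11 * level_sum (\<lambda>m k. (e m k)\<^sup>2) m)"
      using e by (intro summable_mult) (auto simp: l2_tree_def)
    fix m
    have "level_sum (\<lambda>m k. (E m k)\<^sup>2) m \<le> (\<Sum>k\<in>{0..<2 ^ m::int}. C\<^sup>2)"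
      unfolding level_sum_def using E by (intro sum_mono power_mono) auto
    then show "level_sum (\<lambda>m k. (E m k)\<^sup>2) m \<le> C\<^sup>2 * 2 ^ m" by (simp add: mult.commute)
  next
    fix m assume "m \<ge> M"
    have "(E m k)\<^sup>2 \<le> 2 / 5 * ((E (Suc m) (2 * k))\<^sup>2 + (E (Suc m) (2 * k + 1))\<^sup>2) + 11 * (e m k)\<^sup>2" for k
    proof -
      let ?X = "max (E (Suc m) (2 * k)) (E (Suc m) (2 * k + 1))"
      have "(E m k)\<^sup>2 \<le> (3 / 5 * ?X + \<bar>e m k\<bar>)\<^sup>2"
        using rec[OF \<open>m \<ge> M\<close>] E(2) by (intro power_mono) auto
      also have "\<dots> \<le> 11 / 10 * (3 / 5 * ?X)\<^sup>2 + 11 * \<bar>e m k\<bar>\<^sup>2" by (rule square_split)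
      also have "\<dots> \<le> 2 / 5 * ?X\<^sup>2 + 11 * (e m k)\<^sup>2"
        by (simp add: power_mult_distrib power2_eq_square[of "3::real"] power_divide)
      also have "?X\<^sup>2 \<le> (E (Suc m) (2 * k))\<^sup>2 + (E (Suc m) (2 * k + 1))\<^sup>2"
        by (simp add: max_def)
      finally show ?thesis by simp
    qed
    then have "level_sum (\<lambda>m k. (E m k)\<^sup>2) m
        \<le> (\<Sum>k\<in>{0..<2 ^ m}. 2 / 5 * ((E (Suc m) (2 * k))\<^sup>2 + (E (Suc m) (2 * k + 1))\<^sup>2) + 11 * (e m k)\<^sup>2)"
      unfolding level_sum_def by (intro sum_mono)
    also have "\<dots> = 2 / 5 * level_sum (\<lambda>m k. (E m k)\<^sup>2) (Suc m) + 11 * level_sum (\<lambda>m k. (e m k)\<^sup>2) m"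
      unfolding level_sum_def sum_children by (simp add: sum.distrib sum_distrib_left algebra_simps)
    finally show "level_sum (\<lambda>m k. (E m k)\<^sup>2) m
        \<le> 2 / 5 * level_sum (\<lambda>m k. (E m k)\<^sup>2) (Suc m) + 11 * level_sum (\<lambda>m k. (e m k)\<^sup>2) m" .
  qed (auto intro: level_sum_nonneg)
  then show ?thesis using E by (simp add: l2_tree_def)
qed

section \<open>Lifts of projective maps\<close>

lemma matrix_vector_2: "(A::real^2^2) *v vector [x, y] = vector [A$1$1 * x + A$1$2 * y, A$2$1 * x + A$2$2 * y]"
  by (simp add: vec_eq_iff forall_2 matrix_vector_mult_def sum_2)

lemma span_polar:
  assumes "r \<noteq> 0"
  shows "span {vector [r * cos t, r * sin t] :: real^2} = rp1_point t"
proof -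
  have e: "(vector [r * cos t, r * sin t] :: real^2) = r *\<^sub>R vector [cos t, sin t]"
    by (simp add: vec_eq_iff forall_2)
  have "(vector [cos t, sin t] :: real^2) = inverse r *\<^sub>R (r *\<^sub>R vector [cos t, sin t])"
    using assms by simp
  then show ?thesis unfolding rp1_point_def e span_eq
    by (auto simp: span_singleton)
qed

lemma image_rp1_point:
  fixes A :: "real^2^2"
  shows "(\<lambda>v. A *v v) ` rp1_point t
     = span {vector [A$1$1 * cos t + A$1$2 * sin t, A$2$1 * cos t + A$2$2 * sin t]}"
proof -
  have "(\<lambda>v. A *v v) ` rp1_point t = span ((\<lambda>v. A *v v) ` {vector [cos t, sin t]})"
    unfolding rp1_point_def by (rule linear_span_image[symmetric]) simp
  then show ?thesis by (simp add: matrix_vector_2)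
qed

text \<open>Translation by multiples of \<open>pi\<close> makes \<open>F\<close> unbounded in both directions, hence onto; an injective
continuous map of the line is open.\<close>

lemma homeomorphic_map_real:
  fixes F :: "real \<Rightarrow> real"
  assumes "strict_mono F" "continuous_on UNIV F" "\<And>t. F (t + pi) = F t + pi"
  shows "homeomorphic_map euclideanreal euclideanreal F"
proof -
  have inj: "inj F" using assms(1) by (rule strict_mono_imp_inj_on)
  have nat: "F (t + real n * pi) = F t + real n * pi" for t n
  proof (induction n)
    case (Suc n)
    then show ?case using assms(3)[of "t + real n * pi"] by (simp add: algebra_simps)
  qed simp
  have "y \<in> range F" for y
  proof -
    obtain n :: nat where n: "\<bar>y - F 0\<bar> < real n * pi" using ex_less_of_nat_mult[OF pi_gt_zero] by blast
    have "F (real n * pi) = F 0 + real n * pi" using nat[of 0 n] by simp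
    then have b: "y \<le> F (real n * pi)" using n by linarith
    have "F 0 = F (- (real n * pi)) + real n * pi" using nat[of "- (real n * pi)" n] by simp
    then have a: "F (- (real n * pi)) \<le> y" using n by linarith
    obtain t where "F t = y"
      using a b IVT'[of F "- (real n * pi)" y "real n * pi"] assms(2) continuous_on_subset by force
    then show ?thesis by blast
  qed
  then have "range F = UNIV" by blast
  moreover have "open (F ` U)" if "open U" for U
    using injective_into_1d_imp_open_map_UNIV[of U UNIV F] that assms(2) inj by simp
  ultimately show ?thesis using assms(2) inj
    by (intro bijective_open_imp_homeomorphic_map) (auto simp: open_map_def)
qed

text \<open>The vector \<open>(w1 t, w2 t)\<close> is the image of the unit vector at angle \<open>t\<close>. The square of its component
orthogonal to the direction \<open>F t\<close>, divided by its squared length, has derivative 0, so once \<open>F\<close>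
gives the direction of the vector at \<open>t0\<close> it gives it everywhere. How far \<open>F\<close> has turned is then
read off from the fact that the vectors at \<open>s\<close> and \<open>t\<close> span a parallelogram of area \<open>sin (t - s)\<close>.\<close>

lemma angle_function_lifts:
  fixes A :: "real^2^2" and F :: "real \<Rightarrow> real"
  defines "w1 \<equiv> \<lambda>t. A$1$1 * cos t + A$1$2 * sin t"
    and "w2 \<equiv> \<lambda>t. A$2$1 * cos t + A$2$2 * sin t"
  assumes det: "det A = 1"
    and F: "\<And>t. (F has_real_derivative 1 / ((w1 t)\<^sup>2 + (w2 t)\<^sup>2)) (at t)"
    and init: "w1 t0 = r * cos (F t0)" "w2 t0 = r * sin (F t0)"
  shows "is_lift (\<lambda>L. (\<lambda>v. A *v v) ` L) F"
    and "\<And>t. w1 t = (w1 t * cos (F t) + w2 t * sin (F t)) * cos (F t)"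
    and "\<And>t. w2 t = (w1 t * cos (F t) + w2 t * sin (F t)) * sin (F t)"
    and "\<And>s. 0 < s \<Longrightarrow> s < pi \<Longrightarrow> F t0 < F (t0 + s) \<and> F (t0 + s) < F t0 + pi"
proof -
  define a b c d where abcd: "a = A$1$1" "b = A$1$2" "c = A$2$1" "d = A$2$2"
  have dt: "a * d - b * c = 1" using det by (simp add: abcd det_2)
  define v1 v2 where "v1 t = b * cos t - a * sin t" and "v2 t = d * cos t - c * sin t" for t
  note defs = w1_def w2_def v1_def v2_def abcd[symmetric]
  have w_deriv: "(w1 has_real_derivative v1 t) (at t)" "(w2 has_real_derivative v2 t) (at t)" for t
    unfolding defs by (auto intro!: derivative_eq_intros)
  define N where "N t = (w1 t)\<^sup>2 + (w2 t)\<^sup>2" for t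
  have cs: "cos t * cos t + sin t * sin t = 1" for t :: real
    using sin_cos_squared_add[of t] by (simp add: power2_eq_square)
  have wr: "w1 s * w2 t - w2 s * w1 t = sin (t - s)" for s t
  proof -
    have "w1 s * w2 t - w2 s * w1 t = (a * d - b * c) * (cos s * sin t - sin s * cos t)"
      unfolding defs by (simp add: algebra_simps)
    then show ?thesis using dt by (simp add: sin_diff algebra_simps)
  qed
  have wv: "w1 t * v2 t - w2 t * v1 t = 1" for t
  proof -
    have "w1 t * v2 t - w2 t * v1 t = (a * d - b * c) * (cos t * cos t + sin t * sin t)"
      unfolding defs by algebra
    then show ?thesis using dt cs by simp
  qed
  have Npos: "N t > 0" for t
  proof -
    have "w1 t \<noteq> 0 \<or> w2 t \<noteq> 0" using wv[of t] by auto
    then show ?thesis by (simp add: N_def sum_power2_gt_zero_iff)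
  qed
  define z p where "z t = w2 t * cos (F t) - w1 t * sin (F t)"
    and "p t = w1 t * cos (F t) + w2 t * sin (F t)" for t
  have F': "(F has_real_derivative 1 / N t) (at t)" for t using F by (simp add: N_def)
  have z': "(z has_real_derivative (v2 t * cos (F t) - v1 t * sin (F t) - p t / N t)) (at t)" for t
    unfolding z_def[abs_def] p_def
    by (auto intro!: derivative_eq_intros w_deriv F' simp: algebra_simps add_divide_distrib)
  have key: "(v2 t * cos (F t) - v1 t * sin (F t)) * N t - p t = (w1 t * v1 t + w2 t * v2 t) * z t" for t
  proof -
    have "p t = p t * (w1 t * v2 t - w2 t * v1 t)" using wv by simp
    then show ?thesis unfolding N_def z_def
      by (simp add: p_def power2_eq_square algebra_simps)
  qed
  have N': "(N has_real_derivative 2 * (w1 t * v1 t + w2 t * v2 t)) (at t)" for t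
    unfolding N_def[abs_def] by (auto intro!: derivative_eq_intros w_deriv simp: power2_eq_square algebra_simps)
  have "((\<lambda>t. (z t)\<^sup>2 / N t) has_real_derivative 0) (at t)" for t
  proof -
    have e: "v2 t * cos (F t) - v1 t * sin (F t) - p t / N t = (w1 t * v1 t + w2 t * v2 t) * z t / N t"
      using key[of t] Npos[of t] by (simp add: field_simps)
    have z'': "(z has_real_derivative (w1 t * v1 t + w2 t * v2 t) * z t / N t) (at t)"
      using z'[of t] by (simp only: e)
    show ?thesis
      by (rule derivative_eq_intros z'' N' refl | use Npos[of t] in \<open>simp; fail\<close>)+
         (use Npos[of t] in \<open>simp add: power2_eq_square field_simps\<close>)
  qed
  then have zc: "(z t)\<^sup>2 / N t = (z t0)\<^sup>2 / N t0" for t by (intro DERIV_isconst_all) auto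
  have z00: "z t0 = 0" unfolding z_def init by (simp add: algebra_simps)
  have z0: "z t = 0" for t
    using zc[of t] Npos[of t] by (simp add: z00)
  have p1: "w1 t = p t * cos (F t)" for t
  proof -
    have "p t * cos (F t) - z t * sin (F t) = w1 t * (cos (F t) * cos (F t) + sin (F t) * sin (F t))"
      unfolding p_def z_def by algebra
    then show ?thesis using z0 cs by simp
  qed
  have p2: "w2 t = p t * sin (F t)" for t
  proof -
    have "p t * sin (F t) + z t * cos (F t) = w2 t * (cos (F t) * cos (F t) + sin (F t) * sin (F t))"
      unfolding p_def z_def by algebra
    then show ?thesis using z0 cs by simp
  qed
  show "\<And>t. w1 t = (w1 t * cos (F t) + w2 t * sin (F t)) * cos (F t)"
    "\<And>t. w2 t = (w1 t * cos (F t) + w2 t * sin (F t)) * sin (F t)"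
    by (fact p1[unfolded p_def], fact p2[unfolded p_def])
  have pn0: "p t \<noteq> 0" for t
    using Npos[of t] p1[of t] p2[of t] by (auto simp: N_def)
  have turn: "sin (t - t0) = p t0 * p t * sin (F t - F t0)" for t
    using wr[of t0 t] p1[of t] p2[of t] p1[of t0] p2[of t0] by (simp add: sin_diff algebra_simps)
  have mono: "strict_mono F"
    unfolding strict_mono_def
  proof (intro allI impI)
    fix x y :: real assume "x < y"
    then show "F x < F y"
      by (rule DERIV_pos_imp_increasing) (use F' Npos in \<open>auto intro!: exI\<close>)
  qed
  have cont: "continuous_on UNIV F"
    using F' by (meson DERIV_continuous_on has_field_derivative_at_within)
  have le_pi: "F (t0 + s) < F t0 + pi" if s: "0 < s" "s < pi" for s
  proof (rule ccontr)
    assume "\<not> F (t0 + s) < F t0 + pi"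
    then obtain t where t: "t0 \<le> t" "t \<le> t0 + s" "F t = F t0 + pi"
      using IVT'[of F t0 "F t0 + pi" "t0 + s"] s cont continuous_on_subset by force
    then have "sin (t - t0) = 0" using turn[of t] by simp
    moreover have "t \<noteq> t0" using t by auto
    ultimately show False using t s sin_gt_zero[of "t - t0"] by auto
  qed
  then show "\<And>s. 0 < s \<Longrightarrow> s < pi \<Longrightarrow> F t0 < F (t0 + s) \<and> F (t0 + s) < F t0 + pi"
    using mono by (auto simp: strict_mono_def)
  have full: "F (t0 + pi) = F t0 + pi"
  proof -
    have "sin (F (t0 + pi) - F t0) = 0" using turn[of "t0 + pi"] pn0 by auto
    moreover have "F (t0 + pi) - F t0 > 0" using mono by (auto simp: strict_mono_def)
    moreover have "F (t0 + pi) \<le> F t0 + pi"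
    proof (rule tendsto_le)
      have "isCont F (t0 + pi)" using F' DERIV_isCont by blast
      moreover have "isCont (\<lambda>s. t0 + s) pi" by simp
      ultimately have "isCont (\<lambda>s. F (t0 + s)) pi" by (rule isCont_o2[rotated])
      then show "((\<lambda>s. F (t0 + s)) \<longlongrightarrow> F (t0 + pi)) (at_left pi)"
        unfolding isCont_def by (rule tendsto_mono[OF at_le[OF subset_UNIV]])
      show "((\<lambda>s. F t0 + pi) \<longlongrightarrow> F t0 + pi) (at_left pi)" by simp
      show "\<forall>\<^sub>F s in at_left pi. F (t0 + s) \<le> F t0 + pi"
        using eventually_at_left_real[OF pi_gt_zero] by eventually_elim (use le_pi in \<open>auto intro: less_imp_le\<close>)
    qed simp
    ultimately show ?thesis
      by (smt (verit) sin_gt_zero)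
  qed
  have dper: "F (t + pi) - F t = F (t0 + pi) - F t0" for t
  proof (rule DERIV_isconst_all[where f="\<lambda>t. F (t + pi) - F t"])
    show "\<forall>x. ((\<lambda>t. F (t + pi) - F t) has_real_derivative 0) (at x)"
    proof
      fix x
      have "((\<lambda>t. F (t + pi)) has_real_derivative 1 / N (x + pi)) (at x)"
        using F'[of "x + pi"] by (simp add: DERIV_shift)
      moreover have "N (x + pi) = N x" unfolding N_def defs by (simp add: power2_eq_square algebra_simps)
      ultimately show "((\<lambda>t. F (t + pi) - F t) has_real_derivative 0) (at x)"
        using DERIV_diff[OF _ F'[of x]] by fastforce
    qed
  qed
  have per: "F (t + pi) = F t + pi" for t using dper[of t] full by linarith
  have "(\<lambda>v. A *v v) ` rp1_point t = rp1_point (F t)" for t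
  proof -
    have "(\<lambda>v. A *v v) ` rp1_point t = span {vector [w1 t, w2 t]}"
      by (simp add: image_rp1_point w1_def w2_def)
    also have "\<dots> = rp1_point (F t)" unfolding p1[of t] p2[of t] using pn0 by (rule span_polar)
    finally show ?thesis .
  qed
  then show "is_lift (\<lambda>L. (\<lambda>v. A *v v) ` L) F"
    unfolding is_lift_def using mono per homeomorphic_map_real[OF mono cont] by auto
qed

lemma angle_function_exists:
  fixes A :: "real^2^2"
  assumes "det A = 1"
  shows "\<exists>F. F t0 = y0 \<and> (\<forall>t. (F has_real_derivative
     1 / ((A$1$1 * cos t + A$1$2 * sin t)\<^sup>2 + (A$2$1 * cos t + A$2$2 * sin t)\<^sup>2)) (at t))"
proof -
  define g where "g t = 1 / ((A$1$1 * cos t + A$1$2 * sin t)\<^sup>2 + (A$2$1 * cos t + A$2$2 * sin t)\<^sup>2)" for t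
  have "(A$1$1 * cos t + A$1$2 * sin t)\<^sup>2 + (A$2$1 * cos t + A$2$2 * sin t)\<^sup>2 \<noteq> 0" for t
  proof
    assume "(A$1$1 * cos t + A$1$2 * sin t)\<^sup>2 + (A$2$1 * cos t + A$2$2 * sin t)\<^sup>2 = 0"
    then have e: "A$1$1 * cos t + A$1$2 * sin t = 0" "A$2$1 * cos t + A$2$2 * sin t = 0" by auto
    have "cos t = A$2$2 * (A$1$1 * cos t + A$1$2 * sin t) - A$1$2 * (A$2$1 * cos t + A$2$2 * sin t)"
      "sin t = A$1$1 * (A$2$1 * cos t + A$2$2 * sin t) - A$2$1 * (A$1$1 * cos t + A$1$2 * sin t)"
      using assms unfolding det_2 by algebra+
    then have "cos t = 0" "sin t = 0" unfolding e by auto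
    then show False using sin_cos_squared_add[of t] by simp
  qed
  then have "isCont g t" for t unfolding g_def by (intro continuous_intros) auto
  then obtain F where F: "\<And>t. (F has_real_derivative g t) (at t)"
    using einterval_antiderivative[of "-\<infinity>" \<infinity> g] by (auto simp: has_real_derivative_iff_has_vector_derivative)
  show ?thesis
    by (rule exI[of _ "\<lambda>t. F t - F t0 + y0"])
       (use F in \<open>auto intro!: derivative_eq_intros simp: g_def\<close>)
qed

text \<open>The angle of the moving vector changes at the rate 1 over its squared length, which is a
quadratic form of determinant 1 in \<open>(cos s, sin s)\<close>.\<close>

lemma mobius_lift_derivative:
  assumes "f \<in> PSL2R" "is_lift f F"
  shows "\<exists>n b g. n > 0 \<and> n * g - b\<^sup>2 = 1 \<and>
    (\<forall>s. (F has_real_derivative 1 / (n * (cos s)\<^sup>2 + 2 * b * sin s * cos s + g * (sin s)\<^sup>2)) (at (x + s)))"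
proof -
  obtain A :: "real^2^2" where A: "f = (\<lambda>L. (\<lambda>v. A *v v) ` L)" "det A = 1"
    using assms(1) by (auto simp: PSL2R_def)
  define w1 where "w1 t = A$1$1 * cos t + A$1$2 * sin t" for t
  define w2 where "w2 t = A$2$1 * cos t + A$2$2 * sin t" for t
  obtain r y where ry: "w1 0 = r * cos y" "w2 0 = r * sin y"
    using polar_Ex[of "w1 0" "w2 0"] by blast
  obtain G where G: "G 0 = y" "\<And>t. (G has_real_derivative 1 / ((w1 t)\<^sup>2 + (w2 t)\<^sup>2)) (at t)"
    using angle_function_exists[OF A(2), of 0 y] unfolding w1_def w2_def by blast
  have "is_lift f G" unfolding A(1)
    by (rule angle_function_lifts(1)[OF A(2), of G 0 r]) (use G ry in \<open>auto simp: w1_def w2_def\<close>)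
  then obtain k :: int where k: "\<And>x. F x = G x + of_int k * pi" using is_lift_unique[OF assms(2)] by blast
  have F: "(F has_real_derivative 1 / ((w1 t)\<^sup>2 + (w2 t)\<^sup>2)) (at t)" for t
    unfolding k by (auto intro!: derivative_eq_intros G)
  define v1 where "v1 = A$1$2 * cos x - A$1$1 * sin x"
  define v2 where "v2 = A$2$2 * cos x - A$2$1 * sin x"
  have w: "w1 (x + s) = w1 x * cos s + v1 * sin s" "w2 (x + s) = w2 x * cos s + v2 * sin s" for s
    unfolding w1_def w2_def v1_def v2_def by (simp_all add: cos_add sin_add algebra_simps)
  have "w1 x * v2 - w2 x * v1 = (A$1$1 * A$2$2 - A$1$2 * A$2$1) * ((cos x)\<^sup>2 + (sin x)\<^sup>2)"
    unfolding w1_def w2_def v1_def v2_def by algebra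
  then have one: "w1 x * v2 - w2 x * v1 = 1" using A(2) by (simp add: det_2)
  show ?thesis
  proof (intro exI conjI allI)
    have "w1 x \<noteq> 0 \<or> w2 x \<noteq> 0" using one by auto
    then show "(w1 x)\<^sup>2 + (w2 x)\<^sup>2 > 0" by (simp add: sum_power2_gt_zero_iff)
    have "((w1 x)\<^sup>2 + (w2 x)\<^sup>2) * (v1\<^sup>2 + v2\<^sup>2) - (w1 x * v1 + w2 x * v2)\<^sup>2 = (w1 x * v2 - w2 x * v1)\<^sup>2"
      by (simp add: power2_eq_square algebra_simps)
    then show "((w1 x)\<^sup>2 + (w2 x)\<^sup>2) * (v1\<^sup>2 + v2\<^sup>2) - (w1 x * v1 + w2 x * v2)\<^sup>2 = 1" using one by simp
    fix s
    have "(w1 (x + s))\<^sup>2 + (w2 (x + s))\<^sup>2 = ((w1 x)\<^sup>2 + (w2 x)\<^sup>2) * (cos s)\<^sup>2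
        + 2 * (w1 x * v1 + w2 x * v2) * sin s * cos s + (v1\<^sup>2 + v2\<^sup>2) * (sin s)\<^sup>2"
      unfolding w by (simp add: power2_eq_square algebra_simps)
    then show "(F has_real_derivative 1 / (((w1 x)\<^sup>2 + (w2 x)\<^sup>2) * (cos s)\<^sup>2
        + 2 * (w1 x * v1 + w2 x * v2) * sin s * cos s + (v1\<^sup>2 + v2\<^sup>2) * (sin s)\<^sup>2)) (at (x + s))"
      using F[of "x + s"] by simp
  qed
qed

text \<open>In the coordinates \<open>cot (t - x)\<close> on the source and \<open>cot (t - y)\<close> on the target, a projective map
taking \<open>x\<close> to \<open>y\<close> fixes infinity, hence is affine. Its linear part is the inverse of the derivative
at \<open>x\<close>, and its translation part \<open>\<kappa>\<close> is a free parameter that sets the second derivative.\<close>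

lemma mobius_with_jet:
  fixes x y \<mu> \<kappa> :: real
  assumes "\<mu> > 0"
  shows "\<exists>f\<in>PSL2R. \<exists>F. is_lift f F \<and> F x = y \<and>
    (\<forall>s. (F has_real_derivative \<mu> / ((cos s - \<kappa> * \<mu> * sin s)\<^sup>2 + (\<mu> * sin s)\<^sup>2)) (at (x + s))) \<and>
    (\<forall>s. 0 < s \<longrightarrow> s < pi \<longrightarrow> y < F (x + s) \<and> F (x + s) < y + pi \<and> cot (F (x + s) - y) = cot s / \<mu> - \<kappa>)"
proof -
  define p where "p = 1 / sqrt \<mu>"
  have p: "p > 0" "p * p = 1 / \<mu>" using assms by (auto simp: p_def)
  define q where "q = - (\<kappa> * \<mu> * p)"
  \<comment> \<open>the rotation by \<open>y\<close>, times the upper triangular matrix with rows \<open>(p, q)\<close> and \<open>(0, 1/p)\<close>,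
    times the rotation by \<open>- x\<close>\<close>
  define A :: "real^2^2" where "A = vector [vector
      [cos y * (p * cos x - q * sin x) + sin y * sin x / p, cos y * (p * sin x + q * cos x) - sin y * cos x / p],
    vector [sin y * (p * cos x - q * sin x) - cos y * sin x / p, sin y * (p * sin x + q * cos x) + cos y * cos x / p]]"
  define b1 where "b1 s = p * cos s + q * sin s" for s
  define b2 where "b2 s = sin s / p" for s
  define w1 where "w1 t = A$1$1 * cos t + A$1$2 * sin t" for t
  define w2 where "w2 t = A$2$1 * cos t + A$2$2 * sin t" for t
  have w1: "w1 (x + s) = cos y * b1 s - sin y * b2 s" for s
  proof -
    have "w1 (x + s) = cos y * b1 ((x + s) - x) - sin y * b2 ((x + s) - x)"
      unfolding w1_def b1_def b2_def cos_diff sin_diff A_def by (simp add: algebra_simps diff_divide_distrib)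
    then show ?thesis by simp
  qed
  have w2: "w2 (x + s) = sin y * b1 s + cos y * b2 s" for s
  proof -
    have "w2 (x + s) = sin y * b1 ((x + s) - x) + cos y * b2 ((x + s) - x)"
      unfolding w2_def b1_def b2_def cos_diff sin_diff A_def by (simp add: algebra_simps diff_divide_distrib)
    then show ?thesis by simp
  qed
  have det: "det A = 1"
  proof -
    have "det A = (cos y * cos y + sin y * sin y) * (cos x * cos x + sin x * sin x) * (p * (1/p))"
      unfolding det_2 A_def vector_2 times_divide_eq_right[symmetric, of _ _ p] divide_inverse by algebra
    then show ?thesis using p sin_cos_squared_add3[of x] sin_cos_squared_add3[of y] by simp
  qed
  have N: "(w1 (x + s))\<^sup>2 + (w2 (x + s))\<^sup>2 = ((cos s - \<kappa> * \<mu> * sin s)\<^sup>2 + (\<mu> * sin s)\<^sup>2) / \<mu>" for s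
  proof -
    have "(w1 (x + s))\<^sup>2 + (w2 (x + s))\<^sup>2 = ((cos y)\<^sup>2 + (sin y)\<^sup>2) * ((b1 s)\<^sup>2 + (b2 s)\<^sup>2)"
      unfolding w1 w2 by algebra
    also have "\<dots> = (b1 s)\<^sup>2 + (b2 s)\<^sup>2" by simp
    also have "(b1 s)\<^sup>2 = p * p * (cos s - \<kappa> * \<mu> * sin s)\<^sup>2"
      unfolding b1_def q_def by (simp add: power2_eq_square algebra_simps)
    also have "(b2 s)\<^sup>2 = (sin s)\<^sup>2 / (p * p)" unfolding b2_def by (simp add: power2_eq_square)
    finally show ?thesis unfolding p using assms by (simp add: power2_eq_square field_simps)
  qed
  obtain F where F: "F x = y" "\<And>t. (F has_real_derivative 1 / ((w1 t)\<^sup>2 + (w2 t)\<^sup>2)) (at t)"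
    using angle_function_exists[OF det, of x y] unfolding w1_def w2_def by blast
  have init: "w1 x = p * cos (F x)" "w2 x = p * sin (F x)"
    using w1[of 0] w2[of 0] F(1) by (simp_all add: b1_def b2_def)
  note lifts = angle_function_lifts[OF det, of F x p, folded w1_def w2_def, OF F(2) init]
  have cot: "cot (F (x + s) - y) = cot s / \<mu> - \<kappa>" if s: "0 < s" "s < pi" for s
  proof -
    define \<rho> where "\<rho> = w1 (x + s) * cos (F (x + s)) + w2 (x + s) * sin (F (x + s))"
    have r: "w1 (x + s) = \<rho> * cos (F (x + s))" "w2 (x + s) = \<rho> * sin (F (x + s))"
      unfolding \<rho>_def by (rule lifts(2), rule lifts(3))
    have one: "cos y * cos y + sin y * sin y = 1" using sin_cos_squared_add3[of y] by simp
    have "\<rho> * cos (F (x + s) - y) = cos y * w1 (x + s) + sin y * w2 (x + s)"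
      unfolding r by (simp add: cos_diff algebra_simps)
    also have "\<dots> = (cos y * cos y + sin y * sin y) * b1 s" unfolding w1 w2 by algebra
    finally have c: "\<rho> * cos (F (x + s) - y) = b1 s" using one by simp
    have "\<rho> * sin (F (x + s) - y) = cos y * w2 (x + s) - sin y * w1 (x + s)"
      unfolding r by (simp add: sin_diff algebra_simps)
    also have "\<dots> = (cos y * cos y + sin y * sin y) * b2 s" unfolding w1 w2 by algebra
    finally have d: "\<rho> * sin (F (x + s) - y) = b2 s" using one by simp
    have sp: "sin s > 0" using s by (rule sin_gt_zero)
    then have "b2 s \<noteq> 0" using p by (simp add: b2_def)
    then have "\<rho> \<noteq> 0" using d by auto
    then have "cot (F (x + s) - y) = b1 s / b2 s" unfolding c[symmetric] d[symmetric] cot_def by simp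
    also have "\<dots> = p * p * cot s - \<kappa> * \<mu> * (p * p)"
      using sp p(1) unfolding b1_def b2_def q_def cot_def by (simp add: field_simps)
    finally show ?thesis unfolding p using assms by simp
  qed
  show ?thesis
  proof (intro bexI exI conjI allI impI)
    show "(\<lambda>L. (\<lambda>v. A *v v) ` L) \<in> PSL2R" using det by (auto simp: PSL2R_def)
    show "is_lift (\<lambda>L. (\<lambda>v. A *v v) ` L) F" by (rule lifts(1))
    show "F x = y" by (rule F)
    fix s
    show "(F has_real_derivative \<mu> / ((cos s - \<kappa> * \<mu> * sin s)\<^sup>2 + (\<mu> * sin s)\<^sup>2)) (at (x + s))"
      using F(2)[of "x + s"] unfolding N by simp
    assume "0 < s" "s < pi"
    then show "y < F (x + s)" "F (x + s) < y + pi" "cot (F (x + s) - y) = cot s / \<mu> - \<kappa>"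
      using lifts(4)[of s] cot F(1) by auto
  qed
qed

section \<open>Dyadic slopes of a lift\<close>

lemma exp_minus_one_le: "0 \<le> x \<Longrightarrow> x \<le> 1 \<Longrightarrow> exp x - 1 \<le> 2 * (x::real)"
  using exp_bound[of x] mult_left_le[of x x] by (simp add: power2_eq_square)

lemma abs_exp_minus_one_le: "\<bar>exp x - 1\<bar> \<le> exp \<bar>x\<bar> - (1::real)"
proof (cases "x \<ge> 0")
  case False
  then have "exp x * exp (-x) = 1" by (simp add: exp_minus field_simps)
  moreover have "exp x \<le> 1" "1 \<le> exp (-x)" using False by auto
  ultimately have "(1 - exp x) \<le> exp (-x) - 1"
    using mult_nonneg_nonneg[of "1 - exp x" "exp (-x) - 1"] by (simp add: algebra_simps)
  then show ?thesis using False \<open>exp x \<le> 1\<close> by simp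
qed auto

lemma exp_tenth: "x \<le> 1/10 \<Longrightarrow> exp x \<le> (6/5 :: real)"
proof -
  assume "x \<le> 1/10"
  then have "exp x \<le> exp (1/10)" by simp
  also have "\<dots> \<le> 6/5" using exp_minus_one_le[of "1/10"] by simp
  finally show ?thesis .
qed

definition dyad :: "nat \<Rightarrow> int \<Rightarrow> real" where
  "dyad m k = of_int k * pi / 2 ^ m"

definition slope :: "(real \<Rightarrow> real) \<Rightarrow> nat \<Rightarrow> int \<Rightarrow> real" where
  "slope h m k = (h (dyad m (k + 1)) - h (dyad m k)) * 2 ^ m / pi"

definition logslope :: "(real \<Rightarrow> real) \<Rightarrow> nat \<Rightarrow> int \<Rightarrow> real" where
  "logslope h m k = ln (slope h m k)"

text \<open>The last summand compares adjacent cells; these may have a common ancestor only far up the tree, so it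
is not bounded by the other two.\<close>

definition slope_variation :: "(real \<Rightarrow> real) \<Rightarrow> nat \<Rightarrow> int \<Rightarrow> real" where
  "slope_variation h m k =
     \<bar>logslope h (Suc m) (2 * k) - logslope h m k\<bar>
     + \<bar>logslope h (Suc m) (2 * k + 1) - logslope h m k\<bar>
     + \<bar>logslope h m (k + 1) - logslope h m k\<bar>"

lemma dyad_child: "dyad (Suc m) (2 * k) = dyad m k"
  by (simp add: dyad_def field_simps)

lemma dyad_child_end: "dyad (Suc m) (2 * k + 2) = dyad m (k + 1)"
  by (simp add: dyad_def field_simps)

lemma dyad_add: "dyad m (k + j) = dyad m k + of_int j * pi / 2 ^ m"
  by (simp add: dyad_def field_simps)

lemma dyad_period: "dyad m (k + 2 ^ m) = dyad m k + pi"
  by (simp add: dyad_add)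

lemma dyad_less: "j < k \<Longrightarrow> dyad m j < dyad m k"
  by (simp add: dyad_def divide_strict_right_mono)

lemma dyad_mono: "j \<le> k \<Longrightarrow> dyad m j \<le> dyad m k"
  by (simp add: dyad_def divide_right_mono)

lemma slope_variation_nonneg: "0 \<le> slope_variation h m k"
  by (simp add: slope_variation_def)

locale circle_lift =
  fixes h :: "real \<Rightarrow> real"
  assumes mono: "strict_mono h" and cont: "continuous_on UNIV h"
    and per: "h (x + pi) = h x + pi"
begin

lemma less_iff: "h x < h y \<longleftrightarrow> x < y" using mono by (rule strict_mono_less)
lemma le_iff: "h x \<le> h y \<longleftrightarrow> x \<le> y" using mono by (rule strict_mono_less_eq)

lemma per_int: "h (x + of_int n * pi) = h x + of_int n * pi"
proof (induction n rule: int_induct[of _ 0])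
  case base then show ?case by simp
next
  case (step1 i)
  then show ?case using per[of "x + of_int i * pi"] by (simp add: algebra_simps)
next
  case (step2 i)
  then show ?case using per[of "x + of_int (i - 1) * pi"] by (simp add: algebra_simps)
qed

lemma slope_pos: "slope h m k > 0"
  using dyad_less[of k "k+1" m] by (simp add: slope_def less_iff)

lemma exp_logslope: "exp (logslope h m k) = slope h m k"
  using slope_pos by (simp add: logslope_def)

lemma slope_periodic: "slope h m (k + 2 ^ m) = slope h m k"
proof -
  have "k + 2 ^ m + 1 = (k + 1) + 2 ^ m" by simp
  then show ?thesis unfolding slope_def by (simp only: dyad_period per) simp
qed

lemma increment: "h (dyad m (k + 1)) - h (dyad m k) = slope h m k * (pi / 2 ^ m)"
  by (simp add: slope_def)

lemma slope_root: "slope h 0 k = 1"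
  using per[of "of_int k * pi"] by (simp add: slope_def dyad_def algebra_simps)

lemma slope_variation_periodic: "tree_periodic (slope_variation h)"
  unfolding tree_periodic_def
proof (intro allI)
  fix m and k :: int
  have p: "logslope h m (j + 2 ^ m) = logslope h m j" for m j by (simp add: logslope_def slope_periodic)
  have p': "logslope h (Suc m) (j + 2 * 2 ^ m) = logslope h (Suc m) j" for j
    using p[of "Suc m" j] by simp
  have "2 * (k + 2 ^ m) = 2 * k + 2 * 2 ^ m" "2 * (k + 2 ^ m) + 1 = (2 * k + 1) + 2 * 2 ^ m"
    "k + 2 ^ m + 1 = (k + 1) + 2 ^ m" by simp_all
  then show "slope_variation h m (k + 2 ^ m) = slope_variation h m k"
    unfolding slope_variation_def by (simp only: p p')
qed

lemma slope_ratio: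
  "slope h n j / slope h m k = exp (logslope h n j - logslope h m k)"
  by (simp add: exp_diff exp_logslope)

lemma slope_diff_le:
  assumes "\<bar>logslope h n j - logslope h m k\<bar> \<le> v" "v \<le> 1"
  shows "\<bar>slope h n j - slope h m k\<bar> \<le> 2 * v * slope h m k"
proof -
  have v0: "0 \<le> v" using assms by linarith
  have "\<bar>slope h n j / slope h m k - 1\<bar> \<le> exp \<bar>logslope h n j - logslope h m k\<bar> - 1"
    unfolding slope_ratio by (rule abs_exp_minus_one_le)
  also have "\<dots> \<le> exp v - 1" using assms by simp
  also have "\<dots> \<le> 2 * v" using assms v0 by (intro exp_minus_one_le) auto
  finally have r: "\<bar>slope h n j / slope h m k - 1\<bar> \<le> 2 * v" .
  have "slope h n j - slope h m k = (slope h n j / slope h m k - 1) * slope h m k"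
    using slope_pos[of m k] by (simp add: field_simps)
  then have "\<bar>slope h n j - slope h m k\<bar> = \<bar>slope h n j / slope h m k - 1\<bar> * slope h m k"
    using slope_pos[of m k] by (simp only: abs_mult abs_of_pos)
  also have "\<dots> \<le> 2 * v * slope h m k"
    using r slope_pos[of m k] by (intro mult_right_mono) auto
  finally show ?thesis .
qed

text \<open>The constant 6/5 is twice 3/5: as the length of a cell halves, the length of its image
contracts by 3/5, the ratio of the tree recursions.\<close>

lemma slope_child_le:
  assumes "slope_variation h m (k div 2) \<le> 1/10"
  shows "slope h (Suc m) k \<le> 6/5 * slope h m (k div 2)"
proof -
  have "k = 2 * (k div 2) \<or> k = 2 * (k div 2) + 1" by presburger
  then have "\<bar>logslope h (Suc m) k - logslope h m (k div 2)\<bar> \<le> slope_variation h m (k div 2)"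
    unfolding slope_variation_def by (smt (verit))
  then have "slope h (Suc m) k / slope h m (k div 2) \<le> 6/5"
    unfolding slope_ratio by (intro exp_tenth) (use assms in linarith)
  then show ?thesis using slope_pos[of m "k div 2"] by (simp add: field_simps)
qed

end

lemma cot_le_imp_ge:
  fixes a b :: real
  assumes "0 < a" "a < pi" "0 < b" "b < pi" "cot a \<le> cot b"
  shows "b \<le> a"
proof (rule ccontr)
  assume "\<not> b \<le> a"
  then have s: "sin (b - a) > 0" "sin a > 0" "sin b > 0" using assms by (auto intro!: sin_gt_zero)
  then have "cot a - cot b = sin (b - a) / (sin a * sin b)"
    by (simp add: cot_def sin_diff field_simps)
  also have "\<dots> > 0" using s by simp
  finally show False using assms by simp
qed

text \<open>For a small angle the cotangent is the inverse of the angle up to a bounded error.\<close>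

lemma cot_near_inverse:
  assumes "0 < x" "x \<le> pi / 2"
  shows "\<bar>cot x - 1 / x\<bar> \<le> (1::real)" "0 \<le> cot x" "cot x \<le> 1 / x"
proof -
  have s: "sin x > 0" using assms by (intro sin_gt_zero) auto
  have c: "cos x \<ge> 0" using assms by (intro cos_ge_zero) auto
  show "0 \<le> cot x" using s c by (simp add: cot_def)
  have a: "x * cos x \<le> sin x"
  proof -
    have "sin 0 - 0 * cos 0 \<le> sin x - x * cos x"
    proof (rule DERIV_nonneg_imp_nondecreasing[where f="\<lambda>x. sin x - x * cos x"])
      fix t assume t: "0 \<le> t" "t \<le> x"
      have "((\<lambda>x. sin x - x * cos x) has_real_derivative t * sin t) (at t)"
        by (auto intro!: derivative_eq_intros)
      moreover have "0 \<le> t * sin t" using t assms by (intro mult_nonneg_nonneg sin_ge_zero) auto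
      ultimately show "\<exists>y. ((\<lambda>x. sin x - x * cos x) has_real_derivative y) (at t) \<and> 0 \<le> y" by blast
    qed (use assms in auto)
    then show ?thesis by simp
  qed
  have cb: "1 - x \<le> cos x"
  proof -
    have "cos 0 + 0 \<le> cos x + x"
    proof (rule DERIV_nonneg_imp_nondecreasing[where f="\<lambda>x. cos x + x"])
      fix t assume t: "0 \<le> t" "t \<le> x"
      have "((\<lambda>x. cos x + x) has_real_derivative 1 - sin t) (at t)"
        by (auto intro!: derivative_eq_intros)
      then show "\<exists>y. ((\<lambda>x. cos x + x) has_real_derivative y) (at t) \<and> 0 \<le> y"
        by (intro exI[of _ "1 - sin t"]) auto
    qed (use assms in auto)
    then show ?thesis by simp
  qed
  have b: "sin x - x * cos x \<le> x * sin x"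
  proof (cases "x \<ge> 1")
    case True
    then have "sin x \<le> x * sin x" using s by (simp add: mult_le_cancel_right1)
    then show ?thesis using c assms by (smt (verit) mult_nonneg_nonneg)
  next
    case False
    have "(1 - x) * sin x \<le> (1 - x) * x" using False sin_x_le_x[of x] assms by (intro mult_left_mono) auto
    also have "\<dots> \<le> cos x * x"
      using cb assms by (intro mult_right_mono) auto
    finally show ?thesis by (simp add: algebra_simps)
  qed
  show "cot x \<le> 1 / x" using a s assms by (simp add: cot_def field_simps)
  moreover have "1 / x - cot x \<le> 1" using b s assms by (simp add: cot_def field_simps)
  ultimately show "\<bar>cot x - 1 / x\<bar> \<le> 1" by linarith
qed

section \<open>Projective barriers\<close>

lemma deviation_from_linear:
  fixes G :: "real \<Rightarrow> real"
  assumes "\<And>s. \<bar>s\<bar> \<le> r \<Longrightarrow> (G has_real_derivative G' s) (at s)"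
    and "\<And>s. \<bar>s\<bar> \<le> r \<Longrightarrow> \<bar>G' s - \<mu>\<bar> \<le> c" and "\<bar>s\<bar> \<le> r"
  shows "\<bar>G s - G 0 - \<mu> * s\<bar> \<le> c * \<bar>s\<bar>"
proof -
  have "norm ((G s - \<mu> * s) - (G 0 - \<mu> * 0)) \<le> c * norm (s - 0)"
  proof (rule field_differentiable_bound[of "{-r..r}"])
    fix t assume "t \<in> {-r..r}"
    then have t: "\<bar>t\<bar> \<le> r" by auto
    show "((\<lambda>s. G s - \<mu> * s) has_field_derivative (G' t - \<mu>)) (at t within {-r..r})"
      using has_field_derivative_at_within[OF assms(1)[OF t]] by (auto intro!: derivative_eq_intros)
    show "norm (G' t - \<mu>) \<le> c" using assms(2)[OF t] by simp
  qed (use assms(3) in auto)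
  then show ?thesis by simp
qed

text \<open>The denominator differs from 1 by terms that all carry a factor \<open>sin s\<close>.\<close>

lemma mobius_near_linear:
  fixes \<mu> \<kappa> r s :: real
  assumes "\<mu> > 0" "\<bar>s\<bar> \<le> r"
    and \<tau>: "r\<^sup>2 + 2 * \<bar>\<kappa>\<bar> * \<mu> * r + (\<kappa> * \<mu> * r)\<^sup>2 + (\<mu> * r)\<^sup>2 \<le> \<tau>" "\<tau> \<le> 1/2"
  shows "\<bar>\<mu> / ((cos s - \<kappa> * \<mu> * sin s)\<^sup>2 + (\<mu> * sin s)\<^sup>2) - \<mu>\<bar> \<le> 2 * \<mu> * \<tau>"
proof -
  define D where "D = (cos s - \<kappa> * \<mu> * sin s)\<^sup>2 + (\<mu> * sin s)\<^sup>2"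
  have ss: "\<bar>sin s\<bar> \<le> r" using abs_sin_le_one[of s] abs_sin_x_le_abs_x[of s] assms by linarith
  have r0: "0 \<le> r" using assms by linarith
  have s2: "(sin s)\<^sup>2 \<le> r\<^sup>2" using ss by (metis abs_ge_zero power2_abs power_mono)
  have "D - 1 = - (sin s)\<^sup>2 - 2 * (\<kappa> * \<mu> * sin s * cos s) + (\<kappa> * \<mu>)\<^sup>2 * (sin s)\<^sup>2 + \<mu>\<^sup>2 * (sin s)\<^sup>2"
    unfolding D_def using sin_cos_squared_add[of s] by (simp add: power2_eq_square algebra_simps)
  moreover have "\<bar>\<kappa> * \<mu> * sin s * cos s\<bar> \<le> \<bar>\<kappa>\<bar> * \<mu> * r"
  proof -
    have "\<bar>\<kappa> * \<mu> * sin s * cos s\<bar> = \<bar>\<kappa>\<bar> * \<mu> * \<bar>sin s\<bar> * \<bar>cos s\<bar>" using assms by (simp add: abs_mult)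
    also have "\<dots> \<le> \<bar>\<kappa>\<bar> * \<mu> * r * 1"
      using ss assms r0 by (intro mult_mono) auto
    finally show ?thesis by simp
  qed
  moreover have "(\<kappa> * \<mu>)\<^sup>2 * (sin s)\<^sup>2 \<le> (\<kappa> * \<mu> * r)\<^sup>2" "\<mu>\<^sup>2 * (sin s)\<^sup>2 \<le> (\<mu> * r)\<^sup>2"
    using s2 by (simp_all add: power_mult_distrib mult_left_mono)
  moreover have "0 \<le> (sin s)\<^sup>2" "0 \<le> (\<kappa> * \<mu>)\<^sup>2 * (sin s)\<^sup>2" "0 \<le> \<mu>\<^sup>2 * (sin s)\<^sup>2" by simp_all
  moreover have "2 * \<bar>\<kappa>\<bar> * \<mu> * r = 2 * (\<bar>\<kappa>\<bar> * \<mu> * r)" by simp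
  ultimately have D1: "\<bar>D - 1\<bar> \<le> \<tau>" using \<tau>(1) s2 unfolding abs_le_iff by linarith
  then have D2: "D \<ge> 1/2" using \<tau>(2) by linarith
  have "\<mu> / D - \<mu> = \<mu> * (1 - D) / D" using D2 by (simp add: field_simps)
  then have "\<bar>\<mu> / D - \<mu>\<bar> = \<mu> * \<bar>D - 1\<bar> / D" using D2 assms(1) by (simp add: abs_mult abs_minus_commute)
  also have "\<dots> \<le> \<mu> * \<tau> / (1/2)" using D1 D2 assms(1) by (intro frac_le mult_left_mono) auto
  finally show ?thesis unfolding D_def by simp
qed

lemma mobius_second_derivative:
  fixes \<mu> \<kappa> :: real
  assumes F: "\<And>s. (F has_real_derivative \<mu> / ((cos s - \<kappa> * \<mu> * sin s)\<^sup>2 + (\<mu> * sin s)\<^sup>2)) (at (x + s))"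
  shows "deriv F x = \<mu>" "deriv (deriv F) x = 2 * \<kappa> * \<mu>\<^sup>2"
proof -
  have e: "deriv F t = \<mu> / ((cos (t - x) - \<kappa> * \<mu> * sin (t - x))\<^sup>2 + (\<mu> * sin (t - x))\<^sup>2)" for t
    using F[of "t - x"] by (auto intro: DERIV_imp_deriv)
  then show "deriv F x = \<mu>" by simp
  have "((\<lambda>t. \<mu> / ((cos (t - x) - \<kappa> * \<mu> * sin (t - x))\<^sup>2 + (\<mu> * sin (t - x))\<^sup>2)) has_real_derivative 2 * \<kappa> * \<mu>\<^sup>2) (at x)"
    by (rule derivative_eq_intros refl | simp)+ (simp add: power2_eq_square)
  then show "deriv (deriv F) x = 2 * \<kappa> * \<mu>\<^sup>2"
    unfolding e[abs_def] by (rule DERIV_imp_deriv)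
qed

lemma circle_lift_if_is_lift: "is_lift f F \<Longrightarrow> circle_lift F"
  unfolding is_lift_def by unfold_locales (auto dest: homeomorphic_imp_continuous_map)

context circle_lift
begin

text \<open>An angle beyond \<open>pi / 2\<close> is measured backwards from \<open>x + pi\<close>, the same point of the circle as \<open>x\<close>.\<close>

lemma cot_far:
  assumes r: "0 < r" "r \<le> pi / 2"
    and far: "\<And>s. r \<le> s \<Longrightarrow> s \<le> pi / 2 \<Longrightarrow> \<bar>cot s / \<mu> - cot (h (x + s) - h x)\<bar> \<le> \<kappa>"
      "\<And>s. r \<le> s \<Longrightarrow> s \<le> pi / 2 \<Longrightarrow> \<bar>cot s / \<mu> - cot (h x - h (x - s))\<bar> \<le> \<kappa>"
    and s: "r \<le> s" "s \<le> pi - r"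
  shows "\<bar>cot s / \<mu> - cot (h (x + s) - h x)\<bar> \<le> \<kappa>"
proof (cases "s \<le> pi / 2")
  case True then show ?thesis using far(1) s by simp
next
  case False
  have c: "cot (pi - y) = - cot y" for y :: real by (simp add: cot_def)
  have "h (x + s) = h (x - (pi - s)) + pi" using per[of "x - (pi - s)"] by (simp add: algebra_simps)
  then have "h (x + s) - h x = pi - (h x - h (x - (pi - s)))" by simp
  then have "cot (h (x + s) - h x) = - cot (h x - h (x - (pi - s)))" by (simp only: c)
  moreover have "cot s = - cot (pi - s)" by (simp only: c)
  ultimately show ?thesis using far(2)[of "pi - s"] False s by (simp add: abs_minus_commute)
qed

lemma le_on_period:
  assumes F: "circle_lift F" and le: "\<And>s. - r \<le> s \<Longrightarrow> s \<le> pi - r \<Longrightarrow> h (x + s) \<le> F (x + s)"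
  shows "h y \<le> F y"
proof -
  interpret F: circle_lift F by fact
  define n where "n = \<lfloor>(y - x + r) / pi\<rfloor>"
  define s where "s = y - x - of_int n * pi"
  have "of_int n \<le> (y - x + r) / pi" "(y - x + r) / pi < of_int n + 1" unfolding n_def by linarith+
  then have "- r \<le> s" "s \<le> pi - r" unfolding s_def by (simp_all add: field_simps)
  then have "h (x + s) \<le> F (x + s)" by (rule le)
  moreover have "y = (x + s) + of_int n * pi" by (simp add: s_def)
  ultimately show ?thesis by (simp only: per_int F.per_int add_le_cancel_right)
qed

lemma ge_on_period:
  assumes F: "circle_lift F" and le: "\<And>s. - r \<le> s \<Longrightarrow> s \<le> pi - r \<Longrightarrow> F (x + s) \<le> h (x + s)"
  shows "F y \<le> h y"
  by (rule circle_lift.le_on_period[OF F circle_lift_axioms le])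

text \<open>Take \<open>F\<close> with derivative \<open>\<mu>\<close> at \<open>x\<close>, shifted there by the sum of the distances of \<open>h\<close> and of the
projective map from the line of slope \<open>\<mu>\<close>. The shift decides the comparison for \<open>\<bar>s\<bar> \<le> r\<close>. Outside, the
translation \<open>\<kappa>\<close> makes the cotangent of the increment of \<open>F\<close> smaller than that of \<open>h\<close>, and a smaller
cotangent means a larger angle. The lower barrier is the same with both signs reversed.\<close>

lemma mobius_barriers:
  assumes r: "0 < r" "r \<le> pi / 2" and \<mu>: "\<mu> > 0" and \<kappa>: "\<kappa> \<ge> 0"
    and near: "\<And>s. \<bar>s\<bar> \<le> r \<Longrightarrow> \<bar>h (x + s) - h x - \<mu> * s\<bar> \<le> \<delta>"
    and far: "\<And>s. r \<le> s \<Longrightarrow> s \<le> pi / 2 \<Longrightarrow> \<bar>cot s / \<mu> - cot (h (x + s) - h x)\<bar> \<le> \<kappa>"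
      "\<And>s. r \<le> s \<Longrightarrow> s \<le> pi / 2 \<Longrightarrow> \<bar>cot s / \<mu> - cot (h x - h (x - s))\<bar> \<le> \<kappa>"
    and \<tau>: "r\<^sup>2 + 2 * \<kappa> * \<mu> * r + (\<kappa> * \<mu> * r)\<^sup>2 + (\<mu> * r)\<^sup>2 \<le> \<tau>" "\<tau> \<le> 1/2"
  shows "\<exists>f\<in>PSL2R. \<exists>F. is_lift f F \<and> (\<forall>y. h y \<le> F y) \<and> F x = h x + (\<delta> + 2 * \<mu> * \<tau> * r) \<and>
      deriv F x = \<mu> \<and> deriv (deriv F) x = 2 * \<kappa> * \<mu>\<^sup>2" (is ?up)
    and "\<exists>f\<in>PSL2R. \<exists>F. is_lift f F \<and> (\<forall>y. F y \<le> h y) \<and> F x = h x - (\<delta> + 2 * \<mu> * \<tau> * r) \<and>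
      deriv F x = \<mu> \<and> deriv (deriv F) x = - (2 * \<kappa> * \<mu>\<^sup>2)" (is ?low)
proof -
  have t0: "0 \<le> \<tau>" using \<tau>(1) \<mu> \<kappa> r by (smt (verit) mult_nonneg_nonneg zero_le_power2)
  have d0: "0 \<le> \<delta>" using near[of 0] r by simp
  have D0: "0 \<le> \<delta> + 2 * \<mu> * \<tau> * r" using t0 d0 \<mu> r by simp
  have eta: "0 < h (x + s) - h x" "h (x + s) - h x < pi" if "0 < s" "s < pi" for s
    using that less_iff[of x "x + s"] less_iff[of "x + s" "x + pi"] per[of x] by auto
  have nearF: "\<bar>F (x + s) - F x - \<mu> * s\<bar> \<le> 2 * \<mu> * \<tau> * r"
    if F: "\<And>s. (F has_real_derivative \<mu> / ((cos s - k * \<mu> * sin s)\<^sup>2 + (\<mu> * sin s)\<^sup>2)) (at (x + s))"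
      and k: "\<bar>k\<bar> = \<kappa>" and s: "\<bar>s\<bar> \<le> r" for F k s
  proof -
    have "\<bar>F (x + s) - F (x + 0) - \<mu> * s\<bar> \<le> (2 * \<mu> * \<tau>) * \<bar>s\<bar>"
    proof (rule deviation_from_linear[of r "\<lambda>s. F (x + s)"])
      fix t assume t: "\<bar>t\<bar> \<le> r"
      show "((\<lambda>s. F (x + s)) has_real_derivative \<mu> / ((cos t - k * \<mu> * sin t)\<^sup>2 + (\<mu> * sin t)\<^sup>2)) (at t)"
        using F[of t] by (simp add: DERIV_shift add.commute)
      have "(k * \<mu> * r)\<^sup>2 = (\<kappa> * \<mu> * r)\<^sup>2" using k by (metis power2_abs power_mult_distrib)
      then show "\<bar>\<mu> / ((cos t - k * \<mu> * sin t)\<^sup>2 + (\<mu> * sin t)\<^sup>2) - \<mu>\<bar> \<le> 2 * \<mu> * \<tau>"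
        using \<tau> k by (intro mobius_near_linear[OF \<mu> t]) simp_all
    qed (rule s)
    also have "\<dots> \<le> 2 * \<mu> * \<tau> * r" using s \<mu> t0 by (intro mult_left_mono) auto
    finally show ?thesis by simp
  qed
  show ?up
  proof -
    obtain f F where F0: "f \<in> PSL2R" "is_lift f F" "F x = h x + (\<delta> + 2 * \<mu> * \<tau> * r)"
      "\<forall>s. (F has_real_derivative \<mu> / ((cos s - \<kappa> * \<mu> * sin s)\<^sup>2 + (\<mu> * sin s)\<^sup>2)) (at (x + s))"
      "\<forall>s. 0 < s \<longrightarrow> s < pi \<longrightarrow> h x + (\<delta> + 2 * \<mu> * \<tau> * r) < F (x + s) \<and> F (x + s) < h x + (\<delta> + 2 * \<mu> * \<tau> * r) + pi
        \<and> cot (F (x + s) - (h x + (\<delta> + 2 * \<mu> * \<tau> * r))) = cot s / \<mu> - \<kappa>"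
      using mobius_with_jet[OF \<mu>, of x "h x + (\<delta> + 2 * \<mu> * \<tau> * r)" \<kappa>] by blast
    have F5: "F x < F (x + s) \<and> F (x + s) < F x + pi \<and> cot (F (x + s) - F x) = cot s / \<mu> - \<kappa>"
      if "0 < s" "s < pi" for s using F0(5) that unfolding F0(3) by blast
    note F = F0(1,2,3) spec[OF F0(4)] F5
    have "h y \<le> F y" for y
    proof (rule le_on_period[of F r x])
      show "circle_lift F" using F(2) by (rule circle_lift_if_is_lift)
      fix s assume s: "- r \<le> s" "s \<le> pi - r"
      show "h (x + s) \<le> F (x + s)"
      proof (cases "s \<le> r")
        case True
        then have "\<bar>s\<bar> \<le> r" using s by auto
        then show ?thesis using nearF[OF F(4) _ \<open>\<bar>s\<bar> \<le> r\<close>] near[of s] \<kappa> F(3) by (simp add: abs_le_iff)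
      next
        case False
        then have s': "0 < s" "s < pi" "r \<le> s" using s r by auto
        have f: "0 < F (x + s) - F x" "F (x + s) - F x < pi" using F(5)[OF s'(1,2)] by linarith+
        have c: "cot (F (x + s) - F x) \<le> cot (h (x + s) - h x)"
          using F(5)[OF s'(1,2)] cot_far[OF r far s'(3) s(2)] by (simp add: abs_le_iff)
        have "h (x + s) - h x \<le> F (x + s) - F x"
          by (rule cot_le_imp_ge[OF f eta[OF s'(1,2)] c])
        then show ?thesis using F(3) D0 by linarith
      qed
    qed
    then show ?thesis using F(1-3) mobius_second_derivative[OF F(4)] by blast
  qed
  show ?low
  proof -
    obtain f F where F0: "f \<in> PSL2R" "is_lift f F" "F x = h x - (\<delta> + 2 * \<mu> * \<tau> * r)"
      "\<forall>s. (F has_real_derivative \<mu> / ((cos s - (-\<kappa>) * \<mu> * sin s)\<^sup>2 + (\<mu> * sin s)\<^sup>2)) (at (x + s))"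
      "\<forall>s. 0 < s \<longrightarrow> s < pi \<longrightarrow> h x - (\<delta> + 2 * \<mu> * \<tau> * r) < F (x + s) \<and> F (x + s) < h x - (\<delta> + 2 * \<mu> * \<tau> * r) + pi
        \<and> cot (F (x + s) - (h x - (\<delta> + 2 * \<mu> * \<tau> * r))) = cot s / \<mu> - (-\<kappa>)"
      using mobius_with_jet[OF \<mu>, of x "h x - (\<delta> + 2 * \<mu> * \<tau> * r)" "-\<kappa>"] by blast
    have F5: "F x < F (x + s) \<and> F (x + s) < F x + pi \<and> cot (F (x + s) - F x) = cot s / \<mu> - (-\<kappa>)"
      if "0 < s" "s < pi" for s using F0(5) that unfolding F0(3) by blast
    note F = F0(1,2,3) spec[OF F0(4)] F5
    have "F y \<le> h y" for y
    proof (rule ge_on_period[of F r x])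
      show "circle_lift F" using F(2) by (rule circle_lift_if_is_lift)
      fix s assume s: "- r \<le> s" "s \<le> pi - r"
      show "F (x + s) \<le> h (x + s)"
      proof (cases "s \<le> r")
        case True
        then have "\<bar>s\<bar> \<le> r" using s by auto
        then show ?thesis using nearF[OF F(4) _ \<open>\<bar>s\<bar> \<le> r\<close>] near[of s] \<kappa> F(3) by (simp add: abs_le_iff)
      next
        case False
        then have s': "0 < s" "s < pi" "r \<le> s" using s r by auto
        have f: "0 < F (x + s) - F x" "F (x + s) - F x < pi" using F(5)[OF s'(1,2)] by linarith+
        have c: "cot (h (x + s) - h x) \<le> cot (F (x + s) - F x)"
          using F(5)[OF s'(1,2)] cot_far[OF r far s'(3) s(2)] by (simp add: abs_le_iff)
        have "F (x + s) - F x \<le> h (x + s) - h x"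
          by (rule cot_le_imp_ge[OF eta[OF s'(1,2)] f c])
        then show ?thesis using F(3) D0 by linarith
      qed
    qed
    then show ?thesis using F(1-3) mobius_second_derivative[OF F(4)] by (intro bexI[of _ f] exI[of _ F]) auto
  qed
qed

end

text \<open>The derivative of \<open>F\<close> is the inverse of a quadratic form of determinant 1. The first two
derivatives of \<open>F\<close> at \<open>x\<close> determine two of its coefficients, and the determinant the third; so the bounds at
\<open>x\<close> hold, up to constants, within distance \<open>l\<close>.\<close>

lemma lift_close_spreads:
  fixes \<mu> \<epsilon> l :: real
  assumes f: "f \<in> PSL2R" "is_lift f F" and \<mu>: "\<mu> > 0" and l: "l > 0" and \<epsilon>: "0 \<le> \<epsilon>" "\<epsilon> \<le> 1/10"
    and d1: "\<bar>deriv F x - \<mu>\<bar> \<le> \<epsilon> * \<mu>" and d2: "\<bar>deriv (deriv F) x\<bar> \<le> \<epsilon> * (\<mu> / l)"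
    and \<tau>: "\<tau> = 2 * (\<epsilon> + l\<^sup>2 + (\<mu> * l)\<^sup>2)" "\<tau> \<le> 1/2" and s: "\<bar>s\<bar> \<le> l"
  shows "\<bar>F (x + s) - F x - \<mu> * s\<bar> \<le> 3 * \<tau> * \<mu> * \<bar>s\<bar>"
proof -
  obtain n b g where n: "n > 0" and one: "n * g - b\<^sup>2 = 1"
    and F: "\<And>s. (F has_real_derivative 1 / (n * (cos s)\<^sup>2 + 2 * b * sin s * cos s + g * (sin s)\<^sup>2)) (at (x + s))"
    using mobius_lift_derivative[OF f, of x] by blast
  have e: "deriv F t = 1 / (n * (cos (t - x))\<^sup>2 + 2 * b * sin (t - x) * cos (t - x) + g * (sin (t - x))\<^sup>2)" for t
    using F[of "t - x"] by (auto intro: DERIV_imp_deriv)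
  have D1: "deriv F x = 1 / n" unfolding e by simp
  define Q where "Q t = n * (cos (t - x))\<^sup>2 + 2 * b * sin (t - x) * cos (t - x) + g * (sin (t - x))\<^sup>2" for t
  have "(Q has_real_derivative 2 * b) (at x)"
    unfolding Q_def[abs_def] by (auto intro!: derivative_eq_intros)
  then have "((\<lambda>t. 1 / Q t) has_real_derivative (0 * Q x - 1 * (2 * b)) / (Q x * Q x)) (at x)"
    by (rule DERIV_divide[OF DERIV_const]) (use n in \<open>simp add: Q_def\<close>)
  moreover have "Q x = n" by (simp add: Q_def)
  ultimately have "((\<lambda>t. 1 / Q t) has_real_derivative - (2 * b) / n\<^sup>2) (at x)"
    by (simp add: power2_eq_square)
  then have D2: "deriv (deriv F) x = - (2 * b) / n\<^sup>2"
    unfolding e[abs_def] Q_def by (rule DERIV_imp_deriv)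
  define i where "i = 1 / n"
  have i0: "i > 0" using n by (simp add: i_def)
  have i1: "\<bar>i - \<mu>\<bar> \<le> \<epsilon> * \<mu>" using d1 by (simp add: D1 i_def)
  have "\<epsilon> * \<mu> \<le> 1/10 * \<mu>" using \<epsilon> \<mu> by (intro mult_right_mono) auto
  then have i2: "i \<le> 11/10 * \<mu>" "9/10 * \<mu> \<le> i" using i1 by (auto simp: abs_le_iff)
  \<comment> \<open>\<open>i\<close> is the derivative of \<open>F\<close> at \<open>x\<close>, and \<open>q\<close> is the size of its logarithmic derivative there\<close>
  define q where "q = 2 * \<bar>b\<bar> * i"
  have q0: "0 \<le> q" using i0 by (simp add: q_def)
  have ql: "q * l \<le> 10/9 * \<epsilon>"
  proof -
    have "2 * \<bar>b\<bar> * i\<^sup>2 \<le> \<epsilon> * (\<mu> / l)"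
      using d2 n by (simp add: D2 i_def power_divide abs_mult)
    then have "q * i \<le> \<epsilon> * (\<mu> / l)" by (simp add: q_def power2_eq_square mult.assoc)
    moreover have "q * (9/10 * \<mu>) \<le> q * i" using q0 i2 by (intro mult_left_mono) auto
    ultimately have "q * (9/10 * \<mu>) \<le> \<epsilon> * (\<mu> / l)" by linarith
    then have "(q * l * (9/10)) * \<mu> \<le> \<epsilon> * \<mu>" using l by (simp add: field_simps)
    then show ?thesis using \<mu> by simp
  qed
  have ql32: "q * l \<le> 3/2 * \<epsilon>" using ql \<epsilon> by simp
  have gi: "g * i = i\<^sup>2 + q\<^sup>2 / 4"
  proof -
    have "g = (1 + b\<^sup>2) / n" using one n by (simp add: field_simps)
    then show ?thesis by (simp add: q_def i_def power2_eq_square add_divide_distrib)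
  qed
  have close: "\<bar>1 / (n * (cos t)\<^sup>2 + 2 * b * sin t * cos t + g * (sin t)\<^sup>2) - \<mu>\<bar> \<le> 3 * \<tau> * \<mu>"
    if t: "\<bar>t\<bar> \<le> l" for t
  proof -
    define D where "D = n * (cos t)\<^sup>2 + 2 * b * sin t * cos t + g * (sin t)\<^sup>2"
    have ss: "\<bar>sin t\<bar> \<le> l" using abs_sin_x_le_abs_x[of t] t by linarith
    have s2: "(sin t)\<^sup>2 \<le> l\<^sup>2" using ss by (metis abs_ge_zero power2_abs power_mono)
    have "i * D - 1 = - (sin t)\<^sup>2 + 2 * b * i * sin t * cos t + (i\<^sup>2 + q\<^sup>2 / 4) * (sin t)\<^sup>2"
    proof -
      have "i * D = (i * n) * (cos t)\<^sup>2 + 2 * b * i * sin t * cos t + (g * i) * (sin t)\<^sup>2"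
        unfolding D_def by (simp add: algebra_simps)
      also have "i * n = 1" using n by (simp add: i_def)
      finally show ?thesis unfolding gi using sin_cos_squared_add[of t] by linarith
    qed
    moreover have "\<bar>2 * b * i * sin t * cos t\<bar> \<le> q * l"
    proof -
      have "\<bar>2 * b * i * sin t * cos t\<bar> = q * \<bar>sin t\<bar> * \<bar>cos t\<bar>" using i0 by (simp add: abs_mult q_def)
      also have "\<dots> \<le> q * l * 1" using ss q0 l by (intro mult_mono) auto
      finally show ?thesis by simp
    qed
    moreover have "0 \<le> (i\<^sup>2 + q\<^sup>2 / 4) * (sin t)\<^sup>2" by simp
    moreover have "(i\<^sup>2 + q\<^sup>2 / 4) * (sin t)\<^sup>2 \<le> (i\<^sup>2 + q\<^sup>2 / 4) * l\<^sup>2" using s2 by (intro mult_left_mono) auto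
    moreover have "(i\<^sup>2 + q\<^sup>2 / 4) * l\<^sup>2 \<le> 2 * (\<mu> * l)\<^sup>2 + 1/2 * \<epsilon>"
    proof -
      have "i\<^sup>2 \<le> (11/10 * \<mu>)\<^sup>2" using i0 i2 by (intro power_mono) auto
      then have "i\<^sup>2 * l\<^sup>2 \<le> (11/10 * \<mu>)\<^sup>2 * l\<^sup>2" by (intro mult_right_mono) auto
      moreover have "(q * l)\<^sup>2 \<le> (10/9 * \<epsilon>)\<^sup>2" using ql q0 l by (intro power_mono) auto
      moreover have "\<epsilon>\<^sup>2 \<le> 1/10 * \<epsilon>" unfolding power2_eq_square using \<epsilon> by (intro mult_right_mono) auto
      moreover have "0 \<le> \<mu>\<^sup>2 * l\<^sup>2" "(10/9 * \<epsilon>)\<^sup>2 = 100/81 * \<epsilon>\<^sup>2"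
        "(11/10 * \<mu>)\<^sup>2 * l\<^sup>2 = 121/100 * (\<mu>\<^sup>2 * l\<^sup>2)" "(q * l)\<^sup>2 = q\<^sup>2 * l\<^sup>2"
        by (simp_all add: power_mult_distrib power_divide)
      ultimately have "i\<^sup>2 * l\<^sup>2 \<le> 2 * (\<mu>\<^sup>2 * l\<^sup>2)" "q\<^sup>2 * l\<^sup>2 \<le> 2 * \<epsilon>"
        using \<epsilon> by linarith+
      then show ?thesis by (simp add: power_mult_distrib algebra_simps)
    qed
    moreover have "0 \<le> l\<^sup>2" "0 \<le> (\<mu> * l)\<^sup>2" "0 \<le> (sin t)\<^sup>2" by simp_all
    moreover have "\<bar>X\<bar> \<le> 2 * \<epsilon> + 2 * L + 2 * M" if "X = - S + Y + Z" "\<bar>Y\<bar> \<le> Q" "0 \<le> Z" "Z \<le> W"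
      "W \<le> 2 * M + 1/2 * \<epsilon>" "0 \<le> L" "0 \<le> M" "0 \<le> S" "S \<le> L" "Q \<le> 3/2 * \<epsilon>" for X S Y Z Q W L M
      using that \<epsilon> by linarith
    ultimately have iD: "\<bar>i * D - 1\<bar> \<le> \<tau>"
      using ql32 s2 unfolding \<tau>(1) distrib_left by blast
    then have iD2: "i * D \<ge> 1/2" using \<tau>(2) by linarith
    have "i * D > 0" using iD2 by simp
    then have D0: "D > 0" using i0 by (simp add: zero_less_mult_iff)
    have "1 / D - i = i * (1 - i * D) / (i * D)" using D0 i0 by (simp add: field_simps)
    then have "\<bar>1 / D - i\<bar> = i * \<bar>i * D - 1\<bar> / (i * D)" using D0 i0 by (simp add: abs_mult abs_minus_commute)
    also have "\<dots> \<le> i * \<tau> / (1/2)" using iD iD2 i0 by (intro frac_le mult_left_mono) auto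
    finally have "\<bar>1 / D - i\<bar> \<le> 2 * i * \<tau>" by simp
    also have "\<dots> \<le> 2 * (11/10 * \<mu>) * \<tau>" using i2 iD by (intro mult_right_mono) auto
    finally have "\<bar>1 / D - i\<bar> \<le> 22/10 * (\<mu> * \<tau>)" by simp
    moreover have "\<epsilon> * \<mu> \<le> 1/2 * (\<mu> * \<tau>)"
    proof -
      have "\<epsilon> * \<mu> \<le> (\<tau> / 2) * \<mu>" using \<mu> unfolding \<tau>(1) by (intro mult_right_mono) auto
      then show ?thesis by (simp add: mult.commute)
    qed
    moreover have "0 \<le> \<mu> * \<tau>" using \<mu> iD by simp
    ultimately have "\<bar>1 / D - \<mu>\<bar> \<le> 3 * (\<mu> * \<tau>)" using i1 by linarith
    then show ?thesis by (simp add: D_def mult.commute mult.left_commute)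
  qed
  have "\<bar>F (x + s) - F (x + 0) - \<mu> * s\<bar> \<le> (3 * \<tau> * \<mu>) * \<bar>s\<bar>"
    by (rule deviation_from_linear[of l "\<lambda>s. F (x + s)"])
       (use F close s in \<open>auto simp: DERIV_shift add.commute\<close>)
  then show ?thesis by simp
qed

section \<open>Deviation from linearity\<close>

lemma l2_tree_sum:
  assumes "finite A" "\<And>i. i \<in> A \<Longrightarrow> l2_tree (f i)"
  shows "l2_tree (\<lambda>m k. \<Sum>i\<in>A. f i m k)"
  using assms
proof (induction rule: finite_induct)
  case empty
  then show ?case by (simp add: l2_tree_def tree_periodic_def level_sum_def[abs_def])
next
  case (insert i A)
  then show ?case using l2_tree_add[of "f i" "\<lambda>m k. \<Sum>i\<in>A. f i m k"] by simp
qed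

text \<open>The sum of \<open>e\<close> over those proper ancestors of a node that have level at least \<open>M\<close>, in which the ancestor
\<open>j\<close> generations up has the weight \<open>(3/5) ^ (j - 1)\<close>.\<close>

fun ancestor_sum :: "(nat \<Rightarrow> int \<Rightarrow> real) \<Rightarrow> nat \<Rightarrow> nat \<Rightarrow> int \<Rightarrow> real" where
  "ancestor_sum e M 0 k = 0"
| "ancestor_sum e M (Suc m) k =
     (if m \<ge> M then 3 / 5 * ancestor_sum e M m (k div 2) + e m (k div 2) else 0)"

lemma ancestor_sum_nonneg: "(\<And>m k. 0 \<le> e m k) \<Longrightarrow> 0 \<le> ancestor_sum e M m k"
  by (induction m arbitrary: k) auto

lemma div2_period: "(k + 2 ^ Suc m) div 2 = k div 2 + (2::int) ^ m"
  by simp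

lemma l2_tree_ancestor_sum:
  assumes e: "l2_tree e" and nn: "\<And>m k. 0 \<le> e m k"
  shows "l2_tree (ancestor_sum e M)"
proof -
  have pe: "e m (k + 2 ^ m) = e m k" for m k using e by (simp add: l2_tree_def tree_periodic_def)
  define e' where "e' m k = (case m of 0 \<Rightarrow> 0 | Suc n \<Rightarrow> e n (k div 2))" for m k
  have "tree_periodic e'"
    unfolding tree_periodic_def
  proof (intro allI)
    fix m and k :: int
    show "e' m (k + 2 ^ m) = e' m k"
      by (cases m) (simp_all only: e'_def nat.case div2_period pe)
  qed
  moreover have "summable (level_sum (\<lambda>m k. (e' m k)\<^sup>2))"
  proof -
    have "level_sum (\<lambda>m k. (e' m k)\<^sup>2) (Suc m) = 2 * level_sum (\<lambda>m k. (e m k)\<^sup>2) m" for m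
      unfolding level_sum_def e'_def nat.case by (rule sum_parents)
    then have "summable (\<lambda>m. level_sum (\<lambda>m k. (e' m k)\<^sup>2) (Suc m))"
      using e by (simp add: l2_tree_def summable_mult)
    then show ?thesis by (simp only: summable_Suc_iff)
  qed
  ultimately have e': "l2_tree e'" by (simp add: l2_tree_def)
  show ?thesis
  proof (rule l2_tree_parent_recursion[OF e', where M=0])
    show "tree_periodic (ancestor_sum e M)"
      unfolding tree_periodic_def
    proof (intro allI)
      fix m and k :: int
      show "ancestor_sum e M m (k + 2 ^ m) = ancestor_sum e M m k"
      proof (induction m arbitrary: k)
        case (Suc m)
        show ?case unfolding ancestor_sum.simps div2_period Suc pe ..
      qed simp
    qed
    show "0 \<le> ancestor_sum e M m k" for m k using nn by (rule ancestor_sum_nonneg)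
    show "ancestor_sum e M (Suc m) k \<le> 3 / 5 * ancestor_sum e M m (k div 2) + \<bar>e' (Suc m) k\<bar>" for m k
      using nn[of m "k div 2"] ancestor_sum_nonneg[of e M m "k div 2"] nn by (simp add: e'_def)
  qed
qed

lemma div_two_power: "(k::int) div 2 div 2 ^ j = k div 2 ^ Suc j"
  by (simp add: zdiv_zmult2_eq)

lemma ancestor_sum_dominates:
  assumes nn: "\<And>m k. 0 \<le> e m k"
  shows "j \<le> m \<Longrightarrow> M \<le> m - j \<Longrightarrow> e (m - j) (k div 2 ^ j) / 2 ^ j \<le> ancestor_sum e M m k + e m k"
proof (induction j arbitrary: m k)
  case 0
  then show ?case using ancestor_sum_nonneg[of e M m k] nn by simp
next
  case (Suc j)
  then obtain n where n: "m = Suc n" by (cases m) auto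
  define y where "y = e (n - j) ((k div 2) div 2 ^ j) / 2 ^ j"
  have "y \<le> ancestor_sum e M n (k div 2) + e n (k div 2)"
    unfolding y_def using Suc n by auto
  moreover have "M \<le> n" using Suc n by simp
  moreover have "e (m - Suc j) (k div 2 ^ Suc j) / 2 ^ Suc j = y / 2"
    unfolding y_def n div_two_power by simp
  moreover have "ancestor_sum e M m k = 3 / 5 * ancestor_sum e M n (k div 2) + e n (k div 2)"
    using \<open>M \<le> n\<close> by (simp add: n)
  ultimately show ?case using nn[of n "k div 2"] nn[of m k] ancestor_sum_nonneg[of e M n "k div 2", OF nn]
    by linarith
qed

text \<open>Along the branch from the ancestor down to the node, \<open>a\<close> moves by at most the sum of the \<open>e\<close>. Each
generation multiplies the exponential by at most 6/5 and divides by 2, which is the weight 3/5 of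
\<open>ancestor_sum\<close>.\<close>

lemma ancestor_drift:
  assumes nn: "\<And>m k. 0 \<le> e m k"
    and small: "\<And>m k. M \<le> m \<Longrightarrow> e m k \<le> 1/10"
    and step: "\<And>m k. \<bar>a (Suc m) k - a m (k div 2)\<bar> \<le> e m (k div 2)"
  shows "j \<le> m \<Longrightarrow> M \<le> m - j \<Longrightarrow>
    (exp \<bar>a (m - j) (k div 2 ^ j) - a m k\<bar> - 1) / 2 ^ j \<le> ancestor_sum e M m k"
proof (induction j arbitrary: m k)
  case 0
  then show ?case using ancestor_sum_nonneg[of e M m k] nn by simp
next
  case (Suc j)
  then obtain n where n: "m = Suc n" by (cases m) auto
  define A where "A = \<bar>a (n - j) ((k div 2) div 2 ^ j) - a n (k div 2)\<bar>"
  define s where "s = e n (k div 2)"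
  have Mn: "M \<le> n" using Suc n by simp
  have IH: "(exp A - 1) / 2 ^ j \<le> ancestor_sum e M n (k div 2)"
    unfolding A_def using Suc n by auto
  have s: "0 \<le> s" "s \<le> 1/10" unfolding s_def using nn small Mn by auto
  have "\<bar>a (m - Suc j) (k div 2 ^ Suc j) - a m k\<bar> \<le> A + s"
    using step[of n k] unfolding A_def s_def n by (simp add: div_two_power)
  then have "exp \<bar>a (m - Suc j) (k div 2 ^ Suc j) - a m k\<bar> - 1 \<le> exp (A + s) - 1" by simp
  also have "\<dots> = (exp A - 1) * exp s + (exp s - 1)" by (simp add: exp_add algebra_simps)
  also have "\<dots> \<le> (exp A - 1) * (6/5) + 2 * s"
    using s exp_tenth[of s] exp_minus_one_le[of s] by (intro add_mono mult_left_mono) (auto simp: A_def)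
  finally have "(exp \<bar>a (m - Suc j) (k div 2 ^ Suc j) - a m k\<bar> - 1) / 2 ^ Suc j
      \<le> ((exp A - 1) * (6/5) + 2 * s) / 2 ^ Suc j" by (rule divide_right_mono) simp
  also have "\<dots> = 3/5 * ((exp A - 1) / 2 ^ j) + s / 2 ^ j" by (simp add: field_simps)
  also have "\<dots> \<le> 3/5 * ancestor_sum e M n (k div 2) + s"
  proof (intro add_mono mult_left_mono IH)
    show "s / 2 ^ j \<le> s" using divide_left_mono[of 1 "2 ^ j" s] s by simp
  qed simp
  also have "\<dots> = ancestor_sum e M m k" using n Mn by (simp add: s_def)
  finally show ?case .
qed

lemma inverse_compare:
  fixes \<mu> \<nu> s \<eta> \<alpha> \<beta> :: real
  assumes "\<mu> > 0" "\<nu> > 0" "s > 0" "\<bar>\<eta> - \<nu> * s\<bar> \<le> \<alpha> * (\<nu> * s)" "\<alpha> \<le> 1/2" "\<bar>\<mu> - \<nu>\<bar> \<le> \<beta> * \<nu>"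
  shows "\<bar>1 / (\<mu> * s) - 1 / \<eta>\<bar> \<le> 2 * (\<alpha> + \<beta>) / (\<mu> * s)"
proof -
  have ns: "\<nu> * s > 0" using assms by simp
  have "\<alpha> * (\<nu> * s) \<le> 1/2 * (\<nu> * s)" using ns assms by (intro mult_right_mono) auto
  then have eta: "\<eta> \<ge> \<nu> * s / 2" using assms(4) by (simp add: abs_le_iff)
  then have eta0: "\<eta> > 0" using ns by linarith
  have "\<bar>\<eta> - \<mu> * s\<bar> \<le> \<bar>\<eta> - \<nu> * s\<bar> + \<bar>\<mu> - \<nu>\<bar> * s"
  proof -
    have "\<eta> - \<mu> * s = (\<eta> - \<nu> * s) - (\<mu> - \<nu>) * s" by (simp add: algebra_simps)
    then have "\<bar>\<eta> - \<mu> * s\<bar> \<le> \<bar>\<eta> - \<nu> * s\<bar> + \<bar>(\<mu> - \<nu>) * s\<bar>" by linarith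
    then show ?thesis using assms by (simp add: abs_mult)
  qed
  also have "\<dots> \<le> \<alpha> * (\<nu> * s) + (\<beta> * \<nu>) * s" using assms by (intro add_mono mult_right_mono) auto
  also have "\<dots> = (\<alpha> + \<beta>) * (\<nu> * s)" by (simp add: algebra_simps)
  finally have num: "\<bar>\<eta> - \<mu> * s\<bar> \<le> (\<alpha> + \<beta>) * (\<nu> * s)" .
  have ab: "0 \<le> \<alpha> + \<beta>" using num ns by (smt (verit) mult_le_0_iff zero_le_mult_iff)
  have "1 / (\<mu> * s) - 1 / \<eta> = (\<eta> - \<mu> * s) / (\<mu> * s * \<eta>)" using assms eta0 by (simp add: field_simps)
  then have "\<bar>1 / (\<mu> * s) - 1 / \<eta>\<bar> = \<bar>\<eta> - \<mu> * s\<bar> / (\<mu> * s * \<eta>)" using assms eta0 by (simp add: abs_mult)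
  also have "\<dots> \<le> (\<alpha> + \<beta>) * (\<nu> * s) / (\<mu> * s * (\<nu> * s / 2))"
    using num eta ns assms ab by (intro frac_le mult_left_mono) auto
  also have "\<dots> = 2 * (\<alpha> + \<beta>) / (\<mu> * s)" using assms by (simp add: field_simps)
  finally show ?thesis .
qed

context circle_lift
begin

text \<open>The distance in the supremum norm between \<open>h\<close> and its chord over the cell, relative to the length of
the image of the cell.\<close>

definition deviation :: "nat \<Rightarrow> int \<Rightarrow> real" where
  "deviation m k = (SUP t\<in>{0..pi / 2 ^ m}.
     \<bar>h (dyad m k + t) - h (dyad m k) - slope h m k * t\<bar> / (slope h m k * (pi / 2 ^ m)))"

lemma deviation_raw:
  assumes "t \<in> {0..pi / 2 ^ m}"
  shows "\<bar>h (dyad m k + t) - h (dyad m k) - slope h m k * t\<bar> / (slope h m k * (pi / 2 ^ m)) \<le> 1"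
proof -
  have s: "slope h m k > 0" by (rule slope_pos)
  have "h (dyad m k) \<le> h (dyad m k + t)" using assms by (simp add: le_iff)
  moreover have "h (dyad m k + t) \<le> h (dyad m (k + 1))" using assms by (simp add: le_iff dyad_add)
  moreover have "0 \<le> slope h m k * t" using s assms by simp
  moreover have "slope h m k * t \<le> slope h m k * (pi / 2 ^ m)"
    using s assms by (intro mult_left_mono) auto
  ultimately have "\<bar>h (dyad m k + t) - h (dyad m k) - slope h m k * t\<bar> \<le> slope h m k * (pi / 2 ^ m)"
    using increment[of m k] unfolding abs_le_iff by linarith
  moreover have "0 < slope h m k * (pi / 2 ^ m)" using s by simp
  ultimately show ?thesis by (simp only: pos_divide_le_eq mult_1)
qed

lemma deviation_bdd: "bdd_above ((\<lambda>t. \<bar>h (dyad m k + t) - h (dyad m k) - slope h m k * t\<bar>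
    / (slope h m k * (pi / 2 ^ m))) ` {0..pi / 2 ^ m})"
  by (rule bdd_aboveI2[where M=1]) (rule deviation_raw)

lemma deviation_bound:
  assumes "0 \<le> t" "t \<le> pi / 2 ^ m"
  shows "\<bar>h (dyad m k + t) - h (dyad m k) - slope h m k * t\<bar> \<le> deviation m k * (slope h m k * (pi / 2 ^ m))"
proof -
  have "\<bar>h (dyad m k + t) - h (dyad m k) - slope h m k * t\<bar> / (slope h m k * (pi / 2 ^ m)) \<le> deviation m k"
    unfolding deviation_def using assms by (intro cSUP_upper2[OF deviation_bdd]) auto
  moreover have "0 < slope h m k * (pi / 2 ^ m)" using slope_pos[of m k] by simp
  ultimately show ?thesis by (simp only: pos_divide_le_eq)
qed

lemma deviation_least:
  assumes "\<And>t. 0 \<le> t \<Longrightarrow> t \<le> pi / 2 ^ m \<Longrightarrow>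
    \<bar>h (dyad m k + t) - h (dyad m k) - slope h m k * t\<bar> \<le> c * (slope h m k * (pi / 2 ^ m))"
  shows "deviation m k \<le> c"
proof -
  have p: "0 < slope h m k * (pi / 2 ^ m)" using slope_pos[of m k] by simp
  show ?thesis unfolding deviation_def
  proof (rule cSUP_least)
    fix t assume "t \<in> {0..pi / 2 ^ m}"
    then have "\<bar>h (dyad m k + t) - h (dyad m k) - slope h m k * t\<bar> \<le> c * (slope h m k * (pi / 2 ^ m))"
      by (intro assms) auto
    then show "\<bar>h (dyad m k + t) - h (dyad m k) - slope h m k * t\<bar> / (slope h m k * (pi / 2 ^ m)) \<le> c"
      using p by (simp only: pos_divide_le_eq)
  qed simp
qed

lemma deviation_le_1: "deviation m k \<le> 1"
  unfolding deviation_def by (rule cSUP_least) (simp, rule deviation_raw)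

lemma deviation_nonneg: "0 \<le> deviation m k"
proof -
  have "0 < slope h m k * (pi / 2 ^ m)" using slope_pos[of m k] by simp
  moreover have "0 \<le> deviation m k * (slope h m k * (pi / 2 ^ m))" using deviation_bound[of 0 m k] by simp
  ultimately show ?thesis by (metis not_less mult_neg_pos)
qed

lemma deviation_periodic: "tree_periodic deviation"
proof -
  have "h (dyad m k + pi + t) = h (dyad m k + t) + pi" for m k t
    using per[of "dyad m k + t"] by (simp add: algebra_simps)
  then show ?thesis
    unfolding tree_periodic_def deviation_def by (simp add: dyad_period slope_periodic per)
qed

text \<open>On each half, \<open>h\<close> is compared with the chord over that half; relative to the whole cell this
deviation is scaled by the length of the image of the half, which is at most \<open>6/5 * 1/2\<close> of the whole.
The chords over the halves differ from the chord over the cell by the differences of slopes.\<close>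

lemma deviation_recursion:
  assumes v: "slope_variation h m k \<le> 1/10"
  shows "deviation m k \<le> 3/5 * max (deviation (Suc m) (2 * k)) (deviation (Suc m) (2 * k + 1)) + slope_variation h m k"
proof (rule deviation_least)
  define D where "D = max (deviation (Suc m) (2 * k)) (deviation (Suc m) (2 * k + 1))"
  define \<mu> \<mu>1 \<mu>2 where "\<mu> = slope h m k" and "\<mu>1 = slope h (Suc m) (2 * k)" and "\<mu>2 = slope h (Suc m) (2 * k + 1)"
  define a1 where "a1 = \<bar>logslope h (Suc m) (2 * k) - logslope h m k\<bar>"
  define a2 where "a2 = \<bar>logslope h (Suc m) (2 * k + 1) - logslope h m k\<bar>"
  define l where "l = pi / 2 ^ m"
  define x where "x = dyad m k"
  have l2: "pi / 2 ^ Suc m = l / 2" by (simp add: l_def)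
  have l0: "l > 0" by (simp add: l_def)
  have \<mu>: "\<mu> > 0" by (simp add: \<mu>_def slope_pos)
  have a: "a1 + a2 \<le> slope_variation h m k" "0 \<le> a1" "0 \<le> a2" by (auto simp: a1_def a2_def slope_variation_def)
  have m1: "\<bar>\<mu>1 - \<mu>\<bar> \<le> 2 * a1 * \<mu>" "\<bar>\<mu>2 - \<mu>\<bar> \<le> 2 * a2 * \<mu>"
    unfolding \<mu>1_def \<mu>2_def \<mu>_def using a v by (intro slope_diff_le; simp add: a1_def a2_def)+
  have u1: "\<mu>1 \<le> 6/5 * \<mu>" "\<mu>2 \<le> 6/5 * \<mu>"
    using slope_child_le[of m "2*k"] slope_child_le[of m "2*k+1"] v by (simp_all add: \<mu>1_def \<mu>2_def \<mu>_def)
  have D0: "0 \<le> D" using deviation_nonneg by (simp add: D_def le_max_iff_disj)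
  have x': "dyad (Suc m) (2 * k) = x" "dyad (Suc m) (2 * k + 1) = x + l / 2"
    by (simp_all add: x_def dyad_child dyad_add l_def)
  have b1: "\<bar>h (x + t) - h x - \<mu>1 * t\<bar> \<le> (3/5 * D) * (\<mu> * l)" if "0 \<le> t" "t \<le> l/2" for t
  proof -
    have "\<bar>h (x + t) - h x - \<mu>1 * t\<bar> \<le> deviation (Suc m) (2*k) * (\<mu>1 * (l/2))"
      using deviation_bound[of t "Suc m" "2*k"] that unfolding l2 x' \<mu>1_def by simp
    also have "\<dots> \<le> D * ((6/5 * \<mu>) * (l/2))"
      using u1 D0 l0 slope_pos[of "Suc m" "2*k"] by (intro mult_mono) (auto simp: D_def \<mu>1_def)
    finally show ?thesis by simp
  qed
  have b2: "\<bar>h (x + l/2 + t) - h (x + l/2) - \<mu>2 * t\<bar> \<le> (3/5 * D) * (\<mu> * l)" if "0 \<le> t" "t \<le> l/2" for t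
  proof -
    have "\<bar>h (x + l/2 + t) - h (x + l/2) - \<mu>2 * t\<bar> \<le> deviation (Suc m) (2*k+1) * (\<mu>2 * (l/2))"
      using deviation_bound[of t "Suc m" "2*k+1"] that unfolding l2 x' \<mu>2_def by simp
    also have "\<dots> \<le> D * ((6/5 * \<mu>) * (l/2))"
      using u1 D0 l0 slope_pos[of "Suc m" "2*k+1"] by (intro mult_mono) (auto simp: D_def \<mu>2_def)
    finally show ?thesis by simp
  qed
  have c: "\<bar>(\<mu>1 - \<mu>) * t\<bar> \<le> a1 * (\<mu> * l)" "\<bar>(\<mu>2 - \<mu>) * t\<bar> \<le> a2 * (\<mu> * l)" if "0 \<le> t" "t \<le> l/2" for t
  proof -
    have "\<bar>\<mu>1 - \<mu>\<bar> * t \<le> (2 * a1 * \<mu>) * (l/2)" "\<bar>\<mu>2 - \<mu>\<bar> * t \<le> (2 * a2 * \<mu>) * (l/2)"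
      using m1 that a \<mu> by (intro mult_mono; simp)+
    then show "\<bar>(\<mu>1 - \<mu>) * t\<bar> \<le> a1 * (\<mu> * l)" "\<bar>(\<mu>2 - \<mu>) * t\<bar> \<le> a2 * (\<mu> * l)"
      using that by (simp_all add: abs_mult)
  qed
  have goal: "(3/5 * D) * (\<mu> * l) + (a1 + a2) * (\<mu> * l) \<le> (3/5 * D + slope_variation h m k) * (\<mu> * l)"
  proof -
    have "(a1 + a2) * (\<mu> * l) \<le> slope_variation h m k * (\<mu> * l)"
      using a \<mu> l0 by (intro mult_right_mono) auto
    then show ?thesis by (simp only: distrib_right add_left_mono)
  qed
  fix t :: real assume t: "0 \<le> t" "t \<le> pi / 2 ^ m"
  have "\<bar>h (x + t) - h x - \<mu> * t\<bar> \<le> (3/5 * D) * (\<mu> * l) + (a1 + a2) * (\<mu> * l)"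
  proof (cases "t \<le> l / 2")
    case True
    have "h (x + t) - h x - \<mu> * t = (h (x + t) - h x - \<mu>1 * t) + (\<mu>1 - \<mu>) * t" by (simp add: algebra_simps)
    moreover have "(a1 + a2) * (\<mu> * l) = a1 * (\<mu> * l) + a2 * (\<mu> * l)" "0 \<le> a2 * (\<mu> * l)"
      using a \<mu> l0 by (simp_all add: algebra_simps)
    ultimately show ?thesis using b1[of t] c(1)[of t] True t by linarith
  next
    case False
    define u where "u = t - l/2"
    have u: "0 \<le> u" "u \<le> l/2" using False t by (auto simp: u_def l_def)
    have inc: "h (x + l/2) - h x = \<mu>1 * (l/2)"
      using increment[of "Suc m" "2*k"] unfolding x' l2 \<mu>1_def .
    have e1: "x + l/2 + u = x + t" by (simp add: u_def)
    have "h (x + t) - h x - \<mu> * t = (h (x + l/2 + u) - h (x + l/2) - \<mu>2 * u) + (\<mu>2 - \<mu>) * u + (\<mu>1 - \<mu>) * (l/2)"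
      unfolding e1 using inc by (simp add: u_def field_simps)
    moreover have "(a1 + a2) * (\<mu> * l) = a1 * (\<mu> * l) + a2 * (\<mu> * l)" by (simp add: algebra_simps)
    ultimately show ?thesis using b2[of u] c(2)[of u] c(1)[of "l/2"] u l0 by linarith
  qed
  then show "\<bar>h (dyad m k + t) - h (dyad m k) - slope h m k * t\<bar>
      \<le> (3/5 * max (deviation (Suc m) (2 * k)) (deviation (Suc m) (2 * k + 1)) + slope_variation h m k)
        * (slope h m k * (pi / 2 ^ m))"
    using goal unfolding x_def \<mu>_def l_def D_def by linarith
qed

lemma l2_tree_deviation:
  assumes "l2_tree (slope_variation h)"
  shows "l2_tree deviation"
proof -
  obtain M where M: "\<And>m k. m \<ge> M \<Longrightarrow> \<bar>slope_variation h m k\<bar> \<le> 1/10"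
    using l2_tree_small[OF assms, of "1/10"] by auto
  show ?thesis
    by (rule l2_tree_child_recursion[OF assms deviation_periodic deviation_nonneg deviation_le_1, where M=M])
       (use deviation_recursion M slope_variation_nonneg[of h] in \<open>simp add: abs_of_nonneg\<close>)
qed

text \<open>The window reaches three cells to each side, beyond the two cells over which increments are compared.\<close>

definition window_error :: "nat \<Rightarrow> int \<Rightarrow> real" where
  "window_error m k = (\<Sum>i\<in>{-3..3}. deviation m (k + i) + slope_variation h m (k + i))"

lemma l2_tree_window_error:
  assumes "l2_tree (slope_variation h)"
  shows "l2_tree window_error"
  unfolding window_error_def[abs_def]
  by (intro l2_tree_sum l2_tree_add l2_tree_shift[OF l2_tree_deviation] l2_tree_shift[OF assms] assms) auto

lemma window_error_nonneg: "0 \<le> window_error m k"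
  unfolding window_error_def by (intro sum_nonneg add_nonneg_nonneg deviation_nonneg slope_variation_nonneg)

lemma window_parts:
  "(\<Sum>i\<in>{-3..3}. slope_variation h m (k + i)) \<le> window_error m k"
  "i \<in> {-3..3} \<Longrightarrow> deviation m (k + i) \<le> window_error m k"
proof -
  show "(\<Sum>i\<in>{-3..3}. slope_variation h m (k + i)) \<le> window_error m k"
    unfolding window_error_def using deviation_nonneg by (intro sum_mono) simp
  assume "i \<in> {-3..3}"
  then have "deviation m (k + i) + slope_variation h m (k + i) \<le> window_error m k"
    unfolding window_error_def
    by (intro member_le_sum[of i _ "\<lambda>i. deviation m (k + i) + slope_variation h m (k + i)"])
      (auto intro: add_nonneg_nonneg deviation_nonneg slope_variation_nonneg)
  then show "deviation m (k + i) \<le> window_error m k" using slope_variation_nonneg[of h m "k + i"] by linarith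
qed

lemma slope_variation_le_window: "slope_variation h m k \<le> window_error m k"
proof -
  have "slope_variation h m (k + 0) \<le> (\<Sum>i\<in>{-3..3}. slope_variation h m (k + i))"
    by (rule member_le_sum[of 0 _ "\<lambda>i. slope_variation h m (k + i)"]) (auto intro: slope_variation_nonneg)
  then show ?thesis using window_parts(1)[of m k] by simp
qed

lemma window_slopes:
  assumes e: "window_error m k \<le> 1/10" and j: "j \<in> {-3..3}"
  shows "\<bar>slope h m (k + j) - slope h m k\<bar> \<le> 2 * window_error m k * slope h m k"
proof -
  have step: "\<bar>logslope h m (i + 1) - logslope h m i\<bar> \<le> slope_variation h m i" for i
    by (simp add: slope_variation_def)
  have set: "{-3..3::int} = {-3,-2,-1,0,1,2,3}" by auto
  have sum: "(\<Sum>i\<in>{-3..3}. slope_variation h m (k + i)) = slope_variation h m (k - 3) + slope_variation h m (k - 2)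
     + slope_variation h m (k - 1) + slope_variation h m k + slope_variation h m (k + 1)
     + slope_variation h m (k + 2) + slope_variation h m (k + 3)"
    unfolding set by simp
  have "\<bar>logslope h m (k + j) - logslope h m k\<bar> \<le> (\<Sum>i\<in>{-3..3}. slope_variation h m (k + i))"
    using j step[of "k-3"] step[of "k-2"] step[of "k-1"] step[of k] step[of "k+1"] step[of "k+2"]
      slope_variation_nonneg[of h m "k-3"] slope_variation_nonneg[of h m "k-2"] slope_variation_nonneg[of h m "k-1"]
      slope_variation_nonneg[of h m "k"] slope_variation_nonneg[of h m "k+1"] slope_variation_nonneg[of h m "k+2"]
      slope_variation_nonneg[of h m "k+3"]
    unfolding sum unfolding set
    by (elim insertE emptyE) (simp_all add: algebra_simps abs_le_iff)
  also have "\<dots> \<le> window_error m k" by (rule window_parts)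
  finally show ?thesis using e by (intro slope_diff_le) auto
qed

text \<open>Over the whole window, \<open>h\<close> follows the line with the slope of the middle cell: the errors of the knots
add up from cell to cell, and inside a cell the deviation is added.\<close>

lemma window_linear:
  assumes e: "window_error m k \<le> 1/10"
    and y: "dyad m k \<le> y" "y \<le> dyad m (k + 1)" and z: "dyad m (k - 2) \<le> z" "z \<le> dyad m (k + 3)"
  shows "\<bar>h z - h y - slope h m k * (z - y)\<bar> \<le> 9 * window_error m k * (slope h m k * (pi / 2 ^ m))"
proof -
  define \<mu> where "\<mu> = slope h m k"
  define l where "l = pi / 2 ^ m"
  define \<omega> where "\<omega> = window_error m k"
  have \<mu>: "\<mu> > 0" by (simp add: \<mu>_def slope_pos)
  have l0: "l > 0" by (simp add: l_def)
  have \<omega>0: "0 \<le> \<omega>" by (simp add: \<omega>_def window_error_nonneg)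
  define B where "B = \<omega> * (\<mu> * l)"
  have B0: "0 \<le> B" using \<mu> l0 \<omega>0 by (simp add: B_def)
  have near: "\<bar>slope h m (k + j) - \<mu>\<bar> \<le> 2 * \<omega> * \<mu>" if "j \<in> {-3..3}" for j
    unfolding \<mu>_def \<omega>_def using window_slopes[OF e that] .
  have inc: "\<bar>h (dyad m (k + j + 1)) - h (dyad m (k + j)) - \<mu> * l\<bar> \<le> 2 * B" if "j \<in> {-3..3}" for j
  proof -
    have "h (dyad m (k + j + 1)) - h (dyad m (k + j)) - \<mu> * l = (slope h m (k + j) - \<mu>) * l"
      using increment[of m "k + j"] by (simp add: l_def algebra_simps)
    then show ?thesis using mult_right_mono[OF near[OF that], of l] l0 by (simp add: abs_mult B_def mult.assoc)
  qed
  have set: "{-2..2::int} = {-2,-1,0,1,2}" by auto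
  have knots: "\<bar>h (dyad m (k + j)) - h (dyad m k) - \<mu> * (of_int j * l)\<bar> \<le> 4 * B" if "j \<in> {-2..2}" for j
    using that inc[of "-2"] inc[of "-1"] inc[of 0] inc[of 1] B0 unfolding set
    by (elim insertE emptyE) (simp_all add: algebra_simps abs_le_iff)
  have point: "\<bar>h w - h (dyad m k) - \<mu> * (w - dyad m k)\<bar> \<le> (73/10) * B"
    if j: "j \<in> {-2..2}" and w: "dyad m (k + j) \<le> w" "w \<le> dyad m (k + j + 1)" for j w
  proof -
    define t where "t = w - dyad m (k + j)"
    have t: "0 \<le> t" "t \<le> l" using w by (auto simp: t_def l_def dyad_add[of m _ 1])
    have j3: "j \<in> {-3..3}" using j by auto
    have "\<bar>h (dyad m (k+j) + t) - h (dyad m (k+j)) - slope h m (k+j) * t\<bar> \<le> deviation m (k+j) * (slope h m (k+j) * l)"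
      unfolding l_def by (rule deviation_bound) (use t in \<open>auto simp: l_def\<close>)
    also have "\<dots> \<le> \<omega> * ((12/10 * \<mu>) * l)"
    proof (intro mult_mono)
      show "deviation m (k + j) \<le> \<omega>" unfolding \<omega>_def by (rule window_parts(2)[OF j3])
      have "2 * \<omega> * \<mu> \<le> 2 * (1/10) * \<mu>" using e \<mu> by (intro mult_right_mono) (auto simp: \<omega>_def)
      then show "slope h m (k + j) \<le> 12/10 * \<mu>" using near[OF j3] by (simp add: abs_le_iff)
    qed (use \<mu> l0 \<omega>0 slope_pos[of m "k + j"] in auto)
    finally have 1: "\<bar>h w - h (dyad m (k+j)) - slope h m (k+j) * t\<bar> \<le> 12/10 * B" by (simp add: t_def B_def)
    have "\<bar>(slope h m (k + j) - \<mu>) * t\<bar> \<le> (2 * \<omega> * \<mu>) * l"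
      unfolding abs_mult using near[OF j3] t \<mu> \<omega>0 by (intro mult_mono) auto
    then have 2: "\<bar>(slope h m (k + j) - \<mu>) * t\<bar> \<le> 2 * B" by (simp add: B_def)
    have "h w - h (dyad m k) - \<mu> * (w - dyad m k) = (h w - h (dyad m (k+j)) - slope h m (k+j) * t)
       + (slope h m (k + j) - \<mu>) * t + (h (dyad m (k + j)) - h (dyad m k) - \<mu> * (of_int j * l))"
    proof -
      have "dyad m (k + j) = dyad m k + of_int j * l" by (simp add: dyad_add l_def)
      then show ?thesis by (simp add: t_def algebra_simps)
    qed
    then show ?thesis using 1 2 knots[OF j] B0 by linarith
  qed
  have y': "\<bar>h y - h (dyad m k) - \<mu> * (y - dyad m k)\<bar> \<le> B"
  proof -
    have "\<bar>h (dyad m k + (y - dyad m k)) - h (dyad m k) - slope h m k * (y - dyad m k)\<bar> \<le> deviation m k * (slope h m k * (pi / 2 ^ m))"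
      by (rule deviation_bound) (use y in \<open>auto simp: dyad_add\<close>)
    also have "\<dots> \<le> \<omega> * (\<mu> * l)"
      unfolding \<mu>_def l_def using window_parts(2)[of 0 m k] slope_pos[of m k]
      by (intro mult_right_mono) (auto simp: \<omega>_def)
    finally show ?thesis by (simp add: B_def \<mu>_def)
  qed
  have "\<exists>j\<in>{-2..2}. dyad m (k + j) \<le> z \<and> z \<le> dyad m (k + j + 1)"
  proof -
    have "k - 2 + 2 = k" by simp
    then show ?thesis using z unfolding set
      by (simp add: algebra_simps) linarith
  qed
  then have z': "\<bar>h z - h (dyad m k) - \<mu> * (z - dyad m k)\<bar> \<le> (73/10) * B" using point by blast
  have "h z - h y - \<mu> * (z - y) = (h z - h (dyad m k) - \<mu> * (z - dyad m k)) - (h y - h (dyad m k) - \<mu> * (y - dyad m k))"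
    by (simp add: algebra_simps)
  then have "\<bar>h z - h y - \<mu> * (z - y)\<bar> \<le> 9 * B" using y' z' B0 by linarith
  then show ?thesis by (simp add: B_def \<mu>_def l_def \<omega>_def)
qed

end

section \<open>Cotangents of increments, and quasisymmetry\<close>

lemma dyadic_scale:
  fixes l s :: real
  assumes "l > 0" "l \<le> s" "s \<le> 2 * (2 ^ n * l)"
  shows "\<exists>j\<le>n. 2 ^ j * l \<le> s \<and> s \<le> 2 * (2 ^ j * l)"
  using assms(3)
proof (induction n)
  case 0 then show ?case using assms by auto
next
  case (Suc n)
  show ?case
  proof (cases "s \<le> 2 * (2 ^ n * l)")
    case True then show ?thesis using Suc.IH by (meson le_Suc_eq)
  next
    case False
    then show ?thesis using Suc.prems by (intro exI[of _ "Suc n"]) auto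
  qed
qed

lemma period_reduce: "\<exists>y n. 0 \<le> y \<and> y \<le> pi \<and> x = y + of_int n * (pi::real)"
proof -
  define n where "n = \<lfloor>x / pi\<rfloor>"
  have "of_int n \<le> x / pi" "x / pi < of_int n + 1" unfolding n_def by linarith+
  then have "of_int n * pi \<le> x" "x < (of_int n + 1) * pi" by (simp_all add: field_simps)
  then show ?thesis by (intro exI[of _ "x - of_int n * pi"] exI[of _ n]) (auto simp: algebra_simps)
qed

lemma dyad_ancestor:
  assumes "j \<le> m"
  shows "dyad (m - j) (k div 2 ^ j) \<le> dyad m k" "dyad m k \<le> dyad (m - j) (k div 2 ^ j + 1)"
    "pi / 2 ^ (m - j) = 2 ^ j * (pi / 2 ^ m)"
proof -
  have p: "(2::real) ^ m = 2 ^ (m - j) * 2 ^ j" using assms by (simp flip: power_add)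
  have e: "dyad (m - j) i = dyad m (i * 2 ^ j)" for i by (simp add: dyad_def p)
  show "dyad (m - j) (k div 2 ^ j) \<le> dyad m k" unfolding e
    by (rule dyad_mono) (simp add: minus_mod_eq_div_mult[symmetric])
  have "k < (k div 2 ^ j + 1) * 2 ^ j"
  proof -
    have "k mod 2 ^ j < 2 ^ j" "k = k div 2 ^ j * 2 ^ j + k mod 2 ^ j"
      by (simp, rule div_mult_mod_eq[symmetric])
    then show ?thesis unfolding distrib_right by linarith
  qed
  then show "dyad m k \<le> dyad (m - j) (k div 2 ^ j + 1)" unfolding e by (intro dyad_mono) simp
  show "pi / 2 ^ (m - j) = 2 ^ j * (pi / 2 ^ m)" by (simp add: p)
qed

lemma l2_tree_cell: "l2_tree (\<lambda>m k. pi / 2 ^ m)"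
proof -
  have z: "l2_tree (\<lambda>m k. 0)" by (simp add: l2_tree_def tree_periodic_def level_sum_def[abs_def])
  show ?thesis by (rule l2_tree_parent_recursion[OF z]) (auto simp: tree_periodic_def field_simps)
qed

context circle_lift
begin

text \<open>The mean slope over the triple interval, by which epsilon numbers are normalized.\<close>

definition triple_slope :: "nat \<Rightarrow> int \<Rightarrow> real" where
  "triple_slope m k = (slope h m (k - 1) + slope h m k + slope h m (k + 1)) / 3"

lemma triple_slope_pos: "triple_slope m k > 0"
  using slope_pos[of m "k-1"] slope_pos[of m k] slope_pos[of m "k+1"] by (simp add: triple_slope_def)

lemma uniform_increment_pos:
  assumes "r > 0"
  shows "\<exists>\<eta>>0. \<forall>x. h (x + r) - h x \<ge> \<eta>"
proof -
  have c: "continuous_on {0..pi} (\<lambda>x. h (x + r) - h x)"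
    by (intro continuous_intros continuous_on_compose2[OF cont]) auto
  have "\<exists>x\<in>{0..pi}. \<forall>y\<in>{0..pi}. h (x + r) - h x \<le> h (y + r) - h y"
    by (rule continuous_attains_inf[OF _ _ c]) auto
  then obtain x0 where "\<forall>y\<in>{0..pi}. h (x0 + r) - h x0 \<le> h (y + r) - h y" by blast
  then have x0: "\<And>y. 0 \<le> y \<Longrightarrow> y \<le> pi \<Longrightarrow> h (x0 + r) - h x0 \<le> h (y + r) - h y" by auto
  have "h (x + r) - h x \<ge> h (x0 + r) - h x0" for x
  proof -
    obtain y n where y: "0 \<le> y" "y \<le> pi" "x = y + of_int n * pi" using period_reduce by blast
    have "x + r = (y + r) + of_int n * pi" using y by simp
    then have "h (x + r) - h x = h (y + r) - h y" by (simp only: y(3) per_int add_diff_add diff_self add_0_right)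
    then show ?thesis using x0[OF y(1,2)] by simp
  qed
  moreover have "h (x0 + r) - h x0 > 0" using assms by (simp add: less_iff)
  ultimately show ?thesis by blast
qed

lemma uniform_increment_small:
  assumes "\<epsilon> > 0"
  shows "\<exists>r>0. \<forall>x. h (x + r) - h x \<le> \<epsilon>"
proof -
  have "uniformly_continuous_on {0..2 * pi} h"
    by (intro compact_uniformly_continuous continuous_on_subset[OF cont]) auto
  then obtain d where d: "d > 0" "\<And>x x'. x \<in> {0..2*pi} \<Longrightarrow> x' \<in> {0..2*pi} \<Longrightarrow> dist x' x < d \<Longrightarrow> dist (h x') (h x) < \<epsilon>"
    unfolding uniformly_continuous_on_def using assms by blast
  define r where "r = min (d / 2) pi"
  have r: "r > 0" "r < d" "r \<le> pi" using d by (auto simp: r_def)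
  have "h (x + r) - h x \<le> \<epsilon>" for x
  proof -
    obtain y n where y: "0 \<le> y" "y \<le> pi" "x = y + of_int n * pi" using period_reduce by blast
    have "x + r = (y + r) + of_int n * pi" using y by simp
    then have "h (x + r) - h x = h (y + r) - h y" by (simp only: y(3) per_int add_diff_add diff_self add_0_right)
    moreover have "dist (h (y + r)) (h y) < \<epsilon>" using y r by (intro d(2)) (auto simp: dist_real_def)
    ultimately show ?thesis by (simp add: dist_real_def)
  qed
  then show ?thesis using r(1) by blast
qed

lemma l2_tree_image_cell:
  assumes M: "\<And>m k. m \<ge> M \<Longrightarrow> slope h (Suc m) k \<le> 6/5 * slope h m (k div 2)"
  shows "l2_tree (\<lambda>m k. slope h m k * (pi / 2 ^ m))"
proof -
  have z: "l2_tree (\<lambda>m k. 0)" by (simp add: l2_tree_def tree_periodic_def level_sum_def[abs_def])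
  show ?thesis
  proof (rule l2_tree_parent_recursion[OF z, where M=M])
    show "tree_periodic (\<lambda>m k. slope h m k * (pi / 2 ^ m))" by (simp add: tree_periodic_def slope_periodic)
    show "0 \<le> slope h m k * (pi / 2 ^ m)" for m k using slope_pos[of m k] by simp
    fix m and k :: int assume "m \<ge> M"
    have "slope h (Suc m) k * (pi / 2 ^ Suc m) \<le> (6/5 * slope h m (k div 2)) * (pi / 2 ^ Suc m)"
      using M[OF \<open>m \<ge> M\<close>] by (intro mult_right_mono) auto
    also have "\<dots> = 3/5 * (slope h m (k div 2) * (pi / 2 ^ m)) + \<bar>0\<bar>" by simp
    finally show "slope h (Suc m) k * (pi / 2 ^ Suc m) \<le> 3/5 * (slope h m (k div 2) * (pi / 2 ^ m)) + \<bar>0\<bar>" .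
  qed
qed

lemma l2_tree_triple_cell:
  assumes "l2_tree (\<lambda>m k. slope h m k * (pi / 2 ^ m))"
  shows "l2_tree (\<lambda>m k. triple_slope m k * (pi / 2 ^ m))"
proof -
  have "l2_tree (\<lambda>m k. 1/3 * ((slope h m (k + (-1)) * (pi / 2 ^ m) + slope h m k * (pi / 2 ^ m)) + slope h m (k + 1) * (pi / 2 ^ m)))"
    by (intro l2_tree_cmult l2_tree_add l2_tree_shift[OF assms] assms)
  moreover have "(\<lambda>m k. 1/3 * ((slope h m (k + (-1)) * (pi / 2 ^ m) + slope h m k * (pi / 2 ^ m)) + slope h m (k + 1) * (pi / 2 ^ m)))
     = (\<lambda>m k. triple_slope m k * (pi / 2 ^ m))"
    by (intro ext) (simp add: triple_slope_def algebra_simps add_divide_distrib)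
  ultimately show ?thesis by simp
qed

lemma triple_slope_near:
  assumes e: "window_error m k \<le> 1/10"
  shows "\<bar>triple_slope m k - slope h m k\<bar> \<le> 2 * window_error m k * slope h m k"
proof -
  have "\<bar>slope h m (k + (-1)) - slope h m k\<bar> \<le> 2 * window_error m k * slope h m k"
    "\<bar>slope h m (k + 1) - slope h m k\<bar> \<le> 2 * window_error m k * slope h m k"
    "\<bar>slope h m (k + 0) - slope h m k\<bar> \<le> 2 * window_error m k * slope h m k"
    by (intro window_slopes[OF e]; simp)+
  moreover have "triple_slope m k - slope h m k
      = ((slope h m (k + (-1)) - slope h m k) + (slope h m (k + 1) - slope h m k)) / 3"
    by (simp add: triple_slope_def field_simps)
  moreover have "\<bar>(a + b) / 3\<bar> \<le> T" if "\<bar>a\<bar> \<le> T" "\<bar>b\<bar> \<le> T" for a b T :: real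
    using that by (simp add: abs_le_iff)
  ultimately show ?thesis by presburger
qed

text \<open>The distance \<open>s\<close> is comparable with the length of the ancestor \<open>j\<close> generations up, so \<open>h\<close> is linear at
that scale with the slope \<open>\<nu>\<close> of this ancestor. Replacing \<open>\<nu>\<close> by the slope of the cell itself costs the
drift along the branch, which may be exponential in \<open>j\<close>; but \<open>1 / s\<close> contributes a factor
\<open>2 ^ j\<close> in the denominator, and the quotient is what \<open>ancestor_sum\<close> bounds.\<close>

lemma far_deep:
  assumes M: "\<And>m k. m \<ge> M \<Longrightarrow> window_error m k \<le> 1/20"
    and j: "j \<le> m" "M \<le> m - j"
    and s: "2 ^ j * (pi / 2 ^ m) \<le> s" "s \<le> 2 * (2 ^ j * (pi / 2 ^ m))" "\<bar>t\<bar> = s"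
  shows "\<bar>1 / (triple_slope m k * s) - 1 / \<bar>h (dyad m k + t) - h (dyad m k)\<bar>\<bar>
     \<le> 24 * (ancestor_sum window_error M m k + window_error m k) / (triple_slope m k * (pi / 2 ^ m))"
proof -
  define l where "l = pi / 2 ^ m"
  define n K where "n = m - j" and "K = k div 2 ^ j"
  define \<nu> \<mu>I \<mu> where "\<nu> = slope h n K" and "\<mu>I = slope h m k" and "\<mu> = triple_slope m k"
  define e E eJ where "e = window_error m k" and "E = ancestor_sum window_error M m k" and "eJ = window_error n K"
  define \<eta> where "\<eta> = \<bar>h (dyad m k + t) - h (dyad m k)\<bar>"
  define x where "x = exp \<bar>logslope h n K - logslope h m k\<bar> - 1"
  have l0: "l > 0" by (simp add: l_def)
  have nu: "\<nu> > 0" "\<mu>I > 0" "\<mu> > 0" unfolding \<nu>_def \<mu>I_def \<mu>_def by (rule slope_pos triple_slope_pos)+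
  have x0: "0 \<le> x" by (simp add: x_def)
  have en: "0 \<le> e" "0 \<le> eJ" by (simp_all add: e_def eJ_def window_error_nonneg)
  have E0: "0 \<le> E" unfolding E_def by (intro ancestor_sum_nonneg window_error_nonneg)
  have nM: "M \<le> n" "M \<le> m" using j by (auto simp: n_def)
  have e20: "e \<le> 1/20" "eJ \<le> 1/20" using M nM by (auto simp: e_def eJ_def)
  have ln: "pi / 2 ^ n = 2 ^ j * l" unfolding n_def l_def by (rule dyad_ancestor(3)[OF j(1)])
  have pl: "0 < 2 ^ j * l" using l0 by simp
  then have s0: "s > 0" using s(1) unfolding l_def by linarith
  have lin: "\<bar>h (dyad m k + t) - h (dyad m k) - \<nu> * t\<bar> \<le> 9 * eJ * (\<nu> * (2 ^ j * l))"
  proof -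
    have "\<bar>h (dyad m k + t) - h (dyad m k) - slope h n K * (dyad m k + t - dyad m k)\<bar>
       \<le> 9 * window_error n K * (slope h n K * (pi / 2 ^ n))"
    proof (rule window_linear)
      show "window_error n K \<le> 1/10" using e20 by (simp add: eJ_def)
      show a: "dyad n K \<le> dyad m k" and b: "dyad m k \<le> dyad n (K + 1)"
        unfolding n_def K_def by (rule dyad_ancestor[OF j(1)])+
      have "dyad n (K + (-2)) = dyad n K - 2 * (2 ^ j * l)" "dyad n (K + 3) = dyad n (K + 1) + 2 * (2 ^ j * l)"
        unfolding ln[symmetric] by (simp_all add: dyad_def field_simps)
      then show "dyad n (K - 2) \<le> dyad m k + t" "dyad m k + t \<le> dyad n (K + 3)"
        using a b s(2,3) by (simp_all add: l_def)
    qed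
    then show ?thesis by (simp add: \<nu>_def eJ_def ln)
  qed
  have eta: "\<bar>\<eta> - \<nu> * s\<bar> \<le> (9 * eJ) * (\<nu> * s)"
  proof -
    have "\<nu> * s = \<bar>\<nu> * t\<bar>" using nu s(3) by (simp add: abs_mult)
    then have "\<bar>\<eta> - \<nu> * s\<bar> \<le> \<bar>h (dyad m k + t) - h (dyad m k) - \<nu> * t\<bar>" unfolding \<eta>_def by linarith
    also note lin
    also have "9 * eJ * (\<nu> * (2 ^ j * l)) \<le> (9 * eJ) * (\<nu> * s)"
      using s(1) nu en by (intro mult_left_mono) (auto simp: l_def)
    finally show ?thesis .
  qed
  have r1: "\<bar>\<mu>I - \<nu>\<bar> \<le> x * \<nu>"
  proof -
    have "\<bar>\<mu>I / \<nu> - 1\<bar> \<le> x"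
      using abs_exp_minus_one_le[of "logslope h m k - logslope h n K"]
      unfolding \<mu>I_def \<nu>_def slope_ratio x_def by (simp add: abs_minus_commute)
    moreover have "\<mu>I - \<nu> = (\<mu>I / \<nu> - 1) * \<nu>" using nu by (simp add: field_simps)
    ultimately show ?thesis using nu by (simp add: abs_mult mult_right_mono)
  qed
  have r2: "\<bar>\<mu> - \<nu>\<bar> \<le> (2 * e * (1 + x) + x) * \<nu>"
  proof -
    have "\<bar>\<mu> - \<mu>I\<bar> \<le> 2 * e * \<mu>I" unfolding \<mu>_def \<mu>I_def e_def
      by (rule triple_slope_near) (use e20 in \<open>simp add: e_def\<close>)
    also have "\<dots> \<le> 2 * e * ((1 + x) * \<nu>)" using r1 en by (intro mult_left_mono) (auto simp: abs_le_iff algebra_simps)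
    finally have "\<bar>\<mu> - \<mu>I\<bar> \<le> 2 * e * ((1 + x) * \<nu>)" .
    moreover have "(2 * e * (1 + x) + x) * \<nu> = 2 * e * ((1 + x) * \<nu>) + x * \<nu>" by (simp add: algebra_simps)
    ultimately show ?thesis using r1 by linarith
  qed
  have "\<bar>1 / (\<mu> * s) - 1 / \<eta>\<bar> \<le> 2 * (9 * eJ + (2 * e * (1 + x) + x)) / (\<mu> * s)"
    by (rule inverse_compare[OF nu(3,1) s0 eta _ r2]) (use e20 in simp)
  also have "\<dots> \<le> 2 * (9 * eJ + (2 * e * (1 + x) + x)) / (\<mu> * (2 ^ j * l))"
  proof (rule divide_left_mono)
    show "\<mu> * (2 ^ j * l) \<le> \<mu> * s" using s(1) nu by (intro mult_left_mono) (auto simp: l_def)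
    show "0 \<le> 2 * (9 * eJ + (2 * e * (1 + x) + x))" using en x0 by simp
    show "0 < \<mu> * s * (\<mu> * (2 ^ j * l))" using nu s0 pl mult_pos_pos by metis
  qed
  also have "\<dots> = 2 * (9 * (eJ / 2 ^ j) + (2 * (e / 2 ^ j) + 2 * e * (x / 2 ^ j) + x / 2 ^ j)) / (\<mu> * l)"
    using nu l0 by (simp add: field_simps)
  also have "\<dots> \<le> 2 * (9 * (E + e) + (2 * e + 2 * e * E + E)) / (\<mu> * l)"
  proof (intro divide_right_mono mult_left_mono add_mono)
    show "eJ / 2 ^ j \<le> E + e"
      unfolding eJ_def E_def e_def n_def K_def
      by (rule ancestor_sum_dominates[OF window_error_nonneg j])
    show "e / 2 ^ j \<le> e" using divide_left_mono[of 1 "2 ^ j" e] en by simp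
    show xE: "x / 2 ^ j \<le> E"
      unfolding x_def E_def n_def K_def
    proof (rule ancestor_drift[where e=window_error, OF window_error_nonneg _ _ j])
      show "window_error m k \<le> 1/10" if "M \<le> m" for m k using M[OF that, of k] by linarith
      fix m and k :: int
      have "k = 2 * (k div 2) \<or> k = 2 * (k div 2) + 1" by presburger
      then have "\<bar>logslope h (Suc m) k - logslope h m (k div 2)\<bar> \<le> slope_variation h m (k div 2)"
        unfolding slope_variation_def by (smt (verit))
      then show "\<bar>logslope h (Suc m) k - logslope h m (k div 2)\<bar> \<le> window_error m (k div 2)"
        using slope_variation_le_window[of m "k div 2"] by linarith
    qed
    show "x / 2 ^ j \<le> E" by (rule xE)
  qed (use nu l0 en in auto)
  also have "\<dots> \<le> 24 * (E + e) / (\<mu> * l)"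
  proof (rule divide_right_mono)
    have "e * E \<le> 1/20 * E" using e20 E0 by (intro mult_right_mono) auto
    then show "2 * (9 * (E + e) + (2 * e + 2 * e * E + E)) \<le> 24 * (E + e)" using en E0 by simp
  qed (use nu l0 in simp)
  finally show ?thesis unfolding \<mu>_def \<eta>_def E_def e_def l_def .
qed

text \<open>There are three ranges of \<open>s\<close>. Within one cell length \<open>h\<close> is linear up to the window error. Up to a fixed
distance \<open>R\<close> the cotangents are inverses of the angles up to bounded errors, and the inverses
are compared through the ancestors. Beyond \<open>R\<close> all cotangents are bounded by a constant \<open>C\<close>.
Multiplied by \<open>\<mu> * l\<close>, a bounded error divided by \<open>\<mu>\<close> becomes a multiple of \<open>l\<close> and a bounded error becomes
a multiple of \<open>\<mu> * l\<close>; both are square summable over the tree.\<close>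

theorem cotangent_estimate:
  assumes star: "l2_tree (slope_variation h)"
  shows "\<exists>g M. l2_tree g \<and> (\<forall>m\<ge>M. \<forall>k. m \<ge> 1 \<and> g m k \<le> 1/10 \<and> pi / 2 ^ m \<le> g m k \<and>
     triple_slope m k * (pi / 2 ^ m) \<le> g m k \<and>
     (\<forall>s. \<bar>s\<bar> \<le> pi / 2 ^ m \<longrightarrow>
        \<bar>h (dyad m k + s) - h (dyad m k) - triple_slope m k * s\<bar> \<le> g m k * (triple_slope m k * (pi / 2 ^ m))) \<and>
     (\<forall>s. pi / 2 ^ m \<le> s \<longrightarrow> s \<le> pi / 2 \<longrightarrow>
        \<bar>cot s / triple_slope m k - cot (h (dyad m k + s) - h (dyad m k))\<bar> \<le> g m k / (triple_slope m k * (pi / 2 ^ m)) \<and>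
        \<bar>cot s / triple_slope m k - cot (h (dyad m k) - h (dyad m k - s))\<bar> \<le> g m k / (triple_slope m k * (pi / 2 ^ m))))"
proof -
  have lw: "l2_tree window_error" using star by (rule l2_tree_window_error)
  obtain M1 where M1: "\<And>m k. m \<ge> M1 \<Longrightarrow> \<bar>window_error m k\<bar> \<le> 1/20"
    using l2_tree_small[OF lw, of "1/20"] by auto
  \<comment> \<open>\<open>R\<close> is so small that increments over it stay below \<open>pi / 2\<close>, where the cotangent is controlled by
    the inverse, and it is twice a dyadic length, so that \<open>far_deep\<close> reaches up to it from every cell\<close>
  obtain r where r: "r > 0" "\<And>x. h (x + r) - h x \<le> pi / 2"
    using uniform_increment_small[of "pi/2"] by auto
  obtain M2 :: nat where M2: "2 * pi / min r (pi / 2) < 2 ^ M2"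
    using real_arch_pow[of 2 "2 * pi / min r (pi / 2)"] by auto
  define M where "M = max M1 M2"
  define R where "R = 2 * (pi / 2 ^ M)"
  have R: "0 < R" "R \<le> r" "R \<le> pi / 2"
  proof -
    show "0 < R" by (simp add: R_def)
    have "(2::real) ^ M2 \<le> 2 ^ M" by (simp add: M_def)
    then have "2 * pi / min r (pi / 2) < 2 ^ M" using M2 by linarith
    moreover have "0 < min r (pi / 2)" using r by simp
    ultimately have "2 * pi < 2 ^ M * min r (pi/2)" by (simp only: pos_divide_less_eq)
    then have "2 * pi / 2 ^ M < min r (pi/2)" by (simp only: pos_divide_less_eq zero_less_power zero_less_numeral mult.commute)
    then have "R < min r (pi/2)" by (simp add: R_def)
    then show "R \<le> r" "R \<le> pi / 2" by auto
  qed
  have M: "window_error m k \<le> 1/20" if "m \<ge> M" for m k using M1[of m k] that by (simp add: M_def)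
  define E where "E = ancestor_sum window_error M"
  obtain \<eta>0 where \<eta>0: "\<eta>0 > 0" "\<And>x. h (x + R) - h x \<ge> \<eta>0" using uniform_increment_pos[OF R(1)] by blast
  obtain \<eta>1 where \<eta>1: "\<eta>1 > 0" "\<And>x. h (x + pi/2) - h x \<ge> \<eta>1" using uniform_increment_pos[of "pi/2"] by auto
  have "bounded (cot ` {\<eta>0..pi - \<eta>1})"
  proof (intro compact_imp_bounded compact_continuous_image)
    show "continuous_on {\<eta>0..pi - \<eta>1} (cot :: real \<Rightarrow> real)"
    proof (intro continuous_at_imp_continuous_on ballI isCont_cot)
      fix y assume "y \<in> {\<eta>0..pi - \<eta>1}"
      then have "sin y > 0" using \<eta>0 \<eta>1 by (intro sin_gt_zero) auto
      then show "sin y \<noteq> 0" by simp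
    qed
  qed simp
  then obtain C1 where "\<forall>y\<in>{\<eta>0..pi - \<eta>1}. \<bar>cot y\<bar> \<le> C1"
    unfolding bounded_iff by auto
  then have C1: "\<And>y. \<eta>0 \<le> y \<Longrightarrow> y \<le> pi - \<eta>1 \<Longrightarrow> \<bar>cot y\<bar> \<le> C1" by auto
  define C where "C = max 1 (max C1 (1 / R))"
  have C: "C \<ge> 1" "C \<ge> C1" "C \<ge> 1 / R" by (auto simp: C_def)
  define g where "g m k = 24 * (E m k + window_error m k) + C * (pi / 2 ^ m + triple_slope m k * (pi / 2 ^ m))" for m k
  have lE: "l2_tree E" unfolding E_def by (intro l2_tree_ancestor_sum lw window_error_nonneg)
  have E0: "0 \<le> E m k" for m k unfolding E_def by (intro ancestor_sum_nonneg window_error_nonneg)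
  have lg: "l2_tree g"
    unfolding g_def[abs_def]
  proof (intro l2_tree_add l2_tree_cmult l2_tree_cell lE lw l2_tree_triple_cell l2_tree_image_cell[where M=M])
    fix m and k :: int assume "m \<ge> M"
    then have "slope_variation h m (k div 2) \<le> 1/10"
      using M[of m "k div 2"] slope_variation_le_window[of m "k div 2"] by linarith
    then show "slope h (Suc m) k \<le> 6/5 * slope h m (k div 2)" by (rule slope_child_le)
  qed
  obtain M3 where M3: "\<And>m k. m \<ge> M3 \<Longrightarrow> \<bar>g m k\<bar> \<le> 1/10" using l2_tree_small[OF lg, of "1/10"] by auto
  define M' where "M' = max (max M 1) M3"
  show ?thesis
  proof (intro exI[of _ g] exI[of _ M'] conjI allI impI lg)
    fix m k assume "M' \<le> m"
    then have m: "m \<ge> M" "m \<ge> 1" "m \<ge> M3" by (auto simp: M'_def)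
    define l \<mu> x where "l = pi / 2 ^ m" and "\<mu> = triple_slope m k" and "x = dyad m k"
    define e where "e = window_error m k"
    have l0: "l > 0" by (simp add: l_def)
    have \<mu>: "\<mu> > 0" by (simp add: \<mu>_def triple_slope_pos)
    have e0: "0 \<le> e" "e \<le> 1/20" using M[OF m(1)] by (auto simp: e_def window_error_nonneg)
    have gd: "g m k = 24 * (E m k + e) + C * (l + \<mu> * l)" by (simp add: g_def l_def \<mu>_def e_def)
    have ml: "0 < \<mu> * l" using \<mu> l0 by simp
    have Cl: "l + \<mu> * l \<le> C * (l + \<mu> * l)" using C ml l0 mult_right_mono[of 1 C "l + \<mu> * l"] by simp
    define P where "P = C * (l + \<mu> * l)"
    have P0: "l + \<mu> * l \<le> P" using Cl by (simp only: P_def)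
    have gP: "g m k = 24 * E m k + 24 * e + P" by (simp add: gd P_def)
    show "1 \<le> m" by (rule m(2))
    show "g m k \<le> 1/10" using M3[OF m(3), of k] by linarith
    show "pi / 2 ^ m \<le> g m k" "triple_slope m k * (pi / 2 ^ m) \<le> g m k"
      using gP P0 ml l0 E0[of m k] e0 unfolding l_def[symmetric] \<mu>_def[symmetric] by linarith+
    have g0: "24 * (E m k + e) \<le> g m k" using gP P0 ml l0 unfolding distrib_left by linarith
    {
      fix s assume s: "\<bar>s\<bar> \<le> pi / 2 ^ m"
      define \<nu> where "\<nu> = slope h m k"
      have nu: "\<nu> > 0" by (simp add: \<nu>_def slope_pos)
      have near: "\<bar>\<mu> - \<nu>\<bar> \<le> 2 * e * \<nu>" unfolding \<mu>_def \<nu>_def e_def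
        by (rule triple_slope_near) (use e0 in \<open>simp add: e_def\<close>)
      have "\<bar>h (x + s) - h x - \<nu> * (x + s - x)\<bar> \<le> 9 * e * (\<nu> * l)"
        unfolding x_def \<nu>_def e_def l_def
      proof (rule window_linear)
        show "window_error m k \<le> 1/10" using e0 by (simp add: e_def)
        have "dyad m (k - 2) = dyad m k - 2 * (pi / 2 ^ m)" "dyad m (k + 3) = dyad m k + 3 * (pi / 2 ^ m)"
          "dyad m (k + 1) = dyad m k + pi / 2 ^ m"
          by (simp_all add: dyad_def field_simps)
        then show "dyad m k \<le> dyad m (k + 1)" "dyad m (k - 2) \<le> dyad m k + s" "dyad m k + s \<le> dyad m (k + 3)"
          using s l0 unfolding l_def abs_le_iff by linarith+
      qed simp
      then have 1: "\<bar>h (x + s) - h x - \<nu> * s\<bar> \<le> 9 * (e * (\<nu> * l))" by simp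
      have "\<bar>(\<mu> - \<nu>) * s\<bar> \<le> (2 * e * \<nu>) * l"
        unfolding abs_mult using near s e0 nu by (intro mult_mono) (auto simp: l_def)
      then have 2: "\<bar>(\<mu> - \<nu>) * s\<bar> \<le> 2 * (e * (\<nu> * l))" by simp
      have "e * \<nu> \<le> 1/20 * \<nu>" using e0 nu by (intro mult_right_mono) auto
      then have "\<nu> \<le> 2 * \<mu>" using near unfolding abs_le_iff by linarith
      then have 3: "e * (\<nu> * l) \<le> e * (2 * \<mu> * l)" using e0 l0 by (intro mult_left_mono mult_right_mono) auto
      have "h (x + s) - h x - \<mu> * s = (h (x + s) - h x - \<nu> * s) - (\<mu> - \<nu>) * s" by (simp add: algebra_simps)
      then have "\<bar>h (x + s) - h x - \<mu> * s\<bar> \<le> 22 * (e * (\<mu> * l))" using 1 2 3 by linarith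
      also have "\<dots> = 22 * e * (\<mu> * l)" by simp
      also have "\<dots> \<le> g m k * (\<mu> * l)" using g0 E0[of m k] e0 ml by (intro mult_right_mono) auto
      finally show "\<bar>h (dyad m k + s) - h (dyad m k) - triple_slope m k * s\<bar> \<le> g m k * (triple_slope m k * (pi / 2 ^ m))"
        by (simp add: x_def \<mu>_def l_def)
    }
    {
      fix s assume s: "pi / 2 ^ m \<le> s" "s \<le> pi / 2"
      have s0: "s > 0" using s l0 unfolding l_def by linarith
      have gml: "g m k / (\<mu> * l) = 24 * (E m k + e) / (\<mu> * l) + C * (1 / \<mu> + 1)"
        using \<mu> l0 by (simp add: gd field_simps)
      have est: "\<bar>cot s / \<mu> - cot \<eta>\<bar> \<le> g m k / (\<mu> * l)"
        if eta: "\<eta> = h (y + s) - h y" and t: "\<bar>t\<bar> = s" "\<eta> = \<bar>h (x + t) - h x\<bar>" for \<eta> y t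
      proof (cases "s \<le> R")
        case True
        have Re: "R = 2 * (2 ^ (m - M) * l)"
        proof -
          have "(2::real) ^ m = 2 ^ (m - M) * 2 ^ M" using m by (simp flip: power_add)
          then show ?thesis by (simp add: R_def l_def)
        qed
        obtain j where j: "j \<le> m - M" "2 ^ j * l \<le> s" "s \<le> 2 * (2 ^ j * l)"
          using dyadic_scale[OF l0, of s "m - M"] s True unfolding Re l_def by blast
        have deep: "\<bar>1 / (\<mu> * s) - 1 / \<eta>\<bar> \<le> 24 * (E m k + e) / (\<mu> * l)"
          unfolding \<mu>_def t(2) E_def e_def l_def x_def
          by (rule far_deep[OF M _ _ _ _ t(1)]) (use j m in \<open>auto simp: l_def\<close>)
        have eta1: "0 < \<eta>" "\<eta> \<le> pi / 2"
        proof -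
          show "0 < \<eta>" using s0 by (simp add: eta less_iff)
          have "h (y + s) \<le> h (y + r)" using True R by (simp add: le_iff)
          then show "\<eta> \<le> pi / 2" using r(2)[of y] by (simp add: eta)
        qed
        have a: "\<bar>cot s - 1 / s\<bar> \<le> 1" using s0 s(2) by (rule cot_near_inverse)
        have b: "\<bar>cot \<eta> - 1 / \<eta>\<bar> \<le> 1" using eta1 by (rule cot_near_inverse)
        have "\<bar>cot s / \<mu> - 1 / (\<mu> * s)\<bar> \<le> 1 / \<mu>"
        proof -
          have "cot s / \<mu> - 1 / (\<mu> * s) = (cot s - 1 / s) / \<mu>" using \<mu> s0 by (simp add: field_simps)
          then show ?thesis using a \<mu> by (simp add: abs_divide divide_right_mono)
        qed
        then have "\<bar>cot s / \<mu> - cot \<eta>\<bar> \<le> 1 / \<mu> + 24 * (E m k + e) / (\<mu> * l) + 1"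
          using deep b by linarith
        also have "\<dots> \<le> g m k / (\<mu> * l)"
        proof -
          have "1 * (1 / \<mu> + 1) \<le> C * (1 / \<mu> + 1)" using C \<mu> by (intro mult_right_mono) auto
          moreover have "1 / \<mu> + X + 1 \<le> X + Y" if "1 * (1 / \<mu> + 1) \<le> Y" for X Y :: real
            using that by simp
          ultimately show ?thesis unfolding gml by blast
        qed
        finally show ?thesis .
      next
        case False
        have c: "0 \<le> cot s" "cot s \<le> 1 / s" using s0 s(2) by (rule cot_near_inverse)+
        have "1 / s \<le> 1 / R" using False R s0 by (intro divide_left_mono) auto
        then have "cot s \<le> C" using c C by linarith
        then have 1: "\<bar>cot s / \<mu>\<bar> \<le> C / \<mu>" using c \<mu> by (simp add: abs_divide divide_right_mono)
        have "\<eta>0 \<le> \<eta>"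
        proof -
          have "h (y + R) \<le> h (y + s)" using False by (simp add: le_iff)
          then show ?thesis using \<eta>0(2)[of y] by (simp add: eta)
        qed
        moreover have "\<eta> \<le> pi - \<eta>1"
        proof -
          have "h (y + s) \<le> h (y + pi/2)" using s by (simp add: le_iff)
          moreover have "y + pi/2 + pi/2 = y + pi" by simp
          ultimately show ?thesis using \<eta>1(2)[of "y + pi/2"] per[of y] eta by (simp only:)
        qed
        ultimately have "\<bar>cot \<eta>\<bar> \<le> C" using C1 C by fastforce
        then have "\<bar>cot s / \<mu> - cot \<eta>\<bar> \<le> C / \<mu> + C" using 1 by linarith
        also have "\<dots> \<le> g m k / (\<mu> * l)"
          unfolding gml using E0[of m k] e0 ml by (simp add: algebra_simps)
        finally show ?thesis .
      qed
      have "\<bar>cot s / \<mu> - cot (h (x + s) - h x)\<bar> \<le> g m k / (\<mu> * l)"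
        by (rule est[where y=x and t=s]) (use s0 in \<open>auto simp: less_iff le_iff\<close>)
      moreover have "\<bar>cot s / \<mu> - cot (h x - h (x - s))\<bar> \<le> g m k / (\<mu> * l)"
      proof (rule est[where y="x - s" and t="-s"])
        have "h (x - s) \<le> h x" using s0 by (simp add: le_iff)
        then show "h x - h (x - s) = \<bar>h (x + - s) - h x\<bar>" by simp
      qed (use s0 in auto)
      ultimately show "\<bar>cot s / triple_slope m k - cot (h (dyad m k + s) - h (dyad m k))\<bar> \<le> g m k / (triple_slope m k * (pi / 2 ^ m))"
        "\<bar>cot s / triple_slope m k - cot (h (dyad m k) - h (dyad m k - s))\<bar> \<le> g m k / (triple_slope m k * (pi / 2 ^ m))"
        by (simp_all add: \<mu>_def x_def l_def)
    }
  qed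
qed

lemma slope_variation_bounded:
  assumes "l2_tree (slope_variation h)"
  shows "\<exists>V\<ge>0. \<forall>m k. slope_variation h m k \<le> V"
proof -
  let ?S = "level_sum (\<lambda>m k. (slope_variation h m k)\<^sup>2)"
  have s: "summable ?S" using assms by (simp add: l2_tree_def)
  have "(slope_variation h m k)\<^sup>2 \<le> (\<Sum>m. ?S m)" for m k
  proof -
    have "(slope_variation h m (k mod 2 ^ m))\<^sup>2 \<le> ?S m"
      unfolding level_sum_def by (rule member_le_sum[where f="\<lambda>k. (slope_variation h m k)\<^sup>2"]) auto
    also have "\<dots> \<le> (\<Sum>m. ?S m)"
      using sum_le_suminf[OF s, of "{m}"] level_sum_nonneg[of "\<lambda>m k. (slope_variation h m k)\<^sup>2"] by simp
    finally show ?thesis by (simp add: tree_periodic_mod[OF slope_variation_periodic])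
  qed
  then have "slope_variation h m k \<le> sqrt (\<Sum>m. ?S m)" for m k by (rule real_le_rsqrt)
  moreover have "0 \<le> sqrt (\<Sum>m. ?S m)" using suminf_nonneg[OF s] level_sum_nonneg[of "\<lambda>m k. (slope_variation h m k)\<^sup>2"] by simp
  ultimately show ?thesis by blast
qed

text \<open>Up to one period, take cells of length \<open>l\<close> with \<open>2 * l \<le> t < 4 * l\<close>: each of the two adjacent intervals of
length \<open>t\<close> contains a cell and is covered by five, and neighbouring slopes have bounded ratios. Beyond one
period, both increments lie between \<open>n * pi\<close> and \<open>(n + 1) * pi\<close> for the same \<open>n \<ge> 1\<close>.\<close>

lemma increments_comparable:
  assumes star: "l2_tree (slope_variation h)"
  shows "\<exists>K\<ge>1. \<forall>x. \<forall>t>0. h (x + t) - h x \<le> K * (h x - h (x - t)) \<and> h x - h (x - t) \<le> K * (h (x + t) - h x)"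
proof -
  obtain V where V: "V \<ge> 0" "\<And>m k. slope_variation h m k \<le> V" using slope_variation_bounded[OF star] by blast
  have step: "slope h m (k + 1) \<le> exp V * slope h m k" "slope h m k \<le> exp V * slope h m (k + 1)" for m k
  proof -
    have d: "\<bar>logslope h m (k + 1) - logslope h m k\<bar> \<le> V"
      using V(2)[of m k] by (simp add: slope_variation_def)
    have "slope h m (k + 1) / slope h m k \<le> exp V" "slope h m k / slope h m (k + 1) \<le> exp V"
      unfolding slope_ratio using d by (simp_all add: abs_le_iff)
    then show "slope h m (k + 1) \<le> exp V * slope h m k" "slope h m k \<le> exp V * slope h m (k + 1)"
      using slope_pos by (simp_all add: pos_divide_le_eq)
  qed
  define W where "W = exp V"
  have W: "W \<ge> 1" using V by (simp add: W_def)
  have near: "slope h m (k + int i) \<le> W ^ i * slope h m k" "slope h m k \<le> W ^ i * slope h m (k + int i)" for m k i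
  proof (induction i)
    case (Suc i)
    case 1
    have "slope h m (k + int (Suc i)) \<le> W * slope h m (k + int i)"
      using step(1)[of m "k + int i"] by (simp add: W_def algebra_simps)
    also have "\<dots> \<le> W * (W ^ i * slope h m k)" using Suc W by (intro mult_left_mono) auto
    finally show ?case by simp
    case 2
    have "slope h m k \<le> W ^ i * slope h m (k + int i)" by (rule Suc)
    also have "\<dots> \<le> W ^ i * (W * slope h m (k + int i + 1))"
      using step(2)[of m "k + int i"] W by (intro mult_left_mono) (auto simp: W_def)
    finally show ?case by (simp add: algebra_simps)
  qed auto
  define K where "K = 5 * W ^ 5"
  have K: "K \<ge> 5" using W by (simp add: K_def)
  have le5: "slope h m (k + int i) \<le> W ^ 5 * slope h m k" "slope h m k \<le> W ^ 5 * slope h m (k + int i)" if "i \<le> 5" for m k i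
  proof -
    have p: "W ^ i \<le> W ^ 5" using that W by (intro power_increasing) auto
    show "slope h m (k + int i) \<le> W ^ 5 * slope h m k"
      using near(1)[of m k i] mult_right_mono[OF p, of "slope h m k"] slope_pos[of m k] by linarith
    show "slope h m k \<le> W ^ 5 * slope h m (k + int i)"
      using near(2)[of m k i] mult_right_mono[OF p, of "slope h m (k + int i)"] slope_pos[of m "k + int i"] by linarith
  qed
  have five: "h (dyad m (k + 5)) - h (dyad m k) = (slope h m k + slope h m (k+1) + slope h m (k+2) + slope h m (k+3) + slope h m (k+4)) * (pi / 2 ^ m)" for m k
  proof -
    have "k + 1 + 1 = k + 2" "k + 2 + 1 = k + 3" "k + 3 + 1 = k + 4" "k + 4 + 1 = k + 5" by simp_all
    then show ?thesis
      using increment[of m k] increment[of m "k+1"] increment[of m "k+2"] increment[of m "k+3"] increment[of m "k+4"]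
      unfolding distrib_right by (simp only:)
  qed
  have small: "h (x + t) - h x \<le> K * (h x - h (x - t)) \<and> h x - h (x - t) \<le> K * (h (x + t) - h x)"
    if t: "0 < t" "t \<le> pi" for x t
  proof -
    obtain n :: nat where "2 * pi / t < 2 ^ n" using real_arch_pow[of 2 "2 * pi / t"] by auto
    then have n: "pi / 2 ^ n \<le> t / 2" using t by (simp add: field_simps)
    define m where "m = (LEAST m. pi / 2 ^ m \<le> t / 2)"
    define l where "l = pi / 2 ^ m"
    have m1: "l \<le> t / 2" unfolding m_def l_def using n by (rule LeastI)
    have "m \<noteq> 0"
    proof
      assume "m = 0"
      then have "l = pi" by (simp add: l_def)
      then show False using m1 t pi_gt_zero by linarith
    qed
    then have "\<not> pi / 2 ^ (m - 1) \<le> t / 2" using not_less_Least[of "m - 1" "\<lambda>m. pi / 2 ^ m \<le> t / 2"] unfolding m_def by auto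
    moreover have "pi / 2 ^ (m - 1) = 2 * l" using \<open>m \<noteq> 0\<close> by (cases m) (auto simp: l_def)
    ultimately have m2: "t < 4 * l" by linarith
    have l0: "l > 0" by (simp add: l_def)
    define k where "k = \<lfloor>x / l\<rfloor>"
    have d: "dyad m j = of_int j * l" for j by (simp add: dyad_def l_def)
    have "of_int k \<le> x / l" "x / l < of_int k + 1" unfolding k_def by linarith+
    then have k: "of_int k * l \<le> x" "x < (of_int k + 1) * l" using l0 by (simp_all add: pos_le_divide_eq pos_divide_less_eq)
    have A1: "h (x + t) - h x \<ge> slope h m (k + 1) * l"
    proof -
      have "h x \<le> h (dyad m (k+1))" "h (dyad m (k + 1 + 1)) \<le> h (x + t)"
        unfolding le_iff d using k m1 by (simp_all add: algebra_simps)
      then show ?thesis using increment[of m "k+1"] by (simp add: l_def)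
    qed
    have A2: "h (x + t) - h x \<le> (5 * W ^ 5 * slope h m (k - 1)) * l"
    proof -
      have "h (dyad m k) \<le> h x" "h (x + t) \<le> h (dyad m (k + 5))"
        unfolding le_iff d using k m2 by (simp_all add: algebra_simps)
      moreover have "slope h m k + slope h m (k+1) + slope h m (k+2) + slope h m (k+3) + slope h m (k+4) \<le> 5 * W ^ 5 * slope h m (k - 1)"
        using le5(1)[of 1 m "k-1"] le5(1)[of 2 m "k-1"] le5(1)[of 3 m "k-1"] le5(1)[of 4 m "k-1"] le5(1)[of 5 m "k-1"] by (simp add: add.commute)
      ultimately show ?thesis using five[of m k] mult_right_mono[of _ "5 * W ^ 5 * slope h m (k - 1)" l] l0
        by (smt (verit) l_def)
    qed
    have B1: "h x - h (x - t) \<ge> slope h m (k - 1) * l"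
    proof -
      have "h (dyad m (k - 1 + 1)) \<le> h x" "h (x - t) \<le> h (dyad m (k - 1))"
        unfolding le_iff d using k m1 by (simp_all add: algebra_simps)
      then show ?thesis using increment[of m "k-1"] by (simp add: l_def)
    qed
    have B2: "h x - h (x - t) \<le> (5 * W ^ 5 * slope h m (k + 1)) * l"
    proof -
      have "h x \<le> h (dyad m (k - 4 + 5))" "h (dyad m (k - 4)) \<le> h (x - t)"
        unfolding le_iff d using k m2 by (simp_all add: algebra_simps)
      moreover have "slope h m (k-4) + slope h m (k-4+1) + slope h m (k-4+2) + slope h m (k-4+3) + slope h m (k-4+4) \<le> 5 * W ^ 5 * slope h m (k + 1)"
        using le5(2)[of 1 m "k"] le5(2)[of 2 m "k-1"] le5(2)[of 3 m "k-2"] le5(2)[of 4 m "k-3"] le5(2)[of 5 m "k-4"] by (simp add: add.commute)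
      ultimately show ?thesis using five[of m "k-4"] mult_right_mono[of _ "5 * W ^ 5 * slope h m (k + 1)" l] l0
        by (smt (verit) l_def)
    qed
    have "h (x + t) - h x \<le> K * (slope h m (k - 1) * l)" "h x - h (x - t) \<le> K * (slope h m (k + 1) * l)"
      using A2 B2 by (simp_all add: K_def algebra_simps)
    moreover have "K * (slope h m (k - 1) * l) \<le> K * (h x - h (x - t))" "K * (slope h m (k + 1) * l) \<le> K * (h (x + t) - h x)"
      using A1 B1 K by (intro mult_left_mono; simp)+
    ultimately show ?thesis by linarith
  qed
  have large: "h (x + t) - h x \<le> K * (h x - h (x - t)) \<and> h x - h (x - t) \<le> K * (h (x + t) - h x)"
    if t: "pi < t" for x t
  proof -
    define n where "n = \<lfloor>t / pi\<rfloor>"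
    have "of_int n \<le> t / pi" "t / pi < of_int n + 1" unfolding n_def by linarith+
    then have n: "of_int n * pi \<le> t" "t \<le> of_int (n + 1) * pi" by (simp_all add: field_simps)
    have "n \<ge> 1" using t unfolding n_def by (simp add: le_floor_iff pos_le_divide_eq)
    then have n1: "of_int n * pi \<ge> pi" by simp
    have "h (x + of_int n * pi) \<le> h (x + t)" "h (x + t) \<le> h (x + of_int (n + 1) * pi)"
      "h (x - t) \<le> h (x + of_int (-n) * pi)" "h (x + of_int (- (n+1)) * pi) \<le> h (x - t)"
      unfolding le_iff using n by (simp_all add: algebra_simps)
    moreover define A B where "A = h (x + t) - h x" and "B = h x - h (x - t)"
    ultimately have AB: "of_int n * pi \<le> A" "A \<le> of_int n * pi + pi"
      "of_int n * pi \<le> B" "B \<le> of_int n * pi + pi"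
      unfolding per_int A_def B_def by (simp_all add: algebra_simps)
    then have "0 \<le> A" "0 \<le> B" using n1 pi_gt_zero by linarith+
    then have "5 * A \<le> K * A" "5 * B \<le> K * B" using K by (intro mult_right_mono; simp)+
    then have "A \<le> K * B \<and> B \<le> K * A" using AB n1 \<open>0 \<le> A\<close> \<open>0 \<le> B\<close> by linarith
    then show ?thesis by (simp only: A_def B_def)
  qed
  show ?thesis
  proof (intro exI[of _ K] conjI allI impI)
    show "1 \<le> K" using K by simp
    fix x t :: real assume "t > 0"
    then show "h (x + t) - h x \<le> K * (h x - h (x - t))" "h x - h (x - t) \<le> K * (h (x + t) - h x)"
      using small[of t x] large[of t x] by linarith+
  qed
qed

end

section \<open>Epsilon numbers and slope variation\<close>

definition epsilon_tree :: "((real^2) set \<Rightarrow> (real^2) set) \<Rightarrow> real \<Rightarrow> nat \<Rightarrow> int \<Rightarrow> real" where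
  "epsilon_tree \<phi> x0 m k = epsilon_number \<phi> (dyadic_interval x0 m (nat (k mod 2 ^ m)))"

lemma epsilon_number_nonneg: "0 \<le> epsilon_number \<phi> I"
proof (cases "admissible \<phi> I = {}")
  case False
  then have "0 \<le> Inf (admissible \<phi> I)" by (rule cInf_greatest) (auto simp: admissible_def)
  then show ?thesis using False by (simp add: epsilon_number_def)
qed (simp add: epsilon_number_def)

lemma epsilon_number_le:
  assumes "\<epsilon> \<in> admissible \<phi> I" shows "epsilon_number \<phi> I \<le> \<epsilon>"
proof -
  have "bdd_below (admissible \<phi> I)" by (rule bdd_belowI[where m=0]) (auto simp: admissible_def)
  then show ?thesis using assms cInf_lower[OF assms] by (auto simp: epsilon_number_def)
qed

text \<open>The value 1 stands for an empty set of admissible numbers, so below 1 the epsilon number is a true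
infimum.\<close>

lemma epsilon_number_approx:
  assumes "epsilon_number \<phi> I < \<epsilon>" "epsilon_number \<phi> I < 1"
  shows "\<exists>\<epsilon>'\<in>admissible \<phi> I. \<epsilon>' < \<epsilon>"
  using assms cInf_lessD[of "admissible \<phi> I" \<epsilon>] by (auto simp: epsilon_number_def split: if_splits)

lemma dyadic_interval_eq: "dyadic_interval x0 m k = {x0 + dyad m (int k) .. x0 + dyad m (int k + 1)}"
  by (simp add: dyadic_interval_def dyad_def)

lemma dyad_succ_less: "dyad m k < dyad m (k + 1)" by (rule dyad_less) simp

lemma dyadic_interval_inj:
  assumes "dyadic_interval x0 m k = dyadic_interval x0 n j"
  shows "m = n \<and> k = j"
proof -
  have "x0 + dyad m (int k) = x0 + dyad n (int j)" "x0 + dyad m (int k + 1) = x0 + dyad n (int j + 1)"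
    using assms dyad_succ_less[of m "int k"] dyad_succ_less[of n "int j"]
    unfolding dyadic_interval_eq by (auto simp: Icc_eq_Icc)
  then have a: "dyad m (int k) = dyad n (int j)" and b: "pi / 2 ^ m = pi / 2 ^ n"
    using dyad_add[of m "int k" 1] dyad_add[of n "int j" 1] by auto
  have "(2::real) ^ m = 2 ^ n" using b by (simp add: frac_eq_eq)
  then have "m = n" by simp
  then show ?thesis using a by (simp add: dyad_def)
qed

text \<open>Different indices give different intervals, so a sum over the set of intervals is a sum over levels of
finite sums.\<close>

lemma summable_on_dyadic_decomposition:
  "(\<lambda>I. (epsilon_number \<phi> I)\<^sup>2) summable_on dyadic_decomposition_at x0 \<longleftrightarrow> l2_tree (epsilon_tree \<phi> x0)"
proof -
  define S where "S = (SIGMA m:UNIV. {..<2 ^ m :: nat})"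
  define f where "f = (\<lambda>(m, k). (epsilon_number \<phi> (dyadic_interval x0 m k))\<^sup>2)"
  define s where "s m = (\<Sum>k<2 ^ m. (epsilon_number \<phi> (dyadic_interval x0 m k))\<^sup>2)" for m
  have img: "dyadic_decomposition_at x0 = (\<lambda>(m, k). dyadic_interval x0 m k) ` S"
    by (auto simp: dyadic_decomposition_at_def S_def)
  have inj: "inj_on (\<lambda>(m, k). dyadic_interval x0 m k) S"
    by (auto simp: inj_on_def dest!: dyadic_interval_inj)
  have "(\<lambda>I. (epsilon_number \<phi> I)\<^sup>2) summable_on dyadic_decomposition_at x0 \<longleftrightarrow> f summable_on S"
    unfolding img summable_on_reindex[OF inj] by (simp add: f_def o_def case_prod_unfold)
  also have "\<dots> \<longleftrightarrow> s summable_on UNIV"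
  proof
    assume "f summable_on S"
    then have "(\<lambda>m. \<Sum>\<^sub>\<infinity>k\<in>{..<2 ^ m}. f (m, k)) summable_on UNIV"
      unfolding S_def by (intro summable_on_Sigma_banach) (simp add: case_prod_unfold)
    then show "s summable_on UNIV" by (simp add: s_def[abs_def] f_def)
  next
    assume "s summable_on UNIV"
    then show "f summable_on S"
      unfolding S_def
      by (rule summable_on_SigmaI[rotated]) (auto simp: f_def s_def intro!: has_sum_finite)
  qed
  also have "\<dots> \<longleftrightarrow> summable s"
    by (rule summable_on_UNIV_nonneg_real_iff) (auto simp: s_def intro!: sum_nonneg)
  also have "s = level_sum (\<lambda>m k. (epsilon_tree \<phi> x0 m k)\<^sup>2)"
  proof
    fix m
    have "(\<Sum>k\<in>{0..<2 ^ m}. (epsilon_tree \<phi> x0 m k)\<^sup>2) = s m"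
      unfolding s_def by (rule sum.reindex_bij_witness[of _ int nat]) (auto simp: epsilon_tree_def nat_less_iff)
    then show "s m = level_sum (\<lambda>m k. (epsilon_tree \<phi> x0 m k)\<^sup>2) m" by (simp add: level_sum_def)
  qed
  finally show ?thesis by (simp add: l2_tree_def tree_periodic_def epsilon_tree_def)
qed

lemma circle_lift_translate:
  assumes "circle_lift h" shows "circle_lift (\<lambda>t. h (x0 + t))"
proof -
  interpret circle_lift h by fact
  show ?thesis
  proof
    show "strict_mono (\<lambda>t. h (x0 + t))" by (auto simp: strict_mono_def less_iff)
    show "continuous_on UNIV (\<lambda>t. h (x0 + t))" by (intro continuous_on_compose2[OF cont] continuous_intros) auto
    show "h (x0 + (x + pi)) = h (x0 + x) + pi" for x using per[of "x0 + x"] by (simp add: add.assoc)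
  qed
qed

lemma triple_of_dyadic:
  "triple_interval (dyadic_interval x0 m k) = {x0 + dyad m (int k - 1) .. x0 + dyad m (int k + 2)}"
  "interval_length (triple_interval (dyadic_interval x0 m k)) = 3 * (pi / 2 ^ m)"
proof -
  define l where "l = pi / 2 ^ m"
  have d: "dyad m (int k + 1) = dyad m (int k) + l" "dyad m (int k - 1) = dyad m (int k) - l"
    "dyad m (int k + 2) = dyad m (int k) + 2 * l"
    by (simp_all add: dyad_def l_def field_simps)
  have p: "0 < l" by (simp add: l_def)
  show e: "triple_interval (dyadic_interval x0 m k) = {x0 + dyad m (int k - 1) .. x0 + dyad m (int k + 2)}"
    unfolding triple_interval_def interval_length_def dyadic_interval_eq d using p by (simp add: field_simps)
  show "interval_length (triple_interval (dyadic_interval x0 m k)) = 3 * (pi / 2 ^ m)"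
    unfolding e interval_length_def d l_def[symmetric] using p by simp
qed

lemma (in circle_lift) triple_increment:
  "h (dyad m (k + 2)) - h (dyad m (k - 1)) = 3 * (triple_slope m k * (pi / 2 ^ m))"
proof -
  define l where "l = pi / 2 ^ m"
  have "3 * (triple_slope m k * l) = slope h m (k - 1) * l + slope h m k * l + slope h m (k + 1) * l"
    by (simp add: triple_slope_def field_simps)
  moreover have "k - 1 + 1 = k" "k + 1 + 1 = k + 2" by simp_all
  ultimately show ?thesis
    using increment[of m "k - 1"] increment[of m k] increment[of m "k + 1"] unfolding l_def by (simp only:)
qed

lemma image_length_triple:
  assumes "circle_lift (\<lambda>t. lift \<phi> (x0 + t))"
  shows "image_length \<phi> (triple_interval (dyadic_interval x0 m k))
    = 3 * (circle_lift.triple_slope (\<lambda>t. lift \<phi> (x0 + t)) m (int k) * (pi / 2 ^ m))"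
proof -
  interpret H: circle_lift "\<lambda>t. lift \<phi> (x0 + t)" by fact
  have "dyad m (int k - 1) \<le> dyad m (int k + 2)" by (intro less_imp_le dyad_less) simp
  then show ?thesis
    unfolding triple_of_dyadic(1) image_length_def using H.triple_increment[of m "int k"] by simp
qed

text \<open>The barriers are attached to the left endpoint of the cell, with \<open>r\<close> the length \<open>l\<close> of the cell and
\<open>\<kappa> = g / (\<mu> * l)\<close>, where \<open>g\<close> is the error of the cotangent estimate.\<close>

theorem epsilon_tree_if_slope_variation:
  assumes \<phi>: "orientation_preserving_homeo \<phi>"
    and star: "l2_tree (slope_variation (\<lambda>t. lift \<phi> (x0 + t)))"
  shows "l2_tree (epsilon_tree \<phi> x0)"
proof -
  define H where "H = (\<lambda>t. lift \<phi> (x0 + t))"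
  have h: "circle_lift (lift \<phi>)" using is_lift_lift[OF \<phi>] by (rule circle_lift_if_is_lift)
  then interpret h: circle_lift "lift \<phi>" .
  interpret H: circle_lift H unfolding H_def by (rule circle_lift_translate[OF h])
  obtain g M where lg: "l2_tree g" and g: "\<And>m k. m \<ge> M \<Longrightarrow> m \<ge> 1 \<and> g m k \<le> 1/10 \<and> pi / 2 ^ m \<le> g m k \<and>
     H.triple_slope m k * (pi / 2 ^ m) \<le> g m k \<and>
     (\<forall>s. \<bar>s\<bar> \<le> pi / 2 ^ m \<longrightarrow>
        \<bar>H (dyad m k + s) - H (dyad m k) - H.triple_slope m k * s\<bar> \<le> g m k * (H.triple_slope m k * (pi / 2 ^ m))) \<and>
     (\<forall>s. pi / 2 ^ m \<le> s \<longrightarrow> s \<le> pi / 2 \<longrightarrow>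
        \<bar>cot s / H.triple_slope m k - cot (H (dyad m k + s) - H (dyad m k))\<bar> \<le> g m k / (H.triple_slope m k * (pi / 2 ^ m)) \<and>
        \<bar>cot s / H.triple_slope m k - cot (H (dyad m k) - H (dyad m k - s))\<bar> \<le> g m k / (H.triple_slope m k * (pi / 2 ^ m)))"
    using H.cotangent_estimate[OF star[folded H_def]] by blast
  have key: "6 * g m (int k) \<in> admissible \<phi> (dyadic_interval x0 m k)" if m: "m \<ge> M" for m k
  proof -
    define I where "I = dyadic_interval x0 m k"
    define l \<mu> G x where "l = pi / 2 ^ m" and "\<mu> = H.triple_slope m (int k)" and "G = g m (int k)"
      and "x = x0 + dyad m (int k)"
    note gg = g[OF m, of "int k", folded l_def \<mu>_def G_def]
    have l0: "l > 0" by (simp add: l_def)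
    have \<mu>0: "\<mu> > 0" by (simp add: \<mu>_def H.triple_slope_pos)
    have G0: "G > 0" "G \<le> 1/10" using gg l0 by linarith+
    have L: "image_length \<phi> (triple_interval I) = 3 * (\<mu> * l)" and len: "interval_length (triple_interval I) = 3 * l"
      using image_length_triple[OF H.circle_lift_axioms[unfolded H_def]] triple_of_dyadic(2)
      by (simp_all add: I_def \<mu>_def l_def H_def)
    have lle: "l \<le> pi / 2"
    proof -
      have "(2::real) ^ 1 \<le> 2 ^ m" using gg by (intro power_increasing) auto
      then show ?thesis by (simp add: l_def field_simps)
    qed
    have Hx: "H (dyad m (int k) + s) = lift \<phi> (x + s)" "H (dyad m (int k) - s) = lift \<phi> (x - s)"
       "H (dyad m (int k)) = lift \<phi> x" for s by (simp_all add: H_def x_def algebra_simps)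
    \<comment> \<open>now \<open>2 * \<kappa> * \<mu>\<^sup>2 = 2 * G * \<mu> / l\<close>, exactly the second derivative that the bound with \<open>6 * G\<close> allows\<close>
    define \<kappa> where "\<kappa> = G / (\<mu> * l)"
    have kml: "\<kappa> * \<mu> * l = G" using \<mu>0 l0 by (simp add: \<kappa>_def)
    have tau: "l\<^sup>2 + 2 * \<kappa> * \<mu> * l + (\<kappa> * \<mu> * l)\<^sup>2 + (\<mu> * l)\<^sup>2 \<le> 3 * G"
    proof -
      have "l * l \<le> 1/10 * G" "G * G \<le> 1/10 * G" "(\<mu> * l) * (\<mu> * l) \<le> 1/10 * G"
        using gg l0 \<mu>0 G0 by (intro mult_mono; simp)+
      moreover have "2 * \<kappa> * \<mu> * l = 2 * G" using kml by simp
      ultimately show ?thesis using G0 unfolding kml power2_eq_square by linarith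
    qed
    note bars = h.mobius_barriers[of l \<mu> \<kappa> x "G * (\<mu> * l)" "3 * G", OF l0 lle \<mu>0 _ _ _ _ tau]
    have k0: "\<kappa> \<ge> 0" using G0 \<mu>0 l0 by (simp add: \<kappa>_def)
    have near: "\<bar>lift \<phi> (x + s) - lift \<phi> x - \<mu> * s\<bar> \<le> G * (\<mu> * l)" if "\<bar>s\<bar> \<le> l" for s
      using gg that by (simp add: Hx)
    have far: "\<bar>cot s / \<mu> - cot (lift \<phi> (x + s) - lift \<phi> x)\<bar> \<le> \<kappa>"
      "\<bar>cot s / \<mu> - cot (lift \<phi> x - lift \<phi> (x - s))\<bar> \<le> \<kappa>" if "l \<le> s" "s \<le> pi / 2" for s
      using gg that by (simp_all add: Hx \<kappa>_def)
    have half: "3 * G \<le> 1/2" using G0 by simp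
    obtain fp Fp where p: "fp \<in> PSL2R" "is_lift fp Fp" "\<And>y. lift \<phi> y \<le> Fp y"
      "Fp x = lift \<phi> x + (G * (\<mu> * l) + 2 * \<mu> * (3 * G) * l)" "deriv Fp x = \<mu>" "deriv (deriv Fp) x = 2 * \<kappa> * \<mu>\<^sup>2"
      using bars(1)[OF k0 near far half] by blast
    obtain fm Fm where n: "fm \<in> PSL2R" "is_lift fm Fm" "\<And>y. Fm y \<le> lift \<phi> y"
      "Fm x = lift \<phi> x - (G * (\<mu> * l) + 2 * \<mu> * (3 * G) * l)" "deriv Fm x = \<mu>" "deriv (deriv Fm) x = - (2 * \<kappa> * \<mu>\<^sup>2)"
      using bars(2)[OF k0 near far half] by blast
    have close: "lift_close \<phi> I (6 * G) x F"
      if F: "\<bar>F x - lift \<phi> x\<bar> = G * (\<mu> * l) + 2 * \<mu> * (3 * G) * l" "deriv F x = \<mu>" "\<bar>deriv (deriv F) x\<bar> = 2 * \<kappa> * \<mu>\<^sup>2" for F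
      unfolding lift_close_def Let_def L len F
    proof (intro conjI)
      have "0 \<le> G * (\<mu> * l)" using G0 \<mu>0 l0 by simp
      then show "G * (\<mu> * l) + 2 * \<mu> * (3 * G) * l \<le> 6 * G * (3 * (\<mu> * l))" by (simp add: algebra_simps)
      show "\<bar>\<mu> - 3 * (\<mu> * l) / (3 * l)\<bar> \<le> 6 * G * (3 * (\<mu> * l) / (3 * l))" using l0 G0 \<mu>0 by simp
      show "2 * \<kappa> * \<mu>\<^sup>2 \<le> 6 * G * (3 * (\<mu> * l) / (3 * l)\<^sup>2)"
        using l0 \<mu>0 by (simp add: \<kappa>_def power2_eq_square field_simps)
    qed
    have pos: "0 \<le> G * (\<mu> * l) + 2 * \<mu> * (3 * G) * l" "0 \<le> 2 * \<kappa> * \<mu>\<^sup>2" using G0 \<mu>0 l0 k0 by simp_all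
    have "lift_close \<phi> I (6 * G) x Fp" "lift_close \<phi> I (6 * G) x Fm"
      by (rule close; use p n pos in simp)+
    moreover have "x \<in> I" using dyad_succ_less[of m "int k"] by (simp add: x_def I_def dyadic_interval_eq)
    moreover have "0 < 6 * G" using G0 by simp
    ultimately show ?thesis unfolding admissible_def I_def[symmetric] G_def[symmetric]
      using p(1-3) n(1-3) by blast
  qed
  show ?thesis
  proof (rule l2_tree_dominated[OF l2_tree_cmult[OF lg, of 6]])
    show "tree_periodic (epsilon_tree \<phi> x0)" by (simp add: tree_periodic_def epsilon_tree_def)
    fix m k assume "M \<le> m"
    have pg: "tree_periodic g" using lg by (simp add: l2_tree_def)
    have "epsilon_tree \<phi> x0 m k \<le> 6 * g m (int (nat (k mod 2 ^ m)))"
      unfolding epsilon_tree_def by (rule epsilon_number_le[OF key[OF \<open>M \<le> m\<close>]])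
    also have "g m (int (nat (k mod 2 ^ m))) = g m k" by (simp add: tree_periodic_mod[OF pg])
    finally show "\<bar>epsilon_tree \<phi> x0 m k\<bar> \<le> 6 * g m k"
      using epsilon_number_nonneg by (simp add: epsilon_tree_def abs_of_nonneg)
  qed
qed

lemma abs_ln_le:
  assumes "\<bar>x - 1\<bar> \<le> c" "c \<le> 1/2" shows "\<bar>ln x\<bar> \<le> 2 * (c::real)"
proof -
  have x: "x > 0" "x \<ge> 1/2" using assms by (auto simp: abs_le_iff)
  have "ln x \<le> x - 1" using x by (intro ln_le_minus_one)
  moreover have "- ln x \<le> 2 * c"
  proof -
    have "ln (1 / x) \<le> 1 / x - 1" using x by (intro ln_le_minus_one) simp
    also have "1 / x - 1 = (1 - x) / x" using x by (simp add: field_simps)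
    also have "\<dots> \<le> c / (1/2)" using x assms by (intro frac_le) (auto simp: abs_le_iff)
    finally show ?thesis using x by (simp add: ln_div)
  qed
  ultimately show ?thesis using assms by (simp add: abs_le_iff)
qed

text \<open>Both barriers stay close to one and the same line with slope \<open>\<mu>\<close> on the triple interval, and so does
\<open>h\<close> between them. The four slopes that enter the variation belong to cells inside the triple
interval, hence are \<open>\<mu>\<close> up to the same relative error. This works where \<open>\<tau>\<close> is small, which holds
on all deep levels: cells and their images have small lengths, by uniform continuity of \<open>h\<close>.\<close>

theorem slope_variation_if_epsilon_tree:
  assumes \<phi>: "orientation_preserving_homeo \<phi>" and eps: "l2_tree (epsilon_tree \<phi> x0)"
  shows "l2_tree (slope_variation (\<lambda>t. lift \<phi> (x0 + t)))"
proof -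
  define H where "H = (\<lambda>t. lift \<phi> (x0 + t))"
  have h: "circle_lift (lift \<phi>)" using is_lift_lift[OF \<phi>] by (rule circle_lift_if_is_lift)
  then interpret h: circle_lift "lift \<phi>" .
  interpret H: circle_lift H unfolding H_def by (rule circle_lift_translate[OF h])
  \<comment> \<open>an upper bound for \<open>2 * (\<epsilon> + (3 * l)\<^sup>2 + (3 * \<mu> * l)\<^sup>2)\<close>, the error of \<open>lift_close_spreads\<close> at the scale of
    the triple interval, whenever \<open>l\<close> and \<open>\<mu> * l\<close> are small and \<open>\<epsilon>\<close> exceeds the epsilon number by less than \<open>l\<close>\<close>
  define \<tau> where "\<tau> m k = 2 * (epsilon_tree \<phi> x0 m k + 10 * (pi / 2 ^ m) + 9 * (H.triple_slope m k * (pi / 2 ^ m)))" for m k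
  \<comment> \<open>three differences of two logarithms, each within \<open>88 * \<tau>\<close> of \<open>ln \<mu>\<close>, give the constant 528\<close>
  have main: "slope_variation H m k \<le> 528 * \<tau> m k"
    if small: "\<tau> m k \<le> 1/100" for m k
  proof -
    define k' where "k' = nat (k mod 2 ^ m)"
    define I where "I = dyadic_interval x0 m k'"
    define l \<mu> e where "l = pi / 2 ^ m" and "\<mu> = H.triple_slope m (int k')" and "e = epsilon_number \<phi> I"
    have l0: "l > 0" by (simp add: l_def)
    have \<mu>0: "\<mu> > 0" by (simp add: \<mu>_def H.triple_slope_pos)
    have e0: "e \<ge> 0" unfolding e_def by (rule epsilon_number_nonneg)
    have "tree_periodic H.triple_slope"
    proof -
      have "k + 2 ^ m - 1 = (k - 1) + 2 ^ m" "k + 2 ^ m + 1 = (k + 1) + 2 ^ m" for k :: int and m by simp_all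
      then show ?thesis unfolding tree_periodic_def H.triple_slope_def by (simp only: H.slope_periodic) simp
    qed
    then have "H.triple_slope m k = \<mu>" using tree_periodic_mod[of H.triple_slope m k] by (simp add: \<mu>_def k'_def)
    then have td: "\<tau> m k = 2 * e + 20 * l + 18 * (\<mu> * l)"
      by (simp add: \<tau>_def e_def I_def k'_def epsilon_tree_def l_def algebra_simps)
    define T where "T = \<tau> m k"
    have T: "T = 2 * e + 20 * l + 18 * (\<mu> * l)" "T \<le> 1/100" using td small by (simp_all add: T_def)
    have ml: "0 < \<mu> * l" using \<mu>0 l0 by simp
    have es: "e < 1" "l \<le> 1/100" "\<mu> * l \<le> 1/100" "T > 0" using T l0 ml e0 by linarith+
    obtain \<epsilon> where \<epsilon>: "\<epsilon> \<in> admissible \<phi> I" "\<epsilon> < e + l"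
      using epsilon_number_approx[of \<phi> I "e + l"] es l0 by (auto simp: e_def)
    have L: "image_length \<phi> (triple_interval I) = 3 * (\<mu> * l)" and len: "interval_length (triple_interval I) = 3 * l"
      using image_length_triple[OF H.circle_lift_axioms[unfolded H_def]] triple_of_dyadic(2)
      by (simp_all add: I_def \<mu>_def l_def H_def)
    obtain x fm fp Fm Fp where x: "x \<in> I" and f: "fm \<in> PSL2R" "fp \<in> PSL2R" "is_lift fm Fm" "is_lift fp Fp"
      and sandwich: "\<And>y. Fm y \<le> lift \<phi> y" "\<And>y. lift \<phi> y \<le> Fp y"
      and close: "lift_close \<phi> I \<epsilon> x Fm" "lift_close \<phi> I \<epsilon> x Fp" and e_pos: "\<epsilon> > 0"
      using \<epsilon>(1) unfolding admissible_def by blast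
    define \<sigma> where "\<sigma> = 2 * (\<epsilon> + (3 * l)\<^sup>2 + (\<mu> * (3 * l))\<^sup>2)"
    have \<sigma>: "\<sigma> \<le> T" "2 * \<epsilon> \<le> \<sigma>"
    proof -
      have "l * l \<le> 1/100 * l" "(\<mu> * l) * (\<mu> * l) \<le> 1/100 * (\<mu> * l)"
        using es l0 ml by (intro mult_right_mono; simp)+
      then have "(3 * l)\<^sup>2 \<le> 1/10 * l" "(\<mu> * (3 * l))\<^sup>2 \<le> 1/10 * (\<mu> * l)"
        using l0 ml by (simp_all add: power2_eq_square algebra_simps)
      then show "\<sigma> \<le> T" using \<epsilon>(2) T(1) l0 ml unfolding \<sigma>_def distrib_left by linarith
      show "2 * \<epsilon> \<le> \<sigma>" by (simp add: \<sigma>_def)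
    qed
    have spread: "\<bar>F (x + s) - lift \<phi> x - \<mu> * s\<bar> \<le> 11 * T * (\<mu> * l)"
      if F: "f \<in> PSL2R" "is_lift f F" "lift_close \<phi> I \<epsilon> x F" and s: "\<bar>s\<bar> \<le> 3 * l" for f F s
    proof -
      have c: "\<bar>F x - lift \<phi> x\<bar> \<le> \<epsilon> * (3 * (\<mu> * l))" "\<bar>deriv F x - \<mu>\<bar> \<le> \<epsilon> * \<mu>"
        "\<bar>deriv (deriv F) x\<bar> \<le> \<epsilon> * (\<mu> / (3 * l))"
        using F(3) l0 unfolding lift_close_def Let_def L len by (simp_all add: power2_eq_square)
      have "\<bar>F (x + s) - F x - \<mu> * s\<bar> \<le> 3 * \<sigma> * \<mu> * \<bar>s\<bar>"
        by (rule lift_close_spreads[OF F(1,2) \<mu>0 _ _ _ c(2,3) \<sigma>_def _ s])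
           (use l0 e_pos \<sigma> T in auto)
      also have "\<dots> \<le> 3 * T * \<mu> * (3 * l)"
        using \<sigma> s \<mu>0 es e_pos by (intro mult_mono) auto
      finally have "\<bar>F (x + s) - F x - \<mu> * s\<bar> \<le> 9 * (T * (\<mu> * l))" by simp
      moreover have "\<epsilon> * (3 * (\<mu> * l)) \<le> T / 2 * (3 * (\<mu> * l))" using \<sigma> ml by (intro mult_right_mono) auto
      moreover have "0 \<le> T * (\<mu> * l)" using ml es by simp
      moreover have "T / 2 * (3 * (\<mu> * l)) = 3/2 * (T * (\<mu> * l))" "11 * T * (\<mu> * l) = 11 * (T * (\<mu> * l))" by simp_all
      ultimately show ?thesis using c(1) by linarith
    qed
    have lin: "\<bar>lift \<phi> (x + s) - lift \<phi> x - \<mu> * s\<bar> \<le> 11 * T * (\<mu> * l)" if s: "\<bar>s\<bar> \<le> 3 * l" for s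
      using spread[OF f(1,3) close(1) s] spread[OF f(2,4) close(2) s] sandwich[of "x + s"] unfolding abs_le_iff by linarith
    have x': "x0 + dyad m (int k') \<le> x" "x \<le> x0 + dyad m (int k' + 1)" using x by (auto simp: I_def dyadic_interval_eq)
    have two: "\<bar>H q - H p - \<mu> * (q - p)\<bar> \<le> 22 * T * (\<mu> * l)"
      if pq: "dyad m (int k' - 1) \<le> p" "p \<le> dyad m (int k' + 2)" "dyad m (int k' - 1) \<le> q" "q \<le> dyad m (int k' + 2)" for p q
    proof -
      have d: "dyad m (int k' + 1) = dyad m (int k') + l" "dyad m (int k' - 1) = dyad m (int k') - l"
        "dyad m (int k' + 2) = dyad m (int k') + 2 * l"
        by (simp_all add: dyad_def l_def field_simps)
      define s t where "s = x0 + q - x" and "t = x0 + p - x"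
      have "\<bar>s\<bar> \<le> 3 * l" "\<bar>t\<bar> \<le> 3 * l" using pq x' l0 unfolding s_def t_def d abs_le_iff by linarith+
      from lin[OF this(1)] lin[OF this(2)]
      have "\<bar>H q - lift \<phi> x - \<mu> * s\<bar> \<le> 11 * T * (\<mu> * l)" "\<bar>H p - lift \<phi> x - \<mu> * t\<bar> \<le> 11 * T * (\<mu> * l)"
        by (simp_all add: H_def s_def t_def)
      moreover have "H q - H p - \<mu> * (q - p) = (H q - lift \<phi> x - \<mu> * s) - (H p - lift \<phi> x - \<mu> * t)"
        by (simp add: s_def t_def algebra_simps)
      ultimately show ?thesis by linarith
    qed
    have sl: "\<bar>slope H n j / \<mu> - 1\<bar> \<le> 44 * T"
      if n: "pi / 2 ^ n = l \<or> pi / 2 ^ n = l / 2" and j: "dyad m (int k' - 1) \<le> dyad n j" "dyad n (j + 1) \<le> dyad m (int k' + 2)" for n j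
    proof -
      define d where "d = pi / 2 ^ n"
      have d: "d > 0" "l \<le> 2 * d" using n[folded d_def] l0 by auto
      have "dyad n j \<le> dyad n (j + 1)" using dyad_succ_less[of n j] by simp
      then have "\<bar>H (dyad n (j + 1)) - H (dyad n j) - \<mu> * (dyad n (j + 1) - dyad n j)\<bar> \<le> 22 * T * (\<mu> * l)"
        using j by (intro two) auto
      also have "dyad n (j + 1) - dyad n j = d" by (simp add: dyad_add d_def)
      also have "H (dyad n (j + 1)) - H (dyad n j) = slope H n j * d" unfolding d_def by (rule H.increment)
      finally have "\<bar>slope H n j * d - \<mu> * d\<bar> \<le> 22 * T * (\<mu> * l)" .
      also have "\<dots> \<le> 22 * T * (\<mu> * (2 * d))" using d \<mu>0 es by (intro mult_left_mono) auto
      finally have "\<bar>slope H n j * d - \<mu> * d\<bar> \<le> (44 * T) * (\<mu> * d)" by simp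
      moreover have "slope H n j * d - \<mu> * d = (slope H n j / \<mu> - 1) * (\<mu> * d)" using \<mu>0 by (simp add: field_simps)
      ultimately have "\<bar>slope H n j / \<mu> - 1\<bar> * (\<mu> * d) \<le> (44 * T) * (\<mu> * d)" using \<mu>0 d by (simp add: abs_mult)
      then show ?thesis using \<mu>0 d by (simp add: mult_le_cancel_right)
    qed
    have lg: "\<bar>logslope H n j - ln \<mu>\<bar> \<le> 88 * T"
      if n: "pi / 2 ^ n = l \<or> pi / 2 ^ n = l / 2" and j: "dyad m (int k' - 1) \<le> dyad n j" "dyad n (j + 1) \<le> dyad m (int k' + 2)" for n j
    proof -
      have "\<bar>ln (slope H n j / \<mu>)\<bar> \<le> 2 * (44 * T)" by (rule abs_ln_le[OF sl[OF n j]]) (use T in simp)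
      then show ?thesis using H.slope_pos[of n j] \<mu>0 by (simp add: ln_div logslope_def)
    qed
    have m1: "pi / 2 ^ Suc m = l / 2" by (simp add: l_def)
    have lgs: "\<bar>logslope H m (int k') - ln \<mu>\<bar> \<le> 88 * T" "\<bar>logslope H m (int k' + 1) - ln \<mu>\<bar> \<le> 88 * T"
      "\<bar>logslope H (Suc m) (2 * int k') - ln \<mu>\<bar> \<le> 88 * T" "\<bar>logslope H (Suc m) (2 * int k' + 1) - ln \<mu>\<bar> \<le> 88 * T"
    proof -
      have c: "dyad (Suc m) (2 * int k' + 1) = dyad m (int k') + l / 2" "dyad m (int k' + 1) = dyad m (int k') + l"
        "dyad m (int k' - 1) = dyad m (int k') - l" "dyad m (int k' + 2) = dyad m (int k') + 2 * l"
        by (simp_all add: dyad_def l_def field_simps)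
      have c2: "2 * int k' + 1 + 1 = 2 * int k' + 2" by simp
      show "\<bar>logslope H m (int k') - ln \<mu>\<bar> \<le> 88 * T" by (rule lg) (auto simp: l_def intro!: dyad_mono)
      show "\<bar>logslope H m (int k' + 1) - ln \<mu>\<bar> \<le> 88 * T" by (rule lg) (auto simp: l_def intro!: dyad_mono)
      show "\<bar>logslope H (Suc m) (2 * int k') - ln \<mu>\<bar> \<le> 88 * T"
        by (rule lg) (use l0 in \<open>simp_all only: m1 dyad_child c\<close>, simp_all)
      show "\<bar>logslope H (Suc m) (2 * int k' + 1) - ln \<mu>\<bar> \<le> 88 * T"
        by (rule lg) (use l0 in \<open>simp_all only: m1 c2 dyad_child_end c\<close>, simp_all)
    qed
    have "slope_variation H m (int k') \<le> 528 * T"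
      using lgs unfolding slope_variation_def by linarith
    moreover have "slope_variation H m (int k') = slope_variation H m k"
      using tree_periodic_mod[OF H.slope_variation_periodic] by (simp add: k'_def)
    ultimately show ?thesis by (simp add: T_def)
  qed
  obtain r where r: "r > 0" "\<And>x. H (x + r) - H x \<le> 1/1000000"
    using H.uniform_increment_small[of "1/1000000"] by auto
  obtain M1 where M1: "\<And>m k. m \<ge> M1 \<Longrightarrow> \<bar>epsilon_tree \<phi> x0 m k\<bar> \<le> 1/1000000"
    using l2_tree_small[OF eps, of "1/1000000"] by auto
  obtain M2 where M2: "\<And>m k. m \<ge> M2 \<Longrightarrow> \<bar>pi / 2 ^ m\<bar> \<le> min (1/1000000) (r / 3)"
    using l2_tree_small[OF l2_tree_cell, of "min (1/1000000) (r / 3)"] r by auto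
  \<comment> \<open>the bound 1/5280 makes the slope variation at most 1/10\<close>
  have tsmall: "\<tau> m k \<le> 1/5280" if "m \<ge> max M1 M2" for m k
  proof -
    have l: "pi / 2 ^ m \<le> 1/1000000" "pi / 2 ^ m \<le> r / 3" using M2[of m] that by auto
    have "3 * (H.triple_slope m k * (pi / 2 ^ m)) = H (dyad m (k + 2)) - H (dyad m (k - 1))"
      by (rule H.triple_increment[symmetric])
    also have "\<dots> \<le> H (dyad m (k - 1) + r) - H (dyad m (k - 1))"
    proof -
      have "dyad m (k + 2) = dyad m (k - 1) + 3 * (pi / 2 ^ m)" by (simp add: dyad_def field_simps)
      then have "dyad m (k + 2) \<le> dyad m (k - 1) + r" using l(2) by linarith
      then show ?thesis by (simp add: H.le_iff)
    qed
    also have "\<dots> \<le> 1/1000000" by (rule r)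
    finally have "H.triple_slope m k * (pi / 2 ^ m) \<le> 1/3000000" by simp
    moreover have "epsilon_tree \<phi> x0 m k \<le> 1/1000000" using M1[of m k] that by auto
    ultimately show ?thesis using l unfolding \<tau>_def distrib_left by linarith
  qed
  have "l2_tree (\<lambda>m k. 528 * \<tau> m k)"
    unfolding \<tau>_def[abs_def]
  proof (intro l2_tree_cmult l2_tree_add eps l2_tree_cell H.l2_tree_triple_cell H.l2_tree_image_cell[where M="max M1 M2"])
    fix m and k :: int assume m: "m \<ge> max M1 M2"
    have "slope_variation H m (k div 2) \<le> 528 * \<tau> m (k div 2)" using tsmall[OF m, of "k div 2"] by (intro main) simp
    then have "slope_variation H m (k div 2) \<le> 1/10" using tsmall[OF m, of "k div 2"] by linarith
    then show "slope H (Suc m) k \<le> 6/5 * slope H m (k div 2)" by (rule H.slope_child_le)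
  qed
  then have "l2_tree (slope_variation H)"
  proof (rule l2_tree_dominated)
    show "tree_periodic (slope_variation H)" by (rule H.slope_variation_periodic)
    fix m k assume "max M1 M2 \<le> m"
    then show "\<bar>slope_variation H m k\<bar> \<le> 528 * \<tau> m k"
      using tsmall[of m k] main[of m k] slope_variation_nonneg[of H m k] by (simp add: abs_of_nonneg)
  qed
  then show ?thesis by (simp add: H_def)
qed

section \<open>Periodic integrals and densities\<close>

lemma nn_integral_shift:
  fixes f :: "real \<Rightarrow> ennreal"
  assumes [measurable]: "f \<in> borel_measurable borel"
  shows "(\<integral>\<^sup>+x\<in>{a..<b}. f (x + c) \<partial>lborel) = (\<integral>\<^sup>+x\<in>{a + c..<b + c}. f x \<partial>lborel)"
proof -
  have "(\<integral>\<^sup>+x\<in>{a + c..<b + c}. f x \<partial>lborel)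
      = ennreal \<bar>1::real\<bar> * (\<integral>\<^sup>+x. f (c + 1 * x) * indicator {a + c..<b + c} (c + 1 * x) \<partial>lborel)"
    by (rule nn_integral_real_affine) auto
  also have "\<dots> = (\<integral>\<^sup>+x. f (x + c) * indicator {a..<b} x \<partial>lborel)"
    by (auto simp: add.commute indicator_def intro!: nn_integral_cong)
  finally show ?thesis by simp
qed

lemma nn_integral_split:
  fixes f :: "real \<Rightarrow> ennreal"
  assumes [measurable]: "f \<in> borel_measurable borel" and "a \<le> b" "b \<le> c"
  shows "(\<integral>\<^sup>+x\<in>{a..<c}. f x \<partial>lborel) = (\<integral>\<^sup>+x\<in>{a..<b}. f x \<partial>lborel) + (\<integral>\<^sup>+x\<in>{b..<c}. f x \<partial>lborel)"
proof -
  have "(\<integral>\<^sup>+x\<in>{a..<c}. f x \<partial>lborel) = (\<integral>\<^sup>+x. f x * indicator {a..<b} x + f x * indicator {b..<c} x \<partial>lborel)"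
    using assms(2,3) by (intro nn_integral_cong) (auto simp: indicator_def)
  then show ?thesis by (simp add: nn_integral_add)
qed

lemma nn_integral_closed:
  "(\<integral>\<^sup>+x\<in>{a..b}. f x \<partial>lborel) = (\<integral>\<^sup>+x\<in>{a..<b::real}. f x \<partial>lborel)"
proof (rule nn_integral_cong_AE)
  show "AE x in lborel. f x * indicator {a..b} x = f x * indicator {a..<b} x"
    using AE_lborel_singleton[of b] by eventually_elim (auto simp: indicator_def)
qed

lemma periodic_int_shift:
  fixes f :: "real \<Rightarrow> 'a"
  assumes "\<And>x. f (x + pi) = f x"
  shows "f (x + of_int n * pi) = f x"
proof (induction n rule: int_induct[of _ 0])
  case base then show ?case by simp
next
  case (step1 i) then show ?case using assms[of "x + of_int i * pi"] by (simp add: algebra_simps)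
next
  case (step2 i) then show ?case using assms[of "x + of_int (i - 1) * pi"] by (simp add: algebra_simps)
qed

lemma nn_integral_period:
  fixes f :: "real \<Rightarrow> ennreal"
  assumes [measurable]: "f \<in> borel_measurable borel" and p: "\<And>x. f (x + pi) = f x"
  shows "(\<integral>\<^sup>+x\<in>{a..<a + pi}. f x \<partial>lborel) = (\<integral>\<^sup>+x\<in>{0..<pi}. f x \<partial>lborel)"
proof -
  define n where "n = \<lfloor>a / pi\<rfloor>"
  define b where "b = a - of_int n * pi"
  have "of_int n \<le> a / pi" "a / pi < of_int n + 1" unfolding n_def by linarith+
  then have b: "0 \<le> b" "b < pi" by (simp_all add: b_def field_simps)
  have "(\<integral>\<^sup>+x\<in>{a..<a + pi}. f x \<partial>lborel) = (\<integral>\<^sup>+x\<in>{b..<b + pi}. f (x + of_int n * pi) \<partial>lborel)"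
    by (subst nn_integral_shift) (simp_all add: b_def)
  also have "\<dots> = (\<integral>\<^sup>+x\<in>{b..<b + pi}. f x \<partial>lborel)" by (simp only: periodic_int_shift[of f, OF p])
  also have "\<dots> = (\<integral>\<^sup>+x\<in>{b..<pi}. f x \<partial>lborel) + (\<integral>\<^sup>+x\<in>{pi..<b + pi}. f x \<partial>lborel)"
    using b by (intro nn_integral_split) auto
  also have "(\<integral>\<^sup>+x\<in>{pi..<b + pi}. f x \<partial>lborel) = (\<integral>\<^sup>+x\<in>{0..<b}. f (x + pi) \<partial>lborel)"
    by (subst nn_integral_shift) simp_all
  also have "\<dots> = (\<integral>\<^sup>+x\<in>{0..<b}. f x \<partial>lborel)" by (simp only: p)
  also have "(\<integral>\<^sup>+x\<in>{b..<pi}. f x \<partial>lborel) + (\<integral>\<^sup>+x\<in>{0..<b}. f x \<partial>lborel) = (\<integral>\<^sup>+x\<in>{0..<pi}. f x \<partial>lborel)"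
    using b by (subst nn_integral_split[of f 0 b pi]) (auto simp: add.commute)
  finally show ?thesis .
qed

lemma nn_integral_period_translate:
  fixes f :: "real \<Rightarrow> ennreal"
  assumes [measurable]: "f \<in> borel_measurable borel" and p: "\<And>x. f (x + pi) = f x"
  shows "(\<integral>\<^sup>+x\<in>{0..pi}. f (x + c) \<partial>lborel) = (\<integral>\<^sup>+x\<in>{0..pi}. f x \<partial>lborel)"
  unfolding nn_integral_closed nn_integral_shift[OF assms(1)]
  using nn_integral_period[OF assms, of c] by (simp add: add.commute)

lemma nn_integral_periods:
  fixes f :: "real \<Rightarrow> ennreal"
  assumes [measurable]: "f \<in> borel_measurable borel" and p: "\<And>x. f (x + pi) = f x"
  shows "(\<integral>\<^sup>+x\<in>{a..<a + real n * pi}. f x \<partial>lborel) = of_nat n * (\<integral>\<^sup>+x\<in>{0..<pi}. f x \<partial>lborel)"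
proof (induction n)
  case (Suc n)
  have "(\<integral>\<^sup>+x\<in>{a..<a + real (Suc n) * pi}. f x \<partial>lborel)
      = (\<integral>\<^sup>+x\<in>{a..<a + real n * pi}. f x \<partial>lborel) + (\<integral>\<^sup>+x\<in>{a + real n * pi..<a + real (Suc n) * pi}. f x \<partial>lborel)"
    by (rule nn_integral_split) (auto simp: algebra_simps)
  also have "{a + real n * pi..<a + real (Suc n) * pi} = {a + real n * pi..<(a + real n * pi) + pi}"
    by (simp add: algebra_simps)
  finally show ?case unfolding Suc nn_integral_period[OF assms] by (simp add: distrib_right add.commute)
qed simp

lemma nn_integral_periodic_finite:
  fixes f :: "real \<Rightarrow> ennreal"
  assumes [measurable]: "f \<in> borel_measurable borel" and p: "\<And>x. f (x + pi) = f x"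
    and fin: "(\<integral>\<^sup>+x\<in>{0..pi}. f x \<partial>lborel) < \<infinity>"
  shows "(\<integral>\<^sup>+x\<in>{a..b}. f x \<partial>lborel) < \<infinity>"
proof -
  obtain n :: nat where n: "b - a < real n * pi" using ex_less_of_nat_mult[OF pi_gt_zero] by blast
  have "(\<integral>\<^sup>+x\<in>{a..b}. f x \<partial>lborel) \<le> (\<integral>\<^sup>+x\<in>{a..<a + real n * pi}. f x \<partial>lborel)"
    using n by (intro nn_integral_mono) (auto simp: indicator_def)
  also have "\<dots> < \<infinity>" unfolding nn_integral_periods[OF assms(1,2)]
    using fin unfolding nn_integral_closed by (simp add: ennreal_mult_less_top of_nat_less_top)
  finally show ?thesis .
qed

lemma set_integrable_periodic:
  fixes f :: "real \<Rightarrow> real"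
  assumes [measurable]: "f \<in> borel_measurable borel" and p: "\<And>x. f (x + pi) = f x"
    and fin: "set_integrable lborel {0..pi} f"
  shows "set_integrable lborel {a..b} f"
proof -
  have e: "(\<integral>\<^sup>+x. ennreal (norm (indicator {a..b} x *\<^sub>R f x)) \<partial>lborel) = (\<integral>\<^sup>+x\<in>{a..b}. ennreal \<bar>f x\<bar> \<partial>lborel)" for a b
    by (intro nn_integral_cong) (auto simp: indicator_def)
  have "(\<integral>\<^sup>+x\<in>{0..pi}. ennreal \<bar>f x\<bar> \<partial>lborel) < \<infinity>"
    using fin unfolding set_integrable_def integrable_iff_bounded e by simp
  then have "(\<integral>\<^sup>+x\<in>{a..b}. ennreal \<bar>f x\<bar> \<partial>lborel) < \<infinity>"
    by (rule nn_integral_periodic_finite[rotated 2]) (use p in auto)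
  then show ?thesis unfolding set_integrable_def integrable_iff_bounded e by simp
qed

text \<open>Absolute continuity of \<open>h\<close> with density \<open>g\<close>, expressed by increments.\<close>

definition integrates_to :: "(real \<Rightarrow> real) \<Rightarrow> (real \<Rightarrow> real) \<Rightarrow> bool" where
  "integrates_to g h \<longleftrightarrow> g \<in> borel_measurable borel \<and> (\<forall>x. g (x + pi) = g x) \<and> (AE x in lborel. 0 \<le> g x) \<and>
     (\<forall>p q. p \<le> q \<longrightarrow> (\<integral>\<^sup>+x\<in>{p..q}. ennreal (g x) \<partial>lborel) = ennreal (h q - h p))"

lemma integrates_to_integrable:
  assumes "integrates_to g h"
  shows "set_integrable lborel {a..b} g"
proof -
  have [measurable]: "g \<in> borel_measurable borel" using assms by (simp add: integrates_to_def)
  have "(\<integral>\<^sup>+x. ennreal (norm (indicator {a..b} x *\<^sub>R g x)) \<partial>lborel) = (\<integral>\<^sup>+x\<in>{a..b}. ennreal (g x) \<partial>lborel)"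
  proof (rule nn_integral_cong_AE)
    have "AE x in lborel. 0 \<le> g x" using assms by (simp add: integrates_to_def)
    then show "AE x in lborel. ennreal (norm (indicator {a..b} x *\<^sub>R g x)) = ennreal (g x) * indicator {a..b} x"
      by eventually_elim (auto simp: indicator_def)
  qed
  also have "\<dots> < \<infinity>"
    using assms by (cases "a \<le> b") (auto simp: integrates_to_def)
  finally show ?thesis unfolding set_integrable_def integrable_iff_bounded by simp
qed

lemma integrates_to_integral:
  assumes "integrates_to g h" "p \<le> q" "h p \<le> h q"
  shows "(LINT x:{p..q}|lborel. g x) = h q - h p"
proof -
  have [measurable]: "g \<in> borel_measurable borel" using assms by (simp add: integrates_to_def)
  have nn: "AE x in lborel. 0 \<le> g x" using assms by (simp add: integrates_to_def)
  have "(\<integral>\<^sup>+x. ennreal (indicator {p..q} x *\<^sub>R g x) \<partial>lborel) = ennreal (h q - h p)"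
  proof -
    have "(\<integral>\<^sup>+x. ennreal (indicator {p..q} x *\<^sub>R g x) \<partial>lborel) = (\<integral>\<^sup>+x\<in>{p..q}. ennreal (g x) \<partial>lborel)"
      by (intro nn_integral_cong) (auto simp: indicator_def)
    then show ?thesis using assms by (simp add: integrates_to_def)
  qed
  moreover have "AE x in lborel. 0 \<le> indicator {p..q} x *\<^sub>R g x" using nn by eventually_elim auto
  ultimately show ?thesis unfolding set_lebesgue_integral_def
    using assms(3) by (intro integral_eq_nn_integral[THEN trans]) (auto)
qed

section \<open>Densities and distributional derivatives\<close>

text \<open>For \<open>p = 1\<close> this is the smooth function that is flat at 0; polynomial factors make the family
closed under differentiation.\<close>

definition flat :: "real poly \<Rightarrow> real \<Rightarrow> real" where
  "flat p x = (if x \<le> 0 then 0 else poly p (1 / x) * exp (- (1 / x)))"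

lemma poly_exp_vanishes: "((\<lambda>t. poly p t * exp (- t)) \<longlongrightarrow> (0::real)) at_top"
proof -
  have "((\<lambda>t. \<Sum>i\<le>degree p. coeff p i * (t ^ i / exp t)) \<longlongrightarrow> (\<Sum>i\<le>degree p. coeff p i * 0)) at_top"
    by (intro tendsto_sum tendsto_mult tendsto_const tendsto_power_div_exp_0)
  moreover have "(\<lambda>t. \<Sum>i\<le>degree p. coeff p i * (t ^ i / exp t)) = (\<lambda>t. poly p t * exp (- t))"
    by (simp add: poly_altdef exp_minus sum_distrib_right field_simps sum_divide_distrib)
  ultimately show ?thesis by simp
qed

lemma flat_derivative: "(flat p has_real_derivative flat ([:0, 0, 1:] * (p - pderiv p)) x) (at x)"
proof -
  consider "x < 0" | "x = 0" | "x > 0" by linarith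
  then show ?thesis
  proof cases
    case 1
    have ev: "eventually (\<lambda>y. flat p y = 0) (nhds x)"
      using eventually_nhds_in_open[of "{..<0}" x] 1 by (auto elim!: eventually_mono simp: flat_def)
    have "(flat p has_real_derivative 0) (at x)" by (subst DERIV_cong_ev[OF refl ev refl]) simp
    then show ?thesis using 1 by (simp add: flat_def)
  next
    case 2
    have r: "((\<lambda>y. flat p y / y) \<longlongrightarrow> 0) (at_right 0)"
    proof -
      have "((\<lambda>y. poly (pCons 0 p) (inverse y) * exp (- inverse y)) \<longlongrightarrow> 0) (at_right 0)"
        by (rule filterlim_compose[OF poly_exp_vanishes filterlim_inverse_at_top_right])
      moreover have "eventually (\<lambda>y. poly (pCons 0 p) (inverse y) * exp (- inverse y) = flat p y / y) (at_right 0)"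
        using eventually_at_right_less[of 0] by eventually_elim (simp add: flat_def field_simps)
      ultimately show ?thesis by (rule Lim_transform_eventually)
    qed
    have l: "((\<lambda>y. flat p y / y) \<longlongrightarrow> 0) (at_left 0)"
      by (rule Lim_transform_eventually[of "\<lambda>_. 0"])
         (use eventually_at_left_real[of "-1" 0] in \<open>auto elim!: eventually_mono simp: flat_def\<close>)
    have "((\<lambda>y. (flat p y - flat p 0) / (y - 0)) \<longlongrightarrow> 0) (at 0)"
      using filterlim_split_at[OF l r] by (simp add: flat_def)
    then show ?thesis unfolding has_field_derivative_iff 2 by (simp add: flat_def)
  next
    case 3
    have "((\<lambda>x. poly p (1 / x) * exp (- (1 / x))) has_real_derivative flat ([:0, 0, 1:] * (p - pderiv p)) x) (at x)"
      using 3 by (auto intro!: derivative_eq_intros simp: flat_def power2_eq_square field_simps)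
    moreover have ev: "eventually (\<lambda>y. flat p y = poly p (1 / y) * exp (- (1 / y))) (nhds x)"
      using eventually_nhds_in_open[of "{0<..}" x] 3 by (auto elim!: eventually_mono simp: flat_def)
    ultimately show ?thesis by (subst DERIV_cong_ev[OF refl ev refl])
  qed
qed

text \<open>A class of functions closed under differentiation that contains compactly supported bumps: all its
members are smooth, without a formula for their higher derivatives.\<close>

inductive_set flat_products :: "(real \<Rightarrow> real) set" where
  product: "(\<lambda>x. flat p (a * x + b) * flat q (c * x + d)) \<in> flat_products"
| add: "f \<in> flat_products \<Longrightarrow> g \<in> flat_products \<Longrightarrow> (\<lambda>x. f x + g x) \<in> flat_products"

lemma flat_smult: "flat (smult r p) x = r * flat p x" by (simp add: flat_def)

lemma flat_products_derivative:
  assumes "f \<in> flat_products"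
  shows "\<exists>f'\<in>flat_products. \<forall>x. (f has_real_derivative f' x) (at x)"
  using assms
proof induction
  case (product p a b q c d)
  define D where "D p = [:0, 0, 1:] * (p - pderiv p)" for p :: "real poly"
  define f' where "f' x = flat (smult a (D p)) (a * x + b) * flat q (c * x + d)
      + flat p (a * x + b) * flat (smult c (D q)) (c * x + d)" for x
  have ch: "((\<lambda>x. flat p (a * x + b)) has_real_derivative flat (D p) (a * x + b) * a) (at x)" for p a b x
    by (rule DERIV_chain2[OF flat_derivative[folded D_def]]) (auto intro!: derivative_eq_intros)
  have "f' \<in> flat_products" unfolding f'_def[abs_def] by (intro flat_products.intros)
  moreover have "((\<lambda>x. flat p (a * x + b) * flat q (c * x + d)) has_real_derivative f' x) (at x)" for x
    using DERIV_mult[OF ch[of p a b x] ch[of q c d x]] by (simp add: f'_def flat_smult algebra_simps)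
  ultimately show ?case by blast
next
  case (add f g)
  then obtain f' g' where "f' \<in> flat_products" "g' \<in> flat_products"
    "\<forall>x. (f has_real_derivative f' x) (at x)" "\<forall>x. (g has_real_derivative g' x) (at x)" by blast
  then show ?case by (intro bexI[of _ "\<lambda>x. f' x + g' x"]) (auto intro: DERIV_add flat_products.add)
qed

lemma flat_products_smooth:
  assumes "f \<in> flat_products"
  shows "(deriv ^^ n) f \<in> flat_products"
  using assms
proof (induction n arbitrary: f)
  case (Suc n)
  obtain f' where f': "f' \<in> flat_products" "\<forall>x. (f has_real_derivative f' x) (at x)"
    using flat_products_derivative[OF Suc.prems] by blast
  then have "deriv f = f'" by (auto intro: DERIV_imp_deriv)
  then show ?case using Suc.IH[OF f'(1)] by (simp add: funpow_swap1)
qed simp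

lemma flat_products_differentiable: "f \<in> flat_products \<Longrightarrow> f differentiable_on UNIV"
  unfolding differentiable_on_def
  using flat_products_derivative[of f] by (metis differentiable_at_withinI real_differentiable_def)

text \<open>The step is the normalized integral of the bump \<open>exp (- 1/x) * exp (- 1/(1 - x))\<close>.\<close>

lemma smooth_step:
  "\<exists>S \<beta>. (\<forall>x. (S has_real_derivative \<beta> x) (at x)) \<and> (\<forall>a b. (\<lambda>x. a * \<beta> (a * x + b)) \<in> flat_products)
     \<and> (\<forall>a b. (\<lambda>x. - (a * \<beta> (a * x + b))) \<in> flat_products)
     \<and> (\<forall>x. 0 \<le> \<beta> x) \<and> (\<forall>x. x \<le> 0 \<longrightarrow> S x = 0 \<and> \<beta> x = 0) \<and> (\<forall>x\<ge>1. S x = 1 \<and> \<beta> x = 0)"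
proof -
  define b where "b x = flat 1 x * flat 1 (1 - x)" for x
  have b0: "b x \<ge> 0" for x by (simp add: b_def flat_def)
  have bz: "b x = 0" if "x \<le> 0 \<or> x \<ge> 1" for x using that by (auto simp: b_def flat_def)
  have bp: "b x > 0" if "0 < x" "x < 1" for x using that by (simp add: b_def flat_def)
  have "(\<lambda>x. flat 1 (1 * x + 0) * flat 1 ((-1) * x + 1)) \<in> flat_products" by (rule flat_products.product)
  then obtain b' where "\<forall>x. ((\<lambda>x. flat 1 (1 * x + 0) * flat 1 ((-1) * x + 1)) has_real_derivative b' x) (at x)"
    using flat_products_derivative by blast
  moreover have "(\<lambda>x. flat 1 (1 * x + 0) * flat 1 ((-1) * x + 1)) = b" by (simp add: b_def[abs_def])
  ultimately have cb: "isCont b x" for x by (metis DERIV_isCont)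
  obtain B where B: "\<And>x. (B has_real_derivative b x) (at x)"
    using einterval_antiderivative[of "-\<infinity>" \<infinity> b] cb
    by (auto simp: has_real_derivative_iff_has_vector_derivative)
  have pos: "B 0 < B 1"
  proof (rule DERIV_pos_imp_increasing_open[where f=B])
    show "\<exists>y. (B has_real_derivative y) (at x) \<and> 0 < y" if "0 < x" "x < 1" for x
      using B bp that by blast
    show "continuous_on {0..1} B" using B by (meson DERIV_isCont continuous_at_imp_continuous_on)
  qed simp
  define c where "c = 1 / (B 1 - B 0)"
  have c: "c > 0" using pos by (simp add: c_def)
  define S where "S x = c * (B x - B 0)" for x
  define \<beta> where "\<beta> x = c * b x" for x
  have SD: "(S has_real_derivative \<beta> x) (at x)" for x
    unfolding S_def[abs_def] \<beta>_def by (auto intro!: derivative_eq_intros B)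
  have fp: "(\<lambda>x. r * \<beta> (a * x + d)) \<in> flat_products" for r a d
  proof -
    have "(\<lambda>x. flat (smult (r * c) 1) (a * x + d) * flat 1 ((- a) * x + (1 - d))) \<in> flat_products"
      by (rule flat_products.product)
    moreover have "(\<lambda>x. flat (smult (r * c) 1) (a * x + d) * flat 1 ((- a) * x + (1 - d))) = (\<lambda>x. r * \<beta> (a * x + d))"
    proof
      fix x
      have "(- a) * x + (1 - d) = 1 - (a * x + d)" by (simp add: algebra_simps)
      then show "flat (smult (r * c) 1) (a * x + d) * flat 1 ((- a) * x + (1 - d)) = r * \<beta> (a * x + d)"
        by (simp only: flat_smult \<beta>_def b_def mult.assoc)
    qed
    ultimately show ?thesis by simp
  qed
  have fpm: "(\<lambda>x. - (a * \<beta> (a * x + d))) \<in> flat_products" for a d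
    using fp[of "-a" a d] by simp
  have contB: "continuous_on A B" for A
    using B by (meson DERIV_isCont continuous_at_imp_continuous_on)
  have B0: "(B has_real_derivative 0) (at x)" if "x \<le> 0 \<or> x \<ge> 1" for x
    using B[of x] bz[OF that] by simp
  have Bl: "B x = B 0" if "x \<le> 0" for x
  proof (cases "x = 0")
    case False
    then show ?thesis using that
      by (intro DERIV_isconst_end[of x 0 B, symmetric] contB B0) auto
  qed simp
  have Br: "B x = B 1" if "x \<ge> 1" for x
  proof (cases "x = 1")
    case False
    then show ?thesis using that
      by (intro DERIV_isconst_end[of 1 x B] contB B0) auto
  qed simp
  have left: "S x = 0 \<and> \<beta> x = 0" if "x \<le> 0" for x
    using Bl[OF that] bz[of x] that by (simp add: S_def \<beta>_def)
  have right: "S x = 1 \<and> \<beta> x = 0" if "x \<ge> 1" for x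
    using Br[OF that] bz[of x] that pos by (simp add: S_def \<beta>_def c_def)
  have nonneg: "0 \<le> \<beta> x" for x using b0 c by (simp add: \<beta>_def)
  show ?thesis using SD fp fpm left right nonneg by (intro exI[of _ S] exI[of _ \<beta>] conjI allI impI; blast)
qed

context circle_lift
begin

lemma continuous: "isCont h x"
  using cont by (simp add: continuous_on_eq_continuous_at)

lemma measurable_h: "h \<in> borel_measurable borel"
  using cont by (rule borel_measurable_continuous_onI)

text \<open>The test functions rise from 0 to 1 on \<open>[p, p + 1/n]\<close> and fall back to 0 on \<open>[q, q + 1/n]\<close>. Integrating
\<open>h\<close> against their derivatives gives the difference of two averages of \<open>h\<close> over these short intervals,
which tends to \<open>h p - h q\<close>; integrating \<open>g\<close> against them tends to the integral of \<open>g\<close> over \<open>{p<..q}\<close>.\<close>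

lemma integrates_to_if_L1_derivative:
  assumes d: "L1_distributional_derivative h g" and nn: "AE x in lborel. 0 \<le> g x"
  shows "integrates_to g h"
proof -
  have [measurable]: "g \<in> borel_measurable borel" and gp: "\<And>x. g (x + pi) = g x"
    and gi: "set_integrable lborel {0..pi} g"
    and weak: "\<And>\<psi>. test_function \<psi> \<Longrightarrow> (LINT x|lborel. h x * deriv \<psi> x) = - (LINT x|lborel. g x * \<psi> x)"
    using d by (auto simp: L1_distributional_derivative_def)
  have gint: "set_integrable lborel {a..b} g" for a b
    by (rule set_integrable_periodic[OF _ gp gi]) simp
  obtain S \<beta> where S: "\<And>x. (S has_real_derivative \<beta> x) (at x)"
    and fp: "\<And>a b. (\<lambda>x. a * \<beta> (a * x + b)) \<in> flat_products" "\<And>a b. (\<lambda>x. - (a * \<beta> (a * x + b))) \<in> flat_products"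
    and \<beta>0: "\<And>x. 0 \<le> \<beta> x" and l: "\<And>x. x \<le> 0 \<Longrightarrow> S x = 0 \<and> \<beta> x = 0" and r: "\<And>x. x \<ge> 1 \<Longrightarrow> S x = 1 \<and> \<beta> x = 0"
    using smooth_step by blast
  have Smono: "S x \<le> S y" if "x \<le> y" for x y
    by (rule DERIV_nonneg_imp_nondecreasing[OF that]) (use S \<beta>0 in blast)
  have S01: "0 \<le> S x" "S x \<le> 1" for x
    using Smono[of "min x 0" x] Smono[of x "max x 1"] l[of "min x 0"] r[of "max x 1"] by auto
  \<comment> \<open>a smooth probability density on the interval from \<open>a\<close> to \<open>a + 1/n\<close>\<close>
  define \<rho> where "\<rho> n a x = n * \<beta> (n * x + - (n * a))" for n a x :: real
  have \<rho>c: "isCont (\<rho> n a) x" for n a x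
    using flat_products_derivative[OF fp(1)[of n "- (n * a)"]] unfolding \<rho>_def[abs_def] by (meson DERIV_isCont)
  have \<rho>0: "0 \<le> \<rho> n a x" if "n > 0" for n a x using \<beta>0 that by (simp add: \<rho>_def)
  have \<rho>z: "\<rho> n a x = 0" if "n > 0" "x \<notin> {a..a + 1/n}" for n a x
  proof -
    have "x < a \<or> a + 1 / n < x" using that by auto
    then have "n * x + - (n * a) \<le> 0 \<or> 1 \<le> n * x + - (n * a)"
    proof
      assume "x < a" then show ?thesis using that by simp
    next
      assume "a + 1 / n < x"
      then have "n * (a + 1 / n) < n * x" using that by simp
      then show ?thesis using that by (simp add: distrib_left)
    qed
    then show ?thesis using l r by (auto simp: \<rho>_def)
  qed
  have DS: "((\<lambda>x. S (n * x + - (n * a))) has_real_derivative \<rho> n a x) (at x)" for n a x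
  proof -
    have "((\<lambda>x. S (n * x + - (n * a))) has_real_derivative \<beta> (n * x + - (n * a)) * n) (at x)"
      by (rule DERIV_chain2[OF S]) (auto intro!: derivative_eq_intros)
    then show ?thesis by (simp add: \<rho>_def mult.commute)
  qed
  have \<rho>int: "has_bochner_integral lborel (\<rho> n a) 1" if "n > 0" for n a
  proof -
    have "has_bochner_integral lborel (\<lambda>x. \<rho> n a x * indicator {a..a + 1/n} x)
       (S (n * (a + 1/n) + - (n * a)) - S (n * a + - (n * a)))"
      by (rule has_bochner_integral_FTC_Icc_real) (use that DS \<rho>c in auto)
    moreover have "(\<lambda>x. \<rho> n a x * indicator {a..a + 1/n} x) = \<rho> n a"
    proof
      fix x show "\<rho> n a x * indicator {a..a + 1/n} x = \<rho> n a x"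
        using \<rho>z[OF that, of x a] by (cases "x \<in> {a..a + 1/n}") simp_all
    qed
    moreover have "S (n * (a + 1/n) + - (n * a)) - S (n * a + - (n * a)) = 1"
      using l[of 0] r[of 1] that by (simp add: distrib_left)
    ultimately show ?thesis by simp
  qed
  have h\<rho>: "integrable lborel (\<lambda>x. h x * \<rho> n a x)" if "n > 0" for n a
  proof -
    have "integrable lborel (\<lambda>x. (h x * \<rho> n a x) * indicator {a..a + 1/n} x)"
      by (rule borel_integrable_atLeastAtMost) (auto intro!: continuous_mult continuous \<rho>c)
    moreover have "(\<lambda>x. (h x * \<rho> n a x) * indicator {a..a + 1/n} x) = (\<lambda>x. h x * \<rho> n a x)"
    proof
      fix x show "(h x * \<rho> n a x) * indicator {a..a + 1/n} x = h x * \<rho> n a x"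
        using \<rho>z[OF that, of x a] by (cases "x \<in> {a..a + 1/n}") simp_all
    qed
    ultimately show ?thesis by simp
  qed
  have bounds: "h a \<le> (LINT x|lborel. h x * \<rho> n a x)" "(LINT x|lborel. h x * \<rho> n a x) \<le> h (a + 1/n)"
    if n: "n > 0" for n a
  proof -
    have i: "integrable lborel (\<rho> n a)" "(LINT x|lborel. \<rho> n a x) = 1"
      using \<rho>int[OF n] by (auto simp: has_bochner_integral_iff)
    have "(LINT x|lborel. h a * \<rho> n a x) \<le> (LINT x|lborel. h x * \<rho> n a x)"
    proof (rule integral_mono)
      fix x show "h a * \<rho> n a x \<le> h x * \<rho> n a x"
        using \<rho>z[OF n, of x a] \<rho>0[OF n, of a x] by (cases "x \<in> {a..a + 1/n}") (auto intro!: mult_right_mono simp: le_iff)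
    qed (use i h\<rho>[OF n] in auto)
    then show "h a \<le> (LINT x|lborel. h x * \<rho> n a x)" using i by simp
    have "(LINT x|lborel. h x * \<rho> n a x) \<le> (LINT x|lborel. h (a + 1/n) * \<rho> n a x)"
    proof (rule integral_mono)
      fix x show "h x * \<rho> n a x \<le> h (a + 1/n) * \<rho> n a x"
        using \<rho>z[OF n, of x a] \<rho>0[OF n, of a x] by (cases "x \<in> {a..a + 1/n}") (auto intro!: mult_right_mono simp: le_iff)
    qed (use i h\<rho>[OF n] in auto)
    then show "(LINT x|lborel. h x * \<rho> n a x) \<le> h (a + 1/n)" using i by simp
  qed
  have main: "(LINT x|lborel. indicator {p<..q} x *\<^sub>R g x) = h q - h p" if pq: "p < q" for p q
  proof -
    define \<psi> where "\<psi> n x = S (n * x + - (n * p)) - S (n * x + - (n * q))" for n x :: real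
    have D\<psi>: "(\<psi> n has_real_derivative (\<rho> n p x - \<rho> n q x)) (at x)" for n x
      unfolding \<psi>_def[abs_def] by (intro DERIV_diff DS)
    have d\<psi>: "deriv (\<psi> n) = (\<lambda>x. \<rho> n p x - \<rho> n q x)" for n using D\<psi> by (auto intro: DERIV_imp_deriv)
    have \<psi>z: "\<psi> n x = 0" if "n \<ge> 1" "x \<notin> {p..q + 1}" for n x
    proof -
      consider "x < p" | "q + 1 < x" using \<open>x \<notin> _\<close> by force
      then show ?thesis
      proof cases
        case 1
        then have "n * x \<le> n * p" "n * x \<le> n * q" using that pq by (auto intro!: mult_left_mono)
        then show ?thesis using l by (simp add: \<psi>_def)
      next
        case 2
        then have "1 * 1 \<le> n * (x - q)" "1 * 1 \<le> n * (x - p)" using that pq by (intro mult_mono; simp)+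
        then show ?thesis using r by (simp add: \<psi>_def algebra_simps)
      qed
    qed
    have test: "test_function (\<psi> n)" if n: "n \<ge> 1" for n
      unfolding test_function_def
    proof (intro conjI allI)
      fix k
      have dd: "deriv (\<psi> n) \<in> flat_products"
        using flat_products.add[OF fp(1)[of n "- (n * p)"] fp(2)[of n "- (n * q)"]]
        unfolding d\<psi> \<rho>_def by simp
      show "(deriv ^^ k) (\<psi> n) differentiable_on UNIV"
      proof (cases k)
        case 0
        then show ?thesis using D\<psi>
          by (auto simp: differentiable_on_def) (metis differentiable_at_withinI real_differentiable_def)
      next
        case (Suc j)
        then have "(deriv ^^ k) (\<psi> n) = (deriv ^^ j) (deriv (\<psi> n))" by (simp add: funpow_swap1)
        then show ?thesis using flat_products_differentiable[OF flat_products_smooth[OF dd]] by simp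
      qed
      have "{x. \<psi> n x \<noteq> 0} \<subseteq> {p..q + 1}" using \<psi>z[OF n] by blast
      then have "closure {x. \<psi> n x \<noteq> 0} \<subseteq> {p..q + 1}" by (intro closure_minimal) auto
      then show "compact (closure {x. \<psi> n x \<noteq> 0})"
        by (meson closed_closure compact_Icc compact_Int_closed bounded_subset bounded_closed_interval compact_eq_bounded_closed)
    qed
    define X where "X i = (LINT x|lborel. g x * \<psi> (real (Suc i)) x)" for i
    have Xb: "h q - h (p + 1 / real (Suc i)) \<le> X i" "X i \<le> h (q + 1 / real (Suc i)) - h p" for i
    proof -
      define n where "n = real (Suc i)"
      have n: "n \<ge> 1" "n > 0" by (simp_all add: n_def)
      have "- X i = (LINT x|lborel. h x * deriv (\<psi> n) x)"
        unfolding X_def n_def[symmetric] using weak[OF test[OF n(1)]] by simp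
      also have "\<dots> = (LINT x|lborel. h x * \<rho> n p x) - (LINT x|lborel. h x * \<rho> n q x)"
        unfolding d\<psi> right_diff_distrib using h\<rho>[OF n(2)] by (intro Bochner_Integration.integral_diff)
      finally show "h q - h (p + 1 / real (Suc i)) \<le> X i" "X i \<le> h (q + 1 / real (Suc i)) - h p"
        using bounds[OF n(2), of p] bounds[OF n(2), of q] unfolding n_def by linarith+
    qed
    have lim: "(\<lambda>i. h (a + 1 / real (Suc i))) \<longlonglongrightarrow> h a" for a
    proof (rule isCont_tendsto_compose[OF continuous])
      have "(\<lambda>i. a + 1 / real (Suc i)) \<longlonglongrightarrow> a + 0"
        by (intro tendsto_add tendsto_const LIMSEQ_Suc[OF lim_1_over_n])
      then show "(\<lambda>i. a + 1 / real (Suc i)) \<longlonglongrightarrow> a" by simp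
    qed
    have X1: "X \<longlonglongrightarrow> h q - h p"
    proof (rule tendsto_sandwich)
      show "(\<lambda>i. h q - h (p + 1 / real (Suc i))) \<longlonglongrightarrow> h q - h p" by (intro tendsto_diff lim tendsto_const)
      show "(\<lambda>i. h (q + 1 / real (Suc i)) - h p) \<longlonglongrightarrow> h q - h p" by (intro tendsto_diff lim tendsto_const)
    qed (use Xb in \<open>auto simp del: of_nat_Suc\<close>)
    have X2: "X \<longlonglongrightarrow> (LINT x|lborel. indicator {p<..q} x *\<^sub>R g x)"
      unfolding X_def
    proof (rule integral_dominated_convergence[where w="\<lambda>x. \<bar>indicator {p..q + 1} x *\<^sub>R g x\<bar>"])
      show "integrable lborel (\<lambda>x. \<bar>indicator {p..q + 1} x *\<^sub>R g x\<bar>)"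
        using gint[of p "q + 1"] unfolding set_integrable_def by (intro integrable_abs)
      have "\<psi> n \<in> borel_measurable borel" for n
        using D\<psi> by (intro borel_measurable_continuous_onI continuous_at_imp_continuous_on) (auto intro: DERIV_isCont)
      then show "(\<lambda>x. g x * \<psi> (real (Suc i)) x) \<in> borel_measurable lborel" for i by simp
      show "AE x in lborel. norm (g x * \<psi> (real (Suc i)) x) \<le> \<bar>indicator {p..q + 1} x *\<^sub>R g x\<bar>" for i
      proof (intro AE_I2)
        fix x
        show "norm (g x * \<psi> (real (Suc i)) x) \<le> \<bar>indicator {p..q + 1} x *\<^sub>R g x\<bar>"
        proof (cases "x \<in> {p..q + 1}")
          case True
          have "\<bar>\<psi> (real (Suc i)) x\<bar> \<le> 1" unfolding \<psi>_def using S01 by (smt (verit))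
          then have "\<bar>g x\<bar> * \<bar>\<psi> (real (Suc i)) x\<bar> \<le> \<bar>g x\<bar> * 1" by (intro mult_left_mono) auto
          then show ?thesis using True by (simp add: abs_mult)
        next
          case False
          then show ?thesis using \<psi>z[of "real (Suc i)" x] by simp
        qed
      qed
      show "AE x in lborel. (\<lambda>i. g x * \<psi> (real (Suc i)) x) \<longlonglongrightarrow> indicator {p<..q} x *\<^sub>R g x"
      proof (intro AE_I2)
        fix x
        have step: "(\<lambda>i. S (real (Suc i) * x + - (real (Suc i) * a))) \<longlonglongrightarrow> (if a < x then 1 else 0)" for a
        proof (cases "a < x")
          case True
          obtain N :: nat where N: "1 < real N * (x - a)" using ex_less_of_nat_mult[of "x - a" 1] True by auto
          have "eventually (\<lambda>i. S (real (Suc i) * x + - (real (Suc i) * a)) = 1) sequentially"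
            using eventually_ge_at_top[of N]
          proof eventually_elim
            case (elim i)
            have "real N * (x - a) \<le> real (Suc i) * (x - a)" using elim True by (intro mult_right_mono) auto
            then have "1 \<le> real (Suc i) * x + - (real (Suc i) * a)" using N by (simp add: right_diff_distrib)
            then show ?case using r by blast
          qed
          then show ?thesis using True by (simp add: tendsto_eventually)
        next
          case False
          then have "real (Suc i) * x \<le> real (Suc i) * a" for i by (intro mult_left_mono) auto
          then have "S (real (Suc i) * x + - (real (Suc i) * a)) = 0" for i using l by simp
          then show ?thesis using False by simp
        qed
        have "(\<lambda>i. g x * \<psi> (real (Suc i)) x) \<longlonglongrightarrow> g x * ((if p < x then 1 else 0) - (if q < x then 1 else 0))"
          unfolding \<psi>_def by (intro tendsto_mult tendsto_const tendsto_diff step)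
        moreover have "g x * ((if p < x then 1 else 0) - (if q < x then 1 else 0)) = indicator {p<..q} x *\<^sub>R g x"
          using pq by (auto simp: indicator_def)
        ultimately show "(\<lambda>i. g x * \<psi> (real (Suc i)) x) \<longlonglongrightarrow> indicator {p<..q} x *\<^sub>R g x" by simp
      qed
    qed simp
    show ?thesis using LIMSEQ_unique[OF X1 X2] by simp
  qed
  have "(\<integral>\<^sup>+x\<in>{p..q}. ennreal (g x) \<partial>lborel) = ennreal (h q - h p)" if "p \<le> q" for p q
  proof (cases "p = q")
    case True
    then show ?thesis unfolding nn_integral_closed by simp
  next
    case False
    then have pq: "p < q" using that by simp
    have "(\<integral>\<^sup>+x\<in>{p..q}. ennreal (g x) \<partial>lborel) = (\<integral>\<^sup>+x. ennreal (indicator {p<..q} x *\<^sub>R g x) \<partial>lborel)"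
      by (rule nn_integral_cong_AE)
         (use AE_lborel_singleton[of p] in eventually_elim, auto simp: indicator_def)
    also have "\<dots> = ennreal (LINT x|lborel. indicator {p<..q} x *\<^sub>R g x)"
    proof (rule nn_integral_eq_integral)
      have "set_integrable lborel {p<..q} g" using gint[of p q] by (rule set_integrable_subset) auto
      then show "integrable lborel (\<lambda>x. indicator {p<..q} x *\<^sub>R g x)" by (simp add: set_integrable_def)
      show "AE x in lborel. 0 \<le> indicator {p<..q} x *\<^sub>R g x" using nn by eventually_elim auto
    qed
    finally show ?thesis unfolding main[OF pq] .
  qed
  then show ?thesis using nn gp by (simp add: integrates_to_def)
qed

text \<open>Integrate \<open>g x * deriv \<psi> t\<close> over the triangle \<open>t \<le> x\<close> inside a square that contains the support of
\<open>\<psi>\<close>: integrating first over \<open>t\<close> gives \<open>g * \<psi>\<close>, first over \<open>x\<close> gives \<open>(h A - h) * deriv \<psi>\<close>.\<close>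

lemma L1_derivative_if_integrates_to:
  assumes g: "integrates_to g h"
  shows "L1_distributional_derivative h g"
proof -
  have [measurable]: "g \<in> borel_measurable borel" "h \<in> borel_measurable borel"
    using g measurable_h by (auto simp: integrates_to_def)
  have "(LINT x|lborel. h x * deriv \<psi> x) = - (LINT x|lborel. g x * \<psi> x)" if \<psi>: "test_function \<psi>" for \<psi>
  proof -
    have "(deriv ^^ 0) \<psi> differentiable_on UNIV" "(deriv ^^ 1) \<psi> differentiable_on UNIV"
      using \<psi> unfolding test_function_def by blast+
    then have diff: "\<And>x. \<psi> differentiable (at x)" "\<And>x. deriv \<psi> differentiable (at x)"
      by (auto simp: differentiable_on_def)
    then have D: "(\<psi> has_real_derivative deriv \<psi> x) (at x)" for x
      by (simp add: DERIV_deriv_iff_real_differentiable)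
    have dc: "isCont (deriv \<psi>) x" for x using diff(2) by (rule differentiable_imp_continuous_within)
    have dm [measurable]: "deriv \<psi> \<in> borel_measurable borel"
      using dc by (intro borel_measurable_continuous_onI continuous_at_imp_continuous_on) auto
    have "bounded {x. \<psi> x \<noteq> 0}"
      using \<psi> by (auto simp: test_function_def intro: bounded_subset[OF compact_imp_bounded closure_subset])
    then obtain A where A: "A > 0" "\<And>x. \<psi> x \<noteq> 0 \<Longrightarrow> \<bar>x\<bar> < A"
      unfolding bounded_pos_less by auto
    have \<psi>z: "\<psi> x = 0" if "A \<le> \<bar>x\<bar>" for x using A(2)[of x] that by linarith
    have dz: "deriv \<psi> x = 0" if "A < \<bar>x\<bar>" for x
    proof -
      have "open {y. A < \<bar>y\<bar>}" by (intro open_Collect_less continuous_intros)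
      then have "eventually (\<lambda>y. y \<in> {y. A < \<bar>y\<bar>}) (nhds x)"
        using that by (intro eventually_nhds_in_open) auto
      then have ev: "eventually (\<lambda>y. \<psi> y = 0) (nhds x)"
        by eventually_elim (use \<psi>z in auto)
      have "(\<psi> has_real_derivative 0) (at x)" by (subst DERIV_cong_ev[OF refl ev refl]) simp
      then show ?thesis by (rule DERIV_imp_deriv)
    qed
    define u where "u x = indicator {-A..A} x *\<^sub>R g x" for x
    define v where "v t = deriv \<psi> t * indicator {-A..A} t" for t
    have [measurable]: "u \<in> borel_measurable borel" "v \<in> borel_measurable borel"
      unfolding u_def[abs_def] v_def[abs_def] by measurable
    have ui: "integrable lborel u"
      using integrates_to_integrable[OF g, of "-A" A] by (simp add: u_def[abs_def] set_integrable_def)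
    have vi: "has_bochner_integral lborel (\<lambda>t. deriv \<psi> t * indicator {a..b} t) (\<psi> b - \<psi> a)" if "a \<le> b" for a b
      by (rule has_bochner_integral_FTC_Icc_real) (use that D dc in auto)
    have vi': "integrable lborel v" "(LINT t|lborel. v t) = 0"
      using vi[of "-A" A] A(1) \<psi>z[of A] \<psi>z[of "-A"] by (auto simp: v_def[abs_def] has_bochner_integral_iff)
    define f where "f x t = (if t \<le> x then u x * v t else 0)" for x t
    have prod: "integrable (lborel \<Otimes>\<^sub>M lborel) (\<lambda>(x, t). u x * v t)"
    proof (rule lborel_pair.Fubini_integrable)
      show "integrable lborel (\<lambda>x. LINT y|lborel. norm (case (x, y) of (x, t) \<Rightarrow> u x * v t))"
        using ui vi' by (simp add: abs_mult)
      show "AE x in lborel. integrable lborel (\<lambda>y. case (x, y) of (x, t) \<Rightarrow> u x * v t)"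
        using vi' by simp
    qed measurable
    have "integrable (lborel \<Otimes>\<^sub>M lborel) (case_prod f)"
    proof (rule Bochner_Integration.integrable_bound[OF prod])
      show "case_prod f \<in> borel_measurable (lborel \<Otimes>\<^sub>M lborel)" unfolding f_def[abs_def] by measurable
      show "AE x in lborel \<Otimes>\<^sub>M lborel. norm (case_prod f x) \<le> norm (case x of (x, t) \<Rightarrow> u x * v t)"
        by (auto simp: f_def)
    qed
    then have fub: "(LINT t|lborel. (LINT x|lborel. f x t)) = (LINT x|lborel. (LINT t|lborel. f x t))"
      by (rule lborel_pair.Fubini_integral)
    have inner1: "(LINT t|lborel. f x t) = g x * \<psi> x" for x
    proof (cases "x \<in> {-A..A}")
      case True
      have "(LINT t|lborel. f x t) = (LINT t|lborel. g x * (deriv \<psi> t * indicator {-A..x} t))"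
        using True by (intro Bochner_Integration.integral_cong) (auto simp: f_def u_def v_def indicator_def)
      also have "\<dots> = g x * (\<psi> x - \<psi> (-A))"
        using vi[of "-A" x] True by (simp add: has_bochner_integral_iff)
      finally show ?thesis using \<psi>z[of "-A"] A by simp
    next
      case False
      then have "f x t = 0" for t by (simp add: f_def u_def)
      moreover have "\<psi> x = 0" using False by (intro \<psi>z) auto
      ultimately show ?thesis by simp
    qed
    have inner2: "(LINT x|lborel. f x t) = h A * v t - h t * deriv \<psi> t" for t
    proof (cases "t \<in> {-A..A}")
      case True
      have "(LINT x|lborel. f x t) = (LINT x|lborel. v t * (indicator {t..A} x *\<^sub>R g x))"
        using True by (intro Bochner_Integration.integral_cong) (auto simp: f_def u_def indicator_def)
      also have "\<dots> = v t * (LINT x:{t..A}|lborel. g x)" by (simp add: set_lebesgue_integral_def)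
      also have "\<dots> = v t * (h A - h t)"
        using True by (subst integrates_to_integral[OF g]) (auto simp: le_iff)
      finally show ?thesis using True by (simp add: v_def algebra_simps)
    next
      case False
      then have "v t = 0" "deriv \<psi> t = 0" using dz[of t] by (auto simp: v_def)
      moreover from this have "f x t = 0" for x by (simp add: f_def)
      ultimately show ?thesis by simp
    qed
    have hd: "integrable lborel (\<lambda>t. h t * deriv \<psi> t)"
    proof -
      have "integrable lborel (\<lambda>t. (h t * deriv \<psi> t) * indicator {-A..A} t)"
        by (rule borel_integrable_atLeastAtMost) (auto intro!: continuous_mult continuous dc)
      moreover have "(\<lambda>t. (h t * deriv \<psi> t) * indicator {-A..A} t) = (\<lambda>t. h t * deriv \<psi> t)"
      proof
        fix t show "(h t * deriv \<psi> t) * indicator {-A..A} t = h t * deriv \<psi> t"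
        proof (cases "t \<in> {-A..A}")
          case False
          then have "A < \<bar>t\<bar>" by auto
          then show ?thesis by (simp add: dz)
        qed simp
      qed
      ultimately show ?thesis by simp
    qed
    have "(LINT x|lborel. g x * \<psi> x) = (LINT t|lborel. h A * v t - h t * deriv \<psi> t)"
      using fub unfolding inner1 inner2 by simp
    also have "\<dots> = h A * 0 - (LINT t|lborel. h t * deriv \<psi> t)"
      using vi' hd by (subst Bochner_Integration.integral_diff) auto
    finally show ?thesis by simp
  qed
  then show ?thesis
    using g integrates_to_integrable[OF g, of 0 pi] by (simp add: L1_distributional_derivative_def integrates_to_def)
qed

end

section \<open>From slope variation to the Sobolev space\<close>

lemma ennreal_suminf_swap:
  fixes f :: "nat \<Rightarrow> nat \<Rightarrow> ennreal"
  shows "(\<Sum>n. \<Sum>m. f n m) = (\<Sum>m. \<Sum>n. f n m)"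
proof -
  have "(\<Sum>n. \<Sum>m. f n m) = (\<integral>\<^sup>+n. (\<Sum>m. f n m) \<partial>count_space UNIV)" by (simp add: nn_integral_count_space_nat)
  also have "\<dots> = (\<Sum>m. \<integral>\<^sup>+n. f n m \<partial>count_space UNIV)" by (rule nn_integral_suminf) simp
  finally show ?thesis by (simp add: nn_integral_count_space_nat)
qed

text \<open>The Cauchy--Schwarz inequality with the weights \<open>(2/3) ^ m\<close>, whose total mass is 3.\<close>

lemma weighted_square_sum: "(\<Sum>m<N. a m)\<^sup>2 \<le> 3 * (\<Sum>m<N. (3/2) ^ m * (a m)\<^sup>2)" for a :: "nat \<Rightarrow> real"
proof (induction N arbitrary: a)
  case (Suc N)
  define P where "P = (\<Sum>m<N. a (Suc m))"
  have "(\<Sum>m<Suc N. a m) = a 0 + P" unfolding P_def by (rule sum.lessThan_Suc_shift)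
  moreover have "(a 0 + P)\<^sup>2 \<le> 3 * (a 0)\<^sup>2 + 3/2 * P\<^sup>2"
    using zero_le_power2[of "2 * a 0 - P"] by (simp add: power2_eq_square algebra_simps)
  moreover have "P\<^sup>2 \<le> 3 * (\<Sum>m<N. (3/2) ^ m * (a (Suc m))\<^sup>2)" unfolding P_def by (rule Suc)
  moreover have "(\<Sum>m<Suc N. (3/2) ^ m * (a m)\<^sup>2) = (a 0)\<^sup>2 + 3/2 * (\<Sum>m<N. (3/2) ^ m * (a (Suc m))\<^sup>2)"
    unfolding sum.lessThan_Suc_shift by (simp add: sum_distrib_left mult.assoc)
  ultimately show ?case by simp
qed simp

definition cell_index :: "nat \<Rightarrow> real \<Rightarrow> int" where
  "cell_index m x = \<lfloor>x * 2 ^ m / pi\<rfloor>"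

lemma cell_index: "dyad m (cell_index m x) \<le> x" "x < dyad m (cell_index m x + 1)"
proof -
  have "of_int (cell_index m x) \<le> x * 2 ^ m / pi" "x * 2 ^ m / pi < of_int (cell_index m x) + 1"
    unfolding cell_index_def by linarith+
  then show "dyad m (cell_index m x) \<le> x" "x < dyad m (cell_index m x + 1)"
    by (simp_all add: dyad_def field_simps)
qed

lemma cell_index_eqI: "dyad m k \<le> x \<Longrightarrow> x < dyad m (k + 1) \<Longrightarrow> cell_index m x = k"
  unfolding cell_index_def by (rule floor_unique) (simp_all add: dyad_def field_simps)

lemma cell_index_period: "cell_index m (x + pi) = cell_index m x + 2 ^ m"
proof -
  have "(x + pi) * 2 ^ m / pi = x * 2 ^ m / pi + of_int (2 ^ m)" by (simp add: field_simps)
  then show ?thesis by (simp only: cell_index_def floor_add_int)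
qed

lemma cell_index_Suc: "cell_index (Suc m) x = 2 * cell_index m x \<or> cell_index (Suc m) x = 2 * cell_index m x + 1"
proof -
  define y where "y = x * 2 ^ m / pi"
  have "x * 2 ^ Suc m / pi = 2 * y" by (simp add: y_def)
  then have "cell_index (Suc m) x = \<lfloor>2 * y\<rfloor>" "cell_index m x = \<lfloor>y\<rfloor>" by (simp_all only: cell_index_def y_def)
  then show ?thesis by linarith
qed

lemma cell_index_near:
  assumes "\<bar>x - y\<bar> \<le> pi / 2 ^ m"
  shows "\<bar>cell_index m x - cell_index m y\<bar> \<le> 1"
proof -
  define c :: real where "c = 2 ^ m / pi"
  have c: "c > 0" "(pi / 2 ^ m) * c = 1" by (simp_all add: c_def)
  have "x * 2 ^ m / pi - y * 2 ^ m / pi = (x - y) * c" by (simp add: c_def left_diff_distrib diff_divide_distrib)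
  moreover have "\<bar>(x - y) * c\<bar> \<le> 1"
    using mult_right_mono[OF assms, of c] c by (simp add: abs_mult)
  ultimately have "\<bar>x * 2 ^ m / pi - y * 2 ^ m / pi\<bar> \<le> 1" by simp
  then show ?thesis unfolding cell_index_def by linarith
qed

lemma borel_measurable_cell_function:
  fixes f :: "int \<Rightarrow> 'a::topological_space"
  shows "(\<lambda>x. f (cell_index m x)) \<in> borel_measurable borel"
proof -
  have "cell_index m \<in> measurable borel (count_space UNIV)"
    unfolding cell_index_def[abs_def] by measurable
  then show ?thesis by (rule measurable_compose) simp
qed

lemma nn_integral_cells:
  fixes f :: "int \<Rightarrow> ennreal"
  shows "(\<integral>\<^sup>+x\<in>{dyad m i..<dyad m (i + int n)}. f (cell_index m x) \<partial>lborel)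
    = (\<Sum>k\<in>{i..<i + int n}. f k * ennreal (pi / 2 ^ m))"
proof (induction n)
  case (Suc n)
  have c: "(\<integral>\<^sup>+x\<in>{dyad m k..<dyad m (k + 1)}. f (cell_index m x) \<partial>lborel) = f k * ennreal (pi / 2 ^ m)" for k
  proof -
    have "(\<integral>\<^sup>+x\<in>{dyad m k..<dyad m (k + 1)}. f (cell_index m x) \<partial>lborel)
        = (\<integral>\<^sup>+x. f k * indicator {dyad m k..<dyad m (k + 1)} x \<partial>lborel)"
    proof (rule nn_integral_cong)
      fix x
      show "f (cell_index m x) * indicator {dyad m k..<dyad m (k + 1)} x = f k * indicator {dyad m k..<dyad m (k + 1)} x"
      proof (cases "x \<in> {dyad m k..<dyad m (k + 1)}")
        case True
        then have "cell_index m x = k" by (intro cell_index_eqI) auto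
        then show ?thesis by (simp only:)
      qed simp
    qed
    also have "\<dots> = f k * ennreal (dyad m (k + 1) - dyad m k)"
      using dyad_succ_less[of m k] by (subst nn_integral_cmult_indicator) auto
    finally show ?thesis by (simp add: dyad_add)
  qed
  have "(\<integral>\<^sup>+x\<in>{dyad m i..<dyad m (i + int (Suc n))}. f (cell_index m x) \<partial>lborel)
     = (\<integral>\<^sup>+x\<in>{dyad m i..<dyad m (i + int n)}. f (cell_index m x) \<partial>lborel)
     + (\<integral>\<^sup>+x\<in>{dyad m (i + int n)..<dyad m (i + int (Suc n))}. f (cell_index m x) \<partial>lborel)"
    by (rule nn_integral_split[OF borel_measurable_cell_function]) (auto intro!: dyad_mono)
  also have "(\<integral>\<^sup>+x\<in>{dyad m (i + int n)..<dyad m (i + int (Suc n))}. f (cell_index m x) \<partial>lborel) = f (i + int n) * ennreal (pi / 2 ^ m)"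
    using c[of "i + int n"] by (simp add: ac_simps)
  also have "{i..<i + int (Suc n)} = insert (i + int n) {i..<i + int n}" by auto
  ultimately show ?case using Suc by (simp add: add.commute)
qed simp

lemma nn_integral_cells_period:
  fixes f :: "int \<Rightarrow> real"
  assumes "\<And>k. 0 \<le> f k"
  shows "(\<integral>\<^sup>+x\<in>{0..pi}. ennreal (f (cell_index m x)) \<partial>lborel) = ennreal (pi / 2 ^ m * (\<Sum>k\<in>{0..<2 ^ m}. f k))"
proof -
  have "dyad m 0 = 0" "dyad m (0 + int (2 ^ m)) = pi" by (simp_all add: dyad_def)
  then have "(\<integral>\<^sup>+x\<in>{0..pi}. ennreal (f (cell_index m x)) \<partial>lborel) = (\<Sum>k\<in>{0..<0 + int (2 ^ m)}. ennreal (f k) * ennreal (pi / 2 ^ m))"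
    unfolding nn_integral_closed using nn_integral_cells[where m=m and i=0 and n="2 ^ m" and f="\<lambda>k. ennreal (f k)"] by simp
  also have "\<dots> = ennreal (\<Sum>k\<in>{0..<2 ^ m}. f k * (pi / 2 ^ m))"
    using assms by (simp add: ennreal_mult[symmetric] sum_ennreal)
  also have "(\<Sum>k\<in>{0..<2 ^ m}. f k * (pi / 2 ^ m)) = pi / 2 ^ m * (\<Sum>k\<in>{0..<2 ^ m}. f k)"
    by (simp add: sum_distrib_left mult.commute)
  finally show ?thesis .
qed

lemma circle_dist_attained: "\<exists>k. circle_dist x y = \<bar>x - y - of_int k * pi\<bar>"
proof -
  have r: "range (\<lambda>k::int. of_int k * pi) = (\<lambda>x. pi *\<^sub>R x) ` \<int>"
    by (auto simp: Ints_def mult.commute)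
  have "closed (range (\<lambda>k::int. of_int k * pi))" unfolding r by (intro closed_scaling closed_Ints)
  then obtain z where "z \<in> range (\<lambda>k::int. of_int k * pi)" "infdist (x - y) (range (\<lambda>k::int. of_int k * pi)) = dist (x - y) z"
    by (rule infdist_attains_inf) auto
  then show ?thesis by (auto simp: circle_dist_def dist_real_def)
qed

lemma circle_dist_le: "circle_dist x y \<le> \<bar>x - y\<bar>"
proof -
  have "infdist (x - y) (range (\<lambda>k::int. of_int k * pi)) \<le> dist (x - y) 0"
    by (rule infdist_le) (auto intro!: image_eqI[of _ _ 0])
  then show ?thesis by (simp add: circle_dist_def dist_real_def)
qed

lemma circle_dist_nonneg: "0 \<le> circle_dist x y"
  by (simp add: circle_dist_def infdist_nonneg)

lemma measurable_circle_dist [measurable]: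
  assumes [measurable]: "f \<in> borel_measurable M" "g \<in> borel_measurable M"
  shows "(\<lambda>x. circle_dist (f x) (g x)) \<in> borel_measurable M"
proof -
  have [measurable]: "(\<lambda>z. infdist z (range (\<lambda>k::int. of_int k * pi))) \<in> borel_measurable borel"
    by (intro borel_measurable_continuous_onI continuous_intros)
  show ?thesis unfolding circle_dist_def by measurable
qed

lemma dyadic_shell:
  assumes "0 < d" "d \<le> pi"
  shows "\<exists>n. pi / 2 ^ Suc n < d \<and> d \<le> pi / 2 ^ n"
proof -
  obtain N :: nat where "pi / d < 2 ^ N" using real_arch_pow[of 2 "pi / d"] by auto
  then have ex: "pi / 2 ^ N < d" using assms by (simp add: field_simps)
  define n where "n = (LEAST N. pi / 2 ^ N < d)"
  have 1: "pi / 2 ^ n < d" unfolding n_def using ex by (rule LeastI)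
  then have "n \<noteq> 0" using assms by (auto intro: Nat.gr0I)
  then obtain k where k: "n = Suc k" by (cases n) auto
  then have "\<not> pi / 2 ^ k < d" using not_less_Least[of k "\<lambda>N. pi / 2 ^ N < d"] by (simp add: n_def)
  then show ?thesis using 1 k by (intro exI[of _ k]) auto
qed

text \<open>Only five translates of the ball by multiples of \<open>pi\<close> can meet the period.\<close>

lemma circle_ball_measure:
  assumes x: "0 \<le> x" "x \<le> pi" and r: "0 \<le> r" "r \<le> pi"
  shows "(\<integral>\<^sup>+y\<in>{0..pi}. (if circle_dist x y \<le> r then 1 else 0) \<partial>lborel) \<le> ennreal (10 * r)"
proof -
  have "(\<integral>\<^sup>+y\<in>{0..pi}. (if circle_dist x y \<le> r then 1 else 0) \<partial>lborel)
     \<le> (\<integral>\<^sup>+y. (\<Sum>j\<in>{-2..2::int}. indicator {x - of_int j * pi - r..x - of_int j * pi + r} y) \<partial>lborel)"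
  proof (rule nn_integral_mono)
    fix y
    show "(if circle_dist x y \<le> r then 1 else 0) * indicator {0..pi} y
      \<le> (\<Sum>j\<in>{-2..2::int}. indicator {x - of_int j * pi - r..x - of_int j * pi + r} y :: ennreal)"
    proof (cases "circle_dist x y \<le> r \<and> y \<in> {0..pi}")
      case True
      obtain k where k: "circle_dist x y = \<bar>x - y - of_int k * pi\<bar>" using circle_dist_attained by blast
      have "\<bar>x - y - of_int k * pi\<bar> \<le> pi" "0 \<le> y" "y \<le> pi" using k True r by auto
      then have "\<bar>of_int k * pi\<bar> \<le> 2 * pi" using x by linarith
      then have "\<bar>of_int k\<bar> * pi \<le> 2 * pi" by (simp add: abs_mult)
      then have "\<bar>of_int k :: real\<bar> \<le> 2" by (simp add: mult_le_cancel_right)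
      then have "of_int k \<le> (of_int 2 :: real)" "of_int (-2) \<le> (of_int k :: real)" by (simp_all add: abs_le_iff)
      then have kin: "k \<in> {-2..2}" unfolding of_int_le_iff by simp
      have "y \<in> {x - of_int k * pi - r..x - of_int k * pi + r}" using k True by (auto simp: abs_le_iff)
      then have "(1::ennreal) = indicator {x - of_int k * pi - r..x - of_int k * pi + r} y" by simp
      also have "\<dots> \<le> (\<Sum>j\<in>{-2..2::int}. indicator {x - of_int j * pi - r..x - of_int j * pi + r} y)"
        using kin by (intro member_le_sum[where f="\<lambda>j. indicator {x - of_int j * pi - r..x - of_int j * pi + r} y"]) auto
      finally show ?thesis using True by simp
    qed auto
  qed
  also have "\<dots> = (\<Sum>j\<in>{-2..2::int}. ennreal (2 * r))"
    using r by (subst nn_integral_sum) auto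
  also have "\<dots> = ennreal (10 * r)"
    using r by (simp add: ennreal_mult'' flip: ennreal_numeral)
       (simp add: ennreal_mult[symmetric] del: ennreal_numeral)
  finally show ?thesis .
qed

lemma periodic_AE_finite:
  assumes [measurable]: "f \<in> borel_measurable borel" and p: "\<And>x. f (x + pi) = f x"
    and fin: "(\<integral>\<^sup>+x\<in>{0..pi}. f x \<partial>lborel) < \<infinity>"
  shows "AE x in lborel. f x \<noteq> \<infinity>"
proof -
  have "AE x in lborel. f x * indicator {- real N..real N} x \<noteq> \<infinity>" for N
  proof (rule nn_integral_PInf_AE)
    show "(\<integral>\<^sup>+x\<in>{- real N..real N}. f x \<partial>lborel) \<noteq> \<infinity>"
      using nn_integral_periodic_finite[OF assms, of "- real N" "real N"] by simp
  qed measurable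
  then have "AE x in lborel. \<forall>N. f x * indicator {- real N..real N} x \<noteq> \<infinity>" by (simp add: AE_all_countable)
  then show ?thesis
  proof eventually_elim
    case (elim x)
    obtain N :: nat where "\<bar>x\<bar> \<le> real N" using real_arch_simple by blast
    then show ?case using elim[rule_format, of N] by (simp add: abs_le_iff)
  qed
qed

context circle_lift
begin

definition log_approx :: "nat \<Rightarrow> real \<Rightarrow> real" where
  "log_approx m x = logslope h m (cell_index m x)"

definition local_variation :: "nat \<Rightarrow> real \<Rightarrow> real" where
  "local_variation m x = slope_variation h m (cell_index m x)"

text \<open>The weight \<open>(3/2) ^ m\<close> pays for replacing a squared sum by a sum of squares. It is affordable because
a cell of level \<open>n + m\<close> has length \<open>pi / 2 ^ (n + m)\<close>, so that after integration the factor \<open>(3/4) ^ m\<close>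
remains. The constant 24 is the 8 of \<open>(2 * a + 2 * b)\<^sup>2 \<le> 8 * a\<^sup>2 + 8 * b\<^sup>2\<close> times the mass 3 of the inverse
weights.\<close>

definition tail_bound :: "nat \<Rightarrow> real \<Rightarrow> ennreal" where
  "tail_bound n x = (\<Sum>m. ennreal (24 * (3/2) ^ m * (local_variation (n + m) x)\<^sup>2))"

lemma logslope_periodic: "logslope h m (k + 2 ^ m) = logslope h m k"
  by (simp add: logslope_def slope_periodic)

lemma log_approx_periodic: "log_approx m (x + pi) = log_approx m x"
  by (simp add: log_approx_def cell_index_period logslope_periodic)

lemma local_variation_periodic: "local_variation m (x + pi) = local_variation m x"
  using slope_variation_periodic by (simp add: local_variation_def cell_index_period tree_periodic_def)

lemma local_variation_nonneg: "0 \<le> local_variation m x"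
  by (simp add: local_variation_def slope_variation_nonneg)

lemma tail_bound_periodic: "tail_bound n (x + pi) = tail_bound n x"
  by (simp add: tail_bound_def local_variation_periodic)

lemma measurable_approx [measurable]:
  "log_approx m \<in> borel_measurable borel" "local_variation m \<in> borel_measurable borel"
  unfolding log_approx_def[abs_def] local_variation_def[abs_def] by (rule borel_measurable_cell_function)+

lemma measurable_tail_bound [measurable]: "tail_bound n \<in> borel_measurable borel"
  unfolding tail_bound_def[abs_def] by measurable

lemma log_approx_step: "\<bar>log_approx (Suc m) x - log_approx m x\<bar> \<le> local_variation m x"
  using cell_index_Suc[of m x] unfolding log_approx_def local_variation_def slope_variation_def by (smt (verit))

lemma log_approx_diff: "\<bar>log_approx (n + N) x - log_approx n x\<bar> \<le> (\<Sum>m<N. local_variation (n + m) x)"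
proof (induction N)
  case (Suc N)
  then show ?case using log_approx_step[of "n + N" x] by simp
qed simp

lemma log_approx_root: "log_approx 0 x = 0"
  by (simp add: log_approx_def logslope_def slope_root)

lemma partial_tail_le:
  "ennreal (24 * (\<Sum>m<N. (3/2) ^ m * (local_variation (n + m) x)\<^sup>2)) \<le> tail_bound n x"
proof -
  have "ennreal (24 * (\<Sum>m<N. (3/2) ^ m * (local_variation (n + m) x)\<^sup>2))
      = (\<Sum>m<N. ennreal (24 * (3/2) ^ m * (local_variation (n + m) x)\<^sup>2))"
    by (subst sum_ennreal) (auto simp: sum_distrib_left mult.assoc)
  also have "\<dots> \<le> tail_bound n x" unfolding tail_bound_def by (intro sum_le_suminf) auto
  finally show ?thesis .
qed

lemma tail_bound_integral:
  "(\<integral>\<^sup>+x\<in>{0..pi}. tail_bound n x \<partial>lborel)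
    = (\<Sum>m. ennreal (24 * pi * (3/4) ^ m / 2 ^ n * level_sum (\<lambda>m k. (slope_variation h m k)\<^sup>2) (n + m)))"
proof -
  have "(\<integral>\<^sup>+x\<in>{0..pi}. tail_bound n x \<partial>lborel)
      = (\<integral>\<^sup>+x. (\<Sum>m. ennreal (24 * (3/2) ^ m * (local_variation (n + m) x)\<^sup>2) * indicator {0..pi} x) \<partial>lborel)"
    by (simp add: tail_bound_def)
  also have "\<dots> = (\<Sum>m. \<integral>\<^sup>+x\<in>{0..pi}. ennreal (24 * (3/2) ^ m * (local_variation (n + m) x)\<^sup>2) \<partial>lborel)"
    by (rule nn_integral_suminf) measurable
  also have "\<dots> = (\<Sum>m. ennreal (24 * pi * (3/4) ^ m / 2 ^ n * level_sum (\<lambda>m k. (slope_variation h m k)\<^sup>2) (n + m)))"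
  proof (rule arg_cong[where f=suminf], rule ext)
    fix m
    have "(\<integral>\<^sup>+x\<in>{0..pi}. ennreal (24 * (3/2) ^ m * (local_variation (n + m) x)\<^sup>2) \<partial>lborel)
       = ennreal (pi / 2 ^ (n + m) * (\<Sum>k\<in>{0..<2 ^ (n + m)}. 24 * (3/2) ^ m * (slope_variation h (n + m) k)\<^sup>2))"
      unfolding local_variation_def by (rule nn_integral_cells_period) simp
    also have "(\<Sum>k\<in>{0..<2 ^ (n + m)}. 24 * (3/2) ^ m * (slope_variation h (n + m) k)\<^sup>2)
       = 24 * (3/2) ^ m * level_sum (\<lambda>m k. (slope_variation h m k)\<^sup>2) (n + m)"
      by (simp only: level_sum_def sum_distrib_left)
    also have "pi / 2 ^ (n + m) * (24 * (3/2) ^ m * level_sum (\<lambda>m k. (slope_variation h m k)\<^sup>2) (n + m))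
       = 24 * pi * (3/4) ^ m / 2 ^ n * level_sum (\<lambda>m k. (slope_variation h m k)\<^sup>2) (n + m)"
    proof -
      have "(4::real) ^ m = 2 ^ m * 2 ^ m" by (simp add: power_mult_distrib[symmetric])
      then show ?thesis by (simp add: power_add power_divide field_simps)
    qed
    finally show "(\<integral>\<^sup>+x\<in>{0..pi}. ennreal (24 * (3/2) ^ m * (local_variation (n + m) x)\<^sup>2) \<partial>lborel)
      = ennreal (24 * pi * (3/4) ^ m / 2 ^ n * level_sum (\<lambda>m k. (slope_variation h m k)\<^sup>2) (n + m))" .
  qed
  finally show ?thesis .
qed

text \<open>After exchanging the two sums, each level of the tree is counted with the total weight of a geometric
series.\<close>

lemma tail_bound_sum_finite:
  assumes star: "l2_tree (slope_variation h)"
  shows "(\<Sum>n. ennreal (2 ^ n) * (\<integral>\<^sup>+x\<in>{0..pi}. tail_bound n x \<partial>lborel)) < \<infinity>"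
proof -
  define s where "s = level_sum (\<lambda>m k. (slope_variation h m k)\<^sup>2)"
  have s0: "0 \<le> s m" for m unfolding s_def by (intro level_sum_nonneg) simp
  have ss: "summable s" using star by (simp add: l2_tree_def s_def)
  have "(\<Sum>n. ennreal (2 ^ n) * (\<integral>\<^sup>+x\<in>{0..pi}. tail_bound n x \<partial>lborel))
     = (\<Sum>n. \<Sum>m. ennreal (24 * pi * (3/4) ^ m * s (n + m)))"
  proof (rule arg_cong[where f=suminf], rule ext)
    fix n
    have "ennreal (2 ^ n) * (\<Sum>m. ennreal (24 * pi * (3/4) ^ m / 2 ^ n * s (n + m)))
       = (\<Sum>m. ennreal (2 ^ n) * ennreal (24 * pi * (3/4) ^ m / 2 ^ n * s (n + m)))" by simp
    also have "\<dots> = (\<Sum>m. ennreal (24 * pi * (3/4) ^ m * s (n + m)))"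
      using s0 by (intro arg_cong[where f=suminf] ext) (simp add: ennreal_mult[symmetric])
    finally show "ennreal (2 ^ n) * (\<integral>\<^sup>+x\<in>{0..pi}. tail_bound n x \<partial>lborel) = (\<Sum>m. ennreal (24 * pi * (3/4) ^ m * s (n + m)))"
      unfolding tail_bound_integral s_def .
  qed
  also have "\<dots> = (\<Sum>m. \<Sum>n. ennreal (24 * pi * (3/4) ^ m * s (n + m)))" by (rule ennreal_suminf_swap)
  also have "\<dots> \<le> (\<Sum>m. ennreal (24 * pi * suminf s) * ennreal ((3/4) ^ m))"
  proof (intro suminf_le summableI)
    fix m
    have sm: "summable (\<lambda>n. s (n + m))" using ss by simp
    have le: "(\<Sum>n. s (n + m)) \<le> suminf s"
      using suminf_split_initial_segment[OF ss, of m] sum_nonneg[of "{..<m}" s] s0 by simp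
    have "(\<Sum>n. ennreal (24 * pi * (3/4) ^ m * s (n + m))) = ennreal (\<Sum>n. 24 * pi * (3/4) ^ m * s (n + m))"
      using s0 sm by (intro suminf_ennreal2 summable_mult) auto
    also have "(\<Sum>n. 24 * pi * (3/4) ^ m * s (n + m)) = 24 * pi * (3/4) ^ m * (\<Sum>n. s (n + m))"
      using sm by (rule suminf_mult)
    also have "ennreal \<dots> \<le> ennreal (24 * pi * (3/4) ^ m * suminf s)"
      using le by (intro ennreal_leI mult_left_mono) auto
    also have "\<dots> = ennreal (24 * pi * suminf s) * ennreal ((3/4) ^ m)"
      using suminf_nonneg[OF ss s0] by (simp add: ennreal_mult[symmetric] mult.assoc mult.commute mult.left_commute)
    finally show "(\<Sum>n. ennreal (24 * pi * (3/4) ^ m * s (n + m))) \<le> ennreal (24 * pi * suminf s) * ennreal ((3/4) ^ m)" .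
  qed
  also have "\<dots> = ennreal (24 * pi * suminf s) * ennreal (\<Sum>m. (3/4) ^ m)"
    by (subst ennreal_suminf_cmult, subst suminf_ennreal2) (auto intro!: summable_geometric)
  also have "\<dots> < \<infinity>" by (simp add: ennreal_mult_less_top)
  finally show ?thesis .
qed

lemma tail_bound_finite:
  assumes star: "l2_tree (slope_variation h)"
  shows "(\<integral>\<^sup>+x\<in>{0..pi}. tail_bound 0 x \<partial>lborel) < \<infinity>" "AE x in lborel. tail_bound 0 x \<noteq> \<infinity>"
proof -
  have "ennreal (2 ^ 0) * (\<integral>\<^sup>+x\<in>{0..pi}. tail_bound 0 x \<partial>lborel) \<le> (\<Sum>n. ennreal (2 ^ n) * (\<integral>\<^sup>+x\<in>{0..pi}. tail_bound n x \<partial>lborel))"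
    using sum_le_suminf[OF summableI, of "{0}" "\<lambda>n. ennreal (2 ^ n) * (\<integral>\<^sup>+x\<in>{0..pi}. tail_bound n x \<partial>lborel)"] by simp
  then show fin: "(\<integral>\<^sup>+x\<in>{0..pi}. tail_bound 0 x \<partial>lborel) < \<infinity>"
    using tail_bound_sum_finite[OF star] by simp
  show "AE x in lborel. tail_bound 0 x \<noteq> \<infinity>"
    by (rule periodic_AE_finite[OF measurable_tail_bound tail_bound_periodic fin])
qed

lemma log_approx_convergent:
  assumes "tail_bound 0 x \<noteq> \<infinity>"
  shows "convergent (\<lambda>m. log_approx m x)"
proof -
  define d where "d m = local_variation m x" for m
  have "summable (\<lambda>m. 24 * (3/2) ^ m * (d m)\<^sup>2)"
    using assms unfolding tail_bound_def d_def by (intro summable_suminf_not_top) auto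
  then have 1: "summable (\<lambda>m. (24 * (3/2) ^ m * (d m)\<^sup>2 + (2/3) ^ m))"
    by (intro summable_add summable_geometric) auto
  have "summable d"
  proof (rule summable_comparison_test'[OF 1])
    fix m
    have p: "(3/2::real) ^ m * (2/3) ^ m = 1" by (simp add: power_mult_distrib[symmetric])
    have "0 \<le> (d m * (3/2) ^ m - 1)\<^sup>2 * (2/3) ^ m" by simp
    also have "\<dots> = (d m)\<^sup>2 * (3/2) ^ m * ((3/2) ^ m * (2/3) ^ m) - 2 * d m * ((3/2) ^ m * (2/3) ^ m) + (2/3) ^ m"
      by (simp add: power2_eq_square algebra_simps)
    \<comment> \<open>the inequality between the arithmetic and the geometric mean turns square summability with growing
      weights into summability\<close>
    finally have "2 * d m \<le> (d m)\<^sup>2 * (3/2) ^ m + (2/3) ^ m" unfolding p by simp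
    moreover have "0 \<le> (d m)\<^sup>2 * (3/2) ^ m" "0 \<le> d m" "(0::real) \<le> (2/3) ^ m" by (simp_all add: d_def local_variation_nonneg)
    ultimately have "d m \<le> 24 * ((d m)\<^sup>2 * (3/2) ^ m) + (2/3) ^ m" by linarith
    then show "norm (d m) \<le> 24 * (3/2) ^ m * (d m)\<^sup>2 + (2/3) ^ m"
      using \<open>0 \<le> d m\<close> by (simp add: mult.commute mult.left_commute)
  qed
  then have "summable (\<lambda>m. log_approx (Suc m) x - log_approx m x)"
    by (rule summable_comparison_test'[where N=0]) (use log_approx_step in \<open>simp add: d_def\<close>)
  then have "convergent (\<lambda>N. \<Sum>m<N. log_approx (Suc m) x - log_approx m x)" by (simp add: summable_iff_convergent)
  moreover have "(\<Sum>m<N. log_approx (Suc m) x - log_approx m x) = log_approx N x" for N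
    by (induction N) (auto simp: log_approx_root)
  ultimately show ?thesis by simp
qed

definition log_derivative :: "real \<Rightarrow> real" where
  "log_derivative x = lim (\<lambda>m. log_approx m x)"

lemma measurable_log_derivative [measurable]: "log_derivative \<in> borel_measurable borel"
  unfolding log_derivative_def[abs_def] by measurable

lemma log_derivative_periodic: "log_derivative (x + pi) = log_derivative x"
  by (simp add: log_derivative_def log_approx_periodic)

lemma log_approx_tendsto:
  "tail_bound 0 x \<noteq> \<infinity> \<Longrightarrow> (\<lambda>m. log_approx m x) \<longlonglongrightarrow> log_derivative x"
  unfolding log_derivative_def using log_approx_convergent by (simp add: convergent_LIMSEQ_iff)

text \<open>On the scale of their distance the two points lie in the same cell or in adjacent cells; from there
on the variations are summed separately down to each point.\<close>

lemma log_approx_pair: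
  assumes d: "circle_dist x y \<le> pi / 2 ^ n" and N: "N \<ge> 1"
  shows "ennreal ((log_approx (n + N) x - log_approx (n + N) y)\<^sup>2) \<le> tail_bound n x + tail_bound n y"
proof -
  obtain k where k: "circle_dist x y = \<bar>x - y - of_int k * pi\<bar>" using circle_dist_attained by blast
  define y' where "y' = y + of_int k * pi"
  have ay: "log_approx m y' = log_approx m y" for m unfolding y'_def by (rule periodic_int_shift) (rule log_approx_periodic)
  have vy: "local_variation m y' = local_variation m y" for m
    unfolding y'_def by (rule periodic_int_shift[of "local_variation m"]) (rule local_variation_periodic)
  have "\<bar>x - y'\<bar> \<le> pi / 2 ^ n" using d k by (simp add: y'_def algebra_simps)
  then have "\<bar>cell_index n x - cell_index n y'\<bar> \<le> 1" by (rule cell_index_near)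
  then consider "cell_index n x = cell_index n y'" | "cell_index n x = cell_index n y' + 1" | "cell_index n y' = cell_index n x + 1"
    by linarith
  then have "\<bar>log_approx n x - log_approx n y'\<bar> \<le> local_variation n x + local_variation n y'"
    unfolding log_approx_def local_variation_def
    by cases (auto simp: slope_variation_def)
  then have base: "\<bar>log_approx n x - log_approx n y\<bar> \<le> local_variation n x + local_variation n y" by (simp add: ay vy)
  define Px where "Px = (\<Sum>m<N. local_variation (n + m) x)"
  define Py where "Py = (\<Sum>m<N. local_variation (n + m) y)"
  have "local_variation (n + 0) z \<le> (\<Sum>m<N. local_variation (n + m) z)" for z
    using N by (intro member_le_sum[where f="\<lambda>m. local_variation (n + m) z"]) (auto simp: local_variation_nonneg)
  then have "local_variation n x \<le> Px" "local_variation n y \<le> Py" by (simp_all add: Px_def Py_def)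
  then have "\<bar>log_approx (n + N) x - log_approx (n + N) y\<bar> \<le> 2 * Px + 2 * Py"
    using base log_approx_diff[of n N x] log_approx_diff[of n N y] unfolding Px_def[symmetric] Py_def[symmetric] by linarith
  then have "\<bar>log_approx (n + N) x - log_approx (n + N) y\<bar>\<^sup>2 \<le> (2 * Px + 2 * Py)\<^sup>2" by (intro power_mono) auto
  also have "\<dots> \<le> 8 * Px\<^sup>2 + 8 * Py\<^sup>2"
    using zero_le_power2[of "Px - Py"] by (simp add: power2_eq_square algebra_simps)
  also have "\<dots> \<le> 24 * (\<Sum>m<N. (3/2) ^ m * (local_variation (n + m) x)\<^sup>2) + 24 * (\<Sum>m<N. (3/2) ^ m * (local_variation (n + m) y)\<^sup>2)"
    using weighted_square_sum[of "\<lambda>m. local_variation (n + m) x" N] weighted_square_sum[of "\<lambda>m. local_variation (n + m) y" N]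
    unfolding Px_def Py_def by linarith
  finally have "ennreal ((log_approx (n + N) x - log_approx (n + N) y)\<^sup>2)
     \<le> ennreal (24 * (\<Sum>m<N. (3/2) ^ m * (local_variation (n + m) x)\<^sup>2) + 24 * (\<Sum>m<N. (3/2) ^ m * (local_variation (n + m) y)\<^sup>2))"
    by (intro ennreal_leI) simp
  also have "\<dots> = ennreal (24 * (\<Sum>m<N. (3/2) ^ m * (local_variation (n + m) x)\<^sup>2)) + ennreal (24 * (\<Sum>m<N. (3/2) ^ m * (local_variation (n + m) y)\<^sup>2))"
    by (intro ennreal_plus mult_nonneg_nonneg sum_nonneg) auto
  also have "\<dots> \<le> tail_bound n x + tail_bound n y" by (intro add_mono partial_tail_le)
  finally show ?thesis .
qed

lemma log_derivative_pair:
  assumes d: "circle_dist x y \<le> pi / 2 ^ n" and fin: "tail_bound 0 x \<noteq> \<infinity>" "tail_bound 0 y \<noteq> \<infinity>"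
  shows "ennreal ((log_derivative x - log_derivative y)\<^sup>2) \<le> tail_bound n x + tail_bound n y"
proof (rule LIMSEQ_le_const2)
  have "(\<lambda>N. log_approx (n + N) z) \<longlonglongrightarrow> log_derivative z" if "tail_bound 0 z \<noteq> \<infinity>" for z
    using LIMSEQ_ignore_initial_segment[OF log_approx_tendsto[OF that], of n] by (simp add: add.commute)
  then show "(\<lambda>N. ennreal ((log_approx (n + N) x - log_approx (n + N) y)\<^sup>2)) \<longlonglongrightarrow> ennreal ((log_derivative x - log_derivative y)\<^sup>2)"
    using fin by (intro tendsto_ennrealI tendsto_power tendsto_diff) auto
  show "\<exists>N. \<forall>m\<ge>N. ennreal ((log_approx (n + m) x - log_approx (n + m) y)\<^sup>2) \<le> tail_bound n x + tail_bound n y"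
    using log_approx_pair[OF d] by blast
qed

lemma log_derivative_square:
  assumes fin: "tail_bound 0 x \<noteq> \<infinity>"
  shows "ennreal ((log_derivative x)\<^sup>2) \<le> tail_bound 0 x"
proof (rule LIMSEQ_le_const2)
  show "(\<lambda>N. ennreal ((log_approx N x)\<^sup>2)) \<longlonglongrightarrow> ennreal ((log_derivative x)\<^sup>2)"
    by (intro tendsto_ennrealI tendsto_power log_approx_tendsto fin)
  have "ennreal ((log_approx N x)\<^sup>2) \<le> tail_bound 0 x" for N
  proof -
    have "\<bar>log_approx N x\<bar> \<le> (\<Sum>m<N. local_variation m x)" using log_approx_diff[of 0 N x] by (simp add: log_approx_root)
    then have "\<bar>log_approx N x\<bar>\<^sup>2 \<le> (\<Sum>m<N. local_variation m x)\<^sup>2" by (intro power_mono) auto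
    also have "\<dots> \<le> 3 * (\<Sum>m<N. (3/2) ^ m * (local_variation m x)\<^sup>2)" by (rule weighted_square_sum)
    also have "\<dots> \<le> 24 * (\<Sum>m<N. (3/2) ^ m * (local_variation m x)\<^sup>2)" by (intro mult_right_mono sum_nonneg) auto
    finally show ?thesis using partial_tail_le[where N=N and n=0 and x=x] by (simp add: order_trans[OF ennreal_leI])
  qed
  then show "\<exists>N. \<forall>n\<ge>N. ennreal ((log_approx n x)\<^sup>2) \<le> tail_bound 0 x" by blast
qed

text \<open>Where the distance is about \<open>pi / 2 ^ n\<close>, the integrand is at most \<open>4 ^ n\<close> times the two tail bounds of level \<open>n\<close>,
and for given \<open>x\<close> this region has measure of order \<open>2 ^ (- n)\<close>. What remains is \<open>2 ^ n\<close> times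
the integral of the tail bound, and these have a finite sum.\<close>

lemma sobolev_log_derivative:
  assumes star: "l2_tree (slope_variation h)"
  shows "sobolev_half log_derivative"
proof -
  note [measurable] = measurable_tail_bound
  have good: "AE x in lborel. tail_bound 0 x \<noteq> \<infinity>" by (rule tail_bound_finite[OF star])
  have sq: "set_integrable lborel {0..pi} (\<lambda>x. (log_derivative x)\<^sup>2)"
  proof -
    have "(\<integral>\<^sup>+x. ennreal (norm (indicator {0..pi} x *\<^sub>R (log_derivative x)\<^sup>2)) \<partial>lborel) \<le> (\<integral>\<^sup>+x\<in>{0..pi}. tail_bound 0 x \<partial>lborel)"
      by (rule nn_integral_mono_AE) (use good in eventually_elim, auto simp: indicator_def log_derivative_square)
    also have "\<dots> < \<infinity>" by (rule tail_bound_finite[OF star])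
    finally show ?thesis unfolding set_integrable_def integrable_iff_bounded by simp
  qed
  define c where "c n = ennreal (4 ^ Suc n / pi\<^sup>2)" for n :: nat
  define near where "near n x y = (if circle_dist x y \<le> pi / 2 ^ n then 1 else 0 :: ennreal)" for n x y
  have [measurable]: "(\<lambda>(x, y). near n x y) \<in> borel_measurable (borel \<Otimes>\<^sub>M borel)" for n
    unfolding near_def by measurable
  have near_meas [measurable]: "f \<in> borel_measurable M \<Longrightarrow> g \<in> borel_measurable M \<Longrightarrow> (\<lambda>z. near n (f z) (g z)) \<in> borel_measurable M" for f g n and M :: "'z measure"
    unfolding near_def by measurable
  have near_sym: "near n x y = near n y x" for n x y
  proof -
    have "circle_dist x y = circle_dist y x" for x y
    proof -
      have le: "circle_dist x y \<le> circle_dist y x" for x y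
      proof -
        obtain k where k: "circle_dist y x = \<bar>y - x - of_int k * pi\<bar>" using circle_dist_attained by blast
        have "infdist (x - y) (range (\<lambda>k::int. of_int k * pi)) \<le> dist (x - y) (of_int (-k) * pi)"
          by (rule infdist_le) blast
        moreover have "x - y - of_int (-k) * pi = - (y - x - of_int k * pi)" by simp
        ultimately show ?thesis unfolding circle_dist_def[of x y] k dist_real_def by (simp only: abs_minus_cancel)
      qed
      show ?thesis using le[of x y] le[of y x] by simp
    qed
    then show ?thesis by (simp add: near_def)
  qed
  have point: "ennreal ((log_derivative x - log_derivative y)\<^sup>2 / (circle_dist x y)\<^sup>2)
      \<le> (\<Sum>n. c n * (tail_bound n x * near n x y + tail_bound n y * near n x y))"
    if "tail_bound 0 x \<noteq> \<infinity>" "tail_bound 0 y \<noteq> \<infinity>" "0 \<le> x" "x \<le> pi" "0 \<le> y" "y \<le> pi" for x y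
  proof (cases "circle_dist x y = 0")
    case False
    define d where "d = circle_dist x y"
    have d: "0 < d" "d \<le> pi" using False circle_dist_nonneg[of x y] circle_dist_le[of x y] that by (auto simp: d_def)
    obtain n where n: "pi / 2 ^ Suc n < d" "d \<le> pi / 2 ^ n" using dyadic_shell[OF d] by blast
    have "(pi / 2 ^ Suc n)\<^sup>2 \<le> d\<^sup>2" using n by (intro power_mono) auto
    moreover have "(pi / 2 ^ Suc n)\<^sup>2 = pi\<^sup>2 / 4 ^ Suc n"
    proof -
      have "(4::real) ^ Suc n = (2 ^ Suc n)\<^sup>2" by (simp add: power2_eq_square power_mult_distrib[symmetric])
      then show ?thesis by (simp only: power_divide)
    qed
    ultimately have "pi\<^sup>2 / 4 ^ Suc n \<le> d\<^sup>2" by simp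
    then have "1 / d\<^sup>2 \<le> 1 / (pi\<^sup>2 / 4 ^ Suc n)" using d by (intro divide_left_mono mult_pos_pos) auto
    then have inv: "1 / d\<^sup>2 \<le> 4 ^ Suc n / pi\<^sup>2" by simp
    have "ennreal ((log_derivative x - log_derivative y)\<^sup>2 / d\<^sup>2) \<le> ennreal (4 ^ Suc n / pi\<^sup>2 * (log_derivative x - log_derivative y)\<^sup>2)"
      using mult_right_mono[OF inv, of "(log_derivative x - log_derivative y)\<^sup>2"] by (intro ennreal_leI) simp
    also have "\<dots> = c n * ennreal ((log_derivative x - log_derivative y)\<^sup>2)"
      unfolding c_def by (rule ennreal_mult) auto
    also have "\<dots> \<le> c n * (tail_bound n x + tail_bound n y)"
      using n that by (intro mult_left_mono log_derivative_pair) (auto simp: d_def)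
    also have "\<dots> = c n * (tail_bound n x * near n x y + tail_bound n y * near n x y)"
      using n by (simp add: near_def d_def)
    also have "\<dots> \<le> (\<Sum>n. c n * (tail_bound n x * near n x y + tail_bound n y * near n x y))"
      using sum_le_suminf[OF summableI, of "{n}" "\<lambda>n. c n * (tail_bound n x * near n x y + tail_bound n y * near n x y)"] by simp
    finally show ?thesis by (simp add: d_def)
  qed simp
  have ball: "(\<integral>\<^sup>+y\<in>{0..pi}. near n x y \<partial>lborel) \<le> ennreal (10 * (pi / 2 ^ n))" if "0 \<le> x" "x \<le> pi" for n x
    unfolding near_def by (rule circle_ball_measure[OF that]) (auto simp: field_simps)
  have half1: "(\<integral>\<^sup>+x\<in>{0..pi}. (\<integral>\<^sup>+y\<in>{0..pi}. tail_bound n x * near n x y \<partial>lborel) \<partial>lborel)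
      \<le> ennreal (10 * (pi / 2 ^ n)) * (\<integral>\<^sup>+x\<in>{0..pi}. tail_bound n x \<partial>lborel)" for n
  proof -
    have "(\<integral>\<^sup>+x\<in>{0..pi}. (\<integral>\<^sup>+y\<in>{0..pi}. tail_bound n x * near n x y \<partial>lborel) \<partial>lborel)
       \<le> (\<integral>\<^sup>+x. ennreal (10 * (pi / 2 ^ n)) * (tail_bound n x * indicator {0..pi} x) \<partial>lborel)"
    proof (rule nn_integral_mono)
      fix x
      show "(\<integral>\<^sup>+y\<in>{0..pi}. tail_bound n x * near n x y \<partial>lborel) * indicator {0..pi} x
        \<le> ennreal (10 * (pi / 2 ^ n)) * (tail_bound n x * indicator {0..pi} x)"
      proof (cases "x \<in> {0..pi}")
        case True
        have "(\<integral>\<^sup>+y\<in>{0..pi}. tail_bound n x * near n x y \<partial>lborel) = tail_bound n x * (\<integral>\<^sup>+y\<in>{0..pi}. near n x y \<partial>lborel)"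
          by (simp add: mult.assoc nn_integral_cmult)
        also have "\<dots> \<le> tail_bound n x * ennreal (10 * (pi / 2 ^ n))"
          using True by (intro mult_left_mono ball) auto
        finally show ?thesis using True by (simp add: mult.commute)
      qed simp
    qed
    also have "\<dots> = ennreal (10 * (pi / 2 ^ n)) * (\<integral>\<^sup>+x\<in>{0..pi}. tail_bound n x \<partial>lborel)"
      by (rule nn_integral_cmult) measurable
    finally show ?thesis .
  qed
  have half2: "(\<integral>\<^sup>+x\<in>{0..pi}. (\<integral>\<^sup>+y\<in>{0..pi}. tail_bound n y * near n x y \<partial>lborel) \<partial>lborel)
      = (\<integral>\<^sup>+x\<in>{0..pi}. (\<integral>\<^sup>+y\<in>{0..pi}. tail_bound n x * near n x y \<partial>lborel) \<partial>lborel)" for n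
  proof -
    have "(\<integral>\<^sup>+x\<in>{0..pi}. (\<integral>\<^sup>+y\<in>{0..pi}. tail_bound n y * near n x y \<partial>lborel) \<partial>lborel)
       = (\<integral>\<^sup>+x. (\<integral>\<^sup>+y. (tail_bound n y * near n x y * indicator {0..pi} y) * indicator {0..pi} x \<partial>lborel) \<partial>lborel)"
      by (simp add: nn_integral_multc)
    also have "\<dots> = (\<integral>\<^sup>+y. (\<integral>\<^sup>+x. (tail_bound n y * near n x y * indicator {0..pi} y) * indicator {0..pi} x \<partial>lborel) \<partial>lborel)"
      by (rule lborel_pair.Fubini'[symmetric]) measurable
    also have "\<dots> = (\<integral>\<^sup>+y. (\<integral>\<^sup>+x. (tail_bound n y * near n y x * indicator {0..pi} x) * indicator {0..pi} y \<partial>lborel) \<partial>lborel)"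
      by (intro nn_integral_cong) (simp add: near_sym mult.commute mult.left_commute)
    finally show ?thesis by (simp add: nn_integral_multc)
  qed
  have "(\<integral>\<^sup>+x\<in>{0..pi}. (\<integral>\<^sup>+y\<in>{0..pi}. ennreal ((log_derivative x - log_derivative y)\<^sup>2 / (circle_dist x y)\<^sup>2) \<partial>lborel) \<partial>lborel)
     \<le> (\<integral>\<^sup>+x\<in>{0..pi}. (\<integral>\<^sup>+y\<in>{0..pi}. (\<Sum>n. c n * (tail_bound n x * near n x y + tail_bound n y * near n x y)) \<partial>lborel) \<partial>lborel)"
  proof (rule nn_integral_mono_AE)
    show "AE x in lborel. (\<integral>\<^sup>+y\<in>{0..pi}. ennreal ((log_derivative x - log_derivative y)\<^sup>2 / (circle_dist x y)\<^sup>2) \<partial>lborel) * indicator {0..pi} x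
      \<le> (\<integral>\<^sup>+y\<in>{0..pi}. (\<Sum>n. c n * (tail_bound n x * near n x y + tail_bound n y * near n x y)) \<partial>lborel) * indicator {0..pi} x"
      using good
    proof eventually_elim
      case (elim x)
      show ?case
      proof (cases "x \<in> {0..pi}")
        case True
        have "(\<integral>\<^sup>+y\<in>{0..pi}. ennreal ((log_derivative x - log_derivative y)\<^sup>2 / (circle_dist x y)\<^sup>2) \<partial>lborel)
           \<le> (\<integral>\<^sup>+y\<in>{0..pi}. (\<Sum>n. c n * (tail_bound n x * near n x y + tail_bound n y * near n x y)) \<partial>lborel)"
        proof (rule nn_integral_mono_AE)
          show "AE y in lborel. ennreal ((log_derivative x - log_derivative y)\<^sup>2 / (circle_dist x y)\<^sup>2) * indicator {0..pi} y
             \<le> (\<Sum>n. c n * (tail_bound n x * near n x y + tail_bound n y * near n x y)) * indicator {0..pi} y"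
            using good
          proof eventually_elim
            case (elim y)
            then show ?case using point[of x y] \<open>tail_bound 0 x \<noteq> \<infinity>\<close> True by (cases "y \<in> {0..pi}") simp_all
          qed
        qed
        then show ?thesis by (intro mult_right_mono) auto
      qed simp
    qed
  qed
  also have "\<dots> = (\<Sum>n. c n * ((\<integral>\<^sup>+x\<in>{0..pi}. (\<integral>\<^sup>+y\<in>{0..pi}. tail_bound n x * near n x y \<partial>lborel) \<partial>lborel)
      + (\<integral>\<^sup>+x\<in>{0..pi}. (\<integral>\<^sup>+y\<in>{0..pi}. tail_bound n y * near n x y \<partial>lborel) \<partial>lborel)))"
  proof -
    have inner: "(\<integral>\<^sup>+y\<in>{0..pi}. (\<Sum>n. c n * (tail_bound n x * near n x y + tail_bound n y * near n x y)) \<partial>lborel)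
      = (\<Sum>n. c n * ((\<integral>\<^sup>+y\<in>{0..pi}. tail_bound n x * near n x y \<partial>lborel) + (\<integral>\<^sup>+y\<in>{0..pi}. tail_bound n y * near n x y \<partial>lborel)))" for x
    proof -
      have "(\<integral>\<^sup>+y\<in>{0..pi}. (\<Sum>n. c n * (tail_bound n x * near n x y + tail_bound n y * near n x y)) \<partial>lborel)
        = (\<integral>\<^sup>+y. (\<Sum>n. c n * (tail_bound n x * near n x y * indicator {0..pi} y + tail_bound n y * near n x y * indicator {0..pi} y)) \<partial>lborel)"
        by (intro nn_integral_cong) (simp add: ennreal_suminf_multc[symmetric] distrib_right mult.assoc del: ennreal_suminf_multc)
      also have "\<dots> = (\<Sum>n. \<integral>\<^sup>+y. c n * (tail_bound n x * near n x y * indicator {0..pi} y + tail_bound n y * near n x y * indicator {0..pi} y) \<partial>lborel)"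
        by (rule nn_integral_suminf) measurable
      also have "\<dots> = (\<Sum>n. c n * ((\<integral>\<^sup>+y\<in>{0..pi}. tail_bound n x * near n x y \<partial>lborel) + (\<integral>\<^sup>+y\<in>{0..pi}. tail_bound n y * near n x y \<partial>lborel)))"
        by (intro arg_cong[where f=suminf] ext, subst nn_integral_cmult, measurable, subst nn_integral_add, measurable)
      finally show ?thesis .
    qed
    have [measurable]: "(\<lambda>x. \<integral>\<^sup>+y\<in>{0..pi}. tail_bound n x * near n x y \<partial>lborel) \<in> borel_measurable lborel"
      "(\<lambda>x. \<integral>\<^sup>+y\<in>{0..pi}. tail_bound n y * near n x y \<partial>lborel) \<in> borel_measurable lborel" for n
      by measurable
    have "(\<integral>\<^sup>+x\<in>{0..pi}. (\<Sum>n. c n * ((\<integral>\<^sup>+y\<in>{0..pi}. tail_bound n x * near n x y \<partial>lborel) + (\<integral>\<^sup>+y\<in>{0..pi}. tail_bound n y * near n x y \<partial>lborel))) \<partial>lborel)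
      = (\<integral>\<^sup>+x. (\<Sum>n. c n * ((\<integral>\<^sup>+y\<in>{0..pi}. tail_bound n x * near n x y \<partial>lborel) * indicator {0..pi} x + (\<integral>\<^sup>+y\<in>{0..pi}. tail_bound n y * near n x y \<partial>lborel) * indicator {0..pi} x)) \<partial>lborel)"
      by (intro nn_integral_cong) (simp add: ennreal_suminf_multc[symmetric] distrib_right mult.assoc del: ennreal_suminf_multc)
    also have "\<dots> = (\<Sum>n. \<integral>\<^sup>+x. c n * ((\<integral>\<^sup>+y\<in>{0..pi}. tail_bound n x * near n x y \<partial>lborel) * indicator {0..pi} x + (\<integral>\<^sup>+y\<in>{0..pi}. tail_bound n y * near n x y \<partial>lborel) * indicator {0..pi} x) \<partial>lborel)"
      by (rule nn_integral_suminf) measurable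
    also have "\<dots> = (\<Sum>n. c n * ((\<integral>\<^sup>+x\<in>{0..pi}. (\<integral>\<^sup>+y\<in>{0..pi}. tail_bound n x * near n x y \<partial>lborel) \<partial>lborel)
      + (\<integral>\<^sup>+x\<in>{0..pi}. (\<integral>\<^sup>+y\<in>{0..pi}. tail_bound n y * near n x y \<partial>lborel) \<partial>lborel)))"
      by (intro arg_cong[where f=suminf] ext, subst nn_integral_cmult, measurable, subst nn_integral_add, measurable)
    finally show ?thesis unfolding inner .
  qed
  also have "\<dots> \<le> (\<Sum>n. ennreal (80 / pi) * (ennreal (2 ^ n) * (\<integral>\<^sup>+x\<in>{0..pi}. tail_bound n x \<partial>lborel)))"
  proof (intro suminf_le summableI)
    fix n
    define J where "J = (\<integral>\<^sup>+x\<in>{0..pi}. tail_bound n x \<partial>lborel)"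
    have "c n * ((\<integral>\<^sup>+x\<in>{0..pi}. (\<integral>\<^sup>+y\<in>{0..pi}. tail_bound n x * near n x y \<partial>lborel) \<partial>lborel)
      + (\<integral>\<^sup>+x\<in>{0..pi}. (\<integral>\<^sup>+y\<in>{0..pi}. tail_bound n y * near n x y \<partial>lborel) \<partial>lborel))
      \<le> c n * (ennreal (10 * (pi / 2 ^ n)) * J + ennreal (10 * (pi / 2 ^ n)) * J)"
      unfolding half2 J_def by (intro mult_left_mono add_mono half1) auto
    also have "\<dots> = (c n * (ennreal (10 * (pi / 2 ^ n)) + ennreal (10 * (pi / 2 ^ n)))) * J"
      by (simp add: distrib_left distrib_right mult.assoc)
    also have "c n * (ennreal (10 * (pi / 2 ^ n)) + ennreal (10 * (pi / 2 ^ n))) = ennreal (80 / pi * 2 ^ n)"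
    proof -
      have "c n * (ennreal (10 * (pi / 2 ^ n)) + ennreal (10 * (pi / 2 ^ n))) = ennreal (4 ^ Suc n / pi\<^sup>2 * (10 * (pi / 2 ^ n) + 10 * (pi / 2 ^ n)))"
        unfolding c_def by (simp only: ennreal_plus[symmetric] ennreal_mult[symmetric] divide_nonneg_nonneg zero_le_power pi_ge_zero mult_nonneg_nonneg zero_le_numeral add_nonneg_nonneg zero_le_power2)
      also have "4 ^ Suc n / pi\<^sup>2 * (10 * (pi / 2 ^ n) + 10 * (pi / 2 ^ n)) = 80 / pi * 2 ^ n"
      proof -
        have "(4::real) ^ Suc n = 4 * (2 ^ n * 2 ^ n)" by (simp add: power_mult_distrib[symmetric])
        then show ?thesis by (simp add: power2_eq_square field_simps)
      qed
      finally show ?thesis .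
    qed
    also have "ennreal (80 / pi * 2 ^ n) * J = ennreal (80 / pi) * (ennreal (2 ^ n) * J)"
    proof -
      have "ennreal (80 / pi * 2 ^ n) = ennreal (80 / pi) * ennreal (2 ^ n)" by (rule ennreal_mult) auto
      then show ?thesis by (simp only: mult.assoc)
    qed
    finally show "c n * ((\<integral>\<^sup>+x\<in>{0..pi}. (\<integral>\<^sup>+y\<in>{0..pi}. tail_bound n x * near n x y \<partial>lborel) \<partial>lborel)
      + (\<integral>\<^sup>+x\<in>{0..pi}. (\<integral>\<^sup>+y\<in>{0..pi}. tail_bound n y * near n x y \<partial>lborel) \<partial>lborel))
      \<le> ennreal (80 / pi) * (ennreal (2 ^ n) * (\<integral>\<^sup>+x\<in>{0..pi}. tail_bound n x \<partial>lborel))" by (simp add: J_def)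
  qed
  also have "\<dots> = ennreal (80 / pi) * (\<Sum>n. ennreal (2 ^ n) * (\<integral>\<^sup>+x\<in>{0..pi}. tail_bound n x \<partial>lborel))" by simp
  also have "\<dots> < \<infinity>" using tail_bound_sum_finite[OF star] by (simp add: ennreal_mult_less_top)
  finally show ?thesis
    unfolding sobolev_half_def using sq log_derivative_periodic by simp
qed

lemma slope_growth:
  assumes M: "\<And>m k. m \<ge> M \<Longrightarrow> slope_variation h m k \<le> 1/10"
  shows "slope h m k \<le> 2 ^ M * (6/5) ^ m"
proof (induction m arbitrary: k)
  case 0
  then show ?case by (simp add: slope_root)
next
  case (Suc m)
  show ?case
  proof (cases "m \<ge> M")
    case True
    have "slope h (Suc m) k \<le> 6/5 * slope h m (k div 2)" by (rule slope_child_le) (rule M[OF True])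
    also have "\<dots> \<le> 6/5 * (2 ^ M * (6/5) ^ m)" by (intro mult_left_mono Suc) auto
    finally show ?thesis by simp
  next
    case False
    have "dyad (Suc m) (k + 1) \<le> dyad (Suc m) k + pi"
      using divide_left_mono[of 1 "2 ^ Suc m" pi] one_le_power[of "2::real" "Suc m"] by (simp add: dyad_add)
    then have "h (dyad (Suc m) (k + 1)) - h (dyad (Suc m) k) \<le> pi"
      using per[of "dyad (Suc m) k"] le_iff[of "dyad (Suc m) (k + 1)" "dyad (Suc m) k + pi"] by linarith
    then have "slope h (Suc m) k \<le> pi * 2 ^ Suc m / pi" unfolding slope_def by (intro divide_right_mono mult_right_mono) auto
    also have "\<dots> = 2 ^ Suc m * 1" by simp
    also have "\<dots> \<le> 2 ^ M * (6/5) ^ Suc m"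
    proof (intro mult_mono)
      show "(2::real) ^ Suc m \<le> 2 ^ M" using False by (intro power_increasing) auto
      show "1 \<le> (6/5::real) ^ Suc m" by (rule one_le_power) simp
    qed auto
    finally show ?thesis .
  qed
qed

text \<open>Deep in the tree the slopes grow at most like \<open>(6/5) ^ m\<close>, and one step changes them by at most
\<open>2 * d * (6/5) ^ m\<close>, where \<open>d\<close> is the local variation. By the inequality between the arithmetic
and the geometric mean this is at most \<open>(3/2) ^ m * d\<^sup>2 + (24/25) ^ m\<close>, the terms of the tail bound
plus those of a geometric series with sum 25.\<close>

lemma approx_slope_dominated:
  assumes star: "l2_tree (slope_variation h)"
  shows "\<exists>C. \<forall>m x. ennreal (slope h m (cell_index m x)) \<le> ennreal C * (26 + tail_bound 0 x)"
proof -
  obtain M where M: "\<And>m k. m \<ge> M \<Longrightarrow> \<bar>slope_variation h m k\<bar> \<le> 1/10"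
    using l2_tree_small[OF star, of "1/10"] by auto
  define V where "V m x = slope h m (cell_index m x)" for m x
  have M': "slope_variation h m k \<le> 1/10" if "m \<ge> M" for m k using M[OF that, of k] by linarith
  have growth: "V m x \<le> 2 ^ M * (6/5) ^ m" for m x unfolding V_def by (rule slope_growth[OF M'])
  have step: "V (Suc m) x - V m x \<le> 2 ^ M * ((3/2) ^ m * (local_variation m x)\<^sup>2 + (24/25) ^ m)" if m: "m \<ge> M" for m x
  proof -
    define d where "d = local_variation m x"
    have d: "0 \<le> d" "d \<le> 1/10" using M'[OF m] by (auto simp: d_def local_variation_def slope_variation_nonneg)
    have "\<bar>slope h (Suc m) (cell_index (Suc m) x) - slope h m (cell_index m x)\<bar> \<le> 2 * d * slope h m (cell_index m x)"
      using log_approx_step[of m x] d by (intro slope_diff_le) (auto simp: log_approx_def d_def)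
    then have "V (Suc m) x - V m x \<le> 2 * d * V m x" by (simp add: V_def abs_le_iff)
    also have "\<dots> \<le> 2 * d * (2 ^ M * (6/5) ^ m)" using d by (intro mult_left_mono growth) auto
    also have "\<dots> = 2 ^ M * (2 * d * (6/5) ^ m)" by simp
    also have "\<dots> \<le> 2 ^ M * ((3/2) ^ m * d\<^sup>2 + (24/25) ^ m)"
    proof (rule mult_left_mono)
      \<comment> \<open>the splitting \<open>6/5 * 5/4 = 3/2\<close> and \<open>6/5 * 4/5 = 24/25 < 1\<close> keeps both series summable\<close>
      have p: "(5/4::real) ^ m * (4/5) ^ m = 1" "(6/5::real) ^ m * (5/4) ^ m = (3/2) ^ m" "(6/5::real) ^ m * (4/5) ^ m = (24/25) ^ m"
        by (simp_all add: power_mult_distrib[symmetric])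
      have "0 \<le> (6/5) ^ m * (4/5) ^ m * (d * (5/4) ^ m - 1)\<^sup>2" by simp
      also have "\<dots> = ((6/5) ^ m * (5/4) ^ m) * ((5/4) ^ m * (4/5) ^ m) * d\<^sup>2 - 2 * d * (6/5) ^ m * ((5/4) ^ m * (4/5) ^ m) + (6/5) ^ m * (4/5) ^ m"
        by (simp add: power2_eq_square algebra_simps)
      finally show "2 * d * (6/5) ^ m \<le> (3/2) ^ m * d\<^sup>2 + (24/25) ^ m" unfolding p by simp
    qed simp
    finally show ?thesis by (simp add: d_def)
  qed
  have geo: "(\<Sum>j<m. (24/25::real) ^ j) \<le> 25" for m
  proof -
    have "(\<Sum>j<m. (24/25::real) ^ j) = 25 * (1 - (24/25) ^ m)" by (simp add: sum_gp_strict)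
    also have "\<dots> \<le> 25 * 1" by (intro mult_left_mono) auto
    finally show ?thesis by simp
  qed
  have small: "V m x \<le> 2 ^ M * 12 ^ M" if "m \<le> M" for m x
  proof -
    have "(6/5::real) ^ m \<le> 12 ^ m" by (intro power_mono) auto
    also have "\<dots> \<le> 12 ^ M" using that by (intro power_increasing) auto
    finally have "(2::real) ^ M * (6/5) ^ m \<le> 2 ^ M * 12 ^ M" by (intro mult_left_mono) auto
    then show ?thesis using growth[of m x] by linarith
  qed
  have bound: "V m x \<le> 24 ^ M * (1 + (\<Sum>j<m. (3/2) ^ j * (local_variation j x)\<^sup>2 + (24/25) ^ j))" for m x
  proof (induction m)
    case 0
    then show ?case using small[of 0 x] by (simp add: power_mult_distrib[symmetric])
  next
    case (Suc m)
    define t where "t = (3/2) ^ m * (local_variation m x)\<^sup>2 + (24/25) ^ m"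
    have t0: "0 \<le> t" by (simp add: t_def)
    show ?case
    proof (cases "m \<ge> M")
      case True
      have "(2::real) ^ M * t \<le> 24 ^ M * t" using t0 by (intro mult_right_mono power_mono) auto
      then show ?thesis using step[OF True, of x] Suc unfolding t_def[symmetric] by (simp add: distrib_left t_def)
    next
      case False
      have "(2::real) ^ M * 12 ^ M = 24 ^ M" by (simp add: power_mult_distrib[symmetric])
      then have "V (Suc m) x \<le> 24 ^ M * 1" using small[of "Suc m" x] False by simp
      also have "\<dots> \<le> 24 ^ M * (1 + (\<Sum>j<Suc m. (3/2) ^ j * (local_variation j x)\<^sup>2 + (24/25) ^ j))"
        using sum_nonneg[of "{..<Suc m}" "\<lambda>j. (3/2) ^ j * (local_variation j x)\<^sup>2 + (24/25) ^ j"]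
        by (intro mult_left_mono) auto
      finally show ?thesis .
    qed
  qed
  have "ennreal (V m x) \<le> ennreal (24 ^ M) * (26 + tail_bound 0 x)" for m x
  proof -
    define Q where "Q = (\<Sum>j<m. (3/2) ^ j * (local_variation j x)\<^sup>2)"
    have Q0: "0 \<le> Q" unfolding Q_def by (intro sum_nonneg) auto
    have "V m x \<le> 24 ^ M * (1 + (Q + (\<Sum>j<m. (24/25) ^ j)))" using bound[of m x] by (simp add: Q_def sum.distrib)
    also have "\<dots> \<le> 24 ^ M * (26 + 24 * Q)" using geo[of m] Q0 by (intro mult_left_mono) auto
    finally have "ennreal (V m x) \<le> ennreal (24 ^ M * (26 + 24 * Q))" by (rule ennreal_leI)
    also have "\<dots> = ennreal (24 ^ M) * ennreal (26 + 24 * Q)" using Q0 by (intro ennreal_mult) auto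
    also have "ennreal (26 + 24 * Q) = ennreal 26 + ennreal (24 * Q)" using Q0 by (intro ennreal_plus) auto
    also have "ennreal (24 ^ M) * (ennreal 26 + ennreal (24 * Q)) = ennreal (24 ^ M) * (26 + ennreal (24 * Q))" by simp
    also have "\<dots> \<le> ennreal (24 ^ M) * (26 + tail_bound 0 x)"
      using partial_tail_le[where N=m and n=0 and x=x] by (intro mult_left_mono add_mono) (auto simp: Q_def)
    finally show ?thesis .
  qed
  then show ?thesis unfolding V_def by blast
qed

text \<open>Between dyadic points the increment of \<open>h\<close> is the integral of the piecewise constant slopes. These
converge almost everywhere and are dominated by the tail bound, while the dyadic points below \<open>p\<close> and \<open>q\<close>
converge to \<open>p\<close> and \<open>q\<close>.\<close>

lemma exp_log_derivative_integrates:
  assumes star: "l2_tree (slope_variation h)"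
  shows "integrates_to (\<lambda>x. exp (log_derivative x)) h"
proof -
  have [measurable]: "(\<lambda>x. slope h n (cell_index n x)) \<in> borel_measurable borel" for n
    by (rule borel_measurable_cell_function)
  note [measurable] = measurable_tail_bound
  obtain C where C: "\<And>m x. ennreal (slope h m (cell_index m x)) \<le> ennreal C * (26 + tail_bound 0 x)"
    using approx_slope_dominated[OF star] by blast
  have "(\<integral>\<^sup>+x\<in>{p..q}. ennreal (exp (log_derivative x)) \<partial>lborel) = ennreal (h q - h p)" if pq: "p \<le> q" for p q
  proof -
    define P where "P n = dyad n (cell_index n p)" for n
    define Q where "Q n = dyad n (cell_index n q)" for n
    have lim: "(\<lambda>n. dyad n (cell_index n z)) \<longlonglongrightarrow> z" for z
    proof (rule tendsto_sandwich[of "\<lambda>n. z - pi / 2 ^ n" _ _ "\<lambda>n. z"])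
      show "\<forall>\<^sub>F n in sequentially. z - pi / 2 ^ n \<le> dyad n (cell_index n z)"
      proof (intro always_eventually allI)
        fix n show "z - pi / 2 ^ n \<le> dyad n (cell_index n z)"
          using cell_index(2)[of z n] dyad_add[of n "cell_index n z" 1] by simp
      qed
      show "\<forall>\<^sub>F n in sequentially. dyad n (cell_index n z) \<le> z" by (simp add: cell_index)
      have "(\<lambda>n. z - pi * (1/2) ^ n) \<longlonglongrightarrow> z - pi * 0" by (intro tendsto_intros LIMSEQ_realpow_zero) auto
      then show "(\<lambda>n. z - pi / 2 ^ n) \<longlonglongrightarrow> z" by (simp add: power_divide)
    qed simp
    have idx: "cell_index n p \<le> cell_index n q" for n
      unfolding cell_index_def using pq by (intro floor_mono divide_right_mono mult_right_mono) auto
    have P: "p - pi \<le> P n" "P n \<le> p" and Q: "Q n \<le> q" for n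
    proof -
      have "p - pi / 2 ^ n \<le> P n" using cell_index(2)[of p n] dyad_add[of n "cell_index n p" 1] by (simp add: P_def)
      moreover have "pi / 2 ^ n \<le> pi" by (simp add: field_simps)
      ultimately show "p - pi \<le> P n" by linarith
      show "P n \<le> p" "Q n \<le> q" by (simp_all add: P_def Q_def cell_index)
    qed
    have int: "(\<integral>\<^sup>+x\<in>{P n..<Q n}. ennreal (slope h n (cell_index n x)) \<partial>lborel) = ennreal (h (Q n) - h (P n))" for n
    proof -
      define N where "N = nat (cell_index n q - cell_index n p)"
      have N: "cell_index n q = cell_index n p + int N" using idx[of n] by (simp add: N_def)
      have "(\<Sum>k\<in>{i..<i + int N}. ennreal (slope h n k) * ennreal (pi / 2 ^ n)) = ennreal (h (dyad n (i + int N)) - h (dyad n i))" for i N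
      proof (induction N)
        case (Suc N)
        have "{i..<i + int (Suc N)} = insert (i + int N) {i..<i + int N}" by auto
        then have "(\<Sum>k\<in>{i..<i + int (Suc N)}. ennreal (slope h n k) * ennreal (pi / 2 ^ n))
          = ennreal (slope h n (i + int N)) * ennreal (pi / 2 ^ n) + (\<Sum>k\<in>{i..<i + int N}. ennreal (slope h n k) * ennreal (pi / 2 ^ n))"
          by simp
        also have "\<dots> = ennreal (slope h n (i + int N) * (pi / 2 ^ n)) + ennreal (h (dyad n (i + int N)) - h (dyad n i))"
          unfolding Suc using slope_pos[of n "i + int N"] by (subst ennreal_mult) auto
        also have "\<dots> = ennreal ((h (dyad n (i + int N + 1)) - h (dyad n (i + int N))) + (h (dyad n (i + int N)) - h (dyad n i)))"
          unfolding increment[symmetric] by (rule ennreal_plus[symmetric]) (auto simp: le_iff intro!: dyad_mono)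
        finally show ?case by (simp add: ac_simps)
      qed simp
      then show ?thesis unfolding P_def Q_def N using nn_integral_cells[where m=n and i="cell_index n p" and n=N and f="\<lambda>k. ennreal (slope h n k)"] by simp
    qed
    have "(\<lambda>n. \<integral>\<^sup>+x\<in>{P n..<Q n}. ennreal (slope h n (cell_index n x)) \<partial>lborel) \<longlonglongrightarrow> (\<integral>\<^sup>+x\<in>{p..<q}. ennreal (exp (log_derivative x)) \<partial>lborel)"
    proof (rule nn_integral_dominated_convergence[where w="\<lambda>x. (ennreal C * (26 + tail_bound 0 x)) * indicator {p - pi..q} x"])
      show "AE x in lborel. ennreal (slope h n (cell_index n x)) * indicator {P n..<Q n} x \<le> (ennreal C * (26 + tail_bound 0 x)) * indicator {p - pi..q} x" for n
      proof (intro AE_I2)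
        fix x
        show "ennreal (slope h n (cell_index n x)) * indicator {P n..<Q n} x \<le> (ennreal C * (26 + tail_bound 0 x)) * indicator {p - pi..q} x"
          using C[of n x] P[of n] Q[of n] by (cases "x \<in> {P n..<Q n}") (auto simp: indicator_def)
      qed
      have "(\<integral>\<^sup>+x\<in>{0..pi}. (ennreal C * (26 + tail_bound 0 x)) \<partial>lborel)
          = ennreal C * (\<integral>\<^sup>+x. 26 * indicator {0..pi} x + tail_bound 0 x * indicator {0..pi} x \<partial>lborel)"
        by (subst nn_integral_cmult[symmetric]) (auto intro!: nn_integral_cong simp: distrib_right mult.assoc)
      also have "\<dots> = ennreal C * (26 * ennreal pi + (\<integral>\<^sup>+x\<in>{0..pi}. tail_bound 0 x \<partial>lborel))"
        by (subst nn_integral_add) (auto simp: nn_integral_cmult_indicator)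
      also have "\<dots> < \<infinity>" using tail_bound_finite(1)[OF star] by (simp add: ennreal_mult_less_top)
      finally show "(\<integral>\<^sup>+x\<in>{p - pi..q}. (ennreal C * (26 + tail_bound 0 x)) \<partial>lborel) < \<infinity>"
        by (rule nn_integral_periodic_finite[rotated 2]) (auto simp: tail_bound_periodic)
      show "AE x in lborel. (\<lambda>n. ennreal (slope h n (cell_index n x)) * indicator {P n..<Q n} x) \<longlonglongrightarrow> ennreal (exp (log_derivative x)) * indicator {p..<q} x"
        using tail_bound_finite(2)[OF star]
      proof eventually_elim
        case (elim x)
        have "(\<lambda>n. exp (log_approx n x)) \<longlonglongrightarrow> exp (log_derivative x)"
          by (intro tendsto_exp log_approx_tendsto elim)
        then have v: "(\<lambda>n. ennreal (slope h n (cell_index n x))) \<longlonglongrightarrow> ennreal (exp (log_derivative x))"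
          by (simp add: log_approx_def exp_logslope tendsto_ennrealI)
        have ev: "\<forall>\<^sub>F n in sequentially. (x \<in> {P n..<Q n}) = (x \<in> {p..<q})"
        proof -
          have "\<forall>\<^sub>F n in sequentially. (P n \<le> x) = (p \<le> x)"
          proof (cases "p \<le> x")
            case True
            then show ?thesis using P(2) by (intro always_eventually) (auto intro: order_trans)
          next
            case False
            then have "\<forall>\<^sub>F n in sequentially. x < P n" unfolding P_def by (intro order_tendstoD(1)[OF lim]) simp
            then show ?thesis by eventually_elim (use False in auto)
          qed
          moreover have "\<forall>\<^sub>F n in sequentially. (x < Q n) = (x < q)"
          proof (cases "x < q")
            case True
            then have "\<forall>\<^sub>F n in sequentially. x < Q n" unfolding Q_def by (intro order_tendstoD(1)[OF lim])
            then show ?thesis by eventually_elim (use True in auto)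
          next
            case False
            have "Q n \<le> x" for n using Q[of n] False by linarith
            then show ?thesis using False by (intro always_eventually) (auto simp: not_less)
          qed
          ultimately show ?thesis by eventually_elim auto
        qed
        show ?case
        proof (cases "x \<in> {p..<q}")
          case True
          have "(\<lambda>n. ennreal (slope h n (cell_index n x)) * indicator {P n..<Q n} x) \<longlonglongrightarrow> ennreal (exp (log_derivative x))"
            by (rule Lim_transform_eventually[OF v]) (use ev in eventually_elim, use True in auto)
          then show ?thesis using True by simp
        next
          case False
          have "(\<lambda>n. ennreal (slope h n (cell_index n x)) * indicator {P n..<Q n} x) \<longlonglongrightarrow> 0"
            by (rule tendsto_eventually) (use ev in eventually_elim, use False in auto)
          then show ?thesis using False by simp
        qed
      qed
    qed measurable
    moreover have "(\<lambda>n. ennreal (h (Q n) - h (P n))) \<longlonglongrightarrow> ennreal (h q - h p)"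
      unfolding P_def Q_def by (intro tendsto_ennrealI tendsto_diff isCont_tendsto_compose[OF continuous] lim)
    ultimately have "(\<integral>\<^sup>+x\<in>{p..<q}. ennreal (exp (log_derivative x)) \<partial>lborel) = ennreal (h q - h p)"
      unfolding int by (rule LIMSEQ_unique)
    then show ?thesis by (simp add: nn_integral_closed)
  qed
  then show ?thesis by (simp add: integrates_to_def log_derivative_periodic)
qed

end

section \<open>Averages of a function of the Sobolev space\<close>

definition avg :: "(real \<Rightarrow> real) \<Rightarrow> real \<Rightarrow> real \<Rightarrow> real" where
  "avg u a b = (LINT x:{a..b}|lborel. u x) / (b - a)"

text \<open>The average minimizes the mean square distance to constants. It suffices to integrate
the tangent line of the square at the average, \<open>2 * (m - s) * (u x - s) - (m - s)\<^sup>2 \<le> (u x - s)\<^sup>2\<close>.\<close>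

lemma average_minimizes_square:
  assumes [measurable]: "u \<in> borel_measurable borel" and ab: "a < b"
    and i2: "set_integrable lborel {a..b} (\<lambda>x. (u x)\<^sup>2)" and i1: "set_integrable lborel {a..b} u"
  shows "ennreal ((avg u a b - s)\<^sup>2) * ennreal (b - a) \<le> (\<integral>\<^sup>+x\<in>{a..b}. ennreal ((u x - s)\<^sup>2) \<partial>lborel)"
proof -
  define m where "m = avg u a b"
  have one: "set_integrable lborel {a..b} (\<lambda>x. 1::real)" "(LINT x:{a..b}|lborel. 1) = b - a"
    using ab by (auto simp: set_integrable_def set_lebesgue_integral_def)
  have int: "(LINT x:{a..b}|lborel. u x) = m * (b - a)" using ab by (simp add: m_def avg_def)
  have is2: "set_integrable lborel {a..b} (\<lambda>x. (u x)\<^sup>2 + ((- 2 * s) * u x + s\<^sup>2 * 1))"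
    by (intro set_integral_add set_integrable_mult_right i1 i2 one)
  have sq: "(u x)\<^sup>2 + ((- 2 * s) * u x + s\<^sup>2 * 1) = (u x - s)\<^sup>2" for x by (simp add: power2_eq_square algebra_simps)
  have iS: "set_integrable lborel {a..b} (\<lambda>x. (u x - s)\<^sup>2)" using is2 unfolding sq .
  have lin: "set_integrable lborel {a..b} (\<lambda>x. (2 * (m - s)) * u x + (- 2 * (m - s) * s - (m - s)\<^sup>2) * 1)"
    by (intro set_integral_add set_integrable_mult_right i1 one)
  have "(LINT x:{a..b}|lborel. (2 * (m - s)) * u x + (- 2 * (m - s) * s - (m - s)\<^sup>2) * 1)
      = (LINT x:{a..b}|lborel. (2 * (m - s)) * u x) + (LINT x:{a..b}|lborel. (- 2 * (m - s) * s - (m - s)\<^sup>2) * 1)"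
    by (intro set_integral_add(2) set_integrable_mult_right i1 one(1))
  also have "\<dots> = (2 * (m - s)) * (m * (b - a)) + (- 2 * (m - s) * s - (m - s)\<^sup>2) * (b - a)"
    unfolding set_integral_mult_right int one(2) ..
  also have "\<dots> = (m - s)\<^sup>2 * (b - a)" by (simp add: power2_eq_square algebra_simps)
  finally have "(m - s)\<^sup>2 * (b - a) = (LINT x:{a..b}|lborel. (2 * (m - s)) * u x + (- 2 * (m - s) * s - (m - s)\<^sup>2) * 1)" ..
  also have "\<dots> \<le> (LINT x:{a..b}|lborel. (u x - s)\<^sup>2)"
  proof (rule set_integral_mono[OF lin iS])
    fix x
    have "0 \<le> (u x - s - (m - s))\<^sup>2" by simp
    then show "(2 * (m - s)) * u x + (- 2 * (m - s) * s - (m - s)\<^sup>2) * 1 \<le> (u x - s)\<^sup>2"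
      by (simp add: power2_eq_square algebra_simps)
  qed
  finally have "ennreal ((m - s)\<^sup>2 * (b - a)) \<le> ennreal (LINT x:{a..b}|lborel. (u x - s)\<^sup>2)" by (rule ennreal_leI)
  also have "\<dots> = (\<integral>\<^sup>+x. ennreal (indicator {a..b} x *\<^sub>R (u x - s)\<^sup>2) \<partial>lborel)"
    using iS unfolding set_integrable_def set_lebesgue_integral_def by (intro nn_integral_eq_integral[symmetric]) auto
  also have "\<dots> = (\<integral>\<^sup>+x\<in>{a..b}. ennreal ((u x - s)\<^sup>2) \<partial>lborel)"
    by (intro nn_integral_cong) (auto simp: indicator_def)
  finally show ?thesis using ab by (simp add: m_def ennreal_mult)
qed

lemma averages_difference:
  assumes [measurable]: "u \<in> borel_measurable borel"
    and i2: "\<And>a b. set_integrable lborel {a..b} (\<lambda>x. (u x)\<^sup>2)" and i1: "\<And>a b. set_integrable lborel {a..b} u"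
    and ab: "a < b" "a' < b'" and sub: "{a..b} \<subseteq> S" "{a'..b'} \<subseteq> S" and [measurable]: "S \<in> sets borel"
  shows "ennreal ((avg u a b - avg u a' b')\<^sup>2) * ennreal (b - a) * ennreal (b' - a')
    \<le> (\<integral>\<^sup>+y\<in>S. (\<integral>\<^sup>+x\<in>S. ennreal ((u x - u y)\<^sup>2) \<partial>lborel) \<partial>lborel)"
proof -
  have "ennreal ((avg u a b - avg u a' b')\<^sup>2) * ennreal (b - a) * ennreal (b' - a')
     = ennreal ((avg u a' b' - avg u a b)\<^sup>2) * ennreal (b' - a') * ennreal (b - a)"
    by (simp add: power2_commute ac_simps)
  also have "\<dots> \<le> (\<integral>\<^sup>+y\<in>{a'..b'}. ennreal ((u y - avg u a b)\<^sup>2) \<partial>lborel) * ennreal (b - a)"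
    by (intro mult_right_mono average_minimizes_square ab i1 i2) auto
  also have "\<dots> = (\<integral>\<^sup>+y. ennreal ((avg u a b - u y)\<^sup>2) * ennreal (b - a) * indicator {a'..b'} y \<partial>lborel)"
    by (subst nn_integral_multc[symmetric]) (auto intro!: nn_integral_cong simp: mult.commute mult.left_commute power2_commute)
  also have "\<dots> \<le> (\<integral>\<^sup>+y. (\<integral>\<^sup>+x\<in>{a..b}. ennreal ((u x - u y)\<^sup>2) \<partial>lborel) * indicator {a'..b'} y \<partial>lborel)"
    by (intro nn_integral_mono mult_right_mono average_minimizes_square ab i1 i2) auto
  also have "\<dots> \<le> (\<integral>\<^sup>+y\<in>S. (\<integral>\<^sup>+x\<in>S. ennreal ((u x - u y)\<^sup>2) \<partial>lborel) \<partial>lborel)"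
    using sub by (intro nn_integral_mono mult_mono mult_left_mono) (auto simp: indicator_def)
  finally show ?thesis .
qed

lemma circle_dist_period: "circle_dist (x + pi) y = circle_dist x y" "circle_dist x (y + pi) = circle_dist x y"
proof -
  have s: "circle_dist x y = infdist (x - y) (range (\<lambda>k::int. of_int k * pi))" for x y by (simp add: circle_dist_def)
  have inv: "infdist (z + pi) (range (\<lambda>k::int. of_int k * pi)) = infdist z (range (\<lambda>k::int. of_int k * pi))" for z
  proof -
    have "(\<lambda>k::int. dist (z + pi) (of_int k * pi)) = (\<lambda>k. dist z (of_int k * pi)) \<circ> (\<lambda>k. k - 1)"
      by (auto simp: dist_real_def algebra_simps)
    moreover have "range (\<lambda>k::int. k - 1) = UNIV" by (auto simp: surj_def intro: exI[of _ "_ + 1"])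
    ultimately have "range (\<lambda>k::int. dist (z + pi) (of_int k * pi)) = range (\<lambda>k::int. dist z (of_int k * pi))"
      by (metis image_comp)
    then show ?thesis by (simp add: infdist_def image_image)
  qed
  show "circle_dist (x + pi) y = circle_dist x y" using inv[of "x - y"] by (simp add: s algebra_simps)
  show "circle_dist x (y + pi) = circle_dist x y" using inv[of "x - (y + pi)"] by (simp add: s algebra_simps)
qed

text \<open>The two points lie in a common double cell of level \<open>m\<close> only if \<open>\<bar>x - y\<bar> \<le> 2 * pi / 2 ^ m\<close>, and then in at
most three of them. The sum of the weights \<open>4 ^ m\<close> over these levels is comparable with the last one,
that is with the kernel of the Sobolev norm.\<close>

lemma cells_over_scales:
  assumes "x \<noteq> (y::real)"
  shows "(\<Sum>m. \<Sum>k\<in>{0..<2 ^ m}. ennreal ((2 ^ m / pi)\<^sup>2) * (indicator {dyad m k..dyad m (k + 2)} x * indicator {dyad m k..dyad m (k + 2)} y))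
    \<le> ennreal (16 / (x - y)\<^sup>2)"
proof -
  define D where "D = \<bar>x - y\<bar>"
  have D: "D > 0" using assms by (simp add: D_def)
  define a where "a m = (if D \<le> 2 * (pi / 2 ^ m) then 3 * (2 ^ m / pi)\<^sup>2 else 0)" for m :: nat
  have a0: "0 \<le> a m" for m by (simp add: a_def)
  have level: "(\<Sum>k\<in>{0..<2 ^ m}. ennreal ((2 ^ m / pi)\<^sup>2) * (indicator {dyad m k..dyad m (k + 2)} x * indicator {dyad m k..dyad m (k + 2)} y)) \<le> ennreal (a m)" for m
  proof (cases "D \<le> 2 * (pi / 2 ^ m)")
    case True
    have "(\<Sum>k\<in>{0..<2 ^ m}. indicator {dyad m k..dyad m (k + 2)} x * indicator {dyad m k..dyad m (k + 2)} y :: ennreal)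
       \<le> (\<Sum>k\<in>{0..<2 ^ m}. indicator {cell_index m x - 2..cell_index m x} k)"
    proof (rule sum_mono)
      fix k :: int
      show "(indicator {dyad m k..dyad m (k + 2)} x * indicator {dyad m k..dyad m (k + 2)} y :: ennreal) \<le> indicator {cell_index m x - 2..cell_index m x} k"
      proof (cases "x \<in> {dyad m k..dyad m (k + 2)}")
        case True
        have "dyad m k < dyad m (cell_index m x + 1)" "dyad m (cell_index m x) \<le> dyad m (k + 2)"
          using True cell_index[where m=m and x=x] by auto
        then have "k < cell_index m x + 1" "cell_index m x \<le> k + 2"
          by (simp_all add: dyad_def divide_less_cancel divide_le_cancel)
        then show ?thesis by (simp add: indicator_def)
      qed simp
    qed
    also have "\<dots> = (\<Sum>k\<in>{0..<2 ^ m} \<inter> {cell_index m x - 2..cell_index m x}. 1)"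
      by (subst sum.inter_restrict, simp, intro sum.cong refl, simp add: indicator_def)
    also have "\<dots> \<le> (\<Sum>k\<in>{cell_index m x - 2..cell_index m x}. 1)" by (intro sum_mono2) auto
    also have "\<dots> = 3" by simp
    finally have "ennreal ((2 ^ m / pi)\<^sup>2) * (\<Sum>k\<in>{0..<2 ^ m}. indicator {dyad m k..dyad m (k + 2)} x * indicator {dyad m k..dyad m (k + 2)} y)
      \<le> ennreal ((2 ^ m / pi)\<^sup>2) * ennreal 3" by (intro mult_left_mono) auto
    also have "\<dots> = ennreal ((2 ^ m / pi)\<^sup>2 * 3)" by (rule ennreal_mult[symmetric]) auto
    also have "\<dots> = ennreal (a m)" using True by (simp add: a_def mult.commute)
    finally show ?thesis by (simp only: sum_distrib_left)
  next
    case False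
    have "\<not> (x \<in> {dyad m k..dyad m (k + 2)} \<and> y \<in> {dyad m k..dyad m (k + 2)})" for k
    proof
      assume "x \<in> {dyad m k..dyad m (k + 2)} \<and> y \<in> {dyad m k..dyad m (k + 2)}"
      then have "D \<le> dyad m (k + 2) - dyad m k" by (auto simp: D_def abs_le_iff)
      then show False using False by (simp add: dyad_add)
    qed
    then have z: "indicator {dyad m k..dyad m (k + 2)} x * indicator {dyad m k..dyad m (k + 2)} y = (0::ennreal)" for k
      by (auto simp: indicator_def)
    show ?thesis unfolding z by simp
  qed
  have "(\<Sum>m<N. a m) \<le> 16 / D\<^sup>2" for N
  proof -
    have geo: "(\<Sum>m<n. (4::real) ^ m) \<le> 4 ^ n / 3" for n by (induction n) auto
    have "(\<Sum>m<N. a m) \<le> 3 / pi\<^sup>2 * (4 * (2 * pi / D)\<^sup>2 / 3)"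
    proof (induction N)
      case (Suc N)
      show ?case
      proof (cases "D \<le> 2 * (pi / 2 ^ N)")
        case True
        have four: "(4::real) ^ m = (2 ^ m)\<^sup>2" for m by (simp add: power2_eq_square power_mult_distrib[symmetric])
        have "(2::real) ^ N \<le> 2 * pi / D" using True D by (simp add: field_simps)
        then have "(4::real) ^ N \<le> (2 * pi / D)\<^sup>2" unfolding four by (intro power_mono) auto
        moreover have "(\<Sum>m<Suc N. a m) \<le> (\<Sum>m<Suc N. 3 / pi\<^sup>2 * 4 ^ m)"
          by (intro sum_mono) (auto simp: a_def four power_divide)
        moreover have "(\<Sum>m<Suc N. 3 / pi\<^sup>2 * 4 ^ m) = 3 / pi\<^sup>2 * (\<Sum>m<Suc N. 4 ^ m)" by (simp only: sum_distrib_left)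
        moreover have "3 / pi\<^sup>2 * (\<Sum>m<Suc N. 4 ^ m) \<le> 3 / pi\<^sup>2 * (4 * (2 * pi / D)\<^sup>2 / 3)"
          using geo[of "Suc N"] calculation(1) by (intro mult_left_mono) auto
        ultimately show ?thesis by linarith
      next
        case False
        then show ?thesis using Suc by (simp add: a_def)
      qed
    qed simp
    also have "\<dots> = 16 / D\<^sup>2" using D by (simp add: power2_eq_square field_simps)
    finally show ?thesis .
  qed
  then have "(\<Sum>m<N. ennreal (a m)) \<le> ennreal (16 / D\<^sup>2)" for N
    using a0 by (simp add: sum_ennreal ennreal_leI)
  then have "(\<Sum>m. ennreal (a m)) \<le> ennreal (16 / D\<^sup>2)" by (intro suminf_le_const summableI) auto
  moreover have "(\<Sum>m. \<Sum>k\<in>{0..<2 ^ m}. ennreal ((2 ^ m / pi)\<^sup>2) * (indicator {dyad m k..dyad m (k + 2)} x * indicator {dyad m k..dyad m (k + 2)} y))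
     \<le> (\<Sum>m. ennreal (a m))" by (intro suminf_le summableI level)
  ultimately show ?thesis by (simp add: D_def)
qed

locale weil_petersson_lift = circle_lift +
  fixes g :: "real \<Rightarrow> real"
  assumes integ: "integrates_to g h" and pos: "AE x in lborel. 0 < g x" and sob: "sobolev_half (\<lambda>x. ln (g x))"
begin

definition u :: "real \<Rightarrow> real" where "u x = ln (g x)"

lemma measurable_u [measurable]: "u \<in> borel_measurable borel"
  using sob unfolding sobolev_half_def u_def[abs_def] by simp

lemma measurable_g [measurable]: "g \<in> borel_measurable borel"
  using integ by (simp add: integrates_to_def)

lemma u_periodic: "u (x + pi) = u x"
  using integ by (simp add: u_def integrates_to_def)

lemma u_square_integrable: "set_integrable lborel {a..b} (\<lambda>x. (u x)\<^sup>2)"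
proof (rule set_integrable_periodic)
  show "set_integrable lborel {0..pi} (\<lambda>x. (u x)\<^sup>2)" using sob by (simp add: sobolev_half_def u_def)
qed (simp_all add: u_periodic)

lemma u_integrable: "set_integrable lborel {a..b} u"
proof -
  have "set_integrable lborel {a..b} (\<lambda>x. 1 + (u x)\<^sup>2)"
    by (intro set_integral_add u_square_integrable borel_integrable_atLeastAtMost' continuous_intros)
  then show ?thesis
  proof (rule set_integrable_bound)
    show "set_borel_measurable lborel {a..b} u" by (simp add: set_borel_measurable_def)
    have "\<bar>u x\<bar> \<le> 1 + (u x)\<^sup>2" for x
      using zero_le_power2[of "\<bar>u x\<bar> - 1"] by (simp add: power2_diff)
    then show "AE x in lborel. x \<in> {a..b} \<longrightarrow> norm (u x) \<le> norm (1 + (u x)\<^sup>2)" by (simp add: abs_of_nonneg)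
  qed
qed

definition cell_average :: "nat \<Rightarrow> int \<Rightarrow> real" where
  "cell_average m k = avg u (dyad m k) (dyad m (k + 1))"

lemma set_integral_shift_period: "(LINT x:{a + pi..b + pi}|lborel. u x) = (LINT x:{a..b}|lborel. u x)"
proof -
  have "(LINT x:{a + pi..b + pi}|lborel. u x)
      = \<bar>1\<bar> *\<^sub>R (LINT x|lborel. indicator {a + pi..b + pi} (pi + 1 * x) *\<^sub>R u (pi + 1 * x))"
    unfolding set_lebesgue_integral_def by (rule lborel_integral_real_affine) simp
  also have "\<dots> = (LINT x|lborel. indicator {a..b} x *\<^sub>R u x)"
    using u_periodic by (auto simp: indicator_def add.commute intro!: Bochner_Integration.integral_cong)
  finally show ?thesis by (simp add: set_lebesgue_integral_def)
qed

lemma cell_average_periodic: "cell_average m (k + 2 ^ m) = cell_average m k"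
proof -
  have "k + 2 ^ m + 1 = (k + 1) + 2 ^ m" by simp
  then show ?thesis unfolding cell_average_def avg_def by (simp only: dyad_period set_integral_shift_period) simp
qed

lemma cell_average_children: "cell_average m k = (cell_average (Suc m) (2 * k) + cell_average (Suc m) (2 * k + 1)) / 2"
proof -
  define a b c where "a = dyad m k" and "b = dyad (Suc m) (2 * k + 1)" and "c = dyad m (k + 1)"
  have e: "dyad (Suc m) (2 * k) = a" "dyad (Suc m) (2 * k + 1 + 1) = c"
  proof -
    have "2 * k + 1 + 1 = 2 * k + 2" by simp
    then show "dyad (Suc m) (2 * k) = a" "dyad (Suc m) (2 * k + 1 + 1) = c"
      by (simp_all only: a_def c_def dyad_child dyad_child_end)
  qed
  define l where "l = pi / 2 ^ Suc m"
  have l: "l > 0" by (simp add: l_def)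
  have abc: "b = a + l" "c = a + 2 * l"
    using e(1) dyad_add[of "Suc m" "2 * k" 1] dyad_add[of m k 1] by (simp_all add: a_def b_def c_def l_def)
  have "(LINT x:{a..c}|lborel. u x) = (LINT x:{a..b} \<union> {b<..c}|lborel. u x)"
    using abc l by (intro arg_cong[where f="\<lambda>S. set_lebesgue_integral lborel S u"]) auto
  also have "\<dots> = (LINT x:{a..b}|lborel. u x) + (LINT x:{b<..c}|lborel. u x)"
  proof (rule set_integral_Un)
    show "set_integrable lborel {b<..c} u" using u_integrable[of b c] by (rule set_integrable_subset) auto
  qed (auto intro: u_integrable)
  also have "(LINT x:{b<..c}|lborel. u x) = (LINT x:{b..c}|lborel. u x)"
    unfolding set_lebesgue_integral_def
    by (rule integral_cong_AE) (use AE_lborel_singleton[of b] in \<open>auto simp: indicator_def elim!: eventually_mono\<close>)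
  finally show ?thesis
    unfolding cell_average_def avg_def e b_def[symmetric] a_def[symmetric] c_def[symmetric] abc using l
    by (simp add: field_simps)
qed

text \<open>Double cells, because they contain both a cell and its right neighbour.\<close>

definition oscillation :: "nat \<Rightarrow> int \<Rightarrow> ennreal" where
  "oscillation m k = ennreal ((2 ^ m / pi)\<^sup>2) *
     (\<integral>\<^sup>+y\<in>{dyad m k..dyad m (k + 2)}. (\<integral>\<^sup>+x\<in>{dyad m k..dyad m (k + 2)}. ennreal ((u x - u y)\<^sup>2) \<partial>lborel) \<partial>lborel)"

lemma average_difference_le_oscillation:
  assumes ab: "pi / 2 ^ Suc m \<le> b - a" "pi / 2 ^ Suc m \<le> b' - a'"
    and sub: "{a..b} \<subseteq> {dyad m k..dyad m (k + 2)}" "{a'..b'} \<subseteq> {dyad m k..dyad m (k + 2)}"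
  shows "ennreal ((avg u a b - avg u a' b')\<^sup>2) \<le> 4 * oscillation m k"
proof -
  define l where "l = pi / 2 ^ Suc m"
  have l: "l > 0" by (simp add: l_def)
  have "ennreal ((avg u a b - avg u a' b')\<^sup>2) * ennreal (l * l)
      = ennreal ((avg u a b - avg u a' b')\<^sup>2) * ennreal l * ennreal l"
    using l by (simp add: ennreal_mult mult.assoc)
  also have "\<dots> \<le> ennreal ((avg u a b - avg u a' b')\<^sup>2) * ennreal (b - a) * ennreal (b' - a')"
    using ab unfolding l_def[symmetric] by (intro mult_mono ennreal_leI) auto
  also have "\<dots> \<le> (\<integral>\<^sup>+y\<in>{dyad m k..dyad m (k + 2)}. (\<integral>\<^sup>+x\<in>{dyad m k..dyad m (k + 2)}. ennreal ((u x - u y)\<^sup>2) \<partial>lborel) \<partial>lborel)"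
    using ab l unfolding l_def[symmetric]
    by (intro averages_difference u_square_integrable u_integrable sub) auto
  finally have "ennreal ((2 ^ Suc m / pi)\<^sup>2) * (ennreal ((avg u a b - avg u a' b')\<^sup>2) * ennreal (l * l))
      \<le> ennreal ((2 ^ Suc m / pi)\<^sup>2) * (\<integral>\<^sup>+y\<in>{dyad m k..dyad m (k + 2)}. (\<integral>\<^sup>+x\<in>{dyad m k..dyad m (k + 2)}. ennreal ((u x - u y)\<^sup>2) \<partial>lborel) \<partial>lborel)"
    by (intro mult_left_mono) auto
  also have "ennreal ((2 ^ Suc m / pi)\<^sup>2) = 4 * ennreal ((2 ^ m / pi)\<^sup>2)"
  proof -
    have "(2 ^ Suc m / pi)\<^sup>2 = 4 * (2 ^ m / pi)\<^sup>2" by (simp add: power2_eq_square field_simps)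
    then show ?thesis by (simp add: ennreal_mult)
  qed
  also have "4 * ennreal ((2 ^ m / pi)\<^sup>2) * (ennreal ((avg u a b - avg u a' b')\<^sup>2) * ennreal (l * l)) = ennreal ((avg u a b - avg u a' b')\<^sup>2)"
  proof -
    define A where "A = (2 ^ m / pi)\<^sup>2"
    have one: "4 * A * (l * l) = 1" by (simp add: A_def l_def power2_eq_square field_simps)
    have A: "0 \<le> A" by (simp add: A_def)
    have "4 * ennreal A * ennreal (l * l) = ennreal (4 * A * (l * l))" using A l by (simp add: ennreal_mult)
    then have "4 * ennreal A * ennreal (l * l) = 1" unfolding one by simp
    then have "4 * ennreal A * (X * ennreal (l * l)) = X" for X by (metis mult.assoc mult.commute mult.right_neutral)
    then show ?thesis by (simp add: A_def)
  qed
  finally show ?thesis by (simp add: oscillation_def mult.assoc)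
qed

text \<open>Summing under the integral turns the double cells of all levels into the kernel of the Sobolev norm.
The last double cell of a level reaches beyond the first period, so the integrals extend over two
periods.\<close>

lemma oscillation_summable: "(\<Sum>m. \<Sum>k\<in>{0..<2 ^ m}. oscillation m k) < \<infinity>"
proof -
  define F where "F x y = ennreal ((u x - u y)\<^sup>2 / (circle_dist x y)\<^sup>2)" for x y
  have [measurable]: "(\<lambda>z. F (p z) (q z)) \<in> borel_measurable M" if "p \<in> borel_measurable M" "q \<in> borel_measurable M" for p q and M :: "'z measure"
    using that unfolding F_def by measurable
  have Fp: "F (x + pi) y = F x y" "F x (y + pi) = F x y" for x y by (simp_all add: F_def u_periodic circle_dist_period)
  have fin: "(\<integral>\<^sup>+y\<in>{0..2 * pi}. (\<integral>\<^sup>+x\<in>{0..2 * pi}. F x y \<partial>lborel) \<partial>lborel) < \<infinity>"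
  proof -
    have 2: "(\<integral>\<^sup>+x\<in>{0..2 * pi}. f x \<partial>lborel) = 2 * (\<integral>\<^sup>+x\<in>{0..pi}. f x \<partial>lborel)"
      if "f \<in> borel_measurable borel" "\<And>x. f (x + pi) = f x" for f :: "real \<Rightarrow> ennreal"
      using nn_integral_periods[OF that, of 0 2] by (simp add: nn_integral_closed)
    have "(\<integral>\<^sup>+y\<in>{0..2 * pi}. (\<integral>\<^sup>+x\<in>{0..2 * pi}. F x y \<partial>lborel) \<partial>lborel)
       = 2 * (\<integral>\<^sup>+y\<in>{0..pi}. (\<integral>\<^sup>+x\<in>{0..2 * pi}. F x y \<partial>lborel) \<partial>lborel)"
      by (rule 2) (simp_all add: Fp)
    also have "\<dots> = 2 * (\<integral>\<^sup>+y\<in>{0..pi}. 2 * (\<integral>\<^sup>+x\<in>{0..pi}. F x y \<partial>lborel) \<partial>lborel)"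
    proof -
      have "(\<integral>\<^sup>+x\<in>{0..2 * pi}. F x y \<partial>lborel) = 2 * (\<integral>\<^sup>+x\<in>{0..pi}. F x y \<partial>lborel)" for y
        by (rule 2) (simp_all add: Fp)
      then show ?thesis by simp
    qed
    also have "(\<integral>\<^sup>+y\<in>{0..pi}. 2 * (\<integral>\<^sup>+x\<in>{0..pi}. F x y \<partial>lborel) \<partial>lborel) = 2 * (\<integral>\<^sup>+y\<in>{0..pi}. (\<integral>\<^sup>+x\<in>{0..pi}. F x y \<partial>lborel) \<partial>lborel)"
      by (subst nn_integral_cmult[symmetric]) (auto simp: mult.assoc)
    also have "(\<integral>\<^sup>+y\<in>{0..pi}. (\<integral>\<^sup>+x\<in>{0..pi}. F x y \<partial>lborel) \<partial>lborel)
      = (\<integral>\<^sup>+y. (\<integral>\<^sup>+x. F x y * indicator {0..pi} x * indicator {0..pi} y \<partial>lborel) \<partial>lborel)"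
      by (simp add: nn_integral_multc)
    also have "\<dots> = (\<integral>\<^sup>+x. (\<integral>\<^sup>+y. F x y * indicator {0..pi} x * indicator {0..pi} y \<partial>lborel) \<partial>lborel)"
      by (rule lborel_pair.Fubini') measurable
    also have "\<dots> = (\<integral>\<^sup>+x\<in>{0..pi}. (\<integral>\<^sup>+y\<in>{0..pi}. F x y \<partial>lborel) \<partial>lborel)"
    proof (rule nn_integral_cong)
      fix x
      have "(\<integral>\<^sup>+y. F x y * indicator {0..pi} x * indicator {0..pi} y \<partial>lborel)
        = (\<integral>\<^sup>+y. F x y * indicator {0..pi} y * indicator {0..pi} x \<partial>lborel)"
        by (intro nn_integral_cong) (simp add: ac_simps)
      then show "(\<integral>\<^sup>+y. F x y * indicator {0..pi} x * indicator {0..pi} y \<partial>lborel)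
        = (\<integral>\<^sup>+y\<in>{0..pi}. F x y \<partial>lborel) * indicator {0..pi} x"
        by (simp add: nn_integral_multc)
    qed
    finally show ?thesis using sob by (simp add: sobolev_half_def F_def u_def ennreal_mult_less_top)
  qed
  define I where "I m k = {dyad m k..dyad m (k + 2)}" for m k
  define w where "w m = ennreal ((2 ^ m / pi)\<^sup>2)" for m :: nat
  define E where "E x y = ennreal ((u x - u y)\<^sup>2)" for x y
  have [measurable]: "(\<lambda>z. E (p z) (q z)) \<in> borel_measurable M" if "p \<in> borel_measurable M" "q \<in> borel_measurable M" for p q and M :: "'z measure"
    using that unfolding E_def by measurable
  have [measurable]: "I m k \<in> sets borel" for m k by (simp add: I_def)
  define S where "S = {0..2 * pi}"
  have [measurable]: "S \<in> sets borel" by (simp add: S_def)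
  have IS: "I m k \<subseteq> S" if "k \<in> {0..<2 ^ m}" for m k
  proof -
    have "k + 2 \<le> 2 * 2 ^ m"
    proof (cases m)
      case (Suc n)
      have "(1::int) \<le> 2 ^ n" by simp
      then show ?thesis using that Suc by simp
    qed (use that in simp)
    then have "dyad m (k + 2) \<le> dyad m (2 * 2 ^ m)" "dyad m 0 \<le> dyad m k" using that by (auto intro!: dyad_mono)
    then show ?thesis by (auto simp: I_def S_def dyad_def)
  qed
  have osc: "oscillation m k = (\<integral>\<^sup>+y. (\<integral>\<^sup>+x. (w m * (indicator (I m k) x * indicator (I m k) y)) * E x y * indicator S x * indicator S y \<partial>lborel) \<partial>lborel)"
    if k: "k \<in> {0..<2 ^ m}" for m k
  proof -
    have "oscillation m k = (\<integral>\<^sup>+y. w m * (\<integral>\<^sup>+x. E x y * indicator (I m k) x \<partial>lborel) * indicator (I m k) y \<partial>lborel)"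
      unfolding oscillation_def w_def[symmetric] I_def[symmetric] E_def[symmetric]
      by (subst nn_integral_cmult[symmetric]) (auto simp: mult.assoc)
    also have "\<dots> = (\<integral>\<^sup>+y. (\<integral>\<^sup>+x. (w m * (indicator (I m k) x * indicator (I m k) y)) * E x y * indicator S x * indicator S y \<partial>lborel) \<partial>lborel)"
    proof (rule nn_integral_cong)
      fix y
      have "w m * (\<integral>\<^sup>+x. E x y * indicator (I m k) x \<partial>lborel) * indicator (I m k) y
         = (\<integral>\<^sup>+x. w m * (E x y * indicator (I m k) x) * indicator (I m k) y \<partial>lborel)"
        by (simp add: nn_integral_cmult nn_integral_multc)
      also have "\<dots> = (\<integral>\<^sup>+x. (w m * (indicator (I m k) x * indicator (I m k) y)) * E x y * indicator S x * indicator S y \<partial>lborel)"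
        using IS[OF k] by (intro nn_integral_cong) (auto simp: indicator_def)
      finally show "w m * (\<integral>\<^sup>+x. E x y * indicator (I m k) x \<partial>lborel) * indicator (I m k) y
         = (\<integral>\<^sup>+x. (w m * (indicator (I m k) x * indicator (I m k) y)) * E x y * indicator S x * indicator S y \<partial>lborel)" .
    qed
    finally show ?thesis .
  qed
  have "(\<Sum>m. \<Sum>k\<in>{0..<2 ^ m}. oscillation m k)
    = (\<Sum>m. \<Sum>k\<in>{0..<2 ^ m}. (\<integral>\<^sup>+y. (\<integral>\<^sup>+x. (w m * (indicator (I m k) x * indicator (I m k) y)) * E x y * indicator S x * indicator S y \<partial>lborel) \<partial>lborel))"
    by (intro arg_cong[where f=suminf] ext sum.cong refl osc)
  also have "\<dots> = (\<integral>\<^sup>+y. (\<integral>\<^sup>+x. (\<Sum>m. \<Sum>k\<in>{0..<2 ^ m}. (w m * (indicator (I m k) x * indicator (I m k) y)) * E x y * indicator S x * indicator S y) \<partial>lborel) \<partial>lborel)"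
  proof -
    define G where "G m k x y = (w m * (indicator (I m k) x * indicator (I m k) y)) * E x y * indicator S x * indicator S y" for m k x y
    have [measurable]: "(\<lambda>z. G m k (p z) (q z)) \<in> borel_measurable M" if "p \<in> borel_measurable M" "q \<in> borel_measurable M" for p q m k and M :: "'z measure"
      using that unfolding G_def by measurable
    have "(\<Sum>m. \<Sum>k\<in>{0..<2 ^ m}. \<integral>\<^sup>+y. \<integral>\<^sup>+x. G m k x y \<partial>lborel \<partial>lborel)
      = (\<integral>\<^sup>+y. \<integral>\<^sup>+x. (\<Sum>m. \<Sum>k\<in>{0..<2 ^ m}. G m k x y) \<partial>lborel \<partial>lborel)"
      by (simp add: nn_integral_suminf nn_integral_sum)
    then show ?thesis unfolding G_def .
  qed
  also have "\<dots> \<le> (\<integral>\<^sup>+y. (\<integral>\<^sup>+x. 16 * F x y * indicator S x * indicator S y \<partial>lborel) \<partial>lborel)"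
  proof (intro nn_integral_mono)
    fix x y
    have "(\<Sum>m. \<Sum>k\<in>{0..<2 ^ m}. (w m * (indicator (I m k) x * indicator (I m k) y)) * E x y * indicator S x * indicator S y)
       = (\<Sum>m. \<Sum>k\<in>{0..<2 ^ m}. w m * (indicator (I m k) x * indicator (I m k) y)) * E x y * indicator S x * indicator S y"
      by (simp add: sum_distrib_right[symmetric])
    also have "\<dots> \<le> 16 * F x y * indicator S x * indicator S y"
    proof (intro mult_right_mono)
      show "(\<Sum>m. \<Sum>k\<in>{0..<2 ^ m}. w m * (indicator (I m k) x * indicator (I m k) y)) * E x y \<le> 16 * F x y"
      proof (cases "circle_dist x y = 0")
        case True
        obtain k where "circle_dist x y = \<bar>x - y - of_int k * pi\<bar>" using circle_dist_attained by blast
        then have "x = y + of_int k * pi" using True by simp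
        then have "u x = u y" using periodic_int_shift[of u, OF u_periodic] by simp
        then show ?thesis by (simp add: E_def)
      next
        case False
        then have cd: "circle_dist x y > 0" using circle_dist_nonneg[of x y] by simp
        then have xy: "x \<noteq> y" using circle_dist_le[of x y] by auto
        have "(circle_dist x y)\<^sup>2 \<le> (x - y)\<^sup>2" using circle_dist_le[of x y] cd by (metis less_imp_le power2_abs power_mono)
        then have le: "16 / (x - y)\<^sup>2 \<le> 16 / (circle_dist x y)\<^sup>2" using cd by (intro divide_left_mono mult_pos_pos) (auto simp: xy)
        have "(\<Sum>m. \<Sum>k\<in>{0..<2 ^ m}. w m * (indicator (I m k) x * indicator (I m k) y)) \<le> ennreal (16 / (circle_dist x y)\<^sup>2)"
          using order_trans[OF cells_over_scales[OF xy] ennreal_leI[OF le]] by (simp add: w_def I_def)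
        then have "(\<Sum>m. \<Sum>k\<in>{0..<2 ^ m}. w m * (indicator (I m k) x * indicator (I m k) y)) * E x y
           \<le> ennreal (16 / (circle_dist x y)\<^sup>2) * E x y" by (rule mult_right_mono) simp
        also have "\<dots> = ennreal (16 / (circle_dist x y)\<^sup>2 * (u x - u y)\<^sup>2)" unfolding E_def by (rule ennreal_mult[symmetric]) auto
        also have "\<dots> = ennreal (16 * ((u x - u y)\<^sup>2 / (circle_dist x y)\<^sup>2))" by simp
        also have "\<dots> = 16 * F x y" unfolding F_def by (subst ennreal_mult) auto
        finally show ?thesis .
      qed
    qed auto
    finally show "(\<Sum>m. \<Sum>k\<in>{0..<2 ^ m}. (w m * (indicator (I m k) x * indicator (I m k) y)) * E x y * indicator S x * indicator S y)
      \<le> 16 * F x y * indicator S x * indicator S y" .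
  qed
  also have "\<dots> = 16 * (\<integral>\<^sup>+y\<in>S. (\<integral>\<^sup>+x\<in>S. F x y \<partial>lborel) \<partial>lborel)"
    by (simp only: mult.assoc[of 16] nn_integral_cmult) (simp add: nn_integral_cmult nn_integral_multc)
  also have "\<dots> < \<infinity>" using fin by (simp add: S_def ennreal_mult_less_top)
  finally show ?thesis .
qed

definition average_variation :: "nat \<Rightarrow> int \<Rightarrow> real" where
  "average_variation m k = \<bar>cell_average (Suc m) (2 * k) - cell_average m k\<bar>
     + \<bar>cell_average (Suc m) (2 * k + 1) - cell_average m k\<bar> + \<bar>cell_average m (k + 1) - cell_average m k\<bar>"

lemma average_variation_le: "ennreal ((average_variation m k)\<^sup>2) \<le> 36 * oscillation m k"
proof -
  define l where "l = pi / 2 ^ Suc m"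
  have l: "l > 0" by (simp add: l_def)
  define a where "a = dyad m k"
  have d: "dyad m (k + 1) = a + 2 * l" "dyad m (k + 1 + 1) = a + 4 * l" "dyad m (k + 2) = a + 4 * l"
    "dyad (Suc m) (2 * k) = a" "dyad (Suc m) (2 * k + 1) = a + l" "dyad (Suc m) (2 * k + 1 + 1) = a + 2 * l"
    by (simp_all add: a_def l_def dyad_def field_simps)
  define p where "p = cell_average (Suc m) (2 * k) - cell_average m k"
  define q where "q = cell_average (Suc m) (2 * k + 1) - cell_average m k"
  define r where "r = cell_average m (k + 1) - cell_average m k"
  note ll = l_def[symmetric] and aa = a_def[symmetric]
  have le: "ennreal (p\<^sup>2) \<le> 4 * oscillation m k"
    using average_difference_le_oscillation[where m=m and k=k and a="dyad (Suc m) (2 * k)" and b="dyad (Suc m) (2 * k + 1)"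
        and a'="dyad m k" and b'="dyad m (k + 1)", unfolded ll d aa] l
    unfolding p_def cell_average_def d aa by simp
  moreover have "ennreal (q\<^sup>2) \<le> 4 * oscillation m k"
    using average_difference_le_oscillation[where m=m and k=k and a="dyad (Suc m) (2 * k + 1)" and b="dyad (Suc m) (2 * k + 1 + 1)"
        and a'="dyad m k" and b'="dyad m (k + 1)", unfolded ll d aa] l
    unfolding q_def cell_average_def d aa by simp
  moreover have "ennreal (r\<^sup>2) \<le> 4 * oscillation m k"
    using average_difference_le_oscillation[where m=m and k=k and a="dyad m (k + 1)" and b="dyad m (k + 1 + 1)"
        and a'="dyad m k" and b'="dyad m (k + 1)", unfolded ll d aa] l
    unfolding r_def cell_average_def d aa by simp
  ultimately have le: "ennreal (p\<^sup>2) \<le> 4 * oscillation m k" "ennreal (q\<^sup>2) \<le> 4 * oscillation m k" "ennreal (r\<^sup>2) \<le> 4 * oscillation m k"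
    by blast+
  have "(\<bar>p\<bar> + \<bar>q\<bar> + \<bar>r\<bar>)\<^sup>2 \<le> 3 * p\<^sup>2 + 3 * q\<^sup>2 + 3 * r\<^sup>2"
    using zero_le_power2[of "\<bar>p\<bar> - \<bar>q\<bar>"] zero_le_power2[of "\<bar>p\<bar> - \<bar>r\<bar>"] zero_le_power2[of "\<bar>q\<bar> - \<bar>r\<bar>"]
    by (simp add: power2_eq_square algebra_simps)
  then have "ennreal ((average_variation m k)\<^sup>2) \<le> ennreal (3 * p\<^sup>2 + 3 * q\<^sup>2 + 3 * r\<^sup>2)"
    unfolding average_variation_def p_def q_def r_def by (rule ennreal_leI)
  also have "\<dots> = 3 * ennreal (p\<^sup>2) + 3 * ennreal (q\<^sup>2) + 3 * ennreal (r\<^sup>2)"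
    by (simp add: ennreal_plus ennreal_mult)
  also have "\<dots> \<le> 3 * (4 * oscillation m k) + 3 * (4 * oscillation m k) + 3 * (4 * oscillation m k)"
    by (intro add_mono mult_left_mono le) auto
  also have "\<dots> = 36 * oscillation m k"
  proof -
    have "3 * (4 * X) + 3 * (4 * X) + 3 * (4 * X) = (3 * 4 + 3 * 4 + 3 * 4) * X" for X :: ennreal
      by (simp only: distrib_right mult.assoc)
    then show ?thesis by simp
  qed
  finally show ?thesis .
qed

lemma l2_tree_average_variation: "l2_tree average_variation"
proof -
  have p': "cell_average (Suc m) (j + 2 * 2 ^ m) = cell_average (Suc m) j" for m j
    using cell_average_periodic[of "Suc m" j] by simp
  have "tree_periodic average_variation"
    unfolding tree_periodic_def
  proof (intro allI)
    fix m and k :: int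
    have "2 * (k + 2 ^ m) = 2 * k + 2 * 2 ^ m" "2 * (k + 2 ^ m) + 1 = (2 * k + 1) + 2 * 2 ^ m"
      "k + 2 ^ m + 1 = (k + 1) + 2 ^ m" by simp_all
    then show "average_variation m (k + 2 ^ m) = average_variation m k"
      unfolding average_variation_def by (simp only: cell_average_periodic p')
  qed
  moreover have "summable (level_sum (\<lambda>m k. (average_variation m k)\<^sup>2))"
  proof (rule summable_suminf_not_top)
    show "0 \<le> level_sum (\<lambda>m k. (average_variation m k)\<^sup>2) m" for m by (intro level_sum_nonneg) simp
    have "(\<Sum>m. ennreal (level_sum (\<lambda>m k. (average_variation m k)\<^sup>2) m)) \<le> (\<Sum>m. 36 * (\<Sum>k\<in>{0..<2 ^ m}. oscillation m k))"
    proof (intro suminf_le summableI)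
      fix m
      have "ennreal (level_sum (\<lambda>m k. (average_variation m k)\<^sup>2) m) = (\<Sum>k\<in>{0..<2 ^ m}. ennreal ((average_variation m k)\<^sup>2))"
        unfolding level_sum_def by (rule sum_ennreal[symmetric]) simp
      also have "\<dots> \<le> 36 * (\<Sum>k\<in>{0..<2 ^ m}. oscillation m k)"
        unfolding sum_distrib_left by (intro sum_mono average_variation_le)
      finally show "ennreal (level_sum (\<lambda>m k. (average_variation m k)\<^sup>2) m) \<le> 36 * (\<Sum>k\<in>{0..<2 ^ m}. oscillation m k)" .
    qed
    also have "\<dots> = 36 * (\<Sum>m. \<Sum>k\<in>{0..<2 ^ m}. oscillation m k)" by simp
    also have "\<dots> < \<infinity>" using oscillation_summable by (simp add: ennreal_mult_less_top)
    finally show "(\<Sum>m. ennreal (level_sum (\<lambda>m k. (average_variation m k)\<^sup>2) m)) \<noteq> top" by simp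
  qed
  ultimately show ?thesis by (simp add: l2_tree_def)
qed

end

section \<open>From averages to slopes\<close>

lemma cosh_bound:
  assumes "\<bar>x\<bar> \<le> (1::real)"
  shows "exp x + exp (- x) \<le> 2 + 2 * x\<^sup>2"
proof -
  have pos: "exp x + exp (- x) \<le> 2 + 2 * x\<^sup>2" if x: "0 \<le> x" "x \<le> 1" for x :: real
  proof -
    have "exp x \<le> 1 + x + x\<^sup>2" by (rule exp_bound[OF x])
    moreover have "exp (- x) \<le> 1 - x + x\<^sup>2"
    proof -
      have "1 \<le> 1 + x ^ 3" using x by simp
      also have "\<dots> = (1 - x + x\<^sup>2) * (1 + x)" by (simp add: power2_eq_square power3_eq_cube algebra_simps)
      also have "\<dots> \<le> (1 - x + x\<^sup>2) * exp x"
        using x exp_ge_add_one_self[of x] by (intro mult_left_mono) auto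
      finally have "1 * exp (- x) \<le> ((1 - x + x\<^sup>2) * exp x) * exp (- x)" by (intro mult_right_mono) auto
      then show ?thesis by (simp add: mult.assoc exp_minus)
    qed
    ultimately show ?thesis by simp
  qed
  show ?thesis
  proof (cases "0 \<le> x")
    case True then show ?thesis using pos assms by simp
  next
    case False then show ?thesis using pos[of "- x"] assms by (simp add: add.commute)
  qed
qed

lemma nn_integral_sum_cells:
  fixes f :: "real \<Rightarrow> ennreal"
  assumes [measurable]: "f \<in> borel_measurable borel"
  shows "(\<integral>\<^sup>+x\<in>{dyad m i..<dyad m (i + int n)}. f x \<partial>lborel) = (\<Sum>k\<in>{i..<i + int n}. \<integral>\<^sup>+x\<in>{dyad m k..<dyad m (k + 1)}. f x \<partial>lborel)"
proof (induction n)
  case (Suc n)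
  have "(\<integral>\<^sup>+x\<in>{dyad m i..<dyad m (i + int (Suc n))}. f x \<partial>lborel)
     = (\<integral>\<^sup>+x\<in>{dyad m i..<dyad m (i + int n)}. f x \<partial>lborel) + (\<integral>\<^sup>+x\<in>{dyad m (i + int n)..<dyad m (i + int (Suc n))}. f x \<partial>lborel)"
    by (rule nn_integral_split) (auto intro!: dyad_mono)
  moreover have "{i..<i + int (Suc n)} = insert (i + int n) {i..<i + int n}" by auto
  moreover have "i + int (Suc n) = i + int n + 1" by simp
  ultimately show ?case using Suc by (simp only:) (simp add: add.commute)
qed simp

context weil_petersson_lift
begin

text \<open>The mean square distances between \<open>u\<close> and its averages on cells of level \<open>m\<close> are summable in \<open>m\<close>, so
almost everywhere the squares themselves are summable and tend to 0.\<close>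

lemma cell_averages_converge: "AE x in lborel. (\<lambda>n. cell_average n (cell_index n x)) \<longlonglongrightarrow> u x"
proof -
  have [measurable]: "(\<lambda>x. cell_average m (cell_index m x)) \<in> borel_measurable borel" for m by (rule borel_measurable_cell_function)
  define f where "f m x = ennreal ((u x - cell_average m (cell_index m x))\<^sup>2)" for m x
  have [measurable]: "f m \<in> borel_measurable borel" for m unfolding f_def[abs_def] by measurable
  have fp: "f m (x + pi) = f m x" for m x by (simp add: f_def u_periodic cell_index_period cell_average_periodic)
  have cell: "(\<integral>\<^sup>+x\<in>{dyad m k..<dyad m (k + 1)}. f m x \<partial>lborel) \<le> 4 * oscillation m k" for m k
  proof -
    define l where "l = pi / 2 ^ m"
    have l: "0 < l" "l \<le> 4"
    proof -
      have "l \<le> pi" using divide_left_mono[of 1 "2 ^ m" pi] one_le_power[of "2::real" m] by (simp add: l_def)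
      then show "l \<le> 4" using pi_less_4 by linarith
    qed (simp add: l_def)
    have c1: "dyad m (k + 1) = dyad m k + l" "dyad m (k + 2) = dyad m k + 2 * l" by (simp_all add: l_def dyad_def field_simps)
    define J where "J = {dyad m k..dyad m (k + 2)}"
    define O' where "O' = (\<integral>\<^sup>+y\<in>J. (\<integral>\<^sup>+x\<in>J. ennreal ((u x - u y)\<^sup>2) \<partial>lborel) \<partial>lborel)"
    have "(\<integral>\<^sup>+y\<in>{dyad m k..<dyad m (k + 1)}. f m y \<partial>lborel) * ennreal l
       = (\<integral>\<^sup>+y. f m y * indicator {dyad m k..<dyad m (k + 1)} y * ennreal l \<partial>lborel)"
      by (rule nn_integral_multc[symmetric]) measurable
    also have "\<dots> \<le> O'" unfolding O'_def
    proof (rule nn_integral_mono)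
      fix y
      show "f m y * indicator {dyad m k..<dyad m (k + 1)} y * ennreal l \<le> (\<integral>\<^sup>+x\<in>J. ennreal ((u x - u y)\<^sup>2) \<partial>lborel) * indicator J y"
      proof (cases "y \<in> {dyad m k..<dyad m (k + 1)}")
        case True
        then have idx: "cell_index m y = k" by (intro cell_index_eqI) auto
        have yJ: "y \<in> J" using True l by (auto simp: J_def c1)
        have "f m y * ennreal l = ennreal ((avg u (dyad m k) (dyad m (k + 1)) - u y)\<^sup>2) * ennreal (dyad m (k + 1) - dyad m k)"
          unfolding f_def idx cell_average_def by (simp add: power2_commute c1)
        also have "\<dots> \<le> (\<integral>\<^sup>+x\<in>{dyad m k..dyad m (k + 1)}. ennreal ((u x - u y)\<^sup>2) \<partial>lborel)"
          by (intro average_minimizes_square u_square_integrable u_integrable) (use l in \<open>auto simp: c1\<close>)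
        also have "\<dots> \<le> (\<integral>\<^sup>+x\<in>J. ennreal ((u x - u y)\<^sup>2) \<partial>lborel)"
          using l by (intro nn_integral_mono) (auto simp: indicator_def J_def c1)
        finally show ?thesis using True yJ by simp
      qed simp
    qed
    finally have a: "(\<integral>\<^sup>+y\<in>{dyad m k..<dyad m (k + 1)}. f m y \<partial>lborel) * ennreal l \<le> O'" .
    have "(\<integral>\<^sup>+y\<in>{dyad m k..<dyad m (k + 1)}. f m y \<partial>lborel) = (\<integral>\<^sup>+y\<in>{dyad m k..<dyad m (k + 1)}. f m y \<partial>lborel) * (ennreal l * ennreal (1 / l))"
      using l by (simp add: ennreal_mult[symmetric])
    also have "\<dots> \<le> O' * ennreal (1 / l)" using mult_right_mono[OF a, of "ennreal (1 / l)"] by (simp add: mult.assoc)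
    also have "ennreal (1 / l) = ennreal l * ennreal ((2 ^ m / pi)\<^sup>2)"
    proof -
      have "ennreal l * ennreal ((2 ^ m / pi)\<^sup>2) = ennreal (l * (2 ^ m / pi)\<^sup>2)" using l by (intro ennreal_mult[symmetric]) auto
      also have "l * (2 ^ m / pi)\<^sup>2 = 1 / l" by (simp add: l_def power2_eq_square field_simps)
      finally show ?thesis by simp
    qed
    also have "O' * (ennreal l * ennreal ((2 ^ m / pi)\<^sup>2)) = ennreal l * oscillation m k"
      by (simp add: oscillation_def O'_def J_def ac_simps)
    also have "\<dots> \<le> 4 * oscillation m k"
    proof (rule mult_right_mono)
      show "ennreal l \<le> 4" using ennreal_leI[OF l(2)] by simp
    qed simp
    finally show ?thesis .
  qed
  have level: "(\<integral>\<^sup>+x\<in>{0..pi}. f m x \<partial>lborel) \<le> 4 * (\<Sum>k\<in>{0..<2 ^ m}. oscillation m k)" for m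
  proof -
    have "dyad m 0 = 0" "dyad m (0 + int (2 ^ m)) = pi" by (simp_all add: dyad_def)
    then have "(\<integral>\<^sup>+x\<in>{0..pi}. f m x \<partial>lborel) = (\<Sum>k\<in>{0..<0 + int (2 ^ m)}. \<integral>\<^sup>+x\<in>{dyad m k..<dyad m (k + 1)}. f m x \<partial>lborel)"
      unfolding nn_integral_closed using nn_integral_sum_cells[where m=m and i=0 and n="2 ^ m" and f="f m"] by simp
    also have "\<dots> \<le> (\<Sum>k\<in>{0..<2 ^ m}. 4 * oscillation m k)" using cell by (simp add: sum_mono)
    finally show ?thesis by (simp only: sum_distrib_left)
  qed
  have "(\<integral>\<^sup>+x\<in>{0..pi}. (\<Sum>m. f m x) \<partial>lborel) = (\<Sum>m. \<integral>\<^sup>+x\<in>{0..pi}. f m x \<partial>lborel)"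
    by (subst nn_integral_suminf[symmetric]) simp_all
  also have "\<dots> \<le> (\<Sum>m. 4 * (\<Sum>k\<in>{0..<2 ^ m}. oscillation m k))" by (intro suminf_le summableI level)
  also have "\<dots> < \<infinity>" using oscillation_summable by (simp add: ennreal_mult_less_top)
  finally have "AE x in lborel. (\<Sum>m. f m x) \<noteq> \<infinity>"
    by (intro periodic_AE_finite) (simp_all add: fp)
  then show ?thesis
  proof eventually_elim
    case (elim x)
    then have "summable (\<lambda>m. (u x - cell_average m (cell_index m x))\<^sup>2)"
      unfolding f_def by (intro summable_suminf_not_top) auto
    then have "(\<lambda>m. (u x - cell_average m (cell_index m x))\<^sup>2) \<longlonglongrightarrow> 0" by (rule summable_LIMSEQ_zero)
    then have "(\<lambda>m. sqrt ((u x - cell_average m (cell_index m x))\<^sup>2)) \<longlonglongrightarrow> sqrt 0" by (rule tendsto_real_sqrt)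
    then have "(\<lambda>m. u x - cell_average m (cell_index m x)) \<longlonglongrightarrow> 0" by (simp add: tendsto_rabs_zero_iff)
    then have "(\<lambda>m. u x - (u x - cell_average m (cell_index m x))) \<longlonglongrightarrow> u x - 0" by (intro tendsto_diff tendsto_const)
    then show ?case by simp
  qed
qed

text \<open>The mean, over the cells \<open>n\<close> generations below, of the exponentials of the averages of \<open>u\<close>.\<close>

primrec exp_average :: "nat \<Rightarrow> nat \<Rightarrow> int \<Rightarrow> real" where
  "exp_average 0 = (\<lambda>m k. exp (cell_average m k))"
| "exp_average (Suc n) = (\<lambda>m k. (exp_average n (Suc m) (2 * k) + exp_average n (Suc m) (2 * k + 1)) / 2)"

text \<open>The gap in Jensen's inequality, relative to the exponential of the average.\<close>

definition excess :: "nat \<Rightarrow> nat \<Rightarrow> int \<Rightarrow> real" where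
  "excess n m k = exp_average n m k / exp (cell_average m k) - 1"

text \<open>The averages over the two children are symmetric about the average over the cell.\<close>

lemma excess_Suc:
  "excess (Suc n) m k = (exp (cell_average (Suc m) (2 * k) - cell_average m k) * (1 + excess n (Suc m) (2 * k))
     + exp (- (cell_average (Suc m) (2 * k) - cell_average m k)) * (1 + excess n (Suc m) (2 * k + 1))) / 2 - 1"
proof -
  have e: "- (cell_average (Suc m) (2 * k) - cell_average m k) = cell_average (Suc m) (2 * k + 1) - cell_average m k"
    using cell_average_children[of m k] by simp
  have "exp (a - c) * (1 + (X / exp a - 1)) = X / exp c" for a c X :: real by (simp add: exp_diff)
  then show ?thesis unfolding e excess_def by (simp add: add_divide_distrib)
qed

lemma excess_nonneg: "0 \<le> excess n m k"
proof (induction n arbitrary: m k)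
  case (Suc n)
  define D where "D = cell_average (Suc m) (2 * k) - cell_average m k"
  have "1 + D \<le> exp D" "1 + - D \<le> exp (- D)" by (rule exp_ge_add_one_self)+
  moreover have "exp D * 1 \<le> exp D * (1 + excess n (Suc m) (2 * k))"
    "exp (- D) * 1 \<le> exp (- D) * (1 + excess n (Suc m) (2 * k + 1))"
    using Suc by (intro mult_left_mono; simp)+
  moreover have "0 \<le> (A + B) / 2 - 1" if "1 + D \<le> x" "1 + - D \<le> y" "x * 1 \<le> A" "y * 1 \<le> B" for A B x y :: real
    using that by simp
  ultimately show ?case unfolding excess_Suc D_def[symmetric] by blast
qed (simp add: excess_def)

lemma excess_mono: "excess n m k \<le> excess (Suc n) m k"
proof (induction n arbitrary: m k)
  case 0
  then show ?case using excess_nonneg[of 1 m k] by (simp add: excess_def)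
next
  case (Suc n)
  show ?case
    by (subst excess_Suc[of n m k], subst excess_Suc[of "Suc n" m k])
      (intro diff_right_mono divide_right_mono add_mono mult_left_mono Suc order_refl, auto)
qed

text \<open>The mean of \<open>exp D\<close> and \<open>exp (- D)\<close> exceeds 1 only to second order, and the gaps of the children enter
with the factor \<open>6/5 * 1/2\<close>.\<close>

lemma excess_recursion:
  assumes "average_variation m k \<le> 1/10"
  shows "excess (Suc n) m k \<le> (average_variation m k)\<^sup>2 + 3/5 * (excess n (Suc m) (2 * k) + excess n (Suc m) (2 * k + 1))"
proof -
  define D where "D = cell_average (Suc m) (2 * k) - cell_average m k"
  have D: "\<bar>D\<bar> \<le> average_variation m k" by (simp add: D_def average_variation_def)
  have D1: "\<bar>D\<bar> \<le> 1/10" using D assms by simp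
  have "exp D + exp (- D) \<le> 2 + 2 * D\<^sup>2" using D1 by (intro cosh_bound) simp
  moreover have "D\<^sup>2 \<le> (average_variation m k)\<^sup>2" using D by (metis abs_ge_zero power2_abs power_mono)
  moreover have "exp D * excess n (Suc m) (2 * k) \<le> 6/5 * excess n (Suc m) (2 * k)"
    using D1 by (intro mult_right_mono exp_tenth excess_nonneg) auto
  moreover have "exp (- D) * excess n (Suc m) (2 * k + 1) \<le> 6/5 * excess n (Suc m) (2 * k + 1)"
    using D1 by (intro mult_right_mono exp_tenth excess_nonneg) auto
  moreover have "(d * (1 + X) + e * (1 + Y)) / 2 - 1 \<le> V + 3/5 * (X + Y)"
    if "d + e \<le> 2 + 2 * U" "U \<le> V" "d * X \<le> 6/5 * X" "e * Y \<le> 6/5 * Y" for d e X Y U V :: real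
    using that unfolding distrib_left by argo
  ultimately show ?thesis unfolding excess_Suc D_def[symmetric] by blast
qed

lemma excess_periodic: "excess n m (k + 2 ^ m) = excess n m k"
proof -
  have "exp_average n m (k + 2 ^ m) = exp_average n m k"
  proof (induction n arbitrary: m k)
    case 0 then show ?case by (simp add: cell_average_periodic)
  next
    case (Suc n)
    have "2 * (k + 2 ^ m) = 2 * k + 2 ^ Suc m" "2 * (k + 2 ^ m) + 1 = (2 * k + 1) + 2 ^ Suc m" by simp_all
    then show ?case unfolding exp_average.simps by (simp only: Suc)
  qed
  then show ?thesis by (simp add: excess_def cell_average_periodic)
qed

lemma nn_integral_exp_averages:
  "(\<integral>\<^sup>+x\<in>{dyad m k..<dyad m (k + 1)}. ennreal (exp (cell_average (m + n) (cell_index (m + n) x))) \<partial>lborel)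
    = ennreal (pi / 2 ^ m * exp_average n m k)"
proof (induction n arbitrary: m k)
  case 0
  have "{k..<k + 1} = {k}" by auto
  then show ?case
    using nn_integral_cells[where m=m and i=k and n=1 and f="\<lambda>k. ennreal (exp (cell_average m k))"]
    by (simp add: ennreal_mult[symmetric] mult.commute)
next
  case (Suc n)
  have pos: "0 \<le> exp_average n m k" for m k by (induction n arbitrary: m k) auto
  have "(\<integral>\<^sup>+x\<in>{dyad m k..<dyad m (k + 1)}. ennreal (exp (cell_average (m + Suc n) (cell_index (m + Suc n) x))) \<partial>lborel)
     = (\<integral>\<^sup>+x\<in>{dyad m k..<dyad (Suc m) (2 * k + 1)}. ennreal (exp (cell_average (m + Suc n) (cell_index (m + Suc n) x))) \<partial>lborel)
     + (\<integral>\<^sup>+x\<in>{dyad (Suc m) (2 * k + 1)..<dyad m (k + 1)}. ennreal (exp (cell_average (m + Suc n) (cell_index (m + Suc n) x))) \<partial>lborel)"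
  proof (rule nn_integral_split[OF borel_measurable_cell_function])
    show "dyad m k \<le> dyad (Suc m) (2 * k + 1)" "dyad (Suc m) (2 * k + 1) \<le> dyad m (k + 1)"
      using dyad_succ_less[of "Suc m" "2 * k"] dyad_succ_less[of "Suc m" "2 * k + 1"]
      by (simp_all add: dyad_child dyad_child_end add.assoc)
  qed
  also have "\<dots> = ennreal (pi / 2 ^ Suc m * exp_average n (Suc m) (2 * k)) + ennreal (pi / 2 ^ Suc m * exp_average n (Suc m) (2 * k + 1))"
  proof -
    have "2 * k + 1 + 1 = 2 * k + 2" "m + Suc n = Suc m + n" by simp_all
    then show ?thesis using Suc[of "Suc m" "2 * k"] Suc[of "Suc m" "2 * k + 1"] by (simp only: dyad_child dyad_child_end)
  qed
  also have "\<dots> = ennreal (pi / 2 ^ Suc m * exp_average n (Suc m) (2 * k) + pi / 2 ^ Suc m * exp_average n (Suc m) (2 * k + 1))"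
    using pos by (intro ennreal_plus[symmetric] mult_nonneg_nonneg) auto
  finally show ?case by (simp add: field_simps)
qed

text \<open>Jensen's inequality, by integrating the tangent line of the exponential at the average.\<close>

lemma slope_ge_exp_average: "exp (cell_average m k) \<le> slope h m k"
proof -
  define a b where "a = dyad m k" and "b = dyad m (k + 1)"
  define l where "l = pi / 2 ^ m"
  have l: "l > 0" by (simp add: l_def)
  have ab: "b = a + l" by (simp add: a_def b_def l_def dyad_add)
  define c where "c = cell_average m k"
  have one: "set_integrable lborel {a..b} (\<lambda>x. 1::real)" by (intro borel_integrable_atLeastAtMost' continuous_intros)
  have i1: "set_integrable lborel {a..b} (\<lambda>x. (exp c * (1 - c)) * 1 + exp c * u x)"
    by (intro set_integral_add set_integrable_mult_right one u_integrable)
  have "(LINT x:{a..b}|lborel. (exp c * (1 - c)) * 1 + exp c * u x)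
      = (LINT x:{a..b}|lborel. (exp c * (1 - c)) * 1) + (LINT x:{a..b}|lborel. exp c * u x)"
    by (intro set_integral_add(2) set_integrable_mult_right one u_integrable)
  also have "\<dots> = (exp c * (1 - c)) * l + exp c * (c * l)"
  proof -
    have "(LINT x:{a..b}|lborel. (1::real)) = l" using ab l by (simp add: set_lebesgue_integral_def)
    moreover have "(LINT x:{a..b}|lborel. u x) = c * l"
      using l by (simp add: c_def cell_average_def avg_def a_def[symmetric] b_def[symmetric] ab)
    ultimately show ?thesis by (simp only: set_integral_mult_right)
  qed
  also have "\<dots> = exp c * l" by (simp add: algebra_simps)
  finally have "exp c * l = (LINT x:{a..b}|lborel. (exp c * (1 - c)) * 1 + exp c * u x)" ..
  also have "\<dots> \<le> (LINT x:{a..b}|lborel. g x)"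
  proof (rule set_integral_mono_AE[OF i1 integrates_to_integrable[OF integ]])
    show "AE x\<in>{a..b} in lborel. (exp c * (1 - c)) * 1 + exp c * u x \<le> g x"
      using pos
    proof eventually_elim
      case (elim x)
      have "exp c * (1 + (u x - c)) \<le> exp c * exp (u x - c)" by (intro mult_left_mono exp_ge_add_one_self) auto
      also have "\<dots> = exp (u x)" by (simp add: exp_add[symmetric])
      also have "\<dots> = g x" using elim by (simp add: u_def)
      finally show ?case by (simp add: algebra_simps)
    qed
  qed
  also have "\<dots> = h b - h a" by (rule integrates_to_integral[OF integ]) (use ab l in \<open>auto simp: le_iff\<close>)
  also have "\<dots> = slope h m k * l" unfolding a_def b_def l_def by (rule increment)
  finally show ?thesis using l by (simp add: c_def)
qed

text \<open>The exponentials of the averages converge to \<open>g\<close> almost everywhere, and Fatou's lemma bounds the integral of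
\<open>g\<close> by their integrals.\<close>

lemma slope_le_exp_average:
  assumes w: "\<And>n. excess n m k \<le> w"
  shows "slope h m k \<le> exp (cell_average m k) * (1 + w)"
proof -
  have [measurable]: "(\<lambda>x. cell_average j (cell_index j x)) \<in> borel_measurable borel" for j by (rule borel_measurable_cell_function)
  define l where "l = pi / 2 ^ m"
  have l: "l > 0" by (simp add: l_def)
  have w0: "0 \<le> w" using w[of 0] excess_nonneg[of 0 m k] by linarith
  define v where "v n x = ennreal (exp (cell_average (m + n) (cell_index (m + n) x))) * indicator {dyad m k..<dyad m (k + 1)} x" for n x
  have [measurable]: "v n \<in> borel_measurable lborel" for n unfolding v_def[abs_def] by measurable
  have "ennreal (h (dyad m (k + 1)) - h (dyad m k)) = (\<integral>\<^sup>+x\<in>{dyad m k..<dyad m (k + 1)}. ennreal (g x) \<partial>lborel)"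
    using integ dyad_succ_less[of m k] by (simp add: integrates_to_def nn_integral_closed[symmetric] less_imp_le)
  also have "\<dots> = (\<integral>\<^sup>+x. liminf (\<lambda>n. v n x) \<partial>lborel)"
  proof (rule nn_integral_cong_AE)
    show "AE x in lborel. ennreal (g x) * indicator {dyad m k..<dyad m (k + 1)} x = liminf (\<lambda>n. v n x)"
      using pos cell_averages_converge
    proof eventually_elim
      case (elim x)
      have "(\<lambda>n. cell_average (m + n) (cell_index (m + n) x)) \<longlonglongrightarrow> u x"
        using LIMSEQ_ignore_initial_segment[OF elim(2), of m] by (simp add: add.commute)
      then have "(\<lambda>n. ennreal (exp (cell_average (m + n) (cell_index (m + n) x)))) \<longlonglongrightarrow> ennreal (exp (u x))"
        by (intro tendsto_ennrealI tendsto_exp)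
      then have "(\<lambda>n. v n x) \<longlonglongrightarrow> ennreal (exp (u x)) * indicator {dyad m k..<dyad m (k + 1)} x"
        unfolding v_def by (cases "x \<in> {dyad m k..<dyad m (k + 1)}") auto
      then show ?case using elim(1) lim_imp_Liminf[of sequentially "\<lambda>n. v n x"] by (simp add: u_def)
    qed
  qed
  also have "\<dots> \<le> liminf (\<lambda>n. \<integral>\<^sup>+x. v n x \<partial>lborel)" by (rule nn_integral_liminf) measurable
  also have "\<dots> \<le> liminf (\<lambda>n::nat. ennreal (l * (exp (cell_average m k) * (1 + w))))"
  proof (rule Liminf_mono, rule always_eventually, rule allI)
    fix n
    have "exp_average n m k = exp (cell_average m k) * (1 + excess n m k)" by (simp add: excess_def)
    also have "\<dots> \<le> exp (cell_average m k) * (1 + w)" using w by (intro mult_left_mono) auto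
    finally show "(\<integral>\<^sup>+x. v n x \<partial>lborel) \<le> ennreal (l * (exp (cell_average m k) * (1 + w)))"
      unfolding v_def nn_integral_exp_averages l_def[symmetric] using l by (intro ennreal_leI mult_left_mono) auto
  qed
  also have "\<dots> = ennreal (l * (exp (cell_average m k) * (1 + w)))" by (simp add: Liminf_const)
  finally have "slope h m k * l \<le> l * (exp (cell_average m k) * (1 + w))"
    unfolding increment l_def[symmetric] using l w0 by (subst (asm) ennreal_le_iff) auto
  then show ?thesis using l by (simp add: mult.commute)
qed

text \<open>The recursion for the gaps, summed over a level, contracts by 3/5, so the gaps are summable over
the tree, uniformly in the number \<open>n\<close> of generations; being bounded, their limits \<open>w\<close> are also square
summable. The logarithm of the slope exceeds the average of \<open>u\<close> by at most \<open>w\<close>, so its variation is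
bounded by that of the averages and by values of \<open>w\<close> at nearby nodes.\<close>

theorem slope_variation_l2: "l2_tree (slope_variation h)"
proof -
  define av where "av = average_variation"
  have lav: "l2_tree av" unfolding av_def by (rule l2_tree_average_variation)
  obtain M where M0: "\<And>m k. m \<ge> M \<Longrightarrow> \<bar>av m k\<bar> \<le> 1/10" using l2_tree_small[OF lav, of "1/10"] by auto
  have M: "average_variation m k \<le> 1/10" if "m \<ge> M" for m k using M0[OF that, of k] by (simp add: av_def abs_le_iff)
  define s where "s = level_sum (\<lambda>m k. (av m k)\<^sup>2)"
  have s0: "0 \<le> s m" for m unfolding s_def by (intro level_sum_nonneg) simp
  have ss: "summable s" using lav by (simp add: s_def l2_tree_def)
  define S where "S = suminf s"
  have S0: "0 \<le> S" unfolding S_def by (rule suminf_nonneg[OF ss s0])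
  define T where "T n m = level_sum (excess n) m" for n m
  have T0: "0 \<le> T n m" for n m unfolding T_def by (intro level_sum_nonneg excess_nonneg)
  have rec: "T (Suc n) m \<le> s m + 3/5 * T n (Suc m)" if "m \<ge> M" for n m
  proof -
    have "T (Suc n) m \<le> (\<Sum>k\<in>{0..<2 ^ m}. (average_variation m k)\<^sup>2 + 3/5 * (excess n (Suc m) (2 * k) + excess n (Suc m) (2 * k + 1)))"
      unfolding T_def level_sum_def by (intro sum_mono excess_recursion M that)
    also have "\<dots> = s m + 3/5 * T n (Suc m)"
      unfolding T_def s_def av_def level_sum_def sum_children sum.distrib sum_distrib_left[symmetric] ..
    finally show ?thesis .
  qed
  have sumT: "(\<Sum>m\<in>{M..<K}. T n m) \<le> 5/2 * S" for n K
  proof (induction n arbitrary: K)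
    case 0
    have "T 0 m = 0" for m by (simp add: T_def level_sum_def excess_def)
    then show ?case using S0 by simp
  next
    case (Suc n)
    have "(\<Sum>m\<in>{M..<K}. T (Suc n) m) \<le> (\<Sum>m\<in>{M..<K}. s m + 3/5 * T n (Suc m))" by (intro sum_mono rec) auto
    also have "\<dots> = (\<Sum>m\<in>{M..<K}. s m) + 3/5 * (\<Sum>m\<in>{M..<K}. T n (Suc m))" by (simp add: sum.distrib sum_distrib_left)
    also have "(\<Sum>m\<in>{M..<K}. s m) \<le> S" unfolding S_def using ss s0 by (intro sum_le_suminf) auto
    also have "(\<Sum>m\<in>{M..<K}. T n (Suc m)) = (\<Sum>m\<in>{Suc M..<Suc K}. T n m)" by (rule sum.shift_bounds_Suc_ivl[symmetric])
    also have "\<dots> \<le> (\<Sum>m\<in>{M..<Suc K}. T n m)" using T0 by (intro sum_mono2) auto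
    also have "\<dots> \<le> 5/2 * S" by (rule Suc)
    finally show ?case by simp
  qed
  define B where "B = 5/2 * S"
  have ep: "tree_periodic (excess n)" for n by (simp add: tree_periodic_def excess_periodic)
  have exB: "excess n m k \<le> B" if "m \<ge> M" for n m k
  proof -
    have "excess n m (k mod 2 ^ m) \<le> T n m" unfolding T_def level_sum_def
      by (rule member_le_sum[where f="excess n m"]) (auto simp: excess_nonneg)
    also have "\<dots> \<le> (\<Sum>m\<in>{M..<Suc m}. T n m)" using that T0 by (intro member_le_sum) auto
    also have "\<dots> \<le> B" unfolding B_def by (rule sumT)
    finally show ?thesis by (simp add: tree_periodic_mod[OF ep])
  qed
  define W where "W m k = (SUP n. excess n m k)" for m k
  have bdd: "bdd_above (range (\<lambda>n. excess n m k))" if "m \<ge> M" for m k using exB[OF that] by (intro bdd_aboveI2)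
  have Wup: "excess n m k \<le> W m k" if "m \<ge> M" for n m k unfolding W_def by (intro cSUP_upper bdd that) simp
  have Wlim: "(\<lambda>n. excess n m k) \<longlonglongrightarrow> W m k" if "m \<ge> M" for m k
    unfolding W_def by (intro LIMSEQ_incseq_SUP bdd that) (simp add: incseq_Suc_iff excess_mono)
  have W0: "0 \<le> W m k" if "m \<ge> M" for m k using Wup[OF that, of 0 k] excess_nonneg[of 0 m k] by linarith
  have WB: "W m k \<le> B" if "m \<ge> M" for m k unfolding W_def by (intro cSUP_least exB that) simp
  define w where "w m k = (if m \<ge> M then W m k else 0)" for m k
  have w0: "0 \<le> w m k" and wB: "w m k \<le> B" for m k using W0 WB S0 by (auto simp: w_def B_def)
  have lw: "l2_tree w"
  proof -
    have per: "tree_periodic w" by (simp add: tree_periodic_def w_def W_def excess_periodic)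
    have sumw: "(\<Sum>m\<in>{..<K}. level_sum w m) \<le> B" for K
    proof -
      have "(\<lambda>n. \<Sum>m\<in>{M..<K}. T n m) \<longlonglongrightarrow> (\<Sum>m\<in>{M..<K}. level_sum w m)"
        unfolding T_def level_sum_def
      proof (intro tendsto_sum)
        fix m k assume "m \<in> {M..<K}"
        then show "(\<lambda>n. excess n m k) \<longlonglongrightarrow> w m k" using Wlim[of m k] by (simp add: w_def)
      qed
      then have "(\<Sum>m\<in>{M..<K}. level_sum w m) \<le> B"
        by (rule LIMSEQ_le_const2) (use sumT in \<open>auto simp: B_def\<close>)
      moreover have "(\<Sum>m\<in>{..<K}. level_sum w m) = (\<Sum>m\<in>{M..<K}. level_sum w m)"
        by (rule sum.mono_neutral_right) (auto simp: level_sum_def w_def)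
      ultimately show ?thesis by simp
    qed
    have lw0: "0 \<le> level_sum w m" for m using w0 by (rule level_sum_nonneg)
    have sw: "summable (level_sum w)" using lw0 sumw by (intro summableI_nonneg_bounded[of _ B]) auto
    have "summable (level_sum (\<lambda>m k. (w m k)\<^sup>2))"
    proof (rule summable_comparison_test'[OF summable_mult[OF sw, of B], where N=0])
      fix m
      have "level_sum (\<lambda>m k. (w m k)\<^sup>2) m \<le> B * level_sum w m"
        unfolding level_sum_def sum_distrib_left power2_eq_square using w0 wB by (intro sum_mono mult_right_mono) auto
      then show "norm (level_sum (\<lambda>m k. (w m k)\<^sup>2) m) \<le> B * level_sum w m"
        using level_sum_nonneg[of "\<lambda>m k. (w m k)\<^sup>2" m] by simp
    qed
    then show ?thesis using per by (simp add: l2_tree_def)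
  qed
  have near: "cell_average m k \<le> logslope h m k" "logslope h m k \<le> cell_average m k + w m k" if m: "m \<ge> M" for m k
  proof -
    have "ln (exp (cell_average m k)) \<le> ln (slope h m k)" using slope_ge_exp_average[of m k] by (intro ln_mono) auto
    then show "cell_average m k \<le> logslope h m k" by (simp add: logslope_def)
    have w: "0 < 1 + w m k" using w0[of m k] by linarith
    have "slope h m k \<le> exp (cell_average m k) * (1 + w m k)"
      by (rule slope_le_exp_average) (use Wup[OF m] m in \<open>simp add: w_def\<close>)
    then have "ln (slope h m k) \<le> ln (exp (cell_average m k) * (1 + w m k))" using slope_pos[of m k] by (intro ln_mono) auto
    also have "\<dots> = cell_average m k + ln (1 + w m k)" using w by (simp add: ln_mult)
    also have "ln (1 + w m k) \<le> w m k" using w0 by (intro ln_add_one_self_le_self)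
    finally show "logslope h m k \<le> cell_average m k + w m k" by (simp add: logslope_def)
  qed
  show ?thesis
  proof (rule l2_tree_dominated)
    show "l2_tree (\<lambda>m k. av m k + (3 * w m k + ((\<bar>w (Suc m) (2 * k)\<bar> + \<bar>w (Suc m) (2 * k + 1)\<bar>) + w m (k + 1))))"
      by (intro l2_tree_add l2_tree_cmult l2_tree_children l2_tree_shift lav lw)
    show "tree_periodic (slope_variation h)" by (rule slope_variation_periodic)
    fix m k assume m: "M \<le> m"
    have "\<bar>slope_variation h m k\<bar> = slope_variation h m k" using slope_variation_nonneg[of h m k] by simp
    also have "\<dots> \<le> av m k + (3 * w m k + ((\<bar>w (Suc m) (2 * k)\<bar> + \<bar>w (Suc m) (2 * k + 1)\<bar>) + w m (k + 1)))"
    proof -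
      have d: "\<bar>(a + x) - (b + y)\<bar> \<le> \<bar>a - b\<bar> + x + y" if "0 \<le> x" "0 \<le> y" for a b x y :: real using that by linarith
      define e where "e m k = logslope h m k - cell_average m k" for m k
      have e: "0 \<le> e n j" "e n j \<le> w n j" "logslope h n j = cell_average n j + e n j" if "n \<ge> M" for n j
        using near[OF that, of j] by (auto simp: e_def)
      have m': "M \<le> Suc m" using m by simp
      show ?thesis
        unfolding slope_variation_def av_def average_variation_def e(3)[OF m] e(3)[OF m']
        using d[OF e(1)[OF m', of "2 * k"] e(1)[OF m, of k], of "cell_average (Suc m) (2 * k)" "cell_average m k"]
          d[OF e(1)[OF m', of "2 * k + 1"] e(1)[OF m, of k], of "cell_average (Suc m) (2 * k + 1)" "cell_average m k"]
          d[OF e(1)[OF m, of "k + 1"] e(1)[OF m, of k], of "cell_average m (k + 1)" "cell_average m k"]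
          e(2)[OF m', of "2 * k"] e(2)[OF m', of "2 * k + 1"] e(2)[OF m, of k] e(2)[OF m, of "k + 1"]
          abs_ge_self[of "w (Suc m) (2 * k)"] abs_ge_self[of "w (Suc m) (2 * k + 1)"]
        by linarith
    qed
    finally show "\<bar>slope_variation h m k\<bar> \<le> av m k + (3 * w m k + ((\<bar>w (Suc m) (2 * k)\<bar> + \<bar>w (Suc m) (2 * k + 1)\<bar>) + w m (k + 1)))" .
  qed
qed

end

section \<open>The equivalence\<close>

lemma integrates_to_translate:
  assumes "integrates_to g h"
  shows "integrates_to (\<lambda>x. g (c + x)) (\<lambda>x. h (c + x))"
proof -
  have [measurable]: "g \<in> borel_measurable borel" using assms by (simp add: integrates_to_def)
  have p: "g (x + pi) = g x" for x using assms by (simp add: integrates_to_def)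
  have "AE x in lborel. 0 \<le> g (c + x)" using AE_borel_affine[of 1 "\<lambda>x. 0 \<le> g x" c] assms by (simp add: integrates_to_def)
  moreover have "(\<integral>\<^sup>+x\<in>{a..b}. ennreal (g (c + x)) \<partial>lborel) = ennreal (h (c + b) - h (c + a))" if "a \<le> b" for a b
  proof -
    have "(\<integral>\<^sup>+x\<in>{a..b}. ennreal (g (c + x)) \<partial>lborel) = (\<integral>\<^sup>+x\<in>{a + c..b + c}. ennreal (g x) \<partial>lborel)"
      unfolding nn_integral_closed by (subst nn_integral_shift[symmetric]) (simp_all add: add.commute)
    also have "\<dots> = ennreal (h (b + c) - h (a + c))" using assms that by (simp add: integrates_to_def)
    finally show ?thesis by (simp add: add.commute)
  qed
  ultimately show ?thesis using p[of "c + _"] by (simp add: integrates_to_def add.assoc)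
qed

lemma sobolev_half_translate:
  assumes u: "sobolev_half u"
  shows "sobolev_half (\<lambda>x. u (c + x))"
proof -
  have [measurable]: "u \<in> borel_measurable borel" using u by (simp add: sobolev_half_def)
  have p: "u (x + pi) = u x" for x using u by (simp add: sobolev_half_def)
  define F where "F x y = ennreal ((u x - u y)\<^sup>2 / (circle_dist x y)\<^sup>2)" for x y
  have Fm [measurable]: "(\<lambda>z. F (f z) (k z)) \<in> borel_measurable M"
    if "f \<in> borel_measurable M" "k \<in> borel_measurable M" for f k and M :: "'z measure"
    using that unfolding F_def by measurable
  have Fp: "F (x + pi) y = F x y" "F x (y + pi) = F x y" for x y by (simp_all add: F_def p circle_dist_period)
  have Fc: "ennreal ((u (c + x) - u (c + y))\<^sup>2 / (circle_dist x y)\<^sup>2) = F (x + c) (y + c)" for x y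
    by (simp add: F_def circle_dist_def add.commute)
  have "(\<integral>\<^sup>+x\<in>{0..pi}. (\<integral>\<^sup>+y\<in>{0..pi}. F (x + c) (y + c) \<partial>lborel) \<partial>lborel)
      = (\<integral>\<^sup>+x\<in>{0..pi}. (\<integral>\<^sup>+y\<in>{0..pi}. F (x + c) y \<partial>lborel) \<partial>lborel)"
  proof -
    have "(\<integral>\<^sup>+y\<in>{0..pi}. F (x + c) (y + c) \<partial>lborel) = (\<integral>\<^sup>+y\<in>{0..pi}. F (x + c) y \<partial>lborel)" for x
      by (rule nn_integral_period_translate) (simp_all add: Fp)
    then show ?thesis by simp
  qed
  also have "\<dots> = (\<integral>\<^sup>+x\<in>{0..pi}. (\<integral>\<^sup>+y\<in>{0..pi}. F x y \<partial>lborel) \<partial>lborel)"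
    by (rule nn_integral_period_translate) (simp_all add: Fp)
  also have "\<dots> < \<infinity>" using u by (simp add: sobolev_half_def F_def)
  finally have semi: "(\<integral>\<^sup>+x\<in>{0..pi}. (\<integral>\<^sup>+y\<in>{0..pi}. F (x + c) (y + c) \<partial>lborel) \<partial>lborel) < \<infinity>" .
  have sq: "set_integrable lborel {0..pi} (\<lambda>x. (v x)\<^sup>2) \<longleftrightarrow> (\<integral>\<^sup>+x\<in>{0..pi}. ennreal ((v x)\<^sup>2) \<partial>lborel) < \<infinity>"
    if [measurable]: "v \<in> borel_measurable borel" for v :: "real \<Rightarrow> real"
  proof -
    have "(\<integral>\<^sup>+x. ennreal (norm (indicator {0..pi} x *\<^sub>R (v x)\<^sup>2)) \<partial>lborel) = (\<integral>\<^sup>+x\<in>{0..pi}. ennreal ((v x)\<^sup>2) \<partial>lborel)"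
      by (intro nn_integral_cong) (auto simp: indicator_def)
    then show ?thesis unfolding set_integrable_def integrable_iff_bounded by simp
  qed
  have "(\<integral>\<^sup>+x\<in>{0..pi}. ennreal ((u (x + c))\<^sup>2) \<partial>lborel) = (\<integral>\<^sup>+x\<in>{0..pi}. ennreal ((u x)\<^sup>2) \<partial>lborel)"
    by (rule nn_integral_period_translate) (simp_all add: p)
  then have "set_integrable lborel {0..pi} (\<lambda>x. (u (c + x))\<^sup>2)"
    using u by (simp add: sq sobolev_half_def add.commute)
  then show ?thesis using p[of "c + _"] semi by (simp add: sobolev_half_def Fc add.assoc)
qed

lemma slope_variation_if_weil_petersson:
  assumes \<phi>: "orientation_preserving_homeo \<phi>" and wp: "weil_petersson \<phi>"
  shows "l2_tree (slope_variation (\<lambda>t. lift \<phi> (x0 + t)))"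
proof -
  have h: "circle_lift (lift \<phi>)" using is_lift_lift[OF \<phi>] by (rule circle_lift_if_is_lift)
  obtain g where g: "L1_distributional_derivative (lift \<phi>) g" "AE x in lborel. g x > 0" "sobolev_half (\<lambda>x. ln (g x))"
    using wp by (auto simp: weil_petersson_def)
  have "AE x in lborel. 0 \<le> g x" using g(2) by eventually_elim simp
  then have "integrates_to g (lift \<phi>)" by (rule circle_lift.integrates_to_if_L1_derivative[OF h g(1)])
  then have "integrates_to (\<lambda>x. g (x0 + x)) (\<lambda>t. lift \<phi> (x0 + t))" by (rule integrates_to_translate)
  moreover have "AE x in lborel. 0 < g (x0 + x)"
  proof -
    have [measurable]: "g \<in> borel_measurable borel" using g(1) by (simp add: L1_distributional_derivative_def)
    show ?thesis using AE_borel_affine[of 1 "\<lambda>x. 0 < g x" x0] g(2) by simp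
  qed
  moreover have "sobolev_half (\<lambda>x. ln (g (x0 + x)))" using sobolev_half_translate[OF g(3)] .
  ultimately have "weil_petersson_lift (\<lambda>t. lift \<phi> (x0 + t)) (\<lambda>x. g (x0 + x))"
    by (intro weil_petersson_lift.intro circle_lift_translate[OF h] weil_petersson_lift_axioms.intro)
  then show ?thesis by (rule weil_petersson_lift.slope_variation_l2)
qed

lemma weil_petersson_if_slope_variation:
  assumes \<phi>: "orientation_preserving_homeo \<phi>" and star: "l2_tree (slope_variation (\<lambda>t. lift \<phi> (x0 + t)))"
  shows "weil_petersson \<phi>"
proof -
  have h: "circle_lift (lift \<phi>)" using is_lift_lift[OF \<phi>] by (rule circle_lift_if_is_lift)
  define H where "H = (\<lambda>t. lift \<phi> (x0 + t))"
  interpret H: circle_lift H unfolding H_def by (rule circle_lift_translate[OF h])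
  define v where "v x = H.log_derivative (- x0 + x)" for x
  have "integrates_to (\<lambda>x. exp (H.log_derivative (- x0 + x))) (\<lambda>t. H (- x0 + t))"
    by (intro integrates_to_translate H.exp_log_derivative_integrates star[folded H_def])
  then have "integrates_to (\<lambda>x. exp (v x)) (lift \<phi>)" by (simp add: H_def v_def)
  then have "L1_distributional_derivative (lift \<phi>) (\<lambda>x. exp (v x))"
    by (rule circle_lift.L1_derivative_if_integrates_to[OF h])
  moreover have "sobolev_half (\<lambda>x. ln (exp (v x)))"
    using sobolev_half_translate[OF H.sobolev_log_derivative[OF star[folded H_def]], of "- x0"] by (simp add: v_def)
  ultimately show ?thesis unfolding weil_petersson_def by (intro exI[of _ "\<lambda>x. exp (v x)"]) auto
qed

lemma quasisymmetric_if_slope_variation: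
  assumes \<phi>: "orientation_preserving_homeo \<phi>" and star: "l2_tree (slope_variation (lift \<phi>))"
  shows "quasisymmetric \<phi>"
proof -
  have h: "circle_lift (lift \<phi>)" using is_lift_lift[OF \<phi>] by (rule circle_lift_if_is_lift)
  then interpret h: circle_lift "lift \<phi>" .
  obtain K where K: "K \<ge> 1" and le: "\<And>x t. t > 0 \<Longrightarrow> lift \<phi> (x + t) - lift \<phi> x \<le> K * (lift \<phi> x - lift \<phi> (x - t))
      \<and> lift \<phi> x - lift \<phi> (x - t) \<le> K * (lift \<phi> (x + t) - lift \<phi> x)"
    using h.increments_comparable[OF star] by blast
  have "1 / K \<le> (lift \<phi> (x + t) - lift \<phi> x) / (lift \<phi> x - lift \<phi> (x - t)) \<and>
      (lift \<phi> (x + t) - lift \<phi> x) / (lift \<phi> x - lift \<phi> (x - t)) \<le> K" if t: "t > 0" for x t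
  proof -
    have "lift \<phi> (x - t) < lift \<phi> x" using t by (simp add: h.less_iff)
    then show ?thesis using le[OF t, of x] K by (simp add: field_simps)
  qed
  then show ?thesis unfolding quasisymmetric_def using K by blast
qed

theorem theorem4p2p1:
  fixes \<phi> :: "(real^2) set \<Rightarrow> (real^2) set"
  assumes "orientation_preserving_homeo \<phi>"
  shows "(weil_petersson \<phi> \<longleftrightarrow>
            quasisymmetric \<phi> \<and>
            (\<exists>D. dyadic_decomposition D \<and> (\<lambda>I. (epsilon_number \<phi> I)\<^sup>2) summable_on D)) \<and>
         (weil_petersson \<phi> \<longleftrightarrow>
            quasisymmetric \<phi> \<and>
            (\<forall>D. dyadic_decomposition D \<longrightarrow> (\<lambda>I. (epsilon_number \<phi> I)\<^sup>2) summable_on D))"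
proof -
  have sum_if: "(\<lambda>I. (epsilon_number \<phi> I)\<^sup>2) summable_on dyadic_decomposition_at x0" if "weil_petersson \<phi>" for x0
    unfolding summable_on_dyadic_decomposition
    by (intro epsilon_tree_if_slope_variation slope_variation_if_weil_petersson assms that)
  have wp_if: "weil_petersson \<phi>" if "(\<lambda>I. (epsilon_number \<phi> I)\<^sup>2) summable_on dyadic_decomposition_at x0" for x0
    using that unfolding summable_on_dyadic_decomposition
    by (intro weil_petersson_if_slope_variation slope_variation_if_epsilon_tree assms)
  have qs: "quasisymmetric \<phi>" if "weil_petersson \<phi>"
    using slope_variation_if_weil_petersson[OF assms that, of 0]
    by (intro quasisymmetric_if_slope_variation assms) simp
  show ?thesis unfolding dyadic_decomposition_def using sum_if wp_if qs by blast
qed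

end
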